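(* The polynomial monad $P^\infty$ of stable opetopes is a least fixpoint for the Baez–Dolan construction $BD:\mathbf{PM}_*\to\mathbf{PM}_*$ on the category of pointed polynomial monads.
   Context: **Polynomial monads.** A diagram of sets $I\xleftarrow{s}E\xrightarrow{p}B\xrightarrow{t}I$, where $p$ is always assumed to have finite fibres, defines an endofunctor $P$ of $\mathbf{Set}/I$, $(X\to I)\mapsto \sum_{b\in B}\prod_{e\in E_b}X_{s(e)}$ (a set over $I$ via $t$), with $E_b=p^{-1}(b)$. A *polynomial monad* is such an endofunctor with a monad structure whose multiplication and unit are cartesian natural transformations. $I$ is the set of types, $B$ the set of operations. The unit amounts to a map $u:I\to B$ with $t(u(i))=i$ and $E_{u(i)}$ a singleton of type $i$; the multiplication amounts to a partial composition $B\times_I E=\{(c,e):t(c)=s(e)\}\to B$, substituting $c$ into the input $e$ of $b=p(e)$; the composite has output type $t(b)$ and input set identified (compatibly with types) with $(E_b\setminus\{e\})\sqcup E_c$. **The categories $\mathbf{PM}$ and $\mathbf{PM}_*$.** $\mathbf{PM}$ has as objects all polynomial monads (over arbitrary sets $I$). An arrow from $(I'\leftarrow E'\to B'\to I')$ to $(I\leftarrow E\to B\to I)$ consists of maps $I'\to I$, $E'\to E$, $B'\to B$ commuting with all structure maps, such that the square formed by $E'\to B'$ and $E\to B$ is a pullback, and commuting with the partial compositions and with the units $I'\to B'$, $I\to B$. $\mathbf{PM}_*$ is the category of *pointed* polynomial monads: polynomial monads $M$ with an arrow $\mathrm{Id}\to M$ in $\mathbf{PM}$ from the trivial monad $\mathrm{Id}=(1\leftarrow1\to1\to1)$,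 and arrows respecting these. **Trees.** A *tree* is a finite connected, simply connected graph with a pointed subset of valence-1 vertices (the boundary); the base point is the output vertex, the other boundary vertices are input vertices. Non-boundary vertices are called *dots*. Edges incident to input vertices are *leaves*; the edge incident to the output vertex is the *root edge*. A *unit tree* has no dots and one edge. Each dot has one output edge (towards the root) and a (possibly empty) set of input edges. Trees are not planar. **$P$-trees.** A *$P$-tree* is a tree whose edges are decorated by elements of $I$, whose dots are decorated by elements of $B$, together with, for each dot $n$ with decoration $b$, a bijection between the input edges of $n$ and $E_b$, such that an input edge corresponding to $e\in E_b$ has decoration $s(e)$ and the output edge of $n$ has decoration $t(b)$. $\mathrm{tr}(P)$ is the set of isomorphism classes of $P$-trees and $\mathrm{tr}^{\bullet}(P)$ that of $P$-trees with one marked dot. For a $P$-tree $T$, let $t(T)\in B$ be the operation obtained by contracting all inner edges using the composition of $P$ (for a unit tree decorated by $i$, $t(T)=u(i)$); there is a canonical bijection between leaves of $T$ and $E_{t(T)}$. **Baez–Dolan functor.** $BD(P)=P^+$ is the polynomial monad on $\mathbf{Set}/B$ represented by $B\leftarrow \mathrm{tr}^{\bullet}(P)\to\mathrm{tr}(P)\xrightarrow{t}B$, where the left map returns the decoration of the marked dot and the middle map forgets the mark. Partial composition substitutes a $P$-tree $F$ into the marked dot $f$ of a $P$-tree $G$ whenever $t(F)$ equals the decoration of $f$: the dot $f$ is replaced by $F$, the leaves of $F$ being glued to the input edges of $f$ and the root edge of $F$ to the output edge of $f$ (if $F$ is a unit tree, $f$ is erased). The unit sends $b$ to the one-dot $P$-tree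 decorated by $b$. On an arrow $\alpha: P'\to P$ of $\mathbf{PM}$, $BD(\alpha)$ consists of $B'\to B$ and of the maps on (marked) decorated trees that keep the tree and apply $\alpha$ to all decorations. This is a functor $\mathbf{PM}\to\mathbf{PM}$. If $i:\mathrm{Id}\to M$ is a pointed polynomial monad, then $BD(M)$ is pointed by $\mathrm{Id}\to BD(\mathrm{Id})\xrightarrow{BD(i)}BD(M)$, where $\mathrm{Id}\to BD(\mathrm{Id})$ is the suspension map $S_0$ below; this gives $BD:\mathbf{PM}_*\to\mathbf{PM}_*$. **Opetopes, suspension, stable opetopes.** $P^0=\mathrm{Id}$ and $P^{k+1}=BD(P^k)$. Write $P^k$ as $\mathbf Z^k\leftarrow\overline{\mathbf Z}{}^{k+1}\to\mathbf Z^{k+1}\to\mathbf Z^k$; $\mathbf Z^k$ is the set of $k$-opetopes (so $\mathbf Z^0=\mathbf Z^1=1$, $\mathbf Z^k=\mathrm{tr}(P^{k-2})$ for $k\ge2$, and $\overline{\mathbf Z}{}^{k+1}$ is the set of $(k+1)$-opetopes with a marked input). The *suspension* is the sequence of arrows $S_n:P^n\to P^{n+1}$ in $\mathbf{PM}$ where $S_0:\mathrm{Id}\to BD(\mathrm{Id})$ is the arrow whose map on operations $\mathbf Z^1\to\mathbf Z^2$ picks the linear tree with exactly one dot, and $S_{n+1}=BD(S_n)$; it gives compatible maps $\mathbf Z^n\to\mathbf Z^{n+1}$ ($n\ge0$) and $\overline{\mathbf Z}{}^{n}\to\overline{\mathbf Z}{}^{n+1}$ ($n\ge1$). Let $\mathbf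 Z^\infty$ and $\overline{\mathbf Z}{}^\infty$ be the colimits of these sequences of sets; elements of $\mathbf Z^\infty$ are called *stable opetopes*. The polynomial monad $P^\infty$ on $\mathbf{Set}/\mathbf Z^\infty$ is represented by the induced diagram $\mathbf Z^\infty\leftarrow\overline{\mathbf Z}{}^\infty\to\mathbf Z^\infty\to\mathbf Z^\infty$ (source of the marked input, forget the mark, target), with the induced composition and unit; it is pointed by the canonical map from $P^0=\mathrm{Id}$. **Least fixpoint.** A least fixpoint of an endofunctor $F$ of a category means an initial $F$-algebra, i.e. an object $X$ with an arrow $F(X)\to X$ (necessarily an isomorphism) that is initial among such pairs. *)

theory Defs
  imports Main "HOL-Library.FSet"
begin

section \<open>Polynomial monads\<close>

text \<open>
  A polynomial monad with set of types I, set of inputs E and set of operations B, all given as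
  carriers.  For an operation \<open>c\<close> and an input \<open>e\<close> with \<open>tgt c = src e\<close>, \<open>sub c e\<close> is the
  operation obtained by substituting \<open>c\<close> into the input \<open>e\<close> of \<open>opr e\<close>.
  Its inputs are identified with (fibre of \<open>opr e\<close> minus \<open>e\<close>) + (fibre of \<open>c\<close>); this identification
  is part of the structure and is given by \<open>outer c e\<close> and \<open>inner c e\<close> on the two summands.
\<close>

record ('i, 'b, 'e) pm =
  types  :: "'i set"
  ops    :: "'b set"
  inputs :: "'e set"
  src    :: "'e \<Rightarrow> 'i"
  opr    :: "'e \<Rightarrow> 'b"
  tgt    :: "'b \<Rightarrow> 'i"
  unt    :: "'i \<Rightarrow> 'b"
  sub    :: "'b \<Rightarrow> 'e \<Rightarrow> 'b"
  outer  :: "'b \<Rightarrow> 'e \<Rightarrow> 'e \<Rightarrow> 'e"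
  inner  :: "'b \<Rightarrow> 'e \<Rightarrow> 'e \<Rightarrow> 'e"

definition fib :: "('i, 'b, 'e) pm \<Rightarrow> 'b \<Rightarrow> 'e set" where
  "fib P b = {e \<in> inputs P. opr P e = b}"

definition composable :: "('i, 'b, 'e) pm \<Rightarrow> 'b \<Rightarrow> 'e \<Rightarrow> bool" where
  "composable P c e \<longleftrightarrow> c \<in> ops P \<and> e \<in> inputs P \<and> tgt P c = src P e"

text \<open>
  The monad laws, in terms of partial composition: two unit laws, and associativity for
  nested and for parallel substitutions; each law also says that the identifications of inputs
  are compatible.
\<close>

locale polynomial_monad =
  fixes P :: "('i, 'b, 'e) pm"
  assumes src_type: "e \<in> inputs P \<Longrightarrow> src P e \<in> types P"
    and opr_op: "e \<in> inputs P \<Longrightarrow> opr P e \<in> ops P"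
    and tgt_type: "b \<in> ops P \<Longrightarrow> tgt P b \<in> types P"
    and finite_fib: "b \<in> ops P \<Longrightarrow> finite (fib P b)"
    and unt_op: "i \<in> types P \<Longrightarrow> unt P i \<in> ops P"
    and tgt_unt: "i \<in> types P \<Longrightarrow> tgt P (unt P i) = i"
    and fib_unt: "i \<in> types P \<Longrightarrow> \<exists>e. fib P (unt P i) = {e} \<and> src P e = i"
    and sub_op: "composable P c e \<Longrightarrow> sub P c e \<in> ops P"
    and tgt_sub: "composable P c e \<Longrightarrow> tgt P (sub P c e) = tgt P (opr P e)"
    and fib_sub: "composable P c e \<Longrightarrow>
      bij_betw (case_sum (outer P c e) (inner P c e))
        ((fib P (opr P e) - {e}) <+> fib P c) (fib P (sub P c e))"
    and src_outer: "\<lbrakk>composable P c e; x \<in> fib P (opr P e) - {e}\<rbrakk> \<Longrightarrow> src P (outer P c e x) = src P x"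
    and src_inner: "\<lbrakk>composable P c e; x \<in> fib P c\<rbrakk> \<Longrightarrow> src P (inner P c e x) = src P x"
    and sub_unt_left: "\<lbrakk>c \<in> ops P; fib P (unt P (tgt P c)) = {e}\<rbrakk> \<Longrightarrow>
      sub P c e = c \<and> (\<forall>x \<in> fib P c. inner P c e x = x)"
    and sub_unt_right: "\<lbrakk>e \<in> inputs P; fib P (unt P (src P e)) = {x}\<rbrakk> \<Longrightarrow>
      sub P (unt P (src P e)) e = opr P e \<and> inner P (unt P (src P e)) e x = e \<and>
      (\<forall>y \<in> fib P (opr P e) - {e}. outer P (unt P (src P e)) e y = y)"
    and assoc_nested: "\<lbrakk>composable P c e; f \<in> fib P c; composable P d f\<rbrakk> \<Longrightarrow>
      sub P d (inner P c e f) = sub P (sub P d f) e \<and>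
      (\<forall>x \<in> fib P (opr P e) - {e}. outer P d (inner P c e f) (outer P c e x) = outer P (sub P d f) e x) \<and>
      (\<forall>x \<in> fib P c - {f}. outer P d (inner P c e f) (inner P c e x) = inner P (sub P d f) e (outer P d f x)) \<and>
      (\<forall>x \<in> fib P d. inner P d (inner P c e f) x = inner P (sub P d f) e (inner P d f x))"
    and assoc_parallel: "\<lbrakk>composable P c e; composable P d f; opr P f = opr P e; f \<noteq> e\<rbrakk> \<Longrightarrow>
      sub P d (outer P c e f) = sub P c (outer P d f e) \<and>
      (\<forall>x \<in> fib P (opr P e) - {e, f}.
         outer P d (outer P c e f) (outer P c e x) = outer P c (outer P d f e) (outer P d f x)) \<and>
      (\<forall>x \<in> fib P c. outer P d (outer P c e f) (inner P c e x) = inner P c (outer P d f e) x) \<and>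
      (\<forall>x \<in> fib P d. inner P d (outer P c e f) x = outer P c (outer P d f e) (inner P d f x))"


section \<open>The category of polynomial monads\<close>

record ('i, 'b, 'e, 'j, 'c, 'f) arr =
  onI :: "'i \<Rightarrow> 'j"
  onB :: "'b \<Rightarrow> 'c"
  onE :: "'e \<Rightarrow> 'f"

locale pm_arrow = dom: polynomial_monad P + cod: polynomial_monad Q
  for P :: "('i, 'b, 'e) pm" and Q :: "('j, 'c, 'f) pm" +
  fixes h :: "('i, 'b, 'e, 'j, 'c, 'f) arr"
  assumes onI_type: "i \<in> types P \<Longrightarrow> onI h i \<in> types Q"
    and onB_op: "b \<in> ops P \<Longrightarrow> onB h b \<in> ops Q"
    and onE_input: "e \<in> inputs P \<Longrightarrow> onE h e \<in> inputs Q"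
    and arr_src: "e \<in> inputs P \<Longrightarrow> src Q (onE h e) = onI h (src P e)"
    and arr_opr: "e \<in> inputs P \<Longrightarrow> opr Q (onE h e) = onB h (opr P e)"
    and arr_tgt: "b \<in> ops P \<Longrightarrow> tgt Q (onB h b) = onI h (tgt P b)"
    and pullback: "\<lbrakk>b \<in> ops P; f \<in> inputs Q; opr Q f = onB h b\<rbrakk> \<Longrightarrow>
      \<exists>!e. e \<in> inputs P \<and> opr P e = b \<and> onE h e = f"
    and arr_unt: "i \<in> types P \<Longrightarrow> onB h (unt P i) = unt Q (onI h i)"
    and arr_sub: "composable P c e \<Longrightarrow> onB h (sub P c e) = sub Q (onB h c) (onE h e)"
    and arr_outer: "\<lbrakk>composable P c e; x \<in> fib P (opr P e) - {e}\<rbrakk> \<Longrightarrow>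
      onE h (outer P c e x) = outer Q (onB h c) (onE h e) (onE h x)"
    and arr_inner: "\<lbrakk>composable P c e; x \<in> fib P c\<rbrakk> \<Longrightarrow>
      onE h (inner P c e x) = inner Q (onB h c) (onE h e) (onE h x)"

definition arr_comp :: "('j, 'c, 'f, 'k, 'd, 'g) arr \<Rightarrow> ('i, 'b, 'e, 'j, 'c, 'f) arr \<Rightarrow>
    ('i, 'b, 'e, 'k, 'd, 'g) arr" (infixr \<open>\<circ>\<^sub>a\<close> 55) where
  "k \<circ>\<^sub>a h = \<lparr>onI = onI k \<circ> onI h, onB = onB k \<circ> onB h, onE = onE k \<circ> onE h\<rparr>"

text \<open>Equality of arrows with domain \<open>P\<close>: values outside the carriers are irrelevant.\<close>

definition arr_eq :: "('i, 'b, 'e) pm \<Rightarrow> ('i, 'b, 'e, 'j, 'c, 'f) arr \<Rightarrow>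
    ('i, 'b, 'e, 'j, 'c, 'f) arr \<Rightarrow> bool" where
  "arr_eq P h k \<longleftrightarrow> (\<forall>i \<in> types P. onI h i = onI k i) \<and> (\<forall>b \<in> ops P. onB h b = onB k b) \<and>
     (\<forall>e \<in> inputs P. onE h e = onE k e)"

text \<open>The trivial monad \<open>1 \<leftarrow> 1 \<rightarrow> 1 \<rightarrow> 1\<close> on a singleton \<open>{a}\<close>.\<close>

definition trivial_pm :: "'a \<Rightarrow> ('a, 'a, 'a) pm" where
  "trivial_pm a = \<lparr>types = {a}, ops = {a}, inputs = {a}, src = \<lambda>_. a, opr = \<lambda>_. a, tgt = \<lambda>_. a,
     unt = \<lambda>_. a, sub = \<lambda>_ _. a, outer = \<lambda>_ _ _. a, inner = \<lambda>_ _ _. a\<rparr>"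

abbreviation Id_pm :: "(unit, unit, unit) pm" where
  "Id_pm \<equiv> trivial_pm ()"

type_synonym ('i, 'b, 'e) pointed_pm =
  "('i, 'b, 'e) pm \<times> (unit, unit, unit, 'i, 'b, 'e) arr"

definition is_pointed_pm :: "('i, 'b, 'e) pointed_pm \<Rightarrow> bool" where
  "is_pointed_pm X \<longleftrightarrow> pm_arrow Id_pm (fst X) (snd X)"

definition is_pointed_arrow :: "('i, 'b, 'e) pointed_pm \<Rightarrow> ('j, 'c, 'f) pointed_pm \<Rightarrow>
    ('i, 'b, 'e, 'j, 'c, 'f) arr \<Rightarrow> bool" where
  "is_pointed_arrow X Y h \<longleftrightarrow> is_pointed_pm X \<and> is_pointed_pm Y \<and>
     pm_arrow (fst X) (fst Y) h \<and> arr_eq Id_pm (h \<circ>\<^sub>a snd X) (snd Y)"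


section \<open>Trees\<close>

text \<open>
  The set \<open>tr(P)\<close> of isomorphism classes of \<open>P\<close>-trees.  \<open>Unit i\<close> is the unit tree decorated by \<open>i\<close>;
  \<open>Dot b S\<close> is the tree whose lowest dot is decorated by \<open>b\<close> and in which \<open>(e, T) |\<in>| S\<close> means that
  \<open>T\<close> is the subtree whose root edge is the input edge of that dot labelled by \<open>e\<close>.
  Because the input edges of a dot are in bijection with the fibre of its decoration, a \<open>P\<close>-tree has
  no non-trivial automorphism, and its edges are named by addresses: the list of the labels met on
  the way from the root edge to that edge. A dot is named by the address of its output edge.
  Trees are not planar: the branches form a set, not a list.
  The theorem \<open>graph_tree_iso_class\<close> at the end of this theory shows that well-formed terms are the same
  thing as isomorphism classes of decorated graphs.
\<close>

datatype ('i, 'b, 'e) ptree =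
    Unit 'i
  | Dot 'b "('e \<times> ('i, 'b, 'e) ptree) fset"

fun root_type :: "('i, 'b, 'e) pm \<Rightarrow> ('i, 'b, 'e) ptree \<Rightarrow> 'i" where
  "root_type P (Unit i) = i"
| "root_type P (Dot b S) = tgt P b"

inductive is_ptree :: "('i, 'b, 'e) pm \<Rightarrow> ('i, 'b, 'e) ptree \<Rightarrow> bool" for P where
  unit_tree: "i \<in> types P \<Longrightarrow> is_ptree P (Unit i)"
| dot_tree: "\<lbrakk>b \<in> ops P; bij_betw fst (fset S) (fib P b);
     \<And>e T. (e, T) |\<in>| S \<Longrightarrow> is_ptree P T \<and> root_type P T = src P e\<rbrakk> \<Longrightarrow> is_ptree P (Dot b S)"

definition branch :: "('e \<times> ('i, 'b, 'e) ptree) fset \<Rightarrow> 'e \<Rightarrow> ('i, 'b, 'e) ptree" where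
  "branch S e = (THE T. (e, T) |\<in>| S)"

inductive subtree_at :: "('i, 'b, 'e) ptree \<Rightarrow> 'e list \<Rightarrow> ('i, 'b, 'e) ptree \<Rightarrow> bool" where
  here: "subtree_at T [] T"
| above: "\<lbrakk>(e, T) |\<in>| S; subtree_at T q U\<rbrakk> \<Longrightarrow> subtree_at (Dot b S) (e # q) U"

definition leaves :: "('i, 'b, 'e) ptree \<Rightarrow> 'e list set" where
  "leaves T = {q. \<exists>i. subtree_at T q (Unit i)}"

definition dots :: "('i, 'b, 'e) ptree \<Rightarrow> 'e list set" where
  "dots T = {q. \<exists>b S. subtree_at T q (Dot b S)}"

definition dot_dec :: "('i, 'b, 'e) ptree \<Rightarrow> 'e list \<Rightarrow> 'b" where
  "dot_dec T q = (THE b. \<exists>S. subtree_at T q (Dot b S))"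


text \<open>
  Contraction of all inner edges: \<open>contract P T\<close> is the pair of the operation \<open>t(T)\<close> and of the canonical
  bijection from the leaves of \<open>T\<close> to the inputs of \<open>t(T)\<close>.
  For \<open>Dot b S\<close> the contracted branches are substituted one by one into \<open>b\<close>, starting from the one-dot
  tree, whose leaves are the addresses \<open>[e]\<close>; the order is irrelevant by \<open>assoc_parallel\<close>.
\<close>

fun attach :: "('i, 'b, 'e) pm \<Rightarrow> 'e \<times> 'b \<times> ('e list \<Rightarrow> 'e) \<Rightarrow> 'b \<times> ('e list \<Rightarrow> 'e) \<Rightarrow> 'b \<times> ('e list \<Rightarrow> 'e)"
  where
  "attach P (e, c, m) (b, l) =
     (sub P c (l [e]),
      \<lambda>q. if hd q = e then inner P c (l [e]) (m (tl q)) else outer P c (l [e]) (l q))"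

definition attach_all :: "('i, 'b, 'e) pm \<Rightarrow> 'b \<Rightarrow> ('e \<times> 'b \<times> ('e list \<Rightarrow> 'e)) fset \<Rightarrow> 'b \<times> ('e list \<Rightarrow> 'e)"
  where
  "attach_all P b C = fold (attach P) (SOME xs. distinct xs \<and> set xs = fset C) (b, hd)"

primrec contract :: "('i, 'b, 'e) pm \<Rightarrow> ('i, 'b, 'e) ptree \<Rightarrow> 'b \<times> ('e list \<Rightarrow> 'e)" where
  "contract P (Unit i) = (unt P i, \<lambda>_. THE e. e \<in> fib P (unt P i))"
| "contract P (Dot b S) = attach_all P b (map_prod id (contract P) |`| S)"

definition tree_op :: "('i, 'b, 'e) pm \<Rightarrow> ('i, 'b, 'e) ptree \<Rightarrow> 'b" where
  "tree_op P T = fst (contract P T)"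

definition leaf_input :: "('i, 'b, 'e) pm \<Rightarrow> ('i, 'b, 'e) ptree \<Rightarrow> 'e list \<Rightarrow> 'e" where
  "leaf_input P T = snd (contract P T)"

definition leaf_of :: "('i, 'b, 'e) pm \<Rightarrow> ('i, 'b, 'e) ptree \<Rightarrow> 'e \<Rightarrow> 'e list" where
  "leaf_of P T e = (THE q. q \<in> leaves T \<and> leaf_input P T q = e)"


section \<open>The Baez--Dolan functor\<close>

text \<open>\<open>graft F g\<close> glues the tree \<open>g q\<close> onto the leaf \<open>q\<close> of \<open>F\<close>, for all leaves \<open>q\<close>.\<close>

primrec graft :: "('i, 'b, 'e) ptree \<Rightarrow> ('e list \<Rightarrow> ('i, 'b, 'e) ptree) \<Rightarrow> ('i, 'b, 'e) ptree" where
  "graft (Unit i) = (\<lambda>g. g [])"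
| "graft (Dot b S) = (\<lambda>g. Dot b ((\<lambda>(e, F). (e, F (\<lambda>q. g (e # q)))) |`| (map_prod id graft |`| S)))"

text \<open>
  \<open>replace_dot P F q G\<close> replaces the dot \<open>q\<close> of \<open>G\<close> by \<open>F\<close>, assuming that \<open>tree_op P F\<close> is the decoration
  of that dot. An input edge \<open>e\<close> of the dot becomes the leaf of \<open>F\<close> corresponding to \<open>e\<close>, which
  accounts for the renaming of the dots of \<open>G\<close> in \<open>outer_dot\<close>.
\<close>

fun replace_dot :: "('i, 'b, 'e) pm \<Rightarrow> ('i, 'b, 'e) ptree \<Rightarrow> 'e list \<Rightarrow> ('i, 'b, 'e) ptree \<Rightarrow> ('i, 'b, 'e) ptree"
  where
  "replace_dot P F q (Unit i) = Unit i"
| "replace_dot P F [] (Dot b S) = graft F (\<lambda>l. branch S (leaf_input P F l))"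
| "replace_dot P F (e # q) (Dot b S) =
     Dot b ((\<lambda>(e', T). (e', if e' = e then replace_dot P F q T else T)) |`| S)"

definition outer_dot :: "('i, 'b, 'e) pm \<Rightarrow> ('i, 'b, 'e) ptree \<Rightarrow> 'e list \<Rightarrow> 'e list \<Rightarrow> 'e list" where
  "outer_dot P F q r =
     (if \<exists>e s. r = q @ e # s
      then q @ leaf_of P F (r ! length q) @ drop (Suc (length q)) r
      else r)"

definition one_dot_tree :: "('i, 'b, 'e) pm \<Rightarrow> 'b \<Rightarrow> ('i, 'b, 'e) ptree" where
  "one_dot_tree P b = Dot b (Abs_fset ((\<lambda>e. (e, Unit (src P e))) ` fib P b))"

text \<open>A tree with a marked dot is represented by the pair of the tree and the address of the dot.\<close>

definition BD :: "('i, 'b, 'e) pm \<Rightarrow>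
    ('b, ('i, 'b, 'e) ptree, ('i, 'b, 'e) ptree \<times> 'e list) pm" where
  "BD P = \<lparr>
     types = ops P,
     ops = {T. is_ptree P T},
     inputs = {(T, q). is_ptree P T \<and> q \<in> dots T},
     src = (\<lambda>(T, q). dot_dec T q),
     opr = fst,
     tgt = tree_op P,
     unt = one_dot_tree P,
     sub = (\<lambda>F (G, q). replace_dot P F q G),
     outer = (\<lambda>F (G, q) (_, r). (replace_dot P F q G, outer_dot P F q r)),
     inner = (\<lambda>F (G, q) (_, r). (replace_dot P F q G, q @ r))\<rparr>"

definition BD_arr :: "('i, 'b, 'e, 'j, 'c, 'f) arr \<Rightarrow>
    ('b, ('i, 'b, 'e) ptree, ('i, 'b, 'e) ptree \<times> 'e list,
     'c, ('j, 'c, 'f) ptree, ('j, 'c, 'f) ptree \<times> 'f list) arr" where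
  "BD_arr h = \<lparr>
     onI = onB h,
     onB = map_ptree (onI h) (onB h) (onE h),
     onE = map_prod (map_ptree (onI h) (onB h) (onE h)) (map (onE h))\<rparr>"

text \<open>The arrow \<open>S\<^sub>0\<close> from the trivial monad to its Baez--Dolan construction.\<close>

definition susp0 :: "'a \<Rightarrow>
    ('a, 'a, 'a, 'a, ('a, 'a, 'a) ptree, ('a, 'a, 'a) ptree \<times> 'a list) arr" where
  "susp0 a = \<lparr>
     onI = (\<lambda>_. a),
     onB = (\<lambda>_. Dot a {|(a, Unit a)|}),
     onE = (\<lambda>_. (Dot a {|(a, Unit a)|}, []))\<rparr>"

definition BD_pointed :: "('i, 'b, 'e) pointed_pm \<Rightarrow>
    ('b, ('i, 'b, 'e) ptree, ('i, 'b, 'e) ptree \<times> 'e list) pointed_pm" where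
  "BD_pointed X = (BD (fst X), BD_arr (snd X) \<circ>\<^sub>a susp0 ())"


section \<open>Opetopes\<close>

text \<open>
  The iterates of \<open>BD\<close> have different HOL types.  They are made to live in a single type
  \<open>cell\<close> by renaming the operations and inputs of \<open>BD\<close> along the constructors of \<open>cell\<close>,
  which are injective; thus \<open>opetopic (Suc k)\<close> is an isomorphic copy of \<open>BD (opetopic k)\<close>, and
  \<open>types (opetopic (Suc k)) = ops (opetopic k)\<close>.
\<close>

datatype cell =
    Star
  | Tree (un_tree: "(cell, cell, cell) ptree")
  | Marked (marked_tree: "(cell, cell, cell) ptree") (mark: "cell list")

type_synonym cell_pm = "(cell, cell, cell) pm"
type_synonym cell_arr = "(cell, cell, cell, cell, cell, cell) arr"

definition enc :: "(cell, (cell, cell, cell) ptree, (cell, cell, cell) ptree \<times> cell list,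
    cell, cell, cell) arr" where
  "enc = \<lparr>onI = id, onB = Tree, onE = (\<lambda>(T, q). Marked T q)\<rparr>"

definition dec :: "(cell, cell, cell,
    cell, (cell, cell, cell) ptree, (cell, cell, cell) ptree \<times> cell list) arr" where
  "dec = \<lparr>onI = id, onB = un_tree, onE = (\<lambda>x. (marked_tree x, mark x))\<rparr>"

text \<open>Renaming along componentwise injective maps \<open>h\<close> with left inverse \<open>k\<close>.\<close>

definition rename_pm :: "('i, 'b, 'e, 'j, 'c, 'f) arr \<Rightarrow> ('j, 'c, 'f, 'i, 'b, 'e) arr \<Rightarrow>
    ('i, 'b, 'e) pm \<Rightarrow> ('j, 'c, 'f) pm" where
  "rename_pm h k P = \<lparr>
     types = onI h ` types P,
     ops = onB h ` ops P,
     inputs = onE h ` inputs P,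
     src = (\<lambda>e. onI h (src P (onE k e))),
     opr = (\<lambda>e. onB h (opr P (onE k e))),
     tgt = (\<lambda>b. onI h (tgt P (onB k b))),
     unt = (\<lambda>i. onB h (unt P (onI k i))),
     sub = (\<lambda>c e. onB h (sub P (onB k c) (onE k e))),
     outer = (\<lambda>c e x. onE h (outer P (onB k c) (onE k e) (onE k x))),
     inner = (\<lambda>c e x. onE h (inner P (onB k c) (onE k e) (onE k x)))\<rparr>"

primrec opetopic :: "nat \<Rightarrow> cell_pm" where
  "opetopic 0 = trivial_pm Star"
| "opetopic (Suc n) = rename_pm enc dec (BD (opetopic n))"

primrec suspension :: "nat \<Rightarrow> cell_arr" where
  "suspension 0 = enc \<circ>\<^sub>a susp0 Star"
| "suspension (Suc n) = enc \<circ>\<^sub>a BD_arr (suspension n) \<circ>\<^sub>a dec"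


section \<open>Stable opetopes\<close>

text \<open>The colimit of a sequence of sets \<open>A n\<close> and maps \<open>f n : A n \<rightarrow> A (Suc n)\<close>.\<close>

primrec shift :: "(nat \<Rightarrow> 'a \<Rightarrow> 'a) \<Rightarrow> nat \<Rightarrow> nat \<Rightarrow> 'a \<Rightarrow> 'a" where
  "shift f n 0 x = x"
| "shift f n (Suc k) x = f (n + k) (shift f n k x)"

definition colim_rel :: "(nat \<Rightarrow> 'a set) \<Rightarrow> (nat \<Rightarrow> 'a \<Rightarrow> 'a) \<Rightarrow> ((nat \<times> 'a) \<times> (nat \<times> 'a)) set" where
  "colim_rel A f = {((n, x), (m, y)). x \<in> A n \<and> y \<in> A m \<and>
     (\<exists>k l. n + k = m + l \<and> shift f n k x = shift f m l y)}"

definition colim :: "(nat \<Rightarrow> 'a set) \<Rightarrow> (nat \<Rightarrow> 'a \<Rightarrow> 'a) \<Rightarrow> (nat \<times> 'a) set set" where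
  "colim A f = (SIGMA n:UNIV. A n) // colim_rel A f"

definition colim_in :: "(nat \<Rightarrow> 'a set) \<Rightarrow> (nat \<Rightarrow> 'a \<Rightarrow> 'a) \<Rightarrow> nat \<Rightarrow> 'a \<Rightarrow> (nat \<times> 'a) set" where
  "colim_in A f n x = colim_rel A f `` {(n, x)}"

text \<open>
  The set \<open>Z\<^sup>\<infinity>\<close> of stable opetopes, the set of stable opetopes with a marked input, and
  the maps into them of the types, operations and inputs of \<open>opetopic n\<close>.  An operation of \<open>opetopic n\<close> is
  an (n+1)-opetope, that is, a type of \<open>opetopic (Suc n)\<close>.
\<close>

type_synonym stable = "(nat \<times> cell) set"

definition Z_inf :: "stable set" where
  "Z_inf = colim (\<lambda>n. types (opetopic n)) (\<lambda>n. onI (suspension n))"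

definition Z_bar_inf :: "stable set" where
  "Z_bar_inf = colim (\<lambda>n. inputs (opetopic n)) (\<lambda>n. onE (suspension n))"

definition in_type :: "nat \<Rightarrow> cell \<Rightarrow> stable" where
  "in_type = colim_in (\<lambda>n. types (opetopic n)) (\<lambda>n. onI (suspension n))"

definition in_op :: "nat \<Rightarrow> cell \<Rightarrow> stable" where
  "in_op n = in_type (Suc n)"

definition in_input :: "nat \<Rightarrow> cell \<Rightarrow> stable" where
  "in_input = colim_in (\<lambda>n. inputs (opetopic n)) (\<lambda>n. onE (suspension n))"

definition in_stable :: "nat \<Rightarrow> (cell, cell, cell, stable, stable, stable) arr" where
  "in_stable n = \<lparr>onI = in_type n, onB = in_op n, onE = in_input n\<rparr>"

text \<open>
  The monad \<open>P\<^sup>\<infinity>\<close> : all structure maps are the ones induced on the colimit, that is, they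
  are computed on representatives at a common stage \<open>n\<close>.
\<close>

definition P_inf :: "(stable, stable, stable) pm" where
  "P_inf = \<lparr>
     types = Z_inf,
     ops = Z_inf,
     inputs = Z_bar_inf,
     src = (\<lambda>z. THE w. \<exists>n e. e \<in> inputs (opetopic n) \<and> z = in_input n e \<and>
              w = in_type n (src (opetopic n) e)),
     opr = (\<lambda>z. THE w. \<exists>n e. e \<in> inputs (opetopic n) \<and> z = in_input n e \<and>
              w = in_op n (opr (opetopic n) e)),
     tgt = (\<lambda>z. THE w. \<exists>n b. b \<in> ops (opetopic n) \<and> z = in_op n b \<and>
              w = in_type n (tgt (opetopic n) b)),
     unt = (\<lambda>z. THE w. \<exists>n i. i \<in> types (opetopic n) \<and> z = in_type n i \<and>
              w = in_op n (unt (opetopic n) i)),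
     sub = (\<lambda>y z. THE w. \<exists>n c e. composable (opetopic n) c e \<and> y = in_op n c \<and> z = in_input n e \<and>
              w = in_op n (sub (opetopic n) c e)),
     outer = (\<lambda>y z v. THE w. \<exists>n c e x. composable (opetopic n) c e \<and>
              x \<in> fib (opetopic n) (opr (opetopic n) e) - {e} \<and>
              y = in_op n c \<and> z = in_input n e \<and> v = in_input n x \<and>
              w = in_input n (outer (opetopic n) c e x)),
     inner = (\<lambda>y z v. THE w. \<exists>n c e x. composable (opetopic n) c e \<and>
              x \<in> fib (opetopic n) c \<and>
              y = in_op n c \<and> z = in_input n e \<and> v = in_input n x \<and>
              w = in_input n (inner (opetopic n) c e x))\<rparr>"

definition P_inf_pointed :: "(stable, stable, stable) pointed_pm" where
  "P_inf_pointed = (P_inf,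
     \<lparr>onI = (\<lambda>_. in_type 0 Star), onB = (\<lambda>_. in_op 0 Star), onE = (\<lambda>_. in_input 0 Star)\<rparr>)"


section \<open>Algebras for the Baez--Dolan functor\<close>

definition is_BD_algebra :: "('i, 'b, 'e) pointed_pm \<Rightarrow>
    ('b, ('i, 'b, 'e) ptree, ('i, 'b, 'e) ptree \<times> 'e list, 'i, 'b, 'e) arr \<Rightarrow> bool" where
  "is_BD_algebra X x \<longleftrightarrow> is_pointed_pm X \<and> is_pointed_arrow (BD_pointed X) X x"

definition is_BD_algebra_arrow :: "('i, 'b, 'e) pointed_pm \<Rightarrow>
    ('b, ('i, 'b, 'e) ptree, ('i, 'b, 'e) ptree \<times> 'e list, 'i, 'b, 'e) arr \<Rightarrow>
    ('j, 'c, 'f) pointed_pm \<Rightarrow>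
    ('c, ('j, 'c, 'f) ptree, ('j, 'c, 'f) ptree \<times> 'f list, 'j, 'c, 'f) arr \<Rightarrow>
    ('i, 'b, 'e, 'j, 'c, 'f) arr \<Rightarrow> bool" where
  "is_BD_algebra_arrow X x Y y h \<longleftrightarrow> is_pointed_arrow X Y h \<and>
     arr_eq (BD (fst X)) (h \<circ>\<^sub>a x) (y \<circ>\<^sub>a BD_arr h)"

text \<open>
  The structure map \<open>BD(P\<^sup>\<infinity>) \<rightarrow> P\<^sup>\<infinity>\<close>: for all \<open>n\<close> it sends the image of a cell of \<open>BD (opetopic n)\<close>
  to the image of the corresponding cell of \<open>opetopic (Suc n)\<close>.  On types, which are
  the elements of \<open>Z\<^sup>\<infinity>\<close> on both sides, it is the identity.
\<close>

definition P_inf_struct :: "(stable, (stable, stable, stable) ptree,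
    (stable, stable, stable) ptree \<times> stable list, stable, stable, stable) arr" where
  "P_inf_struct = \<lparr>
     onI = id,
     onB = (\<lambda>z. THE w. \<exists>n T. T \<in> ops (BD (opetopic n)) \<and> z = onB (BD_arr (in_stable n)) T \<and>
              w = in_op (Suc n) (onB enc T)),
     onE = (\<lambda>z. THE w. \<exists>n M. M \<in> inputs (BD (opetopic n)) \<and> z = onE (BD_arr (in_stable n)) M \<and>
              w = in_input (Suc n) (onE enc M))\<rparr>"


section \<open>Trees as graphs\<close>

text \<open>
  This section plays no role in the other definitions. It justifies the representation of \<open>tr(P)\<close> by
  \<open>ptree\<close>: \<open>P\<close>-trees are defined as decorated finite graphs, and every such graph is
  isomorphic to the graph of exactly one well-formed term.
\<close>

record ('v, 'i, 'b, 'e) gtree =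
  verts :: "'v set"
  edges :: "'v set set"
  bdry :: "'v set"
  base :: 'v
  edge_dec :: "'v set \<Rightarrow> 'i"
  vert_dec :: "'v \<Rightarrow> 'b"
  in_dec :: "'v \<Rightarrow> 'v set \<Rightarrow> 'e"

text \<open>
  \<open>base\<close> is the output vertex; \<open>bdry - {base}\<close> are the input vertices and \<open>verts - bdry\<close> the dots.
  \<open>in_dec n E\<close> is the input labelling the input edge \<open>E\<close> of the dot \<open>n\<close>.
\<close>

definition simple_path :: "('v, 'i, 'b, 'e) gtree \<Rightarrow> 'v list \<Rightarrow> 'v \<Rightarrow> 'v \<Rightarrow> bool" where
  "simple_path G p x y \<longleftrightarrow> p \<noteq> [] \<and> distinct p \<and> set p \<subseteq> verts G \<and> hd p = x \<and> last p = y \<and>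
     successively (\<lambda>u v. {u, v} \<in> edges G) p"

text \<open>A finite graph is connected and simply connected iff any two vertices are joined by exactly one simple path.\<close>

definition is_tree :: "('v, 'i, 'b, 'e) gtree \<Rightarrow> bool" where
  "is_tree G \<longleftrightarrow> finite (verts G) \<and>
     (\<forall>E \<in> edges G. \<exists>x \<in> verts G. \<exists>y \<in> verts G. x \<noteq> y \<and> E = {x, y}) \<and>
     (\<forall>x \<in> verts G. \<forall>y \<in> verts G. \<exists>!p. simple_path G p x y) \<and>
     bdry G \<subseteq> verts G \<and> base G \<in> bdry G \<and>
     (\<forall>v \<in> bdry G. \<exists>!E. E \<in> edges G \<and> v \<in> E)"

definition towards_base :: "('v, 'i, 'b, 'e) gtree \<Rightarrow> 'v \<Rightarrow> 'v" where
  "towards_base G v = (THE p. simple_path G p v (base G)) ! 1"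

definition out_edge :: "('v, 'i, 'b, 'e) gtree \<Rightarrow> 'v \<Rightarrow> 'v set" where
  "out_edge G v = {v, towards_base G v}"

definition in_edges :: "('v, 'i, 'b, 'e) gtree \<Rightarrow> 'v \<Rightarrow> 'v set set" where
  "in_edges G v = {E \<in> edges G. v \<in> E} - {out_edge G v}"

definition is_graph_ptree :: "('i, 'b, 'e) pm \<Rightarrow> ('v, 'i, 'b, 'e) gtree \<Rightarrow> bool" where
  "is_graph_ptree P G \<longleftrightarrow> is_tree G \<and> (\<forall>E \<in> edges G. edge_dec G E \<in> types P) \<and>
     (\<forall>n \<in> verts G - bdry G. vert_dec G n \<in> ops P \<and>
        bij_betw (in_dec G n) (in_edges G n) (fib P (vert_dec G n)) \<and>
        (\<forall>E \<in> in_edges G n. edge_dec G E = src P (in_dec G n E)) \<and>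
        edge_dec G (out_edge G n) = tgt P (vert_dec G n))"

definition graph_iso_by :: "('v \<Rightarrow> 'w) \<Rightarrow> ('v, 'i, 'b, 'e) gtree \<Rightarrow> ('w, 'i, 'b, 'e) gtree \<Rightarrow> bool" where
  "graph_iso_by \<phi> G H \<longleftrightarrow> bij_betw \<phi> (verts G) (verts H) \<and> (`) \<phi> ` edges G = edges H \<and>
     \<phi> ` bdry G = bdry H \<and> \<phi> (base G) = base H \<and>
     (\<forall>E \<in> edges G. edge_dec H (\<phi> ` E) = edge_dec G E) \<and>
     (\<forall>n \<in> verts G - bdry G. vert_dec H (\<phi> n) = vert_dec G n \<and>
        (\<forall>E \<in> in_edges G n. in_dec H (\<phi> n) (\<phi> ` E) = in_dec G n E))"

definition graph_iso :: "('v, 'i, 'b, 'e) gtree \<Rightarrow> ('w, 'i, 'b, 'e) gtree \<Rightarrow> bool" where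
  "graph_iso G H \<longleftrightarrow> (\<exists>\<phi>. graph_iso_by \<phi> G H)"

definition addresses :: "('i, 'b, 'e) ptree \<Rightarrow> 'e list set" where
  "addresses T = {q. \<exists>U. subtree_at T q U}"

definition upper_edge :: "'e list \<Rightarrow> 'e list option set" where
  "upper_edge q = {Some q, if q = [] then None else Some (butlast q)}"

text \<open>The vertices of the graph of \<open>T\<close> are the output vertex \<open>None\<close> and the upper end \<open>Some q\<close> of each edge \<open>q\<close>.\<close>

definition graph_of :: "('i, 'b, 'e) pm \<Rightarrow> ('i, 'b, 'e) ptree \<Rightarrow> ('e list option, 'i, 'b, 'e) gtree" where
  "graph_of P T = \<lparr>
     verts = insert None (Some ` addresses T),
     edges = upper_edge ` addresses T,
     bdry = insert None (Some ` leaves T),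
     base = None,
     edge_dec = (\<lambda>E. THE i. \<exists>q U. subtree_at T q U \<and> E = upper_edge q \<and> i = root_type P U),
     vert_dec = (\<lambda>v. dot_dec T (the v)),
     in_dec = (\<lambda>v E. THE e. E = upper_edge (the v @ [e]))\<rparr>"

text \<open>For the proof: trees described by a parent function and a rank decreasing towards the base point.\<close>

definition rooted :: "('v, 'i, 'b, 'e) gtree \<Rightarrow> ('v \<Rightarrow> 'v) \<Rightarrow> ('v \<Rightarrow> nat) \<Rightarrow> bool" where
  "rooted G par rk \<longleftrightarrow> base G \<in> verts G \<and> rk (base G) = 0 \<and>
    (\<forall>v \<in> verts G - {base G}. par v \<in> verts G \<and> rk (par v) < rk v) \<and>
    edges G = (\<lambda>v. {v, par v}) ` (verts G - {base G})"

lemma rootedD: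
  assumes "rooted G par rk"
  shows "base G \<in> verts G" "rk (base G) = 0"
    "\<And>v. v \<in> verts G - {base G} \<Longrightarrow> par v \<in> verts G"
    "\<And>v. v \<in> verts G - {base G} \<Longrightarrow> rk (par v) < rk v"
    "edges G = (\<lambda>v. {v, par v}) ` (verts G - {base G})"
proof -
  note A = assms[unfolded rooted_def]
  show "base G \<in> verts G" using A by (elim conjE)
  show "rk (base G) = 0" using A by (elim conjE)
  have par: "\<forall>v \<in> verts G - {base G}. par v \<in> verts G \<and> rk (par v) < rk v" using A by (elim conjE)
  show "edges G = (\<lambda>v. {v, par v}) ` (verts G - {base G})" using A by (elim conjE)
  show "par v \<in> verts G" if "v \<in> verts G - {base G}" for v using bspec[OF par that] by (elim conjE)
  show "rk (par v) < rk v" if "v \<in> verts G - {base G}" for v using bspec[OF par that] by (elim conjE)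
qed

lemma rooted_subset:
  assumes R: "rooted G par rk" and "e \<in> edges G" shows "e \<subseteq> verts G"
proof -
  obtain v where v: "v \<in> verts G - {base G}" "e = {v, par v}"
    using assms(2) unfolding rootedD(5)[OF R] by auto
  then show ?thesis using rootedD(3)[OF R v(1)] by simp
qed

lemma rooted_edge:
  assumes "rooted G par rk" "{x, y} \<in> edges G"
  shows "x \<noteq> y \<and> x \<in> verts G \<and> y \<in> verts G \<and>
    ((x \<noteq> base G \<and> y = par x \<and> rk y < rk x) \<or> (y \<noteq> base G \<and> x = par y \<and> rk x < rk y))"
proof -
  obtain v where v: "v \<in> verts G" "v \<noteq> base G" "{x, y} = {v, par v}"
    using assms by (auto simp: rooted_def)
  then have "par v \<in> verts G" "rk (par v) < rk v" using assms(1) by (auto simp: rooted_def)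
  with v show ?thesis by (auto simp: doubleton_eq_iff)
qed

lemma rooted_up:
  assumes R: "rooted G par rk"
  shows "\<lbrakk>distinct (x # y # p); successively (\<lambda>u v. {u, v} \<in> edges G) (x # y # p); rk x < rk y\<rbrakk> \<Longrightarrow>
     rk x < rk (last (y # p))"
proof (induction p arbitrary: x y)
  case (Cons z p)
  from Cons.prems rooted_edge[OF R, of x y] rooted_edge[OF R, of y z]
  have "rk y < rk z" by auto
  with Cons.IH[of y z] Cons.prems show ?case by auto
qed simp

lemma rooted_first_step:
  assumes R: "rooted G par rk" and p: "simple_path G (x # p) x y" and "x \<noteq> y" "rk y \<le> rk x"
  shows "simple_path G p (par x) y"
proof -
  obtain z p' where pz: "p = z # p'"
    using p \<open>x \<noteq> y\<close> by (cases p) (auto simp: simple_path_def)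
  have e: "{x, z} \<in> edges G" using p by (auto simp: simple_path_def pz)
  have "\<not> rk x < rk z"
  proof
    assume "rk x < rk z"
    with rooted_up[OF R, of x z p'] p have "rk x < rk y" by (auto simp: simple_path_def pz)
    with assms show False by simp
  qed
  with rooted_edge[OF R e] have "z = par x" by auto
  with p show ?thesis by (auto simp: simple_path_def pz)
qed

lemma simple_path_rev: "simple_path G p x y \<Longrightarrow> simple_path G (rev p) y x"
  by (auto simp: simple_path_def hd_rev last_rev insert_commute)

lemma simple_path_hd: "simple_path G p x y \<Longrightarrow> p = x # tl p"
  by (cases p) (auto simp: simple_path_def)

lemma rooted_unique:
  assumes R: "rooted G par rk"
  shows "\<lbrakk>simple_path G p x y; simple_path G q x y\<rbrakk> \<Longrightarrow> p = q"
proof (induction "rk x + rk y" arbitrary: x y p q rule: less_induct)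
  case less
  show ?case
  proof (cases "x = y")
    case True
    have "r = [x]" if "simple_path G r x y" for r
      using that True by (cases r) (auto simp: simple_path_def split: if_splits)
    with less.prems show ?thesis by blast
  next
    case False
    have main: "p = q" if xy: "rk y \<le> rk x" "x \<noteq> y" and IH: "\<And>p q. simple_path G p (par x) y \<Longrightarrow>
        simple_path G q (par x) y \<Longrightarrow> rk (par x) + rk y < rk x + rk y \<Longrightarrow> p = q"
      and pq: "simple_path G p x y" "simple_path G q x y" for x y p q
    proof -
      have v: "x \<in> verts G" "y \<in> verts G"
        using pq by (metis hd_in_set last_in_set simple_path_def subset_code(1))+
      have "x \<noteq> base G"
      proof
        assume b: "x = base G"
        then have "rk y = 0" using xy R by (simp add: rooted_def)
        moreover have "rk (par y) < rk y" using R v(2) xy(2) b unfolding rooted_def by blast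
        ultimately show False by simp
      qed
      then have "rk (par x) < rk x" using R v by (auto simp: rooted_def)
      moreover have "simple_path G (tl p) (par x) y" "simple_path G (tl q) (par x) y"
        using rooted_first_step[OF R _ xy(2,1)] pq simple_path_hd by metis+
      ultimately have "tl p = tl q" using IH by simp
      with pq simple_path_hd show "p = q" by metis
    qed
    show ?thesis
    proof (cases "rk y \<le> rk x")
      case True
      show ?thesis by (rule main[OF True False _ less.prems]) (use less.hyps in blast)
    next
      case F2: False
      have "rev p = rev q"
      proof (rule main[of x y])
        show "rk x \<le> rk y" "y \<noteq> x" using F2 False by auto
        show "simple_path G (rev p) y x" "simple_path G (rev q) y x"
          using less.prems by (auto intro: simple_path_rev)
        fix p q assume a: "simple_path G p (par y) x" "simple_path G q (par y) x"
          "rk (par y) + rk x < rk y + rk x"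
        have "rev p = rev q"
          by (rule less.hyps[of x "par y"]) (use a in \<open>auto intro: simple_path_rev\<close>)
        then show "p = q" by simp
      qed
      then show ?thesis by simp
    qed
  qed
qed

lemma rooted_exists:
  assumes R: "rooted G par rk"
  shows "\<lbrakk>x \<in> verts G; y \<in> verts G\<rbrakk> \<Longrightarrow>
    \<exists>p. simple_path G p x y \<and> (\<forall>z \<in> set p. z = x \<or> z = y \<or> rk z < max (rk x) (rk y))"
proof (induction "rk x + rk y" arbitrary: x y rule: less_induct)
  case less
  show ?case
  proof (cases "x = y")
    case True
    with less.prems show ?thesis by (intro exI[of _ "[x]"]) (auto simp: simple_path_def)
  next
    case False
    have main: "\<exists>p. simple_path G p x y \<and> (\<forall>z \<in> set p. z = x \<or> z = y \<or> rk z < max (rk x) (rk y))"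
      if xy: "rk y \<le> rk x" "x \<noteq> y" and v: "x \<in> verts G" "y \<in> verts G"
        and IH: "rk (par x) + rk y < rk x + rk y \<Longrightarrow> par x \<in> verts G \<Longrightarrow> \<exists>p. simple_path G p (par x) y \<and>
          (\<forall>z \<in> set p. z = par x \<or> z = y \<or> rk z < max (rk (par x)) (rk y))" for x y
    proof -
      have "x \<noteq> base G"
      proof
        assume b: "x = base G"
        then have "rk y = 0" using xy R by (simp add: rooted_def)
        moreover have "rk (par y) < rk y" using R v(2) xy(2) b unfolding rooted_def by blast
        ultimately show False by simp
      qed
      then have px: "rk (par x) < rk x" "par x \<in> verts G" "{x, par x} \<in> edges G"
        using R v by (auto simp: rooted_def)
      with IH obtain p where p: "simple_path G p (par x) y"
        "\<forall>z \<in> set p. z = par x \<or> z = y \<or> rk z < max (rk (par x)) (rk y)" by auto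
      have "x \<notin> set p" using p(2) px xy by (auto simp: max_def split: if_splits)
      then have "simple_path G (x # p) x y"
        using p px v by (auto simp: simple_path_def successively_Cons)
      moreover have "\<forall>z \<in> set (x # p). z = x \<or> z = y \<or> rk z < max (rk x) (rk y)"
        using p(2) px xy by (auto simp: max_def split: if_splits)
      ultimately show ?thesis by blast
    qed
    show ?thesis
    proof (cases "rk y \<le> rk x")
      case True
      show ?thesis by (rule main[OF True False less.prems]) (use less in auto)
    next
      case F2: False
      have "\<exists>p. simple_path G p y x \<and> (\<forall>z \<in> set p. z = y \<or> z = x \<or> rk z < max (rk y) (rk x))"
      proof (rule main)
        show "rk x \<le> rk y" "y \<noteq> x" using F2 False by auto
        assume "rk (par y) + rk x < rk y + rk x" "par y \<in> verts G"
        then have "\<exists>p. simple_path G p x (par y) \<and>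
           (\<forall>z \<in> set p. z = x \<or> z = par y \<or> rk z < max (rk x) (rk (par y)))"
          using less by auto
        then show "\<exists>p. simple_path G p (par y) x \<and>
           (\<forall>z \<in> set p. z = par y \<or> z = x \<or> rk z < max (rk (par y)) (rk x))"
          by (metis simple_path_rev set_rev max.commute)
      qed (use less.prems in auto)
      then show ?thesis by (metis simple_path_rev set_rev max.commute)
    qed
  qed
qed

lemma rooted_towards_base:
  assumes R: "rooted G par rk" and v: "v \<in> verts G" "v \<noteq> base G"
  shows "towards_base G v = par v"
proof -
  have b: "base G \<in> verts G" "rk (base G) = 0" using R by (auto simp: rooted_def)
  obtain p where p: "simple_path G p v (base G)" using rooted_exists[OF R v(1) b(1)] by blast
  then have the: "(THE p. simple_path G p v (base G)) = p"
    using rooted_unique[OF R] by blast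
  have "simple_path G (tl p) (par v) (base G)"
    using rooted_first_step[OF R, of v "tl p"] p v b simple_path_hd by fastforce
  then have "p = v # par v # tl (tl p)" using p simple_path_hd by metis
  then have "p ! 1 = par v" by (metis One_nat_def nth_Cons_0 nth_Cons_Suc)
  then show ?thesis by (simp add: towards_base_def the)
qed

lemma rooted_is_tree:
  assumes R: "rooted G par rk" and "finite (verts G)" "bdry G \<subseteq> verts G" "base G \<in> bdry G"
    "\<And>v. v \<in> bdry G \<Longrightarrow> \<exists>!E. E \<in> edges G \<and> v \<in> E"
  shows "is_tree G"
proof -
  have "\<exists>x \<in> verts G. \<exists>y \<in> verts G. x \<noteq> y \<and> E = {x, y}" if E: "E \<in> edges G" for E
  proof -
    obtain v where v: "v \<in> verts G - {base G}" "E = {v, par v}"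
      using E unfolding rootedD(5)[OF R] by auto
    have "v \<in> verts G" "par v \<in> verts G" "v \<noteq> par v"
      using rootedD(3,4)[OF R v(1)] v(1) by auto
    with v(2) show ?thesis by blast
  qed
  moreover have "\<exists>!p. simple_path G p x y" if "x \<in> verts G" "y \<in> verts G" for x y
    using rooted_exists[OF R that] rooted_unique[OF R] by blast
  ultimately show ?thesis unfolding is_tree_def
    by (intro conjI ballI assms(2-5)) assumption+
qed

lemma is_tree_rooted:
  assumes T: "is_tree G"
  shows "\<exists>rk. rooted G (towards_base G) rk"
proof -
  define pt where "pt v = (THE p. simple_path G p v (base G))" for v
  have b: "base G \<in> verts G" using T by (auto simp: is_tree_def)
  have ex1: "\<exists>!p. simple_path G p v (base G)" if "v \<in> verts G" for v
    using T b that by (auto simp: is_tree_def)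
  have pt: "simple_path G (pt v) v (base G)" if "v \<in> verts G" for v
    unfolding pt_def using theI'[OF ex1[OF that]] .
  have ptI: "pt v = p" if "simple_path G p v (base G)" for v p
  proof -
    have "v \<in> verts G" using that by (metis hd_in_set simple_path_def subset_code(1))
    then show ?thesis using that pt ex1 by blast
  qed
  have ptb: "pt (base G) = [base G]" by (rule ptI) (use b in \<open>auto simp: simple_path_def\<close>)
  have step: "pt v = v # pt (towards_base G v) \<and> towards_base G v \<in> verts G \<and> {v, towards_base G v} \<in> edges G"
    if v: "v \<in> verts G" "v \<noteq> base G" for v
  proof -
    obtain p where p: "pt v = v # p" using pt[OF v(1)] simple_path_hd by metis
    with pt[OF v(1)] v obtain w q where q: "p = w # q" by (cases p) (auto simp: simple_path_def)
    have w: "towards_base G v = w" using p q by (simp add: towards_base_def pt_def)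
    have "simple_path G p w (base G)" using pt[OF v(1)] by (auto simp: simple_path_def p q)
    then show ?thesis using ptI[of p w] pt[OF v(1)] by (auto simp: simple_path_def p q w)
  qed
  have edge: "E \<in> (\<lambda>v. {v, towards_base G v}) ` (verts G - {base G})" if E: "E \<in> edges G" for E
  proof -
    obtain x y where xy: "x \<in> verts G" "y \<in> verts G" "x \<noteq> y" "E = {x, y}"
      using T E by (auto simp: is_tree_def)
    have *: "pt y = y # pt x \<or> x \<noteq> base G \<and> y = towards_base G x" if xy: "x \<in> verts G" "y \<in> verts G"
      "x \<noteq> y" "{x, y} \<in> edges G" for x y
    proof (cases "y \<in> set (pt x)")
      case False
      have "simple_path G (y # pt x) y (base G)"
        using pt[OF xy(1)] xy False by (auto simp: simple_path_def successively_Cons insert_commute)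
      then show ?thesis using ptI by blast
    next
      case True
      then have xb: "x \<noteq> base G" using ptb xy by auto
      obtain a c where ac: "pt x = a @ y # c" using True by (meson split_list)
      obtain d where d: "a = x # d" using pt[OF xy(1)] ac xy(3) simple_path_hd[of G "pt x"]
        by (metis append_Cons append_Nil list.inject list.exhaust)
      have "simple_path G (x # y # c) x (base G)"
        using pt[OF xy(1)] xy(4) by (auto simp: simple_path_def ac d successively_append_iff successively_Cons)
      then have "pt x = x # y # c" by (rule ptI)
      then have "towards_base G x = y" by (simp add: towards_base_def flip: pt_def)
      with xb show ?thesis by simp
    qed
    show ?thesis
    proof (cases "x \<noteq> base G \<and> y = towards_base G x")
      case True
      with xy show ?thesis by auto
    next
      case False
      then have p: "pt y = y # pt x" using *[of x y] xy E by auto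
      have yb: "y \<noteq> base G" using p ptb pt[OF xy(1)] by (auto simp: simple_path_def)
      have "pt x = pt (towards_base G y)" using p step[OF xy(2) yb] by simp
      then have "x = towards_base G y"
        using pt[OF xy(1)] pt step[OF xy(2) yb] by (metis simple_path_def)
      with xy yb show ?thesis by auto
    qed
  qed
  have "edges G = (\<lambda>v. {v, towards_base G v}) ` (verts G - {base G})"
    using edge step by auto
  moreover have "length (pt (towards_base G v)) - 1 < length (pt v) - 1" if "v \<in> verts G - {base G}" for v
  proof -
    have "pt (towards_base G v) \<noteq> []" using step[of v] that pt by (auto simp: simple_path_def)
    moreover have "pt v = v # pt (towards_base G v)" using step[of v] that by auto
    ultimately show ?thesis by (cases "pt (towards_base G v)") auto
  qed
  ultimately have "rooted G (towards_base G) (\<lambda>v. length (pt v) - 1)"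
    unfolding rooted_def using b step by (simp add: ptb)
  then show ?thesis by blast
qed


lemma rooted_in_edges:
  assumes R: "rooted G (towards_base G) rk" and v: "v \<in> verts G" "v \<noteq> base G"
  shows "in_edges G v = out_edge G ` {c \<in> verts G - {base G}. towards_base G c = v}"
proof (intro set_eqI iffI)
  fix E assume "E \<in> in_edges G v"
  then have E: "E \<in> edges G" "v \<in> E" "E \<noteq> out_edge G v" by (auto simp: in_edges_def)
  then obtain c where c: "c \<in> verts G - {base G}" "E = out_edge G c"
    using R by (auto simp: rooted_def out_edge_def)
  with E have "towards_base G c = v" by (auto simp: out_edge_def)
  with c show "E \<in> out_edge G ` {c \<in> verts G - {base G}. towards_base G c = v}" by auto
next
  fix E assume "E \<in> out_edge G ` {c \<in> verts G - {base G}. towards_base G c = v}"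
  then obtain c where c: "c \<in> verts G - {base G}" "towards_base G c = v" "E = out_edge G c" by auto
  have rc: "rk v < rk c" "rk (towards_base G v) < rk v" using R c v unfolding rooted_def by auto
  then have "out_edge G c \<noteq> out_edge G v" using c by (auto simp: out_edge_def doubleton_eq_iff)
  moreover have "E \<in> edges G" using R c unfolding rooted_def out_edge_def by auto
  ultimately show "E \<in> in_edges G v" using c by (auto simp: in_edges_def out_edge_def)
qed

lemma rooted_out_edge_inj:
  assumes R: "rooted G (towards_base G) rk"
  shows "inj_on (out_edge G) (verts G - {base G})"
proof (rule inj_onI)
  fix x y assume xy: "x \<in> verts G - {base G}" "y \<in> verts G - {base G}" "out_edge G x = out_edge G y"
  have "rk (towards_base G x) < rk x" "rk (towards_base G y) < rk y"
    using R xy(1,2) unfolding rooted_def by blast+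
  with xy(3) show "x = y" by (auto simp: out_edge_def doubleton_eq_iff)
qed

lemma rooted_edges:
  "rooted G (towards_base G) rk \<Longrightarrow> edges G = out_edge G ` (verts G - {base G})"
  by (auto simp: rooted_def out_edge_def)

lemma iso_rooted:
  assumes R: "rooted G (towards_base G) rk" and I: "graph_iso_by \<phi> G H"
  shows "rooted H (\<phi> \<circ> towards_base G \<circ> inv_into (verts G) \<phi>) (rk \<circ> inv_into (verts G) \<phi>)"
proof -
  let ?\<psi> = "inv_into (verts G) \<phi>"
  have b: "bij_betw \<phi> (verts G) (verts H)" and base: "\<phi> (base G) = base H"
    and E: "(`) \<phi> ` edges G = edges H" using I by (auto simp: graph_iso_by_def)
  have inv: "?\<psi> (\<phi> x) = x" if "x \<in> verts G" for x
    using b that by (simp add: bij_betw_inv_into_left)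
  note bG = rootedD(1)[OF R]
  have vH: "verts H = \<phi> ` verts G" using b by (simp add: bij_betw_def)
  have V: "verts H - {base H} = \<phi> ` (verts G - {base G})"
    unfolding vH base[symmetric] using b bG by (auto simp: bij_betw_def inj_on_def)
  have eH: "edges H = (\<lambda>v. {v, \<phi> (towards_base G (?\<psi> v))}) ` (verts H - {base H})"
    unfolding V E[symmetric] rootedD(5)[OF R] image_image using inv by (intro image_cong) auto
  have bH: "base H \<in> verts H" "?\<psi> (base H) = base G"
    using bG inv[OF bG] by (simp_all add: base[symmetric] vH)
  show ?thesis
    unfolding rooted_def
  proof (intro conjI ballI)
    fix v assume "v \<in> verts H - {base H}"
    then obtain w where w: "w \<in> verts G - {base G}" "v = \<phi> w" unfolding V by auto
    note D = rootedD(3,4)[OF R w(1)]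
    show "(\<phi> \<circ> towards_base G \<circ> ?\<psi>) v \<in> verts H" using D w inv by (simp add: vH)
    show "(rk \<circ> ?\<psi>) ((\<phi> \<circ> towards_base G \<circ> ?\<psi>) v) < (rk \<circ> ?\<psi>) v" using D w inv by simp
  qed (use eH bH rootedD(2)[OF R] in simp_all)
qed

lemma iso_towards_base:
  assumes R: "rooted G (towards_base G) rk" and I: "graph_iso_by \<phi> G H"
    and v: "v \<in> verts G - {base G}"
  shows "towards_base H (\<phi> v) = \<phi> (towards_base G v)"
    and "out_edge H (\<phi> v) = \<phi> ` out_edge G v"
proof -
  have b: "bij_betw \<phi> (verts G) (verts H)" and base: "\<phi> (base G) = base H"
    using I by (auto simp: graph_iso_by_def)
  have bG: "base G \<in> verts G" using R by (simp add: rooted_def)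
  have "\<phi> v \<in> verts H" "\<phi> v \<noteq> base H"
    using b v bG by (auto simp: bij_betw_def inj_on_def base[symmetric])
  from rooted_towards_base[OF iso_rooted[OF R I] this]
  show "towards_base H (\<phi> v) = \<phi> (towards_base G v)"
    using b v by (simp add: bij_betw_inv_into_left)
  then show "out_edge H (\<phi> v) = \<phi> ` out_edge G v" by (simp add: out_edge_def)
qed

lemma iso_in_edges:
  assumes R: "rooted G (towards_base G) rk" and I: "graph_iso_by \<phi> G H"
    and v: "v \<in> verts G - {base G}"
  shows "in_edges H (\<phi> v) = (`) \<phi> ` in_edges G v"
proof -
  have b: "bij_betw \<phi> (verts G) (verts H)" and E: "(`) \<phi> ` edges G = edges H"
    using I by (auto simp: graph_iso_by_def)
  have sub: "e \<subseteq> verts G" if "e \<in> edges G" for e using that rooted_subset[OF R] by blast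
  have inj: "\<phi> ` e = \<phi> ` e' \<longleftrightarrow> e = e'" if "e \<subseteq> verts G" "e' \<subseteq> verts G" for e e'
    using inj_on_image_eq_iff[OF _ that] b by (auto simp: bij_betw_def)
  have mem: "\<phi> v \<in> \<phi> ` e \<longleftrightarrow> v \<in> e" if "e \<subseteq> verts G" for e
    using inj_on_image_mem_iff[OF _ _ that] b v by (auto simp: bij_betw_def)
  have o: "out_edge G v \<subseteq> verts G" using rootedD(3)[OF R v] v by (simp add: out_edge_def)
  have "{e \<in> edges H. \<phi> v \<in> e} = (`) \<phi> ` {e \<in> edges G. v \<in> e}"
  proof (intro set_eqI iffI)
    fix x assume "x \<in> {e \<in> edges H. \<phi> v \<in> e}"
    then have "x \<in> (`) \<phi> ` edges G" "\<phi> v \<in> x" by (simp_all only: E mem_Collect_eq)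
    then obtain e where "e \<in> edges G" "x = \<phi> ` e" "\<phi> v \<in> \<phi> ` e" by (metis imageE)
    then show "x \<in> (`) \<phi> ` {e \<in> edges G. v \<in> e}" using mem[OF sub] by blast
  next
    fix x assume "x \<in> (`) \<phi> ` {e \<in> edges G. v \<in> e}"
    then obtain e where "e \<in> edges G" "v \<in> e" "x = \<phi> ` e" by blast
    then show "x \<in> {e \<in> edges H. \<phi> v \<in> e}" by (simp flip: E)
  qed
  also have "\<dots> - {\<phi> ` out_edge G v} = (`) \<phi> ` ({e \<in> edges G. v \<in> e} - {out_edge G v})"
  proof (intro set_eqI iffI)
    fix x assume "x \<in> (`) \<phi> ` {e \<in> edges G. v \<in> e} - {\<phi> ` out_edge G v}"
    then show "x \<in> (`) \<phi> ` ({e \<in> edges G. v \<in> e} - {out_edge G v})" by blast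
  next
    fix x assume "x \<in> (`) \<phi> ` ({e \<in> edges G. v \<in> e} - {out_edge G v})"
    then obtain e where e: "e \<in> edges G" "v \<in> e" "e \<noteq> out_edge G v" "x = \<phi> ` e" by blast
    then have "x \<noteq> \<phi> ` out_edge G v" using inj[OF sub o] by simp
    with e show "x \<in> (`) \<phi> ` {e \<in> edges G. v \<in> e} - {\<phi> ` out_edge G v}" by blast
  qed
  finally show ?thesis by (simp add: in_edges_def iso_towards_base(2)[OF R I v])
qed

lemma iso_sym:
  assumes R: "rooted G (towards_base G) rk" and I: "graph_iso_by \<phi> G H"
    and bd: "bdry G \<subseteq> verts G" "base G \<in> bdry G"
  shows "graph_iso_by (inv_into (verts G) \<phi>) H G"
proof -
  let ?\<psi> = "inv_into (verts G) \<phi>"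
  have b: "bij_betw \<phi> (verts G) (verts H)" and base: "\<phi> (base G) = base H"
    and E: "(`) \<phi> ` edges G = edges H" and B: "\<phi> ` bdry G = bdry H"
    and ed: "\<And>E. E \<in> edges G \<Longrightarrow> edge_dec H (\<phi> ` E) = edge_dec G E"
    and vd: "\<And>n. n \<in> verts G - bdry G \<Longrightarrow> vert_dec H (\<phi> n) = vert_dec G n"
    and id: "\<And>n E. n \<in> verts G - bdry G \<Longrightarrow> E \<in> in_edges G n \<Longrightarrow>
       in_dec H (\<phi> n) (\<phi> ` E) = in_dec G n E"
    using I by (auto simp: graph_iso_by_def)
  have inv: "?\<psi> (\<phi> x) = x" if "x \<in> verts G" for x
    using b that by (simp add: bij_betw_inv_into_left)
  have invi: "?\<psi> ` \<phi> ` e = e" if "e \<subseteq> verts G" for e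
  proof -
    have "?\<psi> ` \<phi> ` e = (\<lambda>x. x) ` e" unfolding image_image using inv that by (intro image_cong) auto
    then show ?thesis by simp
  qed
  have sub: "e \<subseteq> verts G" if "e \<in> edges G" for e using that rooted_subset[OF R] by blast
  have bG: "base G \<in> verts G" using R by (simp add: rooted_def)
  have N: "verts H - bdry H = \<phi> ` (verts G - bdry G)"
    using b bd inj_on_image_set_diff[of \<phi> "verts G" "verts G" "bdry G"]
    by (auto simp: B[symmetric] bij_betw_def)
  show ?thesis
    unfolding graph_iso_by_def
  proof (intro conjI ballI)
    show "bij_betw ?\<psi> (verts H) (verts G)" using b by (rule bij_betw_inv_into)
    show "(`) ?\<psi> ` edges H = edges G"
    proof -
      have "(`) ?\<psi> ` edges H = (\<lambda>e. ?\<psi> ` \<phi> ` e) ` edges G" by (simp only: E[symmetric] image_image)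
      also have "\<dots> = (\<lambda>e. e) ` edges G" by (intro image_cong refl invi sub)
      finally show ?thesis by simp
    qed
    show "?\<psi> ` bdry H = bdry G" using invi bd by (simp add: B[symmetric])
    show "?\<psi> (base H) = base G" using inv bG by (simp add: base[symmetric])
    show "edge_dec G (?\<psi> ` e) = edge_dec H e" if e: "e \<in> edges H" for e
    proof -
      obtain f where f: "f \<in> edges G" "e = \<phi> ` f" using e unfolding E[symmetric] by (metis imageE)
      show ?thesis unfolding f(2) invi[OF sub[OF f(1)]] ed[OF f(1)] ..
    qed
    show "vert_dec G (?\<psi> n) = vert_dec H n" if n: "n \<in> verts H - bdry H" for n
    proof -
      obtain m where m: "m \<in> verts G - bdry G" "n = \<phi> m" using n unfolding N by (metis imageE)
      then show ?thesis using inv[of m] vd[OF m(1)] by simp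
    qed
    show "in_dec G (?\<psi> n) (?\<psi> ` e) = in_dec H n e" if n: "n \<in> verts H - bdry H" and e: "e \<in> in_edges H n" for n e
    proof -
      obtain m where m: "m \<in> verts G - bdry G" "n = \<phi> m" using n unfolding N by (metis imageE)
      with bd have m': "m \<in> verts G - {base G}" by auto
      obtain e' where e': "e' \<in> in_edges G m" "e = \<phi> ` e'"
        using e unfolding m(2) iso_in_edges[OF R I m'] by (metis imageE)
      then have "e' \<in> edges G" by (simp add: in_edges_def)
      from invi[OF sub[OF this]] have "?\<psi> ` e = e'" by (simp add: e')
      moreover have "?\<psi> n = m" using inv[of m] m by simp
      ultimately show ?thesis using id[OF m(1) e'(1)] m e' by simp
    qed
  qed
qed

inductive_cases dot_treeE: "is_ptree P (Dot b S)"
inductive_cases unit_treeE: "is_ptree P (Unit i)"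
inductive_cases subtree_NilE: "subtree_at T [] U"
inductive_cases subtree_ConsE: "subtree_at T (e # q) U"

lemma subtree_Nil [simp]: "subtree_at T [] U \<longleftrightarrow> U = T"
  by (auto elim: subtree_NilE intro: subtree_at.intros)

lemma subtree_Cons: "subtree_at T (e # q) U \<longleftrightarrow> (\<exists>b S V. T = Dot b S \<and> (e, V) |\<in>| S \<and> subtree_at V q U)"
  by (subst subtree_at.simps) auto

lemma subtree_append: "subtree_at T (q @ r) V \<longleftrightarrow> (\<exists>U. subtree_at T q U \<and> subtree_at U r V)"
  by (induction q arbitrary: T) (simp_all add: subtree_Cons, blast)

lemma subtree_snoc: "subtree_at T (q @ [e]) V \<longleftrightarrow> (\<exists>b S. subtree_at T q (Dot b S) \<and> (e, V) |\<in>| S)"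
  by (auto simp: subtree_append subtree_Cons)

lemma subtree_ptree: "\<lbrakk>subtree_at T q U; is_ptree P T\<rbrakk> \<Longrightarrow> is_ptree P U"
  by (induction rule: subtree_at.induct) (auto elim: dot_treeE)

lemma dot_branch_unique: "\<lbrakk>is_ptree P (Dot b S); (e, T) |\<in>| S; (e, U) |\<in>| S\<rbrakk> \<Longrightarrow> T = U"
  by (erule dot_treeE) (metis bij_betw_imp_inj_on fst_conv inj_onD snd_conv)

lemma dot_branch_iff: "is_ptree P (Dot b S) \<Longrightarrow> (\<exists>T. (e, T) |\<in>| S) \<longleftrightarrow> e \<in> fib P b"
  by (erule dot_treeE) (force simp: bij_betw_def)

lemma subtree_unique:
  "\<lbrakk>subtree_at T q U; is_ptree P T; subtree_at T q V\<rbrakk> \<Longrightarrow> U = V"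
proof (induction q arbitrary: T)
  case (Cons e q)
  then show ?case by (metis subtree_Cons dot_branch_unique dot_treeE ptree.inject(2))
qed simp

lemma finite_addresses: "finite (addresses T)"
proof (induction T)
  case (Unit i)
  have "addresses (Unit i) \<subseteq> {[]}"
  proof
    fix q assume "q \<in> addresses (Unit i)"
    then show "q \<in> {[]}" by (cases q) (auto simp: addresses_def subtree_Cons)
  qed
  then show ?case by (rule finite_subset) simp
next
  case (Dot b S)
  have "addresses (Dot b S) \<subseteq> insert [] (\<Union>x \<in> fset S. (#) (fst x) ` addresses (snd x))"
  proof
    fix q assume "q \<in> addresses (Dot b S)"
    then show "q \<in> insert [] (\<Union>x \<in> fset S. (#) (fst x) ` addresses (snd x))"
      by (cases q) (force simp: addresses_def subtree_Cons)+
  qed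
  moreover have "finite (insert [] (\<Union>x \<in> fset S. (#) (fst x) ` addresses (snd x)))"
    using Dot by (auto simp: snds.simps)
  ultimately show ?case by (rule finite_subset)
qed

lemma upper_edge_inj:
  assumes "upper_edge q = upper_edge r" shows "q = r"
proof (rule ccontr)
  assume "q \<noteq> r"
  with assms have *: "q \<noteq> []" "q = butlast r" "r = butlast q"
    by (auto simp: upper_edge_def doubleton_eq_iff split: if_splits)
  have "length q = length r - 1" using arg_cong[OF *(2), of length] by (simp only: length_butlast)
  moreover have "length r = length q - 1" using arg_cong[OF *(3), of length] by (simp only: length_butlast)
  moreover have "length q > 0" using *(1) by (rule length_greater_0_conv[THEN iffD2])
  ultimately show False by linarith
qed

definition up :: "'e list option \<Rightarrow> 'e list option" where
  "up v = (if the v = [] then None else Some (butlast (the v)))"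

lemma addresses_butlast: "q @ [e] \<in> addresses T \<Longrightarrow> q \<in> addresses T"
  by (auto simp: addresses_def subtree_append)

lemma Nil_address [simp]: "[] \<in> addresses T"
  by (auto simp: addresses_def intro: here)

lemma graph_of_rooted0:
  "rooted (graph_of P T) up (\<lambda>v. case v of None \<Rightarrow> 0 | Some q \<Rightarrow> Suc (length q))"
proof -
  have "butlast q \<in> addresses T" if "q \<in> addresses T" "q \<noteq> []" for q
    using that addresses_butlast[of "butlast q" "last q" T] by simp
  moreover have "edges (graph_of P T) = (\<lambda>v. {v, up v}) ` (verts (graph_of P T) - {base (graph_of P T)})"
  proof -
    have "insert None (Some ` addresses T) - {None} = Some ` addresses T" by auto
    then show ?thesis by (simp add: graph_of_def image_image upper_edge_def up_def cong: if_cong)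
  qed
  ultimately show ?thesis
    unfolding rooted_def by (auto simp: graph_of_def up_def)
qed

lemma graph_of_towards_base:
  "q \<in> addresses T \<Longrightarrow> towards_base (graph_of P T) (Some q) = up (Some q)"
  by (rule rooted_towards_base[OF graph_of_rooted0]) (auto simp: graph_of_def)

lemma graph_of_out_edge:
  "q \<in> addresses T \<Longrightarrow> out_edge (graph_of P T) (Some q) = upper_edge q"
  by (simp add: out_edge_def graph_of_towards_base upper_edge_def up_def)

lemma rooted_cong:
  assumes "rooted G p rk" shows "rooted G (towards_base G) rk"
proof -
  have "towards_base G v = p v" if "v \<in> verts G - {base G}" for v
    using rooted_towards_base[OF assms] that by auto
  with assms show ?thesis unfolding rooted_def by auto
qed

lemmas graph_of_rooted = rooted_cong[OF graph_of_rooted0]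

lemma graph_of_in_edges:
  assumes T: "is_ptree P T" and q: "subtree_at T q (Dot b S)"
  shows "in_edges (graph_of P T) (Some q) = (\<lambda>e. upper_edge (q @ [e])) ` fib P b"
proof -
  have D: "is_ptree P (Dot b S)" using subtree_ptree[OF q T] .
  have qa: "q \<in> addresses T" using q by (auto simp: addresses_def)
  have ch: "q @ [e] \<in> addresses T \<longleftrightarrow> e \<in> fib P b" for e
  proof -
    have "q @ [e] \<in> addresses T \<longleftrightarrow> (\<exists>V. subtree_at T (q @ [e]) V)" by (simp add: addresses_def)
    also have "\<dots> \<longleftrightarrow> (\<exists>V. (e, V) |\<in>| S)"
      using q subtree_unique[OF q T] by (metis ptree.inject(2) subtree_snoc)
    finally show ?thesis using dot_branch_iff[OF D] by simp
  qed
  have "{c \<in> verts (graph_of P T) - {base (graph_of P T)}. towards_base (graph_of P T) c = Some q}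
     = (\<lambda>e. Some (q @ [e])) ` fib P b" (is "?A = ?B")
  proof (intro set_eqI iffI)
    fix c assume "c \<in> ?A"
    then obtain r where r: "c = Some r" "r \<in> addresses T" "up (Some r) = Some q"
      by (auto simp: graph_of_def graph_of_towards_base[unfolded graph_of_def])
    then have "r = q @ [last r]" by (auto simp: up_def split: if_splits)
    with r ch show "c \<in> ?B" by (metis imageI)
  next
    fix c assume "c \<in> ?B"
    then obtain e where e: "e \<in> fib P b" "c = Some (q @ [e])" by auto
    with ch have "q @ [e] \<in> addresses T" by simp
    with e show "c \<in> ?A" by (auto simp: graph_of_towards_base up_def) (auto simp: graph_of_def)
  qed
  moreover have "in_edges (graph_of P T) (Some q) = out_edge (graph_of P T) `
     {c \<in> verts (graph_of P T) - {base (graph_of P T)}. towards_base (graph_of P T) c = Some q}"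
    by (rule rooted_in_edges[OF graph_of_rooted]) (use qa in \<open>auto simp: graph_of_def\<close>)
  ultimately show ?thesis using ch by (auto simp: image_image graph_of_out_edge)
qed

lemma graph_of_edge_dec:
  assumes T: "is_ptree P T" and q: "subtree_at T q U"
  shows "edge_dec (graph_of P T) (upper_edge q) = root_type P U"
proof -
  have "(THE i. \<exists>r V. subtree_at T r V \<and> upper_edge q = upper_edge r \<and> i = root_type P V) = root_type P U"
  proof (rule the_equality)
    show "\<exists>r V. subtree_at T r V \<and> upper_edge q = upper_edge r \<and> root_type P U = root_type P V"
      using q by blast
    fix i assume "\<exists>r V. subtree_at T r V \<and> upper_edge q = upper_edge r \<and> i = root_type P V"
    then obtain r V where r: "subtree_at T r V" "upper_edge q = upper_edge r" "i = root_type P V"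
      by blast
    from r(1) have "subtree_at T q V" using upper_edge_inj[OF r(2)] by simp
    from subtree_unique[OF q T this] show "i = root_type P U" using r(3) by simp
  qed
  then show ?thesis by (simp add: graph_of_def)
qed

lemma graph_of_vert_dec:
  assumes T: "is_ptree P T" and q: "subtree_at T q (Dot b S)"
  shows "vert_dec (graph_of P T) (Some q) = b"
proof -
  have "(THE b. \<exists>S. subtree_at T q (Dot b S)) = b"
  proof (rule the_equality)
    show "\<exists>S. subtree_at T q (Dot b S)" using q by blast
    show "c = b" if "\<exists>S. subtree_at T q (Dot c S)" for c
      using that subtree_unique[OF q T] by blast
  qed
  then show ?thesis by (simp add: graph_of_def dot_dec_def)
qed

lemma graph_of_in_dec: "in_dec (graph_of P T) (Some q) (upper_edge (q @ [e])) = e"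
proof -
  have "(THE f. upper_edge (q @ [e]) = upper_edge (q @ [f])) = e"
  proof (rule the_equality)
    fix f assume "upper_edge (q @ [e]) = upper_edge (q @ [f])"
    from upper_edge_inj[OF this] show "f = e" by simp
  qed simp
  then show ?thesis by (simp add: graph_of_def)
qed

lemma graph_of_dotE:
  assumes "n \<in> verts (graph_of P T) - bdry (graph_of P T)"
  obtains q b S where "n = Some q" "subtree_at T q (Dot b S)"
proof -
  obtain q U where q: "n = Some q" "subtree_at T q U" "q \<notin> leaves T"
    using assms by (auto simp: graph_of_def addresses_def)
  with that show thesis by (cases U) (auto simp: leaves_def)
qed

lemma leaves_addresses: "leaves T \<subseteq> addresses T" by (auto simp: leaves_def addresses_def)

lemma graph_of_dot:
  assumes T: "is_ptree P T" and q: "subtree_at T q (Dot b S)"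
  shows "Some q \<in> verts (graph_of P T) - bdry (graph_of P T)"
  using q subtree_unique[OF q T] by (auto simp: graph_of_def leaves_def addresses_def)

theorem (in polynomial_monad) graph_of_is_graph_ptree:
  assumes T: "is_ptree P T"
  shows "is_graph_ptree P (graph_of P T)"
  unfolding is_graph_ptree_def
proof (intro conjI ballI)
  let ?G = "graph_of P T"
  show "is_tree ?G"
  proof (rule rooted_is_tree[OF graph_of_rooted0])
    show "finite (verts ?G)" by (simp add: graph_of_def finite_addresses)
    show "bdry ?G \<subseteq> verts ?G" using leaves_addresses by (auto simp: graph_of_def)
    show "base ?G \<in> bdry ?G" by (simp add: graph_of_def)
    fix v assume v: "v \<in> bdry ?G"
    show "\<exists>!E. E \<in> edges ?G \<and> v \<in> E"
    proof (cases v)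
      case None
      show ?thesis
      proof (rule ex1I[of _ "upper_edge []"])
        show "upper_edge [] \<in> edges ?G \<and> v \<in> upper_edge []"
        proof
          show "upper_edge [] \<in> edges ?G" by (simp add: graph_of_def)
          show "v \<in> upper_edge []" by (simp add: None upper_edge_def)
        qed
        fix E assume "E \<in> edges ?G \<and> v \<in> E"
        then obtain r where "E = upper_edge r" "None \<in> upper_edge r" using None by (auto simp: graph_of_def)
        then show "E = upper_edge []" by (simp add: upper_edge_def split: if_splits)
      qed
    next
      case (Some q)
      then obtain i where q: "subtree_at T q (Unit i)" using v by (auto simp: graph_of_def leaves_def)
      have uniq: "r = q" if r: "r \<in> addresses T" "Some q \<in> upper_edge r" for r
      proof (rule ccontr)
        assume "r \<noteq> q"
        with r have "r \<noteq> []" "q = butlast r" by (auto simp: upper_edge_def split: if_splits)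
        then have "r = q @ [last r]" by simp
        moreover obtain V where "subtree_at T r V" using r by (auto simp: addresses_def)
        ultimately have "subtree_at T (q @ [last r]) V" by simp
        then obtain b S where "subtree_at T q (Dot b S)" unfolding subtree_snoc by blast
        with subtree_unique[OF q T] show False by blast
      qed
      have qa: "q \<in> addresses T" using q by (auto simp: addresses_def)
      show ?thesis
      proof (rule ex1I[of _ "upper_edge q"])
        show "upper_edge q \<in> edges ?G \<and> v \<in> upper_edge q"
          using qa by (simp add: graph_of_def Some) (simp add: upper_edge_def)
        fix E assume "E \<in> edges ?G \<and> v \<in> E"
        then obtain r where "E = upper_edge r" "r \<in> addresses T" "Some q \<in> upper_edge r"
          using Some by (auto simp: graph_of_def)
        then show "E = upper_edge q" using uniq by blast
      qed
    qed
  qed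
  show "edge_dec ?G E \<in> types P" if E: "E \<in> edges ?G" for E
  proof -
    obtain q U where q: "subtree_at T q U" "E = upper_edge q"
      using E by (auto simp: graph_of_def addresses_def)
    have "is_ptree P U" using subtree_ptree[OF q(1) T] .
    then have "root_type P U \<in> types P" by cases (auto intro: tgt_type)
    then show ?thesis using graph_of_edge_dec[OF T q(1)] q by simp
  qed
  fix n assume "n \<in> verts ?G - bdry ?G"
  then obtain q b S where q: "n = Some q" "subtree_at T q (Dot b S)" by (rule graph_of_dotE)
  have D: "is_ptree P (Dot b S)" using subtree_ptree[OF q(2) T] .
  note [simp] = graph_of_in_edges[OF T q(2)] graph_of_vert_dec[OF T q(2)] q(1)
  show "vert_dec ?G n \<in> ops P" using D by (auto elim: dot_treeE)
  show "bij_betw (in_dec ?G n) (in_edges ?G n) (fib P (vert_dec ?G n))"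
    by (auto simp: bij_betw_def inj_on_def image_image graph_of_in_dec)
  have qa: "q \<in> addresses T" using q by (auto simp: addresses_def)
  show "edge_dec ?G (out_edge ?G n) = tgt P (vert_dec ?G n)"
    using graph_of_edge_dec[OF T q(2)] by (simp add: graph_of_out_edge[OF qa])
  fix E assume "E \<in> in_edges ?G n"
  then obtain e where e: "e \<in> fib P b" "E = upper_edge (q @ [e])" by auto
  then obtain U where U: "(e, U) |\<in>| S" using dot_branch_iff[OF D] by auto
  have "subtree_at T (q @ [e]) U" using q U by (auto simp: subtree_snoc)
  then show "edge_dec ?G E = src P (in_dec ?G n E)"
    using graph_of_edge_dec[OF T] e U D by (auto simp: graph_of_in_dec elim: dot_treeE)
qed


text \<open>\<open>repr P G v T\<close>: the part of \<open>G\<close> above the edge from \<open>v\<close> towards the base point is the tree \<open>T\<close>.\<close>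

inductive repr :: "('i, 'b, 'e) pm \<Rightarrow> ('v, 'i, 'b, 'e) gtree \<Rightarrow> 'v \<Rightarrow> ('i, 'b, 'e) ptree \<Rightarrow> bool"
  for P G where
  leaf: "v \<in> bdry G - {base G} \<Longrightarrow> repr P G v (Unit (edge_dec G (out_edge G v)))"
| dot: "\<lbrakk>v \<in> verts G - bdry G; bij_betw fst (fset S) (fib P (vert_dec G v));
     \<And>e T. (e, T) |\<in>| S \<Longrightarrow> \<exists>c. c \<in> verts G - {base G} \<and> towards_base G c = v \<and>
        in_dec G v (out_edge G c) = e \<and> repr P G c T\<rbrakk> \<Longrightarrow> repr P G v (Dot (vert_dec G v) S)"

locale graph_ptree =
  fixes P :: "('i, 'b, 'e) pm" and G :: "('v, 'i, 'b, 'e) gtree" and rk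
  assumes G: "is_graph_ptree P G" and R: "rooted G (towards_base G) rk"
begin

lemma bdry: "bdry G \<subseteq> verts G" "base G \<in> bdry G" "finite (verts G)"
  using G by (simp_all add: is_graph_ptree_def is_tree_def)

lemma bdry_edge: "\<lbrakk>v \<in> bdry G; E \<in> edges G; v \<in> E; F \<in> edges G; v \<in> F\<rbrakk> \<Longrightarrow> E = F"
  using G unfolding is_graph_ptree_def is_tree_def by blast

lemma dot_props:
  assumes "n \<in> verts G - bdry G"
  shows "vert_dec G n \<in> ops P" "bij_betw (in_dec G n) (in_edges G n) (fib P (vert_dec G n))"
    "\<And>E. E \<in> in_edges G n \<Longrightarrow> edge_dec G E = src P (in_dec G n E)"
    "edge_dec G (out_edge G n) = tgt P (vert_dec G n)"
  using G assms by (simp_all add: is_graph_ptree_def)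

lemma dot_not_base: "n \<in> verts G - bdry G \<Longrightarrow> n \<in> verts G - {base G}"
  using bdry by auto

definition kids where "kids v = {c \<in> verts G - {base G}. towards_base G c = v}"

lemma in_edges_kids: "v \<in> verts G - {base G} \<Longrightarrow> in_edges G v = out_edge G ` kids v"
  unfolding kids_def using rooted_in_edges[OF R] by blast

lemma kids_inj:
  assumes v: "v \<in> verts G - bdry G" and c: "c \<in> kids v" "d \<in> kids v"
    and e: "in_dec G v (out_edge G c) = in_dec G v (out_edge G d)"
  shows "c = d"
proof -
  have "inj_on (in_dec G v) (in_edges G v)" using dot_props(2)[OF v] by (rule bij_betw_imp_inj_on)
  then have "out_edge G c = out_edge G d"
    using e c in_edges_kids[OF dot_not_base[OF v]] by (auto dest: inj_onD)
  with rooted_out_edge_inj[OF R] c show ?thesis by (auto simp: kids_def dest: inj_onD)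
qed

lemma kids_fib:
  assumes v: "v \<in> verts G - bdry G"
  shows "(\<lambda>c. in_dec G v (out_edge G c)) ` kids v = fib P (vert_dec G v)"
  using bij_betw_imp_surj_on[OF dot_props(2)[OF v]] in_edges_kids[OF dot_not_base[OF v]]
  by (simp add: image_image)

lemma kids_not_bdry:
  assumes "c \<in> kids v" "v \<noteq> base G"
  shows "v \<in> verts G - bdry G"
proof
  have c: "c \<in> verts G - {base G}" "towards_base G c = v" using assms by (auto simp: kids_def)
  show v: "v \<in> verts G" using rootedD(3)[OF R c(1)] c by simp
  show "v \<notin> bdry G"
  proof
    assume b: "v \<in> bdry G"
    have E: "out_edge G c \<in> edges G" "out_edge G v \<in> edges G"
      using c v assms(2) unfolding rooted_edges[OF R] by auto
    have "out_edge G c = out_edge G v"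
      by (rule bdry_edge[OF b E(1) _ E(2)]) (use c in \<open>auto simp: out_edge_def\<close>)
    then have "c = v" using rooted_out_edge_inj[OF R] c v assms(2) by (auto dest: inj_onD)
    then show False using rootedD(4)[OF R c(1)] c by simp
  qed
qed

lemma repr_verts: "repr P G v T \<Longrightarrow> v \<in> verts G - {base G}"
  by (erule repr.cases) (use bdry in auto)

lemma repr_exists: "v \<in> verts G - {base G} \<Longrightarrow> \<exists>T. repr P G v T"
proof (induction "Max (rk ` verts G) - rk v" arbitrary: v rule: less_induct)
  case less
  show ?case
  proof (cases "v \<in> bdry G")
    case True
    with less.prems show ?thesis by (auto intro: repr.leaf)
  next
    case False
    with less.prems have v: "v \<in> verts G - bdry G" by simp
    have "\<exists>T. repr P G c T" if c: "c \<in> kids v" for c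
    proof (rule less.hyps)
      show c': "c \<in> verts G - {base G}" using c by (simp add: kids_def)
      have "rk v < rk c" using rootedD(4)[OF R c'] c by (simp add: kids_def)
      moreover have "rk c \<le> Max (rk ` verts G)" using c' bdry(3) by (intro Max_ge) auto
      ultimately show "Max (rk ` verts G) - rk c < Max (rk ` verts G) - rk v" by linarith
    qed
    then have "\<forall>c \<in> kids v. \<exists>T. repr P G c T" by blast
    from bchoice[OF this] obtain t where t: "\<forall>c \<in> kids v. repr P G c (t c)" ..
    define S where "S = Abs_fset ((\<lambda>c. (in_dec G v (out_edge G c), t c)) ` kids v)"
    have "finite (kids v)" using bdry(3) by (simp add: kids_def)
    then have S: "fset S = (\<lambda>c. (in_dec G v (out_edge G c), t c)) ` kids v"
      unfolding S_def by (intro Abs_fset_inverse) simp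
    have "repr P G v (Dot (vert_dec G v) S)"
    proof (rule repr.dot[OF v])
      show "bij_betw fst (fset S) (fib P (vert_dec G v))"
        unfolding bij_betw_def
      proof
        show "inj_on fst (fset S)" 
        proof (rule inj_onI)
          fix x y assume x: "x \<in> fset S" and y: "y \<in> fset S" and eq: "fst x = fst y"
          obtain c where c: "c \<in> kids v" "x = (in_dec G v (out_edge G c), t c)" using x unfolding S by (rule imageE)
          obtain d where d: "d \<in> kids v" "y = (in_dec G v (out_edge G d), t d)" using y unfolding S by (rule imageE)
          have "c = d" using kids_inj[OF v c(1) d(1)] eq c(2) d(2) by simp
          with c d show "x = y" by simp
        qed
        show "fst ` fset S = fib P (vert_dec G v)" unfolding S using kids_fib[OF v] by (simp add: image_image)
      qed
      fix e T assume "(e, T) |\<in>| S"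
      then obtain c where "c \<in> kids v" "e = in_dec G v (out_edge G c)" "T = t c" unfolding S by blast
      then show "\<exists>c. c \<in> verts G - {base G} \<and> towards_base G c = v \<and> in_dec G v (out_edge G c) = e \<and> repr P G c T"
        using bspec[OF t] unfolding kids_def by blast
    qed
    then show ?thesis by blast
  qed
qed

lemma repr_ptree: "repr P G v T \<Longrightarrow> is_ptree P T \<and> root_type P T = edge_dec G (out_edge G v)"
proof (induction rule: repr.induct)
  case (leaf v)
  then have "out_edge G v \<in> edges G" using bdry unfolding rooted_edges[OF R] by auto
  then show ?case using G by (auto simp: is_graph_ptree_def intro: unit_tree)
next
  case (dot v S)
  note v = dot(1)
  have "is_ptree P (Dot (vert_dec G v) S)"
  proof (rule dot_tree[OF dot_props(1)[OF v] dot(2)])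
    fix e T assume "(e, T) |\<in>| S"
    then obtain c where c: "c \<in> verts G - {base G}" "towards_base G c = v"
      "in_dec G v (out_edge G c) = e" "is_ptree P T" "root_type P T = edge_dec G (out_edge G c)"
      using dot(3) by blast
    have "out_edge G c \<in> in_edges G v"
      unfolding in_edges_kids[OF dot_not_base[OF v]] using c by (auto simp: kids_def)
    then show "is_ptree P T \<and> root_type P T = src P e" using dot_props(3)[OF v] c by simp
  qed
  then show ?case using dot_props(4)[OF v] by simp
qed

lemma repr_unique: "repr P G v T \<Longrightarrow> repr P G v U \<Longrightarrow> T = U"
proof (induction arbitrary: U rule: repr.induct)
  case (leaf v)
  from leaf.prems leaf.hyps show ?case by cases auto
next
  case (dot v S)
  note v = dot(1)
  from dot.prems v obtain S' where U: "U = Dot (vert_dec G v) S'" "bij_betw fst (fset S') (fib P (vert_dec G v))"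
    and S': "\<And>e T. (e, T) |\<in>| S' \<Longrightarrow> \<exists>c. c \<in> verts G - {base G} \<and> towards_base G c = v \<and>
        in_dec G v (out_edge G c) = e \<and> repr P G c T" by cases auto
  have eq: "T = T'" if e: "(e, T) |\<in>| S" "(e, T') |\<in>| S'" for e T T'
  proof -
    obtain c where c: "c \<in> kids v" "in_dec G v (out_edge G c) = e" "\<forall>U. repr P G c U \<longrightarrow> T = U"
      using dot(3)[OF e(1)] by (auto simp: kids_def)
    obtain d where d: "d \<in> kids v" "in_dec G v (out_edge G d) = e" "repr P G d T'"
      using S'[OF e(2)] by (auto simp: kids_def)
    have "c = d" using kids_inj[OF v c(1) d(1)] c d by simp
    with c d show ?thesis by simp
  qed
  have im: "fst ` fset S = fst ` fset S'"
    using bij_betw_imp_surj_on[OF U(2)] bij_betw_imp_surj_on[OF dot(2)] by simp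
  have "fset S \<subseteq> fset S'"
  proof
    fix x assume x: "x \<in> fset S"
    then have "fst x \<in> fst ` fset S'" unfolding im[symmetric] by simp
    then obtain T' where T': "(fst x, T') |\<in>| S'" by auto
    then show "x \<in> fset S'" using eq[of "fst x" "snd x" T'] x by (cases x) simp
  qed
  moreover have "fset S' \<subseteq> fset S"
  proof
    fix x assume x: "x \<in> fset S'"
    then have "fst x \<in> fst ` fset S" unfolding im by simp
    then obtain T where T: "(fst x, T) |\<in>| S" by auto
    then show "x \<in> fset S" using eq[of "fst x" T "snd x"] x by (cases x) simp
  qed
  ultimately have "S = S'" by (simp add: fset_inject[symmetric])
  with U show ?case by simp
qed

definition v0 where "v0 = (THE c. c \<in> kids (base G))"

lemma v0_eq:
  assumes "c \<in> kids (base G)" shows "c = v0"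
proof -
  have "d = c" if d: "d \<in> kids (base G)" for d
  proof -
    have E: "out_edge G d \<in> edges G" "out_edge G c \<in> edges G"
      using d assms unfolding rooted_edges[OF R] by (auto simp: kids_def)
    have "out_edge G d = out_edge G c"
      by (rule bdry_edge[OF bdry(2) E(1) _ E(2)]) (use d assms in \<open>auto simp: kids_def out_edge_def\<close>)
    then show ?thesis using rooted_out_edge_inj[OF R] d assms by (auto simp: kids_def dest: inj_onD)
  qed
  then show ?thesis unfolding v0_def using assms by (metis the_equality)
qed

lemma v0: "v0 \<in> kids (base G)"
proof -
  obtain E where E: "E \<in> edges G" "base G \<in> E"
    using G bdry(2) unfolding is_graph_ptree_def is_tree_def by blast
  then obtain c where c: "c \<in> verts G - {base G}" "E = out_edge G c" unfolding rooted_edges[OF R] by auto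
  with E have "c \<in> kids (base G)" by (auto simp: kids_def out_edge_def)
  with v0_eq show ?thesis by simp
qed

text \<open>An isomorphism with \<open>graph_of P T\<close> makes \<open>T\<close> represent the vertex next to the base point.\<close>

lemma iso_repr:
  assumes T: "is_ptree P T" and I: "graph_iso_by \<phi> (graph_of P T) G"
  shows "subtree_at T q U \<Longrightarrow> repr P G (\<phi> (Some q)) U"
proof (induction U arbitrary: q)
  let ?H = "graph_of P T"
  note RH = graph_of_rooted[of P T]
  have ed: "edge_dec G (\<phi> ` E) = edge_dec ?H E" if "E \<in> edges ?H" for E
    using I that by (simp add: graph_iso_by_def)
  have vd: "vert_dec G (\<phi> n) = vert_dec ?H n" if "n \<in> verts ?H - bdry ?H" for n
    using I that by (simp add: graph_iso_by_def)
  have idc: "in_dec G (\<phi> n) (\<phi> ` E) = in_dec ?H n E" if "n \<in> verts ?H - bdry ?H" "E \<in> in_edges ?H n" for n E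
    using I that by (simp add: graph_iso_by_def)
  have b: "inj_on \<phi> (verts ?H)" "verts G = \<phi> ` verts ?H" "bdry G = \<phi> ` bdry ?H" "base G = \<phi> (base ?H)"
    using I by (auto simp: graph_iso_by_def bij_betw_def)
  have bd: "bdry ?H \<subseteq> verts ?H" using leaves_addresses by (auto simp: graph_of_def)
  have adr: "Some q \<in> verts ?H - {base ?H}" if "subtree_at T q V" for q V
    using that by (auto simp: graph_of_def addresses_def)
  have nb: "\<phi> v \<in> verts G - {base G}" if v: "v \<in> verts ?H - {base ?H}" for v
    using v b(1) rootedD(1)[OF RH] unfolding b(2,4) by (auto dest: inj_onD)
  {
    case (Unit i)
    have "Some q \<in> bdry ?H" using Unit by (auto simp: graph_of_def leaves_def)
    then have "\<phi> (Some q) \<in> bdry G - {base G}" using nb[OF adr[OF Unit]] b(3) by simp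
    then have "repr P G (\<phi> (Some q)) (Unit (edge_dec G (out_edge G (\<phi> (Some q)))))" by (rule repr.leaf)
    moreover have "edge_dec G (out_edge G (\<phi> (Some q))) = i"
    proof -
      have q: "q \<in> addresses T" using Unit by (auto simp: addresses_def)
      have "upper_edge q \<in> edges ?H" using q by (simp add: graph_of_def)
      from ed[OF this] show ?thesis
        using graph_of_edge_dec[OF T Unit]
        by (simp add: iso_towards_base(2)[OF RH I adr[OF Unit]] graph_of_out_edge[OF q])
    qed
    ultimately show ?case by simp
  next
    case (Dot b S)
    have D: "is_ptree P (Dot b S)" using subtree_ptree[OF Dot(2) T] .
    have q: "Some q \<in> verts ?H - bdry ?H" using graph_of_dot[OF T Dot(2)] .
    have lab: "vert_dec G (\<phi> (Some q)) = b" using vd[OF q] graph_of_vert_dec[OF T Dot(2)] by simp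
    have q': "\<phi> (Some q) \<in> verts G - bdry G"
    proof
      show "\<phi> (Some q) \<in> verts G" using q b(2) by simp
      show "\<phi> (Some q) \<notin> bdry G" unfolding b(3) using inj_on_image_mem_iff[OF b(1) _ bd] q by simp
    qed
    have "repr P G (\<phi> (Some q)) (Dot (vert_dec G (\<phi> (Some q))) S)"
    proof (rule repr.dot[OF q'])
      show "bij_betw fst (fset S) (fib P (vert_dec G (\<phi> (Some q))))"
        unfolding lab using D by (rule dot_treeE)
      fix e V assume eV: "(e, V) |\<in>| S"
      have sub: "subtree_at T (q @ [e]) V" using Dot(2) eV by (auto simp: subtree_snoc)
      have "V \<in> Basic_BNFs.snds (e, V)" by (simp add: prod_set_simps)
      with Dot(1)[OF eV _ sub] have "repr P G (\<phi> (Some (q @ [e]))) V" by simp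
      moreover have qe: "q @ [e] \<in> addresses T" using sub by (auto simp: addresses_def)
      have "towards_base G (\<phi> (Some (q @ [e]))) = \<phi> (Some q)"
        by (simp add: iso_towards_base(1)[OF RH I adr[OF sub]] graph_of_towards_base[OF qe] up_def)
      moreover have "in_dec G (\<phi> (Some q)) (out_edge G (\<phi> (Some (q @ [e])))) = e"
      proof -
        have "e \<in> fib P b" using dot_branch_iff[OF D] eV by blast
        then have "upper_edge (q @ [e]) \<in> in_edges ?H (Some q)"
          unfolding graph_of_in_edges[OF T Dot(2)] by simp
        from idc[OF q this] show ?thesis
          by (simp add: iso_towards_base(2)[OF RH I adr[OF sub]] graph_of_out_edge[OF qe] graph_of_in_dec)
      qed
      ultimately show "\<exists>c. c \<in> verts G - {base G} \<and> towards_base G c = \<phi> (Some q) \<and>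
          in_dec G (\<phi> (Some q)) (out_edge G c) = e \<and> repr P G c V"
        using nb[OF adr[OF sub]] by blast
    qed
    then show ?case by (simp add: lab)
  }
qed

lemma iso_repr_v0:
  assumes T: "is_ptree P T" and I: "graph_iso G (graph_of P T)"
  shows "repr P G v0 T"
proof -
  obtain \<psi> where "graph_iso_by \<psi> G (graph_of P T)" using I by (auto simp: graph_iso_def)
  from iso_sym[OF R this bdry(1,2)] obtain \<phi> where I': "graph_iso_by \<phi> (graph_of P T) G" by blast
  have r: "repr P G (\<phi> (Some [])) T" using iso_repr[OF T I'] by simp
  have "Some [] \<in> verts (graph_of P T) - {base (graph_of P T)}" by (simp add: graph_of_def)
  from iso_towards_base(1)[OF graph_of_rooted I' this]
  have "towards_base G (\<phi> (Some [])) = \<phi> None" by (simp add: graph_of_towards_base up_def)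
  also have "\<dots> = base G" using I' by (simp add: graph_iso_by_def graph_of_def)
  finally have "\<phi> (Some []) = v0" using v0_eq repr_verts[OF r] by (simp add: kids_def)
  with r show ?thesis by simp
qed

definition child where "child v e = (THE c. c \<in> kids v \<and> in_dec G v (out_edge G c) = e)"

definition loc where "loc q = foldl child v0 q"

lemma loc_simps [simp]: "loc [] = v0" "loc (q @ [e]) = child (loc q) e"
  by (simp_all add: loc_def)

lemma child_eq:
  assumes "v \<in> verts G - bdry G" "c \<in> kids v"
  shows "child v (in_dec G v (out_edge G c)) = c"
  unfolding child_def using assms kids_inj[OF assms(1)] by (intro the_equality) auto

lemma loc_repr:
  assumes T: "repr P G v0 T"
  shows "subtree_at T q U \<Longrightarrow> repr P G (loc q) U"
    and "subtree_at T (q @ [e]) U \<Longrightarrow> loc q \<in> verts G - bdry G \<and> loc (q @ [e]) \<in> kids (loc q) \<and>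
       in_dec G (loc q) (out_edge G (loc (q @ [e]))) = e"
proof -
  have step: "repr P G (loc (q @ [e])) U \<and> loc q \<in> verts G - bdry G \<and> loc (q @ [e]) \<in> kids (loc q) \<and>
       in_dec G (loc q) (out_edge G (loc (q @ [e]))) = e"
    if r: "repr P G (loc q) (Dot b S)" and e: "(e, U) |\<in>| S" for q e U b S
  proof -
    have v: "loc q \<in> verts G - bdry G" using r by (cases rule: repr.cases) simp
    have S: "\<exists>c. c \<in> verts G - {base G} \<and> towards_base G c = loc q \<and>
      in_dec G (loc q) (out_edge G c) = e \<and> repr P G c U"
      using r
    proof cases
      case dot
      from dot(4)[OF e] show ?thesis .
    qed
    obtain c where c: "c \<in> kids (loc q)" "in_dec G (loc q) (out_edge G c) = e" "repr P G c U"
      using S by (auto simp: kids_def)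
    then have "child (loc q) e = c" using child_eq[OF v c(1)] by simp
    with v c show ?thesis by simp
  qed
  have 1: "repr P G (loc q) U" if "subtree_at T q U" for q U
    using that
  proof (induction q arbitrary: U rule: rev_induct)
    case Nil
    then show ?case using T by simp
  next
    case (snoc e q)
    then obtain b S where "subtree_at T q (Dot b S)" "(e, U) |\<in>| S" unfolding subtree_snoc by blast
    with snoc.IH step show ?case by blast
  qed
  show "subtree_at T q U \<Longrightarrow> repr P G (loc q) U" by (rule 1)
  show "loc q \<in> verts G - bdry G \<and> loc (q @ [e]) \<in> kids (loc q) \<and>
       in_dec G (loc q) (out_edge G (loc (q @ [e]))) = e" if e: "subtree_at T (q @ [e]) U"
  proof -
    obtain b S where "subtree_at T q (Dot b S)" "(e, U) |\<in>| S" using e unfolding subtree_snoc by blast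
    with 1 step show ?thesis by blast
  qed
qed

lemma loc_towards_base:
  assumes T: "repr P G v0 T" and q: "q \<in> addresses T"
  shows "towards_base G (loc q) = (if q = [] then base G else loc (butlast q))"
proof (cases q rule: rev_cases)
  case Nil
  then show ?thesis using v0 by (simp add: kids_def)
next
  case (snoc r e)
  obtain U where "subtree_at T (r @ [e]) U" using q snoc by (auto simp: addresses_def)
  from loc_repr(2)[OF T this] show ?thesis by (simp add: snoc kids_def)
qed

lemma loc_inj:
  assumes T: "repr P G v0 T"
  shows "q \<in> addresses T \<Longrightarrow> r \<in> addresses T \<Longrightarrow> loc q = loc r \<Longrightarrow> q = r"
proof (induction q arbitrary: r rule: rev_induct)
  case Nil
  show ?case
  proof (rule ccontr)
    assume r: "[] \<noteq> r"
    then have "towards_base G (loc r) = loc (butlast r)" using loc_towards_base[OF T Nil(2)] by auto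
    moreover have "towards_base G (loc r) = base G"
      using loc_towards_base[OF T Nil(1)] by (simp add: Nil(3)[symmetric])
    moreover have "butlast r \<in> addresses T"
      using addresses_butlast[of "butlast r" "last r" T] Nil(2) r by simp
    then obtain U where "subtree_at T (butlast r) U" by (auto simp: addresses_def)
    then have "loc (butlast r) \<in> verts G - {base G}" using loc_repr(1)[OF T] repr_verts by blast
    ultimately show False by simp
  qed
next
  case (snoc e q)
  have b: "q \<in> addresses T" using snoc.prems(1) by (rule addresses_butlast)
  obtain U where U: "subtree_at T (q @ [e]) U" using snoc.prems(1) by (auto simp: addresses_def)
  note qe = loc_repr(2)[OF T U]
  have nb: "loc q \<noteq> base G" using qe bdry by auto
  have tb: "towards_base G (loc r) = loc q"
    using loc_towards_base[OF T snoc.prems(1)] by (simp only: snoc.prems(3)) simp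
  have "r \<noteq> []" using tb nb v0 by (auto simp: kids_def)
  then obtain r' f where r: "r = r' @ [f]" by (metis rev_exhaust)
  obtain V where V: "subtree_at T (r' @ [f]) V" using snoc.prems(2) r by (auto simp: addresses_def)
  note rf = loc_repr(2)[OF T V]
  have "loc q = loc r'" using tb rf r by (simp add: kids_def)
  moreover have "r' \<in> addresses T" using snoc.prems(2) unfolding r by (rule addresses_butlast)
  ultimately have "q = r'" using snoc.IH[OF b] by blast
  moreover have "e = f" using qe rf snoc.prems(3) unfolding r \<open>loc q = loc r'\<close> by metis
  ultimately show ?case by (simp add: r)
qed

lemma loc_surj:
  assumes T: "repr P G v0 T"
  shows "v \<in> verts G - {base G} \<Longrightarrow> \<exists>q \<in> addresses T. loc q = v"
proof (induction "rk v" arbitrary: v rule: less_induct)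
  case less
  note v = less.prems
  show ?case
  proof (cases "towards_base G v = base G")
    case True
    then have "v = v0" using v by (intro v0_eq) (simp add: kids_def)
    then show ?thesis by (intro bexI[of _ "[]"]) simp_all
  next
    case False
    let ?w = "towards_base G v"
    have w: "?w \<in> verts G - {base G}" using rootedD(3)[OF R v] False by simp
    then obtain q where q: "q \<in> addresses T" "loc q = ?w" using less.hyps rootedD(4)[OF R v] by blast
    then obtain U where U: "subtree_at T q U" by (auto simp: addresses_def)
    have r: "repr P G ?w U" using loc_repr(1)[OF T U] q by simp
    have vk: "v \<in> kids ?w" using v by (simp add: kids_def)
    have wd: "?w \<in> verts G - bdry G" using kids_not_bdry[OF vk False] .
    from r wd obtain S where S: "U = Dot (vert_dec G ?w) S" "bij_betw fst (fset S) (fib P (vert_dec G ?w))"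
      by cases auto
    let ?e = "in_dec G ?w (out_edge G v)"
    have "?e \<in> fib P (vert_dec G ?w)" unfolding kids_fib[OF wd, symmetric] using vk by blast
    then obtain V where V: "(?e, V) |\<in>| S" unfolding bij_betw_imp_surj_on[OF S(2), symmetric] by auto
    have "subtree_at T (q @ [?e]) V" using U V unfolding S(1) subtree_snoc by blast
    then have "q @ [?e] \<in> addresses T" by (auto simp: addresses_def)
    moreover have "loc (q @ [?e]) = v" using child_eq[OF wd vk] q by simp
    ultimately show ?thesis by blast
  qed
qed

lemma repr_iso:
  assumes r: "repr P G v0 T"
  shows "graph_iso G (graph_of P T)"
proof -
  have T: "is_ptree P T" using repr_ptree[OF r] by simp
  let ?H = "graph_of P T"
  define \<phi> where "\<phi> = (\<lambda>x. case x of None \<Rightarrow> base G | Some q \<Rightarrow> loc q)"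
  have loc: "loc q \<in> verts G - {base G}" if q: "q \<in> addresses T" for q
  proof -
    obtain U where "subtree_at T q U" using q by (auto simp: addresses_def)
    then show ?thesis by (intro repr_verts) (rule loc_repr(1)[OF r])
  qed
  have img: "loc ` addresses T = verts G - {base G}"
  proof (intro set_eqI iffI)
    show "v \<in> verts G - {base G}" if "v \<in> loc ` addresses T" for v
      using that loc by (elim imageE) simp
    show "v \<in> loc ` addresses T" if "v \<in> verts G - {base G}" for v
      using loc_surj[OF r that] by (elim bexE) auto
  qed
  have ue: "\<phi> ` upper_edge q = out_edge G (loc q)" if "q \<in> addresses T" for q
    using loc_towards_base[OF r that] by (simp add: upper_edge_def out_edge_def \<phi>_def)
  have "graph_iso_by \<phi> ?H G"
    unfolding graph_iso_by_def
  proof (intro conjI ballI)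
    show "bij_betw \<phi> (verts ?H) (verts G)"
      unfolding bij_betw_def
    proof
      show "inj_on \<phi> (verts ?H)"
      proof (rule inj_onI)
        fix x y assume "x \<in> verts ?H" "y \<in> verts ?H" "\<phi> x = \<phi> y"
        then show "x = y" using loc loc_inj[OF r] by (cases x; cases y) (auto simp: graph_of_def \<phi>_def)
      qed
      have "\<phi> ` verts ?H = insert (base G) (loc ` addresses T)"
        by (simp add: graph_of_def \<phi>_def image_image)
      also have "\<dots> = verts G" using rootedD(1)[OF R] by (auto simp: img)
      finally show "\<phi> ` verts ?H = verts G" .
    qed
    have "(`) \<phi> ` edges ?H = (\<lambda>q. \<phi> ` upper_edge q) ` addresses T"
      unfolding graph_of_def by (simp only: image_image gtree.simps)
    also have "\<dots> = (\<lambda>q. out_edge G (loc q)) ` addresses T" by (intro image_cong refl ue)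
    also have "\<dots> = out_edge G ` loc ` addresses T" by (simp only: image_image)
    also have "\<dots> = edges G" by (simp only: img rooted_edges[OF R])
    finally show "(`) \<phi> ` edges ?H = edges G" .
    have "loc ` leaves T = bdry G - {base G}"
    proof (intro set_eqI iffI)
      fix v assume "v \<in> loc ` leaves T"
      then obtain q i where "subtree_at T q (Unit i)" "v = loc q" by (auto simp: leaves_def)
      then have "repr P G v (Unit i)" using loc_repr(1)[OF r] by blast
      then show "v \<in> bdry G - {base G}" by (cases rule: repr.cases) simp
    next
      fix v assume v: "v \<in> bdry G - {base G}"
      then have "v \<in> verts G - {base G}" using bdry(1) by blast
      from loc_surj[OF r this] obtain q where q: "q \<in> addresses T" "loc q = v" by blast
      then obtain U where U: "subtree_at T q U" by (auto simp: addresses_def)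
      have "repr P G v U" using loc_repr(1)[OF r U] q by simp
      then obtain i where "U = Unit i" using v by cases auto
      with U q show "v \<in> loc ` leaves T" by (auto simp: leaves_def)
    qed
    moreover have "\<phi> ` bdry ?H = insert (base G) (loc ` leaves T)"
      by (simp add: graph_of_def \<phi>_def image_image)
    ultimately show "\<phi> ` bdry ?H = bdry G" using bdry(2) by auto
    show "\<phi> (base ?H) = base G" by (simp add: graph_of_def \<phi>_def)
    show "edge_dec G (\<phi> ` E) = edge_dec ?H E" if E: "E \<in> edges ?H" for E
    proof -
      obtain q U where q: "E = upper_edge q" "subtree_at T q U" "q \<in> addresses T"
        using E by (auto simp: graph_of_def addresses_def)
      have "root_type P U = edge_dec G (out_edge G (loc q))" using repr_ptree[OF loc_repr(1)[OF r q(2)]] by simp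
      then show ?thesis using graph_of_edge_dec[OF T q(2)] ue[OF q(3)] q(1) by simp
    qed
    fix n assume "n \<in> verts ?H - bdry ?H"
    then obtain q b S where q: "n = Some q" "subtree_at T q (Dot b S)" by (rule graph_of_dotE)
    have rq: "repr P G (loc q) (Dot b S)" using loc_repr(1)[OF r q(2)] .
    then have "b = vert_dec G (loc q)" by (cases rule: repr.cases) simp
    then show "vert_dec G (\<phi> n) = vert_dec ?H n"
      using graph_of_vert_dec[OF T q(2)] q(1) by (simp add: \<phi>_def)
    fix E assume "E \<in> in_edges ?H n"
    then obtain e where e: "e \<in> fib P b" "E = upper_edge (q @ [e])"
      unfolding q(1) graph_of_in_edges[OF T q(2)] by blast
    then obtain V where "(e, V) |\<in>| S" using dot_branch_iff[OF subtree_ptree[OF q(2) T]] by blast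
    then have V: "subtree_at T (q @ [e]) V" using q(2) unfolding subtree_snoc by blast
    then have qe: "q @ [e] \<in> addresses T" by (auto simp: addresses_def)
    have "in_dec G (\<phi> n) (\<phi> ` E) = e"
      unfolding e(2) ue[OF qe] using loc_repr(2)[OF r V] q(1) by (simp add: \<phi>_def)
    then show "in_dec G (\<phi> n) (\<phi> ` E) = in_dec ?H n E" by (simp add: e(2) q(1) graph_of_in_dec)
  qed
  moreover have "bdry ?H \<subseteq> verts ?H" "base ?H \<in> bdry ?H"
    using leaves_addresses by (auto simp: graph_of_def)
  ultimately show ?thesis using iso_sym[OF graph_of_rooted] unfolding graph_iso_def by blast
qed

end

text \<open>
  Together with \<open>graph_of_is_graph_ptree\<close>: well-formed terms are in bijection with
  isomorphism classes of decorated graphs.  The dots of the graph of \<open>T\<close> are the \<open>Some q\<close> with \<open>q \<in> dots T\<close>.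
\<close>

theorem graph_tree_iso_class:
  assumes "is_graph_ptree P G"
  shows "\<exists>!T. is_ptree P T \<and> graph_iso G (graph_of P T)"
proof -
  obtain rk where "rooted G (towards_base G) rk"
    using is_tree_rooted[of G] assms by (auto simp only: is_graph_ptree_def)
  with assms interpret graph_ptree P G rk by unfold_locales
  have "v0 \<in> verts G - {base G}" using v0 by (simp add: kids_def)
  then obtain T where T: "repr P G v0 T" using repr_exists by blast
  show ?thesis
  proof (rule ex1I[of _ T])
    show "is_ptree P T \<and> graph_iso G (graph_of P T)" using repr_iso[OF T] repr_ptree[OF T] by simp
    fix U assume "is_ptree P U \<and> graph_iso G (graph_of P U)"
    then have "repr P G v0 U" using iso_repr_v0 by simp
    then show "U = T" using repr_unique T by blast
  qed
qed

hide_const (open) verts edges bdry base up repr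

end

theory Submission
  imports Defs "HOL-Library.Sublist" "HOL-Library.Multiset"
begin

text \<open>
  The contraction of a tree is an operation whose inputs are named by the leaves, and grafting and
  replacing dots become substitutions between such operations with named inputs.  By the two
  associativity laws, substitutions into inputs with incomparable addresses commute, so the order of
  contraction is irrelevant; hence replacing a dot by a tree that contracts to its decoration
  does not change the contraction, and \<open>BD P\<close> is a polynomial monad.  Trees with the same labels
  at all addresses are equal, which reduces the monad laws of \<open>BD P\<close> to
  identities between addresses.

  Operations have finitely many inputs and trees are finite, so every law and every tree of the colimit
  of a sequence of polynomial monads lives at a finite stage.  Thus \<open>BD\<close> preserves these colimits, and
  \<open>P_inf\<close> is initial by the usual argument (Adamek): an algebra \<open>x : BD X \<rightarrow> X\<close> determines the arrows
  \<open>opetopic n \<rightarrow> X\<close> by recursion on \<open>n\<close>.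
\<close>


section \<open>Operations with named inputs\<close>

text \<open>Contraction is defined through an arbitrary ordering of the branches, and replacing a
  dot moves the addresses above it. With named inputs and guarded substitutions, lists of
  substitutions can be reordered freely, and one relation, \<open>lop_rel\<close>, compares a tree
  both with the result of replacing a dot and with its image under an arrow.

  Adamek's argument applies because the trivial monad is initial among pointed polynomial monads,
  the base point being the unique arrow from it; \<open>susp0\<close> is the base point of its
  Baez--Dolan construction, so the opetopes with their suspensions are the initial chain.
  \<open>BD\<close> of this chain is the chain without its first term, which has the same colimit;
  this gives the structure map.

  The obstacle in preserving colimits is that equations between types hold only at later stages.
  Trees are therefore lifted with a prescribed lift of the root type, so that separately lifted
  branches fit onto a lifted dot. The pullback condition on arrows keeps the number of stages
  finite: above a lifted operation its inputs lift without changing the stage.\<close>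

type_synonym ('b, 'e, 'k) lop = "'b \<times> ('k list \<rightharpoonup> 'e)"

text \<open>
  In a valid pair \<open>(b, l)\<close> the inputs of \<open>b\<close> are named by pairwise incomparable addresses.  \<open>att P k X s\<close>
  substitutes \<open>X\<close> into the input \<open>k\<close> of \<open>s\<close> and prefixes the names coming from \<open>X\<close> by \<open>k\<close>.  It leaves
  \<open>s\<close> unchanged when the substitution makes no sense, so that substitutions at incomparable
  addresses commute unconditionally.
\<close>

definition valid_lop :: "('i, 'b, 'e) pm \<Rightarrow> ('b, 'e, 'k) lop \<Rightarrow> bool" where
  "valid_lop P s \<longleftrightarrow> fst s \<in> ops P \<and> inj_on (snd s) (dom (snd s)) \<and> ran (snd s) = fib P (fst s) \<and>
     (\<forall>k \<in> dom (snd s). \<forall>q \<in> dom (snd s). prefix k q \<longrightarrow> k = q)"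

definition lop_ok :: "('i, 'b, 'e) pm \<Rightarrow> 'k list \<Rightarrow> ('b, 'e, 'k) lop \<Rightarrow> ('b, 'e, 'k) lop \<Rightarrow> bool" where
  "lop_ok P k X s \<longleftrightarrow> valid_lop P s \<and> valid_lop P X \<and>
     (\<exists>e. snd s k = Some e \<and> tgt P (fst X) = src P e)"

definition att :: "('i, 'b, 'e) pm \<Rightarrow> 'k list \<Rightarrow> ('b, 'e, 'k) lop \<Rightarrow> ('b, 'e, 'k) lop \<Rightarrow> ('b, 'e, 'k) lop" where
  "att P k X s =
     (if lop_ok P k X s then
        (sub P (fst X) (the (snd s k)),
         \<lambda>q. if prefix k q then map_option (inner P (fst X) (the (snd s k))) (snd X (drop (length k) q))
             else map_option (outer P (fst X) (the (snd s k))) (snd s q))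
      else s)"

definition atts :: "('i, 'b, 'e) pm \<Rightarrow> ('k list \<Rightarrow> ('b, 'e, 'k) lop) \<Rightarrow> 'k list list \<Rightarrow>
    ('b, 'e, 'k) lop \<Rightarrow> ('b, 'e, 'k) lop" where
  "atts P X ks = fold (\<lambda>k. att P k (X k)) ks"

lemma atts_simps [simp]:
  "atts P X [] s = s"
  "atts P X (k # ks) s = atts P X ks (att P k (X k) s)"
  "atts P X (ks @ ls) s = atts P X ls (atts P X ks s)"
  by (simp_all add: atts_def)

lemma lop_ok_the: "lop_ok P k X s \<Longrightarrow> snd s k = Some (the (snd s k))"
  by (auto simp: lop_ok_def)

lemma att_fst: "lop_ok P k X s \<Longrightarrow> fst (att P k X s) = sub P (fst X) (the (snd s k))"
  by (simp add: att_def)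

lemma att_snd_above:
  "lop_ok P k X s \<Longrightarrow> snd (att P k X s) (k @ j) = map_option (inner P (fst X) (the (snd s k))) (snd X j)"
  by (simp add: att_def)

lemma att_snd_other:
  "lop_ok P k X s \<Longrightarrow> \<not> prefix k q \<Longrightarrow>
     snd (att P k X s) q = map_option (outer P (fst X) (the (snd s k))) (snd s q)"
  by (simp add: att_def)

lemma valid_lop_antichain:
  "valid_lop P s \<Longrightarrow> snd s k \<noteq> None \<Longrightarrow> snd s q \<noteq> None \<Longrightarrow> prefix k q \<Longrightarrow> k = q"
  unfolding valid_lop_def by blast

lemma valid_lop_parallel:
  "valid_lop P s \<Longrightarrow> k \<in> dom (snd s) \<Longrightarrow> q \<in> dom (snd s) \<Longrightarrow> k \<noteq> q \<Longrightarrow> k \<parallel> q"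
  unfolding valid_lop_def by blast

lemma valid_lop_inj:
  "valid_lop P s \<Longrightarrow> snd s k = Some e \<Longrightarrow> snd s q = Some e \<Longrightarrow> k = q"
  unfolding valid_lop_def inj_on_def by (metis domI)

lemma valid_lop_fib: "valid_lop P s \<Longrightarrow> snd s k = Some e \<Longrightarrow> e \<in> fib P (fst s)"
  unfolding valid_lop_def by (blast intro: ranI)

text \<open>\<open>att\<close> overwrites every name that begins with \<open>k\<close>. As the names
  of \<open>s\<close> form an antichain, \<open>k\<close> itself is the only old name affected, so
  no input of \<open>s\<close> loses its name.\<close>

lemma att_dom:
  assumes ok: "lop_ok P k X s"
  shows "dom (snd (att P k X s)) = (dom (snd s) - {k}) \<union> (@) k ` dom (snd X)"
proof -
  have "q \<in> dom (snd (att P k X s)) \<longleftrightarrow> q \<in> (dom (snd s) - {k}) \<union> (@) k ` dom (snd X)" for q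
  proof (cases "prefix k q")
    case True
    then obtain j where j: "q = k @ j" by (auto simp: prefix_def)
    have "q = k" if "q \<in> dom (snd s)"
      using that valid_lop_antichain[of P s k q] ok True by (auto simp: lop_ok_def)
    with j show ?thesis by (auto simp: att_snd_above[OF ok] dom_def)
  next
    case False
    then show ?thesis by (auto simp: att_snd_other[OF ok] dom_def)
  qed
  then show ?thesis by blast
qed

context polynomial_monad
begin

lemma fib_iff: "e \<in> fib P b \<longleftrightarrow> e \<in> inputs P \<and> opr P e = b"
  by (simp add: fib_def)

lemma outer_fib: "composable P c e \<Longrightarrow> x \<in> fib P (opr P e) \<Longrightarrow> x \<noteq> e \<Longrightarrow> outer P c e x \<in> fib P (sub P c e)"
  using bij_betwE[OF fib_sub[of c e]] by (metis Diff_iff InlI old.sum.simps(5) singletonD)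

lemma inner_fib: "composable P c e \<Longrightarrow> x \<in> fib P c \<Longrightarrow> inner P c e x \<in> fib P (sub P c e)"
  using bij_betwE[OF fib_sub[of c e]] by (metis InrI old.sum.simps(6))

lemma outer_inj: "composable P c e \<Longrightarrow> x \<in> fib P (opr P e) - {e} \<Longrightarrow> y \<in> fib P (opr P e) - {e} \<Longrightarrow>
    outer P c e x = outer P c e y \<Longrightarrow> x = y"
  using bij_betw_imp_inj_on[OF fib_sub, of c e] by (auto dest: inj_onD[where x="Inl x" and y="Inl y"])

lemma inner_inj: "composable P c e \<Longrightarrow> x \<in> fib P c \<Longrightarrow> y \<in> fib P c \<Longrightarrow>
    inner P c e x = inner P c e y \<Longrightarrow> x = y"
  using bij_betw_imp_inj_on[OF fib_sub, of c e] by (auto dest: inj_onD[where x="Inr x" and y="Inr y"])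

lemma outer_neq_inner: "composable P c e \<Longrightarrow> x \<in> fib P (opr P e) - {e} \<Longrightarrow> y \<in> fib P c \<Longrightarrow>
    outer P c e x \<noteq> inner P c e y"
  using bij_betw_imp_inj_on[OF fib_sub, of c e] by (auto dest: inj_onD[where x="Inl x" and y="Inr y"])

lemma fib_sub_cases:
  assumes "composable P c e" "z \<in> fib P (sub P c e)"
  obtains x where "x \<in> fib P (opr P e) - {e}" "z = outer P c e x"
  | y where "y \<in> fib P c" "z = inner P c e y"
proof -
  have "z \<in> case_sum (outer P c e) (inner P c e) ` ((fib P (opr P e) - {e}) <+> fib P c)"
    using bij_betw_imp_surj_on[OF fib_sub[OF assms(1)]] assms(2) by simp
  then obtain w where w: "w \<in> (fib P (opr P e) - {e}) <+> fib P c" "z = case_sum (outer P c e) (inner P c e) w"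
    by blast
  show thesis using that w by (cases w) (simp_all add: Plus_def, blast+)
qed

lemma lop_ok_composable:
  assumes "lop_ok P k X s"
  shows "composable P (fst X) (the (snd s k))" "opr P (the (snd s k)) = fst s" "the (snd s k) \<in> fib P (fst s)"
  using assms valid_lop_fib[of P s k] by (auto simp: lop_ok_def composable_def fib_def valid_lop_def)

text \<open>Old names give the outer summand of \<open>fib_sub\<close> and names prefixed by
  \<open>k\<close> the inner one, so the new naming is a bijection onto the fibre. The antichain
  survives because an old name comparable with some \<open>k @ j\<close> is comparable with
  \<open>k\<close>.\<close>

lemma att_valid:
  assumes ok: "lop_ok P k X s"
  shows "valid_lop P (att P k X s)" "tgt P (fst (att P k X s)) = tgt P (fst s)"
proof -
  let ?e = "the (snd s k)" and ?c = "fst X" and ?s = "att P k X s"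
  note C = lop_ok_composable[OF ok]
  have V: "valid_lop P s" "valid_lop P X" using ok by (auto simp: lop_ok_def)
  have cases: "(\<exists>x. q \<noteq> k \<and> \<not> prefix k q \<and> snd s q = Some x \<and> x \<in> fib P (opr P ?e) - {?e} \<and> z = outer P ?c ?e x) \<or>
      (\<exists>j y. q = k @ j \<and> snd X j = Some y \<and> y \<in> fib P ?c \<and> z = inner P ?c ?e y)" if q: "snd ?s q = Some z" for q z
  proof (cases "prefix k q")
    case True
    then obtain j where j: "q = k @ j" by (auto simp: prefix_def)
    with q show ?thesis using valid_lop_fib[OF V(2)] by (auto simp: att_snd_above[OF ok])
  next
    case False
    with q obtain x where x: "snd s q = Some x" "z = outer P ?c ?e x" by (auto simp: att_snd_other[OF ok])
    moreover have "x \<noteq> ?e" using valid_lop_inj[OF V(1) x(1), of k] lop_ok_the[OF ok] False by auto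
    ultimately show ?thesis using valid_lop_fib[OF V(1) x(1)] C False by auto
  qed
  have inj: "inj_on (snd ?s) (dom (snd ?s))"
  proof (rule inj_onI)
    fix q r assume "q \<in> dom (snd ?s)" "r \<in> dom (snd ?s)" "snd ?s q = snd ?s r"
    then obtain z where z: "snd ?s q = Some z" "snd ?s r = Some z" by auto
    show "q = r"
      using cases[OF z(1)] cases[OF z(2)] valid_lop_inj[OF V(1)] valid_lop_inj[OF V(2)]
        outer_inj[OF C(1)] inner_inj[OF C(1)] outer_neq_inner[OF C(1)] by metis
  qed
  have ran: "ran (snd ?s) = fib P (fst ?s)"
  proof (intro set_eqI iffI)
    fix z assume "z \<in> ran (snd ?s)"
    then obtain q where "snd ?s q = Some z" by (auto simp: ran_def)
    from cases[OF this] show "z \<in> fib P (fst ?s)"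
      using outer_fib[OF C(1)] inner_fib[OF C(1)] by (auto simp: att_fst[OF ok])
  next
    fix z assume "z \<in> fib P (fst ?s)"
    then have "z \<in> fib P (sub P ?c ?e)" by (simp add: att_fst[OF ok])
    then show "z \<in> ran (snd ?s)"
    proof (cases rule: fib_sub_cases[OF C(1), consumes 1])
      case (1 x)
      then have "x \<in> ran (snd s)" using V C by (simp add: valid_lop_def)
      then obtain q where q: "snd s q = Some x" by (auto simp: ran_def)
      have "\<not> prefix k q" using valid_lop_antichain[OF V(1), of k q] q lop_ok_the[OF ok] 1
        by (metis Diff_iff insertI1 option.distinct(1) option.sel)
      with q 1 have "snd ?s q = Some z" by (simp add: att_snd_other[OF ok])
      then show ?thesis by (rule ranI)
    next
      case (2 y)
      then have "y \<in> ran (snd X)" using V by (simp add: valid_lop_def)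
      then obtain q where q: "snd X q = Some y" by (auto simp: ran_def)
      with 2 have "snd ?s (k @ q) = Some z" by (simp add: att_snd_above[OF ok])
      then show ?thesis by (rule ranI)
    qed
  qed
  have "q = r" if qr: "q \<in> dom (snd ?s)" "r \<in> dom (snd ?s)" "prefix q r" for q r
  proof -
    have k: "k \<in> dom (snd s)" using lop_ok_the[OF ok] by (metis domI)
    consider "q \<in> dom (snd s) - {k}" "r \<in> dom (snd s) - {k}" | "q \<in> dom (snd s) - {k}" "prefix k r"
      | "prefix k q" "r \<in> dom (snd s) - {k}" | i j where "q = k @ i" "r = k @ j" "i \<in> dom (snd X)" "j \<in> dom (snd X)"
      using qr(1,2) unfolding att_dom[OF ok] by (elim UnE imageE) (blast intro: prefixI)+
    then show ?thesis
    proof cases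
      case 1
      then show ?thesis using V(1) qr(3) unfolding valid_lop_def by blast
    next
      case 2
      then have "prefix q k \<or> prefix k q" using qr(3) prefix_same_cases by blast
      then show ?thesis using 2 k V(1) unfolding valid_lop_def by blast
    next
      case 3
      then have "prefix k r" using qr(3) prefix_order.trans by blast
      then show ?thesis using 3 k V(1) unfolding valid_lop_def by blast
    next
      case 4
      then show ?thesis using V(2) qr(3) unfolding valid_lop_def by auto
    qed
  qed
  then show "valid_lop P ?s" using inj ran sub_op[OF C(1)] by (auto simp: valid_lop_def att_fst[OF ok])
  show "tgt P (fst ?s) = tgt P (fst s)" using tgt_sub[OF C(1)] C by (simp add: att_fst[OF ok])
qed

lemma att_src_other:
  assumes ok: "lop_ok P k X s" and q: "q \<in> dom (snd s)" "q \<noteq> k"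
  shows "src P (the (snd (att P k X s) q)) = src P (the (snd s q))"
proof -
  note C = lop_ok_composable[OF ok]
  have V: "valid_lop P s" using ok by (auto simp: lop_ok_def)
  obtain x where x: "snd s q = Some x" using q by auto
  have "\<not> prefix k q" using valid_lop_antichain[OF V, of k q] x lop_ok_the[OF ok] q by auto
  moreover have "x \<noteq> the (snd s k)" using valid_lop_inj[OF V x, of k] lop_ok_the[OF ok] q by auto
  ultimately show ?thesis
    using src_outer[OF C(1), of x] valid_lop_fib[OF V x] C x by (simp add: att_snd_other[OF ok])
qed

lemma att_src_above:
  assumes ok: "lop_ok P k X s" and j: "j \<in> dom (snd X)"
  shows "src P (the (snd (att P k X s) (k @ j))) = src P (the (snd X j))"
proof -
  note C = lop_ok_composable[OF ok]
  have V: "valid_lop P X" using ok by (auto simp: lop_ok_def)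
  obtain x where x: "snd X j = Some x" using j by auto
  then show ?thesis using src_inner[OF C(1) valid_lop_fib[OF V x]] by (simp add: att_snd_above[OF ok])
qed

text \<open>A substitution at a parallel address changes neither the presence nor the source of the
  input named \<open>k\<close>. Hence the guards of two parallel substitutions do not influence each
  other, and \<open>att_commute\<close> can do without assumptions on the operations.\<close>

lemma lop_ok_att:
  assumes "k \<parallel> k'"
  shows "lop_ok P k X (att P k' X' s) \<longleftrightarrow> lop_ok P k X s"
proof (cases "lop_ok P k' X' s")
  case True
  have np: "\<not> prefix k' k" using assms by blast
  have "k \<noteq> k'" using assms by auto
  show ?thesis
  proof (cases "snd s k")
    case None
    then show ?thesis by (simp add: lop_ok_def att_snd_other[OF True np])
  next
    case (Some e)
    then have "src P (the (snd (att P k' X' s) k)) = src P e"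
      using att_src_other[OF True, of k] \<open>k \<noteq> k'\<close> by auto
    then show ?thesis using Some att_valid(1)[OF True] True by (auto simp: lop_ok_def att_snd_other[OF True np])
  qed
qed (simp add: att_def)

text \<open>\<open>assoc_parallel\<close> read off name by name: the names above \<open>k\<close>,
  the names above \<open>k'\<close> and the remaining old names are its three families of equations
  between inputs. If a guard fails, the corresponding substitution is the identity on both sides by
  \<open>lop_ok_att\<close>.\<close>

lemma att_commute:
  assumes par: "k \<parallel> k'"
  shows "att P k X (att P k' X' s) = att P k' X' (att P k X s)"
proof (cases "lop_ok P k X s \<and> lop_ok P k' X' s")
  case False
  then show ?thesis using lop_ok_att[OF par] lop_ok_att[OF par[unfolded parallel_commute[of k]]]
    by (metis att_def)
next
  case True
  then have ok: "lop_ok P k X s" and ok': "lop_ok P k' X' s" by auto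
  have par': "k' \<parallel> k" using par by blast
  obtain e f where se: "snd s k = Some e" "snd s k' = Some f"
    using lop_ok_the[OF ok] lop_ok_the[OF ok'] by auto
  note C = lop_ok_composable[OF ok, unfolded se option.sel]
    and C' = lop_ok_composable[OF ok', unfolded se option.sel]
  have V: "valid_lop P s" "valid_lop P X" "valid_lop P X'" using ok ok' by (auto simp: lop_ok_def)
  have ok1: "lop_ok P k X (att P k' X' s)" using lop_ok_att[OF par] ok by blast
  have ok2: "lop_ok P k' X' (att P k X s)" using lop_ok_att[OF par'] ok' by blast
  let ?c = "fst X" and ?d = "fst X'"
  have ne: "f \<noteq> e" using valid_lop_inj[OF V(1), of k e k'] se par by auto
  have np: "\<not> prefix k k'" "\<not> prefix k' k" using par by blast+
  have o: "snd (att P k' X' s) k = Some (outer P ?d f e)" "snd (att P k X s) k' = Some (outer P ?c e f)"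
    using se by (simp_all add: att_snd_other[OF ok np(1)] att_snd_other[OF ok' np(2)])
  note A = assoc_parallel[OF C'(1) C(1), unfolded C(2) C'(2), OF refl ne[symmetric]]
  show ?thesis
  proof (rule prod_eqI)
    show "fst (att P k X (att P k' X' s)) = fst (att P k' X' (att P k X s))"
      using A o by (simp add: att_fst[OF ok1] att_fst[OF ok2] se)
    show "snd (att P k X (att P k' X' s)) = snd (att P k' X' (att P k X s))"
    proof
      fix q
      consider (a) j where "q = k @ j" | (b) j where "q = k' @ j" | (c) "\<not> prefix k q" "\<not> prefix k' q"
        by (auto simp: prefix_def)
      then show "snd (att P k X (att P k' X' s)) q = snd (att P k' X' (att P k X s)) q"
      proof cases
        case a
        then have nq: "\<not> prefix k' q" using np by (metis prefix_same_cases prefixI)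
        show ?thesis
        proof (cases "snd X j")
          case (Some x)
          show ?thesis using A valid_lop_fib[OF V(2) Some]
            by (simp add: att_snd_other[OF ok2 nq[unfolded a]] a att_snd_above[OF ok1] att_snd_above[OF ok] o se Some)
        qed (simp add: att_snd_other[OF ok2 nq[unfolded a]] a att_snd_above[OF ok1] att_snd_above[OF ok])
      next
        case b
        then have nq: "\<not> prefix k q" using np by (metis prefix_same_cases prefixI)
        show ?thesis
        proof (cases "snd X' j")
          case (Some x)
          show ?thesis using A valid_lop_fib[OF V(3) Some]
            by (simp add: att_snd_other[OF ok1 nq[unfolded b]] b att_snd_above[OF ok2] att_snd_above[OF ok'] o se Some)
        qed (simp add: att_snd_other[OF ok1 nq[unfolded b]] b att_snd_above[OF ok2] att_snd_above[OF ok'])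
      next
        case c
        show ?thesis
        proof (cases "snd s q")
          case (Some x)
          have "x \<in> fib P (fst s)" using valid_lop_fib[OF V(1) Some] .
          moreover have "x \<noteq> e" using valid_lop_inj[OF V(1) Some, of k] se c by auto
          moreover have "x \<noteq> f" using valid_lop_inj[OF V(1) Some, of k'] se c by auto
          ultimately show ?thesis using A
            by (simp add: att_snd_other[OF ok1 c(1)] att_snd_other[OF ok2 c(2)]
                att_snd_other[OF ok c(1)] att_snd_other[OF ok' c(2)] o se Some)
        qed (simp add: att_snd_other[OF ok1 c(1)] att_snd_other[OF ok2 c(2)]
                att_snd_other[OF ok c(1)] att_snd_other[OF ok' c(2)] se)
      qed
    qed
  qed
qed

text \<open>\<open>assoc_nested\<close> read off name by name: names above \<open>k @ j\<close>,
  names above \<open>k\<close> only, and old names are its three families of equations between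
  inputs.\<close>

lemma att_nested:
  assumes ok: "lop_ok P k X s" and ok': "lop_ok P j Y X"
  shows "lop_ok P (k @ j) Y (att P k X s)" "lop_ok P k (att P j Y X) s"
    "att P (k @ j) Y (att P k X s) = att P k (att P j Y X) s"
proof -
  obtain e f where se: "snd s k = Some e" "snd X j = Some f"
    using lop_ok_the[OF ok] lop_ok_the[OF ok'] by auto
  note C = lop_ok_composable[OF ok, unfolded se option.sel]
    and C' = lop_ok_composable[OF ok', unfolded se option.sel]
  have V: "valid_lop P s" "valid_lop P X" "valid_lop P Y" using ok ok' by (auto simp: lop_ok_def)
  let ?c = "fst X" and ?d = "fst Y"
  have i: "snd (att P k X s) (k @ j) = Some (inner P ?c e f)" by (simp add: att_snd_above[OF ok] se)
  show ok1: "lop_ok P (k @ j) Y (att P k X s)"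
    using att_valid(1)[OF ok] ok' att_src_above[OF ok domI[where m="snd X", OF se(2)]] by (auto simp: lop_ok_def i se)
  show ok2: "lop_ok P k (att P j Y X) s"
    using att_valid[OF ok'] ok by (auto simp: lop_ok_def)
  note A = assoc_nested[OF C(1) C'(3,1), unfolded C(2)]
  show "att P (k @ j) Y (att P k X s) = att P k (att P j Y X) s"
  proof (rule prod_eqI)
    show "fst (att P (k @ j) Y (att P k X s)) = fst (att P k (att P j Y X) s)"
      using A by (simp add: att_fst[OF ok1] att_fst[OF ok2] att_fst[OF ok'] i se)
    show "snd (att P (k @ j) Y (att P k X s)) = snd (att P k (att P j Y X) s)"
    proof
      fix q
      consider (a) i where "q = k @ j @ i" | (b) i where "q = k @ i" "\<not> prefix j i" | (c) "\<not> prefix k q"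
        by (metis prefix_def)
      then show "snd (att P (k @ j) Y (att P k X s)) q = snd (att P k (att P j Y X) s) q"
      proof cases
        case a
        show ?thesis
        proof (cases "snd Y i")
          case (Some x)
          then show ?thesis using A valid_lop_fib[OF V(3) Some]
              att_snd_above[OF ok1, of i] att_snd_above[OF ok2, of "j @ i"]
            by (simp add: a i att_snd_above[OF ok'] att_fst[OF ok'] se)
        qed (use att_snd_above[OF ok1, of i] att_snd_above[OF ok2, of "j @ i"] in
              \<open>simp add: a i att_snd_above[OF ok'] att_fst[OF ok'] se\<close>)
      next
        case b
        then have nq: "\<not> prefix (k @ j) q" by simp
        show ?thesis
        proof (cases "snd X i")
          case (Some x)
          moreover have "x \<noteq> f" using valid_lop_inj[OF V(2) Some, of j] se b by auto
          ultimately show ?thesis using A valid_lop_fib[OF V(2) Some] att_snd_above[OF ok2, of i] att_snd_above[OF ok, of i] b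
            by (simp add: att_snd_other[OF ok1 nq[unfolded b(1)]] i att_snd_other[OF ok' b(2)] att_fst[OF ok'] se)
        qed (use att_snd_above[OF ok2, of i] att_snd_above[OF ok, of i] b in
              \<open>simp add: att_snd_other[OF ok1 nq[unfolded b(1)]] i att_snd_other[OF ok' b(2)] att_fst[OF ok'] se\<close>)
      next
        case c
        then have nq: "\<not> prefix (k @ j) q" using append_prefixD by blast
        show ?thesis
        proof (cases "snd s q")
          case (Some x)
          moreover have "x \<noteq> e" using valid_lop_inj[OF V(1) Some, of k] se c by auto
          ultimately show ?thesis using A valid_lop_fib[OF V(1) Some]
            by (simp add: att_snd_other[OF ok1 nq] i att_snd_other[OF ok c] att_snd_other[OF ok2 c] att_fst[OF ok'] se)
        qed (simp add: att_snd_other[OF ok1 nq] i att_snd_other[OF ok c] att_snd_other[OF ok2 c] att_fst[OF ok'] se)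
      qed
    qed
  qed
qed

text \<open>The single input is named by the empty address, which is the leaf of a unit tree.
  Substituting into it therefore prefixes nothing, and \<open>att_unit_left\<close> is an equality
  without renaming.\<close>

definition unit_lop :: "'i \<Rightarrow> ('b, 'e, 'k) lop" where
  "unit_lop i = (unt P i, [[] \<mapsto> THE e. e \<in> fib P (unt P i)])"

lemma unit_input:
  assumes "i \<in> types P"
  shows "fib P (unt P i) = {THE e. e \<in> fib P (unt P i)}" "src P (THE e. e \<in> fib P (unt P i)) = i"
proof -
  obtain e where e: "fib P (unt P i) = {e}" "src P e = i" using fib_unt[OF assms] by blast
  then have "(THE e. e \<in> fib P (unt P i)) = e" by simp
  with e show "fib P (unt P i) = {THE e. e \<in> fib P (unt P i)}" "src P (THE e. e \<in> fib P (unt P i)) = i" by auto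
qed

lemma unit_lop_valid: "i \<in> types P \<Longrightarrow> valid_lop P (unit_lop i)"
  using unt_op[of i] unit_input[of i] by (auto simp: valid_lop_def unit_lop_def)

lemma att_unit_left:
  assumes X: "valid_lop P X" and i: "tgt P (fst X) = i"
  shows "att P [] X (unit_lop i) = X"
proof -
  have T: "i \<in> types P" using X i tgt_type by (auto simp: valid_lop_def)
  note U = unit_input[OF T]
  have ok: "lop_ok P [] X (unit_lop i)"
    using X unit_lop_valid[OF T] U(2) i by (auto simp: lop_ok_def unit_lop_def)
  have c: "fst X \<in> ops P" using X by (simp add: valid_lop_def)
  note L = sub_unt_left[OF c, unfolded i, OF U(1)]
  show ?thesis
  proof (rule prod_eqI)
    show "fst (att P [] X (unit_lop i)) = fst X" using L by (simp add: att_fst[OF ok]) (simp add: unit_lop_def)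
    show "snd (att P [] X (unit_lop i)) = snd X"
    proof
      fix q
      have "map_option (inner P (fst X) (THE e. e \<in> fib P (unt P i))) (snd X q) = snd X q"
        using L valid_lop_fib[OF X, of q] by (cases "snd X q") auto
      then show "snd (att P [] X (unit_lop i)) q = snd X q"
        using att_snd_above[OF ok, of q] by (simp add: unit_lop_def)
    qed
  qed
qed

lemma att_unit_right:
  assumes s: "valid_lop P s" and k: "snd s k = Some e"
  shows "att P k (unit_lop (src P e)) s = s"
proof -
  have e: "e \<in> inputs P" "opr P e = fst s" using valid_lop_fib[OF s k] by (auto simp: fib_def)
  then have T: "src P e \<in> types P" by (simp add: src_type)
  note U = unit_input[OF T]
  have ok: "lop_ok P k (unit_lop (src P e)) s"
    using s unit_lop_valid[OF T] tgt_unt[OF T] k by (auto simp: lop_ok_def unit_lop_def)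
  note R = sub_unt_right[OF e(1) U(1)]
  have f: "fst (unit_lop (src P e)) = unt P (src P e)" by (simp add: unit_lop_def)
  show ?thesis
  proof (rule prod_eqI)
    show "fst (att P k (unit_lop (src P e)) s) = fst s" using R e by (simp add: att_fst[OF ok] k f)
    show "snd (att P k (unit_lop (src P e)) s) = snd s"
    proof
      fix q
      show "snd (att P k (unit_lop (src P e)) s) q = snd s q"
      proof (cases "prefix k q")
        case True
        then obtain j where j: "q = k @ j" by (auto simp: prefix_def)
        have "snd s q = None" if "j \<noteq> []"
          using valid_lop_antichain[OF s, of k q] k that unfolding j by (metis append_self_conv option.distinct(1) prefixI)
        then show ?thesis unfolding j att_snd_above[OF ok] using R k by (auto simp: unit_lop_def j)
      next
        case False
        show ?thesis
        proof (cases "snd s q")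
          case (Some x)
          moreover have "x \<noteq> e" using valid_lop_inj[OF s Some, of k] k False by auto
          ultimately show ?thesis using R valid_lop_fib[OF s Some] e
            by (simp add: att_snd_other[OF ok False] k f)
        qed (simp add: att_snd_other[OF ok False])
      qed
    qed
  qed
qed

end

text \<open>The guards are stated once, for the initial operation \<open>s\<close>, and not for the
  intermediate results. They persist along \<open>atts\<close> because distinct names of a valid
  \<open>s\<close> are parallel (\<open>atts_lop_ok\<close>).\<close>

definition fits :: "('i, 'b, 'e) pm \<Rightarrow> ('k list \<Rightarrow> ('b, 'e, 'k) lop) \<Rightarrow> ('b, 'e, 'k) lop \<Rightarrow> 'k list set \<Rightarrow> bool" where
  "fits P X s K \<longleftrightarrow> (\<forall>k \<in> K. k \<in> dom (snd s) \<and> valid_lop P (X k) \<and>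
     tgt P (fst (X k)) = src P (the (snd s k)))"

lemma fits_lop_ok: "valid_lop P s \<Longrightarrow> fits P X s K \<Longrightarrow> k \<in> K \<Longrightarrow> lop_ok P k (X k) s"
  by (force simp: fits_def lop_ok_def)

context polynomial_monad
begin

text \<open>Guarded substitutions at parallel addresses commute as maps, so the multiset of
  addresses alone matters. This is what replaces the list chosen by \<open>SOME\<close> in
  \<open>attach_all\<close> by any other enumeration.\<close>

lemma atts_perm:
  assumes "distinct ks" "distinct ls" "set ks = set ls"
    and par: "\<And>k q. k \<in> set ks \<Longrightarrow> q \<in> set ks \<Longrightarrow> k \<noteq> q \<Longrightarrow> k \<parallel> q"
  shows "atts P X ks = atts P X ls"
  unfolding atts_def
proof (rule fold_multiset_equiv)
  show "mset ks = mset ls" using assms(1-3) set_eq_iff_mset_eq_distinct by blast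
  fix k q assume "k \<in> set ks" "q \<in> set ks"
  then show "att P k (X k) \<circ> att P q (X q) = att P q (X q) \<circ> att P k (X k)"
    using att_commute[OF par, of k q] by (cases "k = q") (auto simp: fun_eq_iff)
qed

lemma atts_att_commute:
  "(\<And>k. k \<in> set ks \<Longrightarrow> k \<parallel> q) \<Longrightarrow> atts P X ks (att P q Y s) = att P q Y (atts P X ks s)"
proof (induction ks arbitrary: s)
  case (Cons k ks)
  then show ?case using att_commute[of k q "X k" Y s] by simp
qed simp

lemma atts_atts_commute:
  "(\<And>k q. k \<in> set ks \<Longrightarrow> q \<in> set ls \<Longrightarrow> k \<parallel> q) \<Longrightarrow>
     atts P X ks (atts P Y ls s) = atts P Y ls (atts P X ks s)"
  by (induction ls arbitrary: s) (simp_all add: atts_att_commute)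

lemma atts_props:
  assumes "valid_lop P s" "distinct ks" "fits P X s (set ks)"
  shows "valid_lop P (atts P X ks s) \<and> tgt P (fst (atts P X ks s)) = tgt P (fst s) \<and>
    dom (snd (atts P X ks s)) = (dom (snd s) - set ks) \<union> (\<Union>k \<in> set ks. (@) k ` dom (snd (X k))) \<and>
    (\<forall>q \<in> dom (snd s) - set ks. src P (the (snd (atts P X ks s) q)) = src P (the (snd s q))) \<and>
    (\<forall>k \<in> set ks. \<forall>j \<in> dom (snd (X k)).
       src P (the (snd (atts P X ks s) (k @ j))) = src P (the (snd (X k) j)))"
  using assms
proof (induction ks rule: rev_induct)
  case (snoc k ks)
  let ?s = "atts P X ks s"
  have "fits P X s (set ks)" "fits P X s {k}" using snoc.prems(3) by (simp_all add: fits_def)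
  with snoc have IH: "valid_lop P ?s" "tgt P (fst ?s) = tgt P (fst s)"
    "dom (snd ?s) = (dom (snd s) - set ks) \<union> (\<Union>k \<in> set ks. (@) k ` dom (snd (X k)))"
    "\<And>q. q \<in> dom (snd s) - set ks \<Longrightarrow> src P (the (snd ?s q)) = src P (the (snd s q))"
    "\<And>k j. k \<in> set ks \<Longrightarrow> j \<in> dom (snd (X k)) \<Longrightarrow> src P (the (snd ?s (k @ j))) = src P (the (snd (X k) j))"
    by auto
  have k: "k \<in> dom (snd s) - set ks" using snoc.prems by (simp add: fits_def)
  have ok: "lop_ok P k (X k) ?s"
    using \<open>fits P X s {k}\<close> IH(1,3) IH(4)[OF k] k
    by (intro fits_lop_ok[where K="{k}"]) (auto simp: fits_def)
  \<comment> \<open>A name created by an earlier substitution cannot coincide with \<open>k\<close>: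
    both \<open>k'\<close> and \<open>k\<close> are names of \<open>s\<close>, hence not
    comparable.\<close>
  have ne: "k' @ j \<noteq> k" if "k' \<in> set ks" for k' j
  proof
    assume "k' @ j = k"
    then have "prefix k' k" by auto
    moreover have "k' \<in> dom (snd s)" using snoc.prems(3) that by (auto simp: fits_def)
    ultimately have "k' = k" using snoc.prems(1) k unfolding valid_lop_def by blast
    with k that show False by simp
  qed
  show ?case
  proof (intro conjI ballI)
    show "dom (snd (atts P X (ks @ [k]) s)) =
        (dom (snd s) - set (ks @ [k])) \<union> (\<Union>k \<in> set (ks @ [k]). (@) k ` dom (snd (X k)))"
      using ne by (auto simp: att_dom[OF ok] IH(3))
    show "valid_lop P (atts P X (ks @ [k]) s)" "tgt P (fst (atts P X (ks @ [k]) s)) = tgt P (fst s)"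
      using att_valid[OF ok] IH(2) by simp_all
    show "src P (the (snd (atts P X (ks @ [k]) s) q)) = src P (the (snd s q))"
      if "q \<in> dom (snd s) - set (ks @ [k])" for q
      using that att_src_other[OF ok, of q] IH(3) IH(4)[of q] by simp
    show "src P (the (snd (atts P X (ks @ [k]) s) (k' @ j))) = src P (the (snd (X k') j))"
      if "k' \<in> set (ks @ [k])" "j \<in> dom (snd (X k'))" for k' j
    proof (cases "k' = k")
      case True
      then show ?thesis using that att_src_above[OF ok, of j] by simp
    next
      case False
      then have k': "k' \<in> set ks" using that by simp
      then have "k' @ j \<in> dom (snd ?s)" using that IH(3) by blast
      then show ?thesis using att_src_other[OF ok _ ne[OF k'], of j] IH(5)[OF k' that(2)] by simp
    qed
  qed
qed simp

lemma atts_lop_ok: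
  assumes "valid_lop P s" "distinct (ks @ [k])" "fits P X s (set (ks @ [k]))"
  shows "lop_ok P k (X k) (atts P X ks s)"
proof -
  have f: "fits P X s (set ks)" "distinct ks" using assms by (auto simp: fits_def)
  have k: "k \<in> dom (snd s) - set ks" "valid_lop P (X k)" "tgt P (fst (X k)) = src P (the (snd s k))"
    using assms by (auto simp: fits_def)
  note A = atts_props[OF assms(1) f(2,1)]
  have "k \<in> dom (snd (atts P X ks s))" using A k(1) by simp
  moreover have "src P (the (snd (atts P X ks s) k)) = src P (the (snd s k))" using A k(1) by blast
  ultimately have "fits P X (atts P X ks s) {k}" using k by (simp add: fits_def)
  then show ?thesis using A by (intro fits_lop_ok[where K="{k}"]) simp_all
qed

text \<open>Iterated \<open>att_nested\<close>: substitutions made inside \<open>X\<close> can be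
  postponed until \<open>X\<close> has been substituted into \<open>s\<close>. The addresses then
  carry the prefix \<open>k\<close>, which is cut off again before \<open>Y\<close> is consulted.
  This is the inductive step for grafting.\<close>

lemma att_atts:
  assumes "lop_ok P k X s" "distinct js" "fits P Y X (set js)"
  shows "lop_ok P k (atts P Y js X) s \<and>
    att P k (atts P Y js X) s = atts P (\<lambda>q. Y (drop (length k) q)) (map ((@) k) js) (att P k X s)"
  using assms
proof (induction js rule: rev_induct)
  case (snoc j js)
  have f: "fits P Y X (set js)" "distinct js" using snoc.prems by (auto simp: fits_def)
  note IH = snoc.IH[OF snoc.prems(1) f(2,1)]
  have "valid_lop P X" using snoc.prems(1) by (simp add: lop_ok_def)
  note ok = atts_lop_ok[OF this snoc.prems(2,3)]
  show ?case using att_nested[OF conjunct1[OF IH] ok] IH by simp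
qed simp

end


text \<open>The operation is transported along \<open>g\<close>, the inputs along \<open>h\<close>,
  and the names along \<open>w\<close>. With \<open>g\<close> and \<open>h\<close> the identity and
  \<open>w\<close> an \<open>outer_dot\<close>, this compares a tree before and after a dot is
  replaced; with the components of an arrow it compares a tree with its image.\<close>

definition lop_rel :: "('b \<Rightarrow> 'c) \<Rightarrow> ('e \<Rightarrow> 'f) \<Rightarrow> ('k list \<Rightarrow> 'l list) \<Rightarrow> ('b, 'e, 'k) lop \<Rightarrow>
    ('c, 'f, 'l) lop \<Rightarrow> bool" where
  "lop_rel g h w s s' \<longleftrightarrow> fst s' = g (fst s) \<and> dom (snd s') = w ` dom (snd s) \<and>
     (\<forall>q \<in> dom (snd s). snd s' (w q) = map_option h (snd s q))"

context pm_arrow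
begin

lemma onE_inj: "e \<in> fib P b \<Longrightarrow> e' \<in> fib P b \<Longrightarrow> onE h e = onE h e' \<Longrightarrow> e = e'"
  using pullback[of b "onE h e"] dom.opr_op onE_input arr_opr by (auto simp: fib_def)

lemma onE_fib: "e \<in> fib P b \<Longrightarrow> onE h e \<in> fib Q (onB h b)"
  using onE_input arr_opr by (auto simp: fib_def)

lemma onE_bij: "b \<in> ops P \<Longrightarrow> bij_betw (onE h) (fib P b) (fib Q (onB h b))"
  unfolding bij_betw_def
proof
  show "inj_on (onE h) (fib P b)" using onE_inj by (auto intro: inj_onI)
  assume b: "b \<in> ops P"
  show "onE h ` fib P b = fib Q (onB h b)"
  proof
    show "fib Q (onB h b) \<subseteq> onE h ` fib P b"
      using pullback[OF b] by (fastforce simp: fib_def)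
  qed (auto intro: onE_fib)
qed

lemma composable_onE: "composable P c e \<Longrightarrow> composable Q (onB h c) (onE h e)"
  by (simp add: composable_def onB_op onE_input arr_tgt arr_src)

text \<open>The condition on \<open>w\<close> says that it acts on the names coming from
  \<open>X\<close> as a renaming \<open>v\<close> followed by a prefix. Injectivity of
  \<open>w\<close> is not assumed; validity of \<open>s'\<close> and injectivity of arrows on fibres
  provide what is used of it.\<close>

lemma att_rel:
  assumes s: "lop_rel (onB h) (onE h) w s s'" "valid_lop Q s'" and X: "lop_rel (onB h) (onE h) v X X'" "valid_lop Q X'"
    and ok: "lop_ok P k X s" and w: "\<And>j. j \<in> dom (snd X) \<Longrightarrow> w (k @ j) = w k @ v j"
  shows "lop_ok Q (w k) X' s' \<and> lop_rel (onB h) (onE h) w (att P k X s) (att Q (w k) X' s')"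
proof -
  obtain e where e: "snd s k = Some e" using lop_ok_the[OF ok] by auto
  note C = dom.lop_ok_composable[OF ok, unfolded e option.sel]
  have V: "valid_lop P s" "valid_lop P X" using ok by (auto simp: lop_ok_def)
  have k: "k \<in> dom (snd s)" using e by auto
  have e': "snd s' (w k) = Some (onE h e)" using s e k by (auto simp: lop_rel_def)
  have fs: "fst s' = onB h (fst s)" "fst X' = onB h (fst X)" using s X by (auto simp: lop_rel_def)
  have "tgt Q (fst X') = src Q (onE h e)"
    using composable_onE[OF C(1)] fs by (simp add: composable_def)
  then have ok': "lop_ok Q (w k) X' s'" using s X e' by (auto simp: lop_ok_def)
  \<comment> \<open>Comparable names of the valid \<open>s'\<close> are equal and so name the same
    input of \<open>Q\<close>. Arrows are injective on fibres, hence \<open>k\<close> and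
    \<open>q\<close> would name the same input of \<open>s\<close>.\<close>
  have ne: "\<not> prefix (w k) (w q)" if q: "q \<in> dom (snd s) - {k}" for q
  proof
    assume p: "prefix (w k) (w q)"
    obtain x where x: "snd s q = Some x" using q by auto
    have x': "snd s' (w q) = Some (onE h x)" using s(1) x q by (auto simp: lop_rel_def)
    have "w k = w q" using valid_lop_antichain[OF s(2) _ _ p] e' x' by simp
    then have "onE h e = onE h x" using e' x' by simp
    then have "e = x" using onE_inj[OF C(3) valid_lop_fib[OF V(1) x]] by simp
    then show False using valid_lop_inj[OF V(1) e, of q] x q by simp
  qed
  have X': "snd X' (v j) = map_option (onE h) (snd X j)" if "j \<in> dom (snd X)" for j
    using X(1) that unfolding lop_rel_def by blast
  have s': "snd s' (w j) = map_option (onE h) (snd s j)" if "j \<in> dom (snd s)" for j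
    using s(1) that unfolding lop_rel_def by blast
  have "lop_rel (onB h) (onE h) w (att P k X s) (att Q (w k) X' s')"
    unfolding lop_rel_def
  proof (intro conjI ballI)
    show "fst (att Q (w k) X' s') = onB h (fst (att P k X s))"
      using arr_sub[OF C(1)] by (simp add: att_fst[OF ok'] att_fst[OF ok] e e' fs)
    have "w ` (dom (snd s) - {k}) = w ` dom (snd s) - {w k}"
      using ne by (auto simp: image_iff) (metis DiffI domI prefix_order.refl singletonD)
    moreover have "w ` (@) k ` dom (snd X) = (@) (w k) ` v ` dom (snd X)"
      unfolding image_image using w by (intro image_cong) auto
    ultimately show "dom (snd (att Q (w k) X' s')) = w ` dom (snd (att P k X s))"
      using s(1) X(1) by (simp add: att_dom[OF ok'] att_dom[OF ok] lop_rel_def image_Un)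
    show "snd (att Q (w k) X' s') (w q) = map_option (onE h) (snd (att P k X s) q)"
      if "q \<in> dom (snd (att P k X s))" for q
    proof -
      from that consider (a) "q \<in> dom (snd s) - {k}" | (b) j where "q = k @ j" "j \<in> dom (snd X)"
        unfolding att_dom[OF ok] by blast
      then show ?thesis
      proof cases
        case a
        then have nq: "\<not> prefix k q" using V(1) k unfolding valid_lop_def by blast
        obtain x where x: "snd s q = Some x" using a by auto
        have "x \<noteq> e" using valid_lop_inj[OF V(1) e, of q] x a by auto
        then have "onE h (outer P (fst X) e x) = outer Q (onB h (fst X)) (onE h e) (onE h x)"
          using arr_outer[OF C(1)] valid_lop_fib[OF V(1) x] C(2) by simp
        then show ?thesis using s'[of q] a x
          by (simp add: att_snd_other[OF ok' ne[OF a]] att_snd_other[OF ok nq] e e' fs)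
      next
        case b
        obtain x where x: "snd X j = Some x" using b by auto
        show ?thesis using arr_inner[OF C(1) valid_lop_fib[OF V(2) x]] X'[OF b(2)]
          by (simp add: b(1) w[OF b(2)] att_snd_above[OF ok'] att_snd_above[OF ok] e e' fs x)
      qed
    qed
  qed
  with ok' show ?thesis ..
qed

text \<open>The renaming \<open>v k\<close> may vary with \<open>k\<close>: when a dot above the
  root is replaced, only the branch that contains it is renamed.\<close>

lemma atts_rel:
  assumes "lop_rel (onB h) (onE h) w s s'" "valid_lop P s" "valid_lop Q s'"
    and "distinct ks" "fits P X s (set ks)"
    and "\<And>k. k \<in> set ks \<Longrightarrow> lop_rel (onB h) (onE h) (v k) (X k) (X' (w k)) \<and> valid_lop Q (X' (w k))"
    and "\<And>k j. k \<in> set ks \<Longrightarrow> j \<in> dom (snd (X k)) \<Longrightarrow> w (k @ j) = w k @ v k j"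
  shows "lop_rel (onB h) (onE h) w (atts P X ks s) (atts Q X' (map w ks) s') \<and> valid_lop Q (atts Q X' (map w ks) s')"
  using assms(4-)
proof (induction ks rule: rev_induct)
  case (snoc k ks)
  have f: "fits P X s (set ks)" "distinct ks" using snoc.prems by (auto simp: fits_def)
  have IH: "lop_rel (onB h) (onE h) w (atts P X ks s) (atts Q X' (map w ks) s')" "valid_lop Q (atts Q X' (map w ks) s')"
    using snoc.IH[OF f(2,1)] snoc.prems(3,4) by auto
  have k: "lop_rel (onB h) (onE h) (v k) (X k) (X' (w k))" "valid_lop Q (X' (w k))" using snoc.prems(3)[of k] by auto
  note ok = dom.atts_lop_ok[OF assms(2) snoc.prems(1,2)]
  have "lop_ok Q (w k) (X' (w k)) (atts Q X' (map w ks) s') \<and>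
      lop_rel (onB h) (onE h) w (att P k (X k) (atts P X ks s)) (att Q (w k) (X' (w k)) (atts Q X' (map w ks) s'))"
    using snoc.prems(4)[of k] by (intro att_rel[OF IH k ok]) simp
  then show ?case using cod.att_valid(1)[of "w k" "X' (w k)" "atts Q X' (map w ks) s'"] by simp
qed (use assms in simp)

end

section \<open>Identity arrows and composition of arrows\<close>

definition id_arr :: "('i, 'b, 'e, 'i, 'b, 'e) arr" where
  "id_arr = \<lparr>onI = id, onB = id, onE = id\<rparr>"

lemma id_arr_simps [simp]: "onI id_arr = id" "onB id_arr = id" "onE id_arr = id"
  by (simp_all add: id_arr_def)

lemma (in polynomial_monad) id_arrow: "pm_arrow P P id_arr"
  by unfold_locales (auto simp: src_type opr_op tgt_type unt_op sub_op)

lemma arr_comp_simps [simp]: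
  "onI (k \<circ>\<^sub>a h) = onI k \<circ> onI h" "onB (k \<circ>\<^sub>a h) = onB k \<circ> onB h" "onE (k \<circ>\<^sub>a h) = onE k \<circ> onE h"
  by (simp_all add: arr_comp_def)

lemma pm_arrow_comp:
  assumes "pm_arrow P Q h" "pm_arrow Q R k"
  shows "pm_arrow P R (k \<circ>\<^sub>a h)"
proof -
  interpret h: pm_arrow P Q h by fact
  interpret k: pm_arrow Q R k by fact
  show ?thesis
  proof
    fix b f assume b: "b \<in> ops P" and f: "f \<in> inputs R" "opr R f = onB (k \<circ>\<^sub>a h) b"
    then obtain g where g: "g \<in> inputs Q" "opr Q g = onB h b" "onE k g = f"
      using k.pullback[of "onB h b" f] h.onB_op by auto
    then obtain e where e: "e \<in> inputs P" "opr P e = b" "onE h e = g" using h.pullback[OF b g(1,2)] by blast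
    show "\<exists>!e. e \<in> inputs P \<and> opr P e = b \<and> onE (k \<circ>\<^sub>a h) e = f"
    proof (rule ex1I[of _ e])
      fix e' assume e': "e' \<in> inputs P \<and> opr P e' = b \<and> onE (k \<circ>\<^sub>a h) e' = f"
      then have "onE h e' = g"
        using k.pullback[of "onB h b" f] h.onB_op[OF b] f g h.onE_input h.arr_opr by auto
      then show "e' = e" using h.pullback[OF b g(1,2)] e e' by blast
    qed (use e g in simp)
  next
    fix c e x assume ce: "composable P c e" and x: "x \<in> fib P (opr P e) - {e}"
    \<comment> \<open>This is the side condition of \<open>arr_outer\<close> for the second arrow;
      it comes from injectivity on the fibre that contains \<open>x\<close> and
      \<open>e\<close>.\<close>
    have "onE h x \<noteq> onE h e" using h.onE_inj[of x "opr P e" e] x ce by (auto simp: composable_def fib_def)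
    then show "onE (k \<circ>\<^sub>a h) (outer P c e x) = outer R (onB (k \<circ>\<^sub>a h) c) (onE (k \<circ>\<^sub>a h) e) (onE (k \<circ>\<^sub>a h) x)"
      using h.arr_outer[OF ce x] k.arr_outer[OF h.composable_onE[OF ce], of "onE h x"] x ce h.onE_fib[of x "opr P e"]
        h.arr_opr[of e]
      by (simp add: composable_def)
  next
    fix c e x assume ce: "composable P c e" and x: "x \<in> fib P c"
    then show "onE (k \<circ>\<^sub>a h) (inner P c e x) = inner R (onB (k \<circ>\<^sub>a h) c) (onE (k \<circ>\<^sub>a h) e) (onE (k \<circ>\<^sub>a h) x)"
      using h.arr_inner[OF ce x] k.arr_inner[OF h.composable_onE[OF ce] h.onE_fib[OF x]] by simp
  next
    fix c e assume ce: "composable P c e"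
    then show "onB (k \<circ>\<^sub>a h) (sub P c e) = sub R (onB (k \<circ>\<^sub>a h) c) (onE (k \<circ>\<^sub>a h) e)"
      using h.arr_sub[OF ce] k.arr_sub[OF h.composable_onE[OF ce]] by simp
  qed (simp_all add: h.onI_type k.onI_type h.onB_op k.onB_op h.onE_input k.onE_input h.arr_src k.arr_src
      h.arr_opr k.arr_opr h.arr_tgt k.arr_tgt h.arr_unt k.arr_unt)
qed

section \<open>Contraction of trees\<close>

lemma leaves_Unit [simp]: "leaves (Unit i) = {[]}"
proof -
  have "q = []" if "subtree_at (Unit i) q (Unit j)" for q j
    using that by (cases q) (auto simp: subtree_Cons)
  then show ?thesis by (auto simp: leaves_def)
qed

lemma Nil_leaf_Dot [simp]: "[] \<notin> leaves (Dot b S)"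
  by (simp add: leaves_def)

lemma finite_leaves: "finite (leaves T)"
  using finite_addresses leaves_addresses by (rule finite_subset[rotated])

lemma branch_eq: "is_ptree P (Dot b S) \<Longrightarrow> (e, T) |\<in>| S \<Longrightarrow> branch S e = T"
  unfolding branch_def by (rule the_equality) (auto dest: dot_branch_unique)

lemma branch_mem: "is_ptree P (Dot b S) \<Longrightarrow> e \<in> fib P b \<Longrightarrow> (e, branch S e) |\<in>| S"
  using dot_branch_iff branch_eq by metis

lemma mem_branches:
  assumes "is_ptree P (Dot b S)"
  shows "(e, T) |\<in>| S \<longleftrightarrow> e \<in> fib P b \<and> T = branch S e"
  using branch_mem[OF assms] branch_eq[OF assms] dot_branch_iff[OF assms] by metis

lemma fset_branches:
  assumes "is_ptree P (Dot b S)"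
  shows "fset S = (\<lambda>e. (e, branch S e)) ` fib P b"
  using mem_branches[OF assms] by auto

lemma branch_ptree:
  assumes "is_ptree P (Dot b S)" "e \<in> fib P b"
  shows "is_ptree P (branch S e)" "root_type P (branch S e) = src P e"
  using branch_mem[OF assms] assms(1) by (auto elim: dot_treeE)

lemma Cons_leaf_Dot:
  "is_ptree P (Dot b S) \<Longrightarrow> e # q \<in> leaves (Dot b S) \<longleftrightarrow> e \<in> fib P b \<and> q \<in> leaves (branch S e)"
  using dot_branch_iff[of P b S e] branch_eq[of P b S e] branch_mem[of P b S e]
  by (auto simp: leaves_def subtree_Cons)

lemma leaves_Dot:
  assumes "is_ptree P (Dot b S)"
  shows "leaves (Dot b S) = (\<Union>e \<in> fib P b. (#) e ` leaves (branch S e))"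
proof -
  have "q \<in> leaves (Dot b S) \<longleftrightarrow> q \<in> (\<Union>e \<in> fib P b. (#) e ` leaves (branch S e))" for q
    using Cons_leaf_Dot[OF assms] by (cases q) auto
  then show ?thesis by blast
qed

lemma dot_tree_op: "is_ptree P (Dot b S) \<Longrightarrow> b \<in> ops P"
  by (auto elim: dot_treeE)

lemma (in polynomial_monad) root_type_types: "is_ptree P T \<Longrightarrow> root_type P T \<in> types P"
  by (cases rule: is_ptree.cases) (auto intro: tgt_type)

text \<open>\<open>graft\<close>, and \<open>replace_dot\<close> above the root, both act branch by
  branch on a dot; this is their common argument for well-formedness and for computing the new
  branches.\<close>

lemma Dot_map_branches:
  assumes D: "is_ptree P (Dot b S)"
    and \<phi>: "\<And>e. e \<in> fib P b \<Longrightarrow> is_ptree P (\<phi> e (branch S e)) \<and> root_type P (\<phi> e (branch S e)) = src P e"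
    and S': "S' = (\<lambda>(e, T). (e, \<phi> e T)) |`| S"
  shows "is_ptree P (Dot b S')" "\<And>e. e \<in> fib P b \<Longrightarrow> branch S' e = \<phi> e (branch S e)"
proof -
  have mem: "(e, U) |\<in>| S' \<longleftrightarrow> e \<in> fib P b \<and> U = \<phi> e (branch S e)" for e U
    unfolding S' fimage.rep_eq fset_branches[OF D] image_image by auto
  then have "fset S' = (\<lambda>e. (e, \<phi> e (branch S e))) ` fib P b" by auto
  then have "bij_betw fst (fset S') (fib P b)" by (auto simp: bij_betw_def inj_on_def image_image)
  with mem \<phi> show D': "is_ptree P (Dot b S')" by (auto intro!: is_ptree.intros dot_tree_op[OF D])
  show "branch S' e = \<phi> e (branch S e)" if "e \<in> fib P b" for e
    using branch_eq[OF D'] mem that by blast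
qed

text \<open>\<open>leaf_input\<close> is a total function with meaningless values off the leaves.
  Cutting it down to a partial map makes equality of contractions a meaningful statement.\<close>

definition lop_of :: "('i, 'b, 'e) pm \<Rightarrow> ('i, 'b, 'e) ptree \<Rightarrow> ('b, 'e, 'e) lop" where
  "lop_of P T = (tree_op P T, \<lambda>q. if q \<in> leaves T then Some (leaf_input P T q) else None)"

text \<open>This is the starting value \<open>(b, hd)\<close> of \<open>attach_all\<close>,
  restricted to the leaves \<open>[e]\<close> of the one-dot tree. It turns out to be the
  contraction of that tree, by the unit law (\<open>one_dot_tree\<close>).\<close>

definition corolla_lop :: "('i, 'b, 'e) pm \<Rightarrow> 'b \<Rightarrow> ('b, 'e, 'e) lop" where
  "corolla_lop P b = (b, \<lambda>q. if q \<in> (\<lambda>e. [e]) ` fib P b then Some (hd q) else None)"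

lemma fst_lop_of [simp]: "fst (lop_of P T) = tree_op P T"
  and dom_lop_of [simp]: "dom (snd (lop_of P T)) = leaves T"
  and snd_lop_of: "q \<in> leaves T \<Longrightarrow> snd (lop_of P T) q = Some (leaf_input P T q)"
  by (auto simp: lop_of_def split: if_splits)

lemma fst_corolla_lop [simp]: "fst (corolla_lop P b) = b"
  and dom_corolla_lop [simp]: "dom (snd (corolla_lop P b)) = (\<lambda>e. [e]) ` fib P b"
  and snd_corolla_lop: "e \<in> fib P b \<Longrightarrow> snd (corolla_lop P b) [e] = Some e"
  by (auto simp: corolla_lop_def split: if_splits)

lemma corolla_lop_valid: "b \<in> ops P \<Longrightarrow> valid_lop P (corolla_lop P b)"
proof -
  have "ran (snd (corolla_lop P b)) = fib P b" by (force simp: ran_def corolla_lop_def)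
  then show "b \<in> ops P \<Longrightarrow> valid_lop P (corolla_lop P b)"
    unfolding valid_lop_def fst_corolla_lop dom_corolla_lop
    by (auto simp: inj_on_def snd_corolla_lop)
qed

lemma atts_cong: "(\<And>k. k \<in> set ks \<Longrightarrow> X k = Y k) \<Longrightarrow> atts P X ks s = atts P Y ks s"
  by (induction ks arbitrary: s) simp_all

lemma graft_Dot: "graft (Dot b S) g = Dot b ((\<lambda>(e, T). (e, graft T (\<lambda>q. g (e # q)))) |`| S)"
proof -
  have "(\<lambda>(e, F). (e, F (\<lambda>q. g (e # q)))) \<circ> map_prod id graft = (\<lambda>(e, T). (e, graft T (\<lambda>q. g (e # q))))"
    by (simp add: fun_eq_iff)
  then show ?thesis by (simp only: graft.simps fset.map_comp)
qed

context polynomial_monad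
begin

lemma lop_of_Unit: "lop_of P (Unit i) = unit_lop i"
  by (auto simp: lop_of_def unit_lop_def tree_op_def leaf_input_def)

lemma fits_branches:
  assumes D: "is_ptree P (Dot b S)"
    and B: "\<And>e. e \<in> fib P b \<Longrightarrow> valid_lop P (lop_of P (branch S e)) \<and> tgt P (tree_op P (branch S e)) = src P e"
    and "K \<subseteq> (\<lambda>e. [e]) ` fib P b"
  shows "fits P (\<lambda>k. lop_of P (branch S (hd k))) (corolla_lop P b) K"
  using assms snd_corolla_lop[of _ P b] unfolding fits_def dom_corolla_lop by force

text \<open>\<open>attach\<close> sorts addresses by their first label and computes with total
  functions, \<open>att\<close> sorts them by prefixes and computes with partial maps. The two agree
  on the names that are present, since these are nonempty addresses and begin with \<open>e\<close>
  exactly when they lie above \<open>[e]\<close>.\<close>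

lemma fold_attach:
  assumes D: "is_ptree P (Dot b S)"
    and B: "\<And>e. e \<in> fib P b \<Longrightarrow> valid_lop P (lop_of P (branch S e)) \<and> tgt P (tree_op P (branch S e)) = src P e"
    and ys: "distinct (map fst ys)" "\<And>e r. (e, r) \<in> set ys \<Longrightarrow> e \<in> fib P b \<and> r = contract P (branch S e)"
  defines "V \<equiv> \<lambda>k. lop_of P (branch S (hd k))"
  shows "fst (fold (attach P) ys (b, hd)) = fst (atts P V (map (\<lambda>y. [fst y]) ys) (corolla_lop P b)) \<and>
    (\<forall>q \<in> dom (snd (atts P V (map (\<lambda>y. [fst y]) ys) (corolla_lop P b))).
       snd (atts P V (map (\<lambda>y. [fst y]) ys) (corolla_lop P b)) q = Some (snd (fold (attach P) ys (b, hd)) q))"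
  using ys
proof (induction ys rule: rev_induct)
  case Nil
  then show ?case by (auto simp: corolla_lop_def split: if_splits)
next
  case (snoc y ys)
  obtain e c m where y: "y = (e, c, m)" by (cases y)
  let ?s = "atts P V (map (\<lambda>y. [fst y]) ys) (corolla_lop P b)"
  obtain b' l where r: "fold (attach P) ys (b, hd) = (b', l)" by fastforce
  have e: "e \<in> fib P b" "(c, m) = contract P (branch S e)" using snoc.prems(2) by (auto simp: y)
  have IH: "fst ?s = b'" "\<And>q. q \<in> dom (snd ?s) \<Longrightarrow> snd ?s q = Some (l q)"
  proof -
    have "distinct (map fst ys)" using snoc.prems(1) by simp
    moreover have "\<And>e r. (e, r) \<in> set ys \<Longrightarrow> e \<in> fib P b \<and> r = contract P (branch S e)"
      by (rule snoc.prems(2)) simp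
    ultimately have "fst (fold (attach P) ys (b, hd)) = fst ?s \<and>
        (\<forall>q \<in> dom (snd ?s). snd ?s q = Some (snd (fold (attach P) ys (b, hd)) q))" by (rule snoc.IH)
    then show "fst ?s = b'" "\<And>q. q \<in> dom (snd ?s) \<Longrightarrow> snd ?s q = Some (l q)" unfolding r by simp_all
  qed
  have V: "V [e] = lop_of P (branch S e)" by (simp add: V_def)
  have cm: "tree_op P (branch S e) = c" "leaf_input P (branch S e) = m"
    using e(2)[symmetric] by (simp_all add: tree_op_def leaf_input_def)
  have "distinct (map (\<lambda>y. [fst y]) ys @ [[e]])"
    using snoc.prems(1) by (auto simp: distinct_map inj_on_def y)
  moreover have "fits P V (corolla_lop P b) (set (map (\<lambda>y. [fst y]) ys @ [[e]]))"
    unfolding V_def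
  proof (rule fits_branches[OF D B])
    have "fst z \<in> fib P b" if "z \<in> set ys" for z using snoc.prems(2)[of "fst z" "snd z"] that by simp
    then show "set (map (\<lambda>y. [fst y]) ys @ [[e]]) \<subseteq> (\<lambda>e. [e]) ` fib P b" using e by auto
  qed
  ultimately have ok: "lop_ok P [e] (V [e]) ?s"
    by (rule atts_lop_ok[OF corolla_lop_valid[OF dot_tree_op[OF D]]])
  have d: "[e] \<in> dom (snd ?s)" using lop_ok_the[OF ok] by auto
  have l: "snd ?s [e] = Some (l [e])" by (rule IH(2)[OF d])
  have fr: "fold (attach P) (ys @ [y]) (b, hd) = attach P y (b', l)" using r by simp
  show ?case
    unfolding fr
  proof (intro conjI ballI)
    show "fst (attach P y (b', l)) = fst (atts P V (map (\<lambda>y. [fst y]) (ys @ [y])) (corolla_lop P b))"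
      by (simp add: y att_fst[OF ok] l) (simp add: V cm)
    fix q assume "q \<in> dom (snd (atts P V (map (\<lambda>y. [fst y]) (ys @ [y])) (corolla_lop P b)))"
    then have "q \<in> dom (snd (att P [e] (V [e]) ?s))" by (simp add: y)
    then consider (a) j where "q = [e] @ j" "j \<in> leaves (branch S e)" | (b) "q \<in> dom (snd ?s)" "q \<noteq> [e]"
      unfolding att_dom[OF ok] by (auto simp: V)
    then have "snd (att P [e] (V [e]) ?s) q = Some (snd (attach P y (b', l)) q)"
    proof cases
      case a
      then show ?thesis unfolding a(1) att_snd_above[OF ok] by (simp add: y l) (simp add: V snd_lop_of cm)
    next
      case b
      \<comment> \<open>The second half excludes the empty address, for which \<open>hd\<close>
        would have no meaning; the first half then says that \<open>q\<close> begins with another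
        label.\<close>
      have n: "\<not> prefix [e] q" "\<not> prefix q [e]"
        using ok b d unfolding lop_ok_def valid_lop_def by blast+
      then have "hd q \<noteq> e" by (cases q) auto
      then show ?thesis unfolding att_snd_other[OF ok n(1)] IH(2)[OF b(1)] by (simp add: y l) (simp add: V cm)
    qed
    then show "snd (atts P V (map (\<lambda>y. [fst y]) (ys @ [y])) (corolla_lop P b)) q = Some (snd (attach P y (b', l)) q)"
      by (simp add: y)
  qed
qed

text \<open>The hypothesis on the branches is what \<open>lop_of_main\<close> proves by an induction
  that uses this lemma; \<open>lop_of_Dot\<close> is the version with the hypothesis
  discharged.\<close>

lemma lop_of_Dot0:
  assumes D: "is_ptree P (Dot b S)"
    and B: "\<And>e. e \<in> fib P b \<Longrightarrow> valid_lop P (lop_of P (branch S e)) \<and> tgt P (tree_op P (branch S e)) = src P e"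
    and es: "distinct es" "set es = fib P b"
  shows "lop_of P (Dot b S) = atts P (\<lambda>k. lop_of P (branch S (hd k))) (map (\<lambda>e. [e]) es) (corolla_lop P b)"
proof -
  let ?V = "\<lambda>k. lop_of P (branch S (hd k))"
  define xs where "xs = (SOME xs. distinct xs \<and> set xs = fset (map_prod id (contract P) |`| S))"
  have "\<exists>xs. distinct xs \<and> set xs = fset (map_prod id (contract P) |`| S)"
    using finite_distinct_list[OF finite_fset[of "map_prod id (contract P) |`| S"]] by (simp only: conj_commute)
  then have xs: "distinct xs" "set xs = fset (map_prod id (contract P) |`| S)"
    using someI_ex[of "\<lambda>xs. distinct xs \<and> set xs = fset (map_prod id (contract P) |`| S)"]
    unfolding xs_def by simp_all
  have sx: "set xs = (\<lambda>e. (e, contract P (branch S e))) ` fib P b"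
    by (simp add: xs fset_branches[OF D] image_image)
  \<comment> \<open>The list chosen by \<open>attach_all\<close> enumerates pairs; each input of
    \<open>b\<close> occurs in exactly one of them, so it is also an enumeration of the fibre of
    \<open>b\<close>.\<close>
  have dx: "distinct (map fst xs)" using xs(1) by (simp add: distinct_map sx inj_on_def)
  have c: "contract P (Dot b S) = fold (attach P) xs (b, hd)" by (simp add: attach_all_def xs_def)
  define s where "s = atts P ?V (map (\<lambda>y. [fst y]) xs) (corolla_lop P b)"
  have F: "fst (fold (attach P) xs (b, hd)) = fst s"
    "\<And>q. q \<in> dom (snd s) \<Longrightarrow> snd s q = Some (snd (fold (attach P) xs (b, hd)) q)"
  proof -
    have "e \<in> fib P b \<and> r = contract P (branch S e)" if "(e, r) \<in> set xs" for e r
      using that unfolding sx by blast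
    note fold_attach[OF D B dx this, folded s_def]
    then show "fst (fold (attach P) xs (b, hd)) = fst s"
      "\<And>q. q \<in> dom (snd s) \<Longrightarrow> snd s q = Some (snd (fold (attach P) xs (b, hd)) q)" by blast+
  qed
  have st: "set (map (\<lambda>y. [fst y]) xs) = (\<lambda>e. [e]) ` fib P b" by (simp add: sx image_image)
  have dt: "distinct (map (\<lambda>y. [fst y]) xs)" using dx by (auto simp: distinct_map inj_on_def)
  have ft: "fits P ?V (corolla_lop P b) (set (map (\<lambda>y. [fst y]) xs))"
    by (rule fits_branches[OF D B]) (auto simp only: st)
  have "dom (snd s) = leaves (Dot b S)"
    using atts_props[OF corolla_lop_valid[OF dot_tree_op[OF D]] dt ft]
    unfolding s_def[symmetric] st by (simp add: leaves_Dot[OF D])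
  then have "snd s q = snd (lop_of P (Dot b S)) q" for q
    using F(2)[of q] c by (cases "q \<in> dom (snd s)") (auto simp: lop_of_def leaf_input_def)
  then have "lop_of P (Dot b S) = s"
    using F(1) c by (intro prod_eqI) (auto simp: tree_op_def)
  moreover have "atts P ?V (map (\<lambda>y. [fst y]) xs) = atts P ?V (map (\<lambda>e. [e]) es)"
    by (rule atts_perm[OF dt]) (use es st in \<open>auto simp: distinct_map inj_on_def intro: Cons_parallelI1\<close>)
  ultimately show ?thesis by (simp add: s_def)
qed

text \<open>Validity and the output type must be proved together: the type of a contracted branch is
  what permits its substitution into \<open>b\<close>. The third claim records the sources of the
  leaves, on which later graftings depend.\<close>

lemma lop_of_main:
  "is_ptree P T \<Longrightarrow> valid_lop P (lop_of P T) \<and> tgt P (tree_op P T) = root_type P T \<and>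
     (\<forall>q i. subtree_at T q (Unit i) \<longrightarrow> src P (leaf_input P T q) = i)"
proof (induction T)
  case (Unit i)
  then have i: "i \<in> types P" by (auto elim: unit_treeE)
  have "q = []" "j = i" if "subtree_at (Unit i) q (Unit j)" for q j
    using that by (cases q, auto simp: subtree_Cons)+
  then show ?case using unit_lop_valid[OF i] tgt_unt[OF i] unit_input(2)[OF i]
    by (auto simp: lop_of_Unit tree_op_def leaf_input_def)
next
  case (Dot b S)
  note D = Dot.prems
  have IH: "valid_lop P (lop_of P (branch S e)) \<and> tgt P (tree_op P (branch S e)) = src P e \<and>
     (\<forall>q i. subtree_at (branch S e) q (Unit i) \<longrightarrow> src P (leaf_input P (branch S e) q) = i)"
    if e: "e \<in> fib P b" for e
    using Dot.IH[OF branch_mem[OF D e], of "branch S e"] branch_ptree[OF D e] by (simp add: snds.simps)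
  obtain es where es: "distinct es" "set es = fib P b"
    using finite_distinct_list[OF finite_fib[OF dot_tree_op[OF D]]] by blast
  let ?V = "\<lambda>k. lop_of P (branch S (hd k))"
  have L: "lop_of P (Dot b S) = atts P ?V (map (\<lambda>e. [e]) es) (corolla_lop P b)"
    by (rule lop_of_Dot0[OF D _ es]) (use IH in blast)
  have f: "fits P ?V (corolla_lop P b) (set (map (\<lambda>e. [e]) es))"
    by (rule fits_branches[OF D]) (use IH es in auto)
  have d: "distinct (map (\<lambda>e. [e]) es)" using es by (simp add: distinct_map inj_on_def)
  note A = atts_props[OF corolla_lop_valid[OF dot_tree_op[OF D]] d f, folded L]
  have "src P (leaf_input P (Dot b S) q) = i" if q: "subtree_at (Dot b S) q (Unit i)" for q i
  proof -
    obtain e r where q': "q = e # r" using q by (cases q) auto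
    have l: "e # r \<in> leaves (Dot b S)" using q q' by (auto simp: leaves_def)
    have e: "e \<in> fib P b" and r: "r \<in> leaves (branch S e)" using l Cons_leaf_Dot[OF D] by auto
    have "subtree_at (branch S e) r (Unit i)"
      using q branch_eq[OF D] unfolding q' subtree_Cons by auto
    then have "src P (leaf_input P (branch S e) r) = i" using IH[OF e] by blast
    moreover have "[e] \<in> set (map (\<lambda>e. [e]) es)" "r \<in> dom (snd (?V [e]))" using e es r by simp_all
    then have "src P (the (snd (lop_of P (Dot b S)) ([e] @ r))) = src P (the (snd (?V [e]) r))"
      using A by blast
    ultimately show ?thesis using l r by (simp add: snd_lop_of q')
  qed
  then show ?case using A by simp
qed

lemma lop_of_valid: "is_ptree P T \<Longrightarrow> valid_lop P (lop_of P T)"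
  and tgt_tree_op: "is_ptree P T \<Longrightarrow> tgt P (tree_op P T) = root_type P T"
  and src_leaf_input: "is_ptree P T \<Longrightarrow> subtree_at T q (Unit i) \<Longrightarrow> src P (leaf_input P T q) = i"
  using lop_of_main by blast+

lemma tree_op_ops: "is_ptree P T \<Longrightarrow> tree_op P T \<in> ops P"
  using lop_of_valid[of T] by (simp add: valid_lop_def)

lemma lop_of_branches:
  assumes "is_ptree P (Dot b S)" "e \<in> fib P b"
  shows "valid_lop P (lop_of P (branch S e)) \<and> tgt P (tree_op P (branch S e)) = src P e"
  using lop_of_main[OF branch_ptree(1)[OF assms]] branch_ptree(2)[OF assms] by simp

lemma lop_of_Dot:
  assumes "is_ptree P (Dot b S)" "distinct es" "set es = fib P b"
  shows "lop_of P (Dot b S) = atts P (\<lambda>k. lop_of P (branch S (hd k))) (map (\<lambda>e. [e]) es) (corolla_lop P b)"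
  using assms lop_of_branches by (intro lop_of_Dot0)

lemma leaf_input_bij:
  assumes T: "is_ptree P T"
  shows "bij_betw (leaf_input P T) (leaves T) (fib P (tree_op P T))"
proof -
  note V = lop_of_valid[OF T, unfolded valid_lop_def fst_lop_of dom_lop_of]
  have "leaf_input P T ` leaves T = ran (snd (lop_of P T))"
    by (auto simp: ran_def lop_of_def split: if_splits)
  moreover have "inj_on (leaf_input P T) (leaves T)"
    using V by (auto simp: inj_on_def snd_lop_of)
  ultimately show ?thesis using V by (simp add: bij_betw_def)
qed

lemma leaf_of_input:
  assumes "is_ptree P T" "q \<in> leaves T"
  shows "leaf_of P T (leaf_input P T q) = q"
  unfolding leaf_of_def
  using assms(2) bij_betw_imp_inj_on[OF leaf_input_bij[OF assms(1)]] by (auto dest: inj_onD)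

lemma leaf_of:
  assumes "is_ptree P T" "e \<in> fib P (tree_op P T)"
  shows "leaf_of P T e \<in> leaves T" "leaf_input P T (leaf_of P T e) = e"
proof -
  obtain q where q: "q \<in> leaves T" "leaf_input P T q = e"
    using assms(2) bij_betw_imp_surj_on[OF leaf_input_bij[OF assms(1)]] by (metis imageE)
  then have "leaf_of P T e = q" using leaf_of_input[OF assms(1) q(1)] by simp
  with q show "leaf_of P T e \<in> leaves T" "leaf_input P T (leaf_of P T e) = e" by simp_all
qed

lemma leaves_parallel:
  "is_ptree P T \<Longrightarrow> q \<in> leaves T \<Longrightarrow> r \<in> leaves T \<Longrightarrow> q \<noteq> r \<Longrightarrow> q \<parallel> r"
  by (rule valid_lop_parallel[OF lop_of_valid]) simp_all

section \<open>Grafting and contraction\<close>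

lemma ptree_graft:
  "is_ptree P F \<Longrightarrow>
    (\<And>q i. subtree_at F q (Unit i) \<Longrightarrow> is_ptree P (g q) \<and> root_type P (g q) = i) \<Longrightarrow>
    is_ptree P (graft F g) \<and> root_type P (graft F g) = root_type P F"
proof (induction F arbitrary: g)
  case (Dot b S)
  note D = Dot.prems(1)
  have "is_ptree P (graft (branch S e) (\<lambda>q. g (e # q))) \<and> root_type P (graft (branch S e) (\<lambda>q. g (e # q))) = src P e"
    if e: "e \<in> fib P b" for e
  proof -
    have "is_ptree P (g (e # q)) \<and> root_type P (g (e # q)) = i" if "subtree_at (branch S e) q (Unit i)" for q i
      using Dot.prems(2)[of "e # q" i] branch_mem[OF D e] that by (auto simp: subtree_Cons)
    then show ?thesis
      using Dot.IH[OF branch_mem[OF D e], of "branch S e" "\<lambda>q. g (e # q)"] branch_ptree[OF D e]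
      by (simp add: snds.simps)
  qed
  from Dot_map_branches(1)[where \<phi>="\<lambda>e T. graft T (\<lambda>q. g (e # q))", OF D this refl] show ?case unfolding graft_Dot by simp
qed simp

text \<open>Contraction turns grafting into substitution. By induction a grafted branch contracts to
  the branch followed by substitutions at its leaves; \<open>att_atts\<close> moves the latter out
  of the branch, and parallel substitutions commute, so they can all be postponed until every branch
  of \<open>F\<close> has been contracted.\<close>

lemma lop_of_graft:
  "is_ptree P F \<Longrightarrow>
    (\<And>q i. subtree_at F q (Unit i) \<Longrightarrow> is_ptree P (g q) \<and> root_type P (g q) = i) \<Longrightarrow>
    distinct ks \<Longrightarrow> set ks = leaves F \<Longrightarrow>
    lop_of P (graft F g) = atts P (\<lambda>k. lop_of P (g k)) ks (lop_of P F)"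
proof (induction F arbitrary: g ks)
  case (Unit i)
  then have "ks = [[]]" by (cases ks) (auto simp: distinct_length_2_or_more dest: subset_singletonD)
  moreover have "is_ptree P (g []) \<and> root_type P (g []) = i" using Unit.prems(2)[of "[]" i] by simp
  ultimately show ?case using lop_of_main[of "g []"] by (simp add: lop_of_Unit att_unit_left)
next
  case (Dot b S)
  note D = Dot.prems(1)
  have "\<exists>lv. \<forall>e. distinct (lv e) \<and> set (lv e) = leaves (branch S e)"
    by (rule choice) (use finite_distinct_list[OF finite_leaves] in blast)
  then obtain lv where lv: "\<And>e. distinct (lv e)" "\<And>e. set (lv e) = leaves (branch S e)" by blast
  let ?V = "\<lambda>k. lop_of P (branch S (hd k))" and ?Z = "\<lambda>k. lop_of P (g k)"
  let ?W = "\<lambda>k. lop_of P (graft (branch S (hd k)) (\<lambda>q. g (hd k # q)))"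
  have ge: "is_ptree P (g (e # q)) \<and> root_type P (g (e # q)) = i"
    if "e \<in> fib P b" "subtree_at (branch S e) q (Unit i)" for e q i
    using Dot.prems(2)[of "e # q" i] branch_mem[OF D that(1)] that(2) by (auto simp: subtree_Cons)
  have IH: "?W [e] = atts P (\<lambda>q. ?Z (e # q)) (lv e) (?V [e])" if e: "e \<in> fib P b" for e
    using Dot.IH[OF branch_mem[OF D e], of "branch S e" "\<lambda>q. g (e # q)" "lv e"] branch_ptree[OF D e] ge[OF e] lv
    by (simp add: snds.simps)
  \<comment> \<open>The leaves of the branches listed in \<open>es\<close>, as addresses in the
    whole tree. They are pairwise parallel, and parallel to \<open>[e]\<close> for every
    \<open>e\<close> outside \<open>es\<close>.\<close>
  let ?cs = "\<lambda>es. concat (map (\<lambda>e. map ((#) e) (lv e)) es)"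
  have main: "atts P ?W (map (\<lambda>e. [e]) es) (corolla_lop P b) =
      atts P ?Z (?cs es) (atts P ?V (map (\<lambda>e. [e]) es) (corolla_lop P b)) \<and> distinct (?cs es)"
    if "distinct es" "set es \<subseteq> fib P b" for es
    using that
  proof (induction es rule: rev_induct)
    case (snoc e es)
    let ?s = "atts P ?V (map (\<lambda>e. [e]) es) (corolla_lop P b)"
    have e: "e \<in> fib P b" using snoc.prems by simp
    have ok: "lop_ok P [e] (?V [e]) ?s"
    proof (rule atts_lop_ok[OF corolla_lop_valid[OF dot_tree_op[OF D]]])
      show "distinct (map (\<lambda>e. [e]) es @ [[e]])" using snoc.prems(1) by (auto simp: distinct_map inj_on_def)
      show "fits P ?V (corolla_lop P b) (set (map (\<lambda>e. [e]) es @ [[e]]))"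
        by (rule fits_branches[OF D lop_of_branches[OF D]]) (use snoc.prems in auto)
    qed
    have fz: "fits P (\<lambda>q. ?Z (e # q)) (?V [e]) (set (lv e))"
      unfolding fits_def
    proof
      fix k assume "k \<in> set (lv e)"
      then obtain i where i: "k \<in> leaves (branch S e)" "subtree_at (branch S e) k (Unit i)"
        unfolding lv by (auto simp: leaves_def)
      then show "k \<in> dom (snd (?V [e])) \<and> valid_lop P (?Z (e # k)) \<and>
          tgt P (fst (?Z (e # k))) = src P (the (snd (?V [e]) k))"
        using lop_of_main ge[OF e i(2)] src_leaf_input[OF branch_ptree(1)[OF D e] i(2)]
        by (simp add: snd_lop_of)
    qed
    have m: "map ((@) [e]) (lv e) = map ((#) e) (lv e)" by simp
    \<comment> \<open>The substitutions at the leaves of the branch \<open>e\<close> are now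
      separated from the branch itself. It remains to move the branch past the leaves of the earlier
      branches, which are parallel to \<open>[e]\<close>.\<close>
    have "att P [e] (?W [e]) ?s = atts P ?Z (map ((#) e) (lv e)) (att P [e] (?V [e]) ?s)"
      unfolding IH[OF e] conjunct2[OF att_atts[OF ok lv(1) fz]] m by (rule atts_cong) auto
    moreover have "k \<parallel> [e]" if "k \<in> set (?cs es)" for k
      using that snoc.prems(1) by (auto intro!: Cons_parallelI1)
    moreover have "k \<parallel> q" if "k \<in> set (?cs es)" "q \<in> set (map ((#) e) (lv e))" for k q
      using that snoc.prems(1) by (auto intro!: Cons_parallelI1)
    ultimately have "att P [e] (?W [e]) (atts P ?Z (?cs es) ?s) =
        atts P ?Z (map ((#) e) (lv e)) (atts P ?Z (?cs es) (att P [e] (?V [e]) ?s))"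
      using atts_atts_commute[of "?cs es" "map ((#) e) (lv e)" ?Z ?Z] atts_att_commute[of "?cs es" "[e]" ?Z "?W [e]" ?s]
      by simp
    moreover have "atts P ?Z (?cs es) (att P [e] (?V [e]) ?s) = att P [e] (?V [e]) (atts P ?Z (?cs es) ?s)"
      using atts_att_commute[of "?cs es" "[e]"] \<open>\<And>k. k \<in> set (?cs es) \<Longrightarrow> k \<parallel> [e]\<close> by blast
    moreover have "distinct (?cs (es @ [e]))"
      using snoc lv(1)[of e] by (auto simp: distinct_map inj_on_def)
    ultimately show ?case
      using snoc \<open>\<And>k. k \<in> set (?cs es) \<Longrightarrow> k \<parallel> [e]\<close> by simp
  qed simp
  obtain es where es: "distinct es" "set es = fib P b"
    using finite_distinct_list[OF finite_fib[OF dot_tree_op[OF D]]] by blast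
  have br: "is_ptree P (graft (branch S e) (\<lambda>q. g (e # q))) \<and> root_type P (graft (branch S e) (\<lambda>q. g (e # q))) = src P e"
    if e: "e \<in> fib P b" for e
    using ptree_graft[OF branch_ptree(1)[OF D e], of "\<lambda>q. g (e # q)"] ge[OF e] branch_ptree(2)[OF D e] by simp
  let ?S' = "(\<lambda>(e, T). (e, graft T (\<lambda>q. g (e # q)))) |`| S"
  have S': "is_ptree P (Dot b ?S')" "\<And>e. e \<in> fib P b \<Longrightarrow> branch ?S' e = graft (branch S e) (\<lambda>q. g (e # q))"
    using Dot_map_branches[where \<phi>="\<lambda>e T. graft T (\<lambda>q. g (e # q))", OF D _ refl] br by blast+
  have "lop_of P (graft (Dot b S) g) = atts P ?W (map (\<lambda>e. [e]) es) (corolla_lop P b)"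
    unfolding graft_Dot lop_of_Dot[OF S'(1) es] by (rule atts_cong) (use es S'(2) in auto)
  also have "\<dots> = atts P ?Z (?cs es) (lop_of P (Dot b S))"
    using main[OF es(1)] es(2) by (simp add: lop_of_Dot[OF D es])
  also have "atts P ?Z (?cs es) = atts P ?Z ks"
  proof (rule atts_perm)
    show "distinct (?cs es)" using main[OF es(1)] es(2) by simp
    show "distinct ks" by fact
    show s: "set (?cs es) = set ks" using Dot.prems(4) es(2) lv(2) by (simp add: leaves_Dot[OF D])
    show "k \<parallel> q" if "k \<in> set (?cs es)" "q \<in> set (?cs es)" "k \<noteq> q" for k q
      using that leaves_parallel[OF D] unfolding s Dot.prems(4) by blast
  qed
  finally show ?case .
qed

end

section \<open>Substitution of trees\<close>

text \<open>The label at an address: the type of a leaf or the decoration of a dot.\<close>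

definition node :: "('i, 'b, 'e) ptree \<Rightarrow> 'e list \<Rightarrow> 'i + 'b \<Rightarrow> bool" where
  "node T q x = (case x of Inl i \<Rightarrow> subtree_at T q (Unit i) | Inr b \<Rightarrow> \<exists>S. subtree_at T q (Dot b S))"

lemma node_Unit [simp]: "node (Unit i) q x \<longleftrightarrow> q = [] \<and> x = Inl i"
  by (cases q) (auto simp: node_def subtree_Cons split: sum.splits)

lemma node_Dot_Nil [simp]: "node (Dot b S) [] x \<longleftrightarrow> x = Inr b"
  by (auto simp: node_def split: sum.splits)

lemma node_Dot_Cons: "node (Dot b S) (e # q) x \<longleftrightarrow> (\<exists>V. (e, V) |\<in>| S \<and> node V q x)"
  by (auto simp: node_def subtree_Cons split: sum.splits)

lemma node_branch: "is_ptree P (Dot b S) \<Longrightarrow> node (Dot b S) (e # q) x \<longleftrightarrow> e \<in> fib P b \<and> node (branch S e) q x"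
  unfolding node_Dot_Cons by (auto simp: mem_branches)

lemma leaves_node: "q \<in> leaves T \<longleftrightarrow> (\<exists>i. node T q (Inl i))"
  by (auto simp: leaves_def node_def)

lemma dots_node: "q \<in> dots T \<longleftrightarrow> (\<exists>b. node T q (Inr b))"
  by (auto simp: dots_def node_def)

lemma node_append: "node T (q @ r) x \<longleftrightarrow> (\<exists>U. subtree_at T q U \<and> node U r x)"
  by (auto simp: node_def subtree_append split: sum.splits)

lemma node_unique: "is_ptree P T \<Longrightarrow> node T q x \<Longrightarrow> node T q y \<Longrightarrow> x = y"
  by (auto simp: node_def split: sum.splits dest: subtree_unique)

lemma dot_dec_node: "is_ptree P T \<Longrightarrow> node T q (Inr b) \<Longrightarrow> dot_dec T q = b"
  unfolding dot_dec_def by (rule the_equality) (auto simp: node_def dest: subtree_unique)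

lemma node_dot_dec: "is_ptree P T \<Longrightarrow> q \<in> dots T \<Longrightarrow> node T q (Inr (dot_dec T q))"
  using dot_dec_node dots_node by metis

lemma leaf_address: "is_ptree P T \<Longrightarrow> q \<in> leaves T \<Longrightarrow> node T (q @ r) x \<Longrightarrow> r = []"
  unfolding node_append leaves_def by (auto dest: subtree_unique)

lemma leaf_not_dot: "is_ptree P T \<Longrightarrow> q \<in> leaves T \<Longrightarrow> r \<in> dots T \<Longrightarrow> \<not> prefix q r"
  unfolding dots_node prefix_def using leaf_address node_unique leaves_node by (metis Inl_Inr_False append_Nil2)

text \<open>The case distinction behind the computations with \<open>outer_dot\<close>: only
  addresses strictly above the replaced dot move, and their next label is an input of that dot,
  which corresponds to a leaf of the inserted tree.\<close>

lemma node_above: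
  assumes "is_ptree P T" "node T q (Inr b)" "node T r x" "r \<noteq> q"
  obtains e s where "e \<in> fib P b" "r = q @ e # s" | "\<not> prefix q r"
proof (cases "prefix q r")
  case True
  then obtain z where z: "r = q @ z" by (auto simp: prefix_def)
  then obtain e s where "z = e # s" using assms(4) by (cases z) auto
  with z have r: "r = q @ e # s" by simp
  obtain S where S: "subtree_at T q (Dot b S)" using assms(2) by (auto simp: node_def)
  obtain U where U: "subtree_at T q U" "node U (e # s) x" using assms(3) unfolding r node_append by blast
  have "U = Dot b S" using subtree_unique[OF S assms(1) U(1)] by simp
  then have "e \<in> fib P b" using U(2) node_branch[OF subtree_ptree[OF S assms(1)]] by simp
  then show thesis using r that(1) by blast
qed (use that in blast)

text \<open>One inclusion suffices. Equal labels at the root force equal sets of inputs, so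
  \<open>U\<close> has no branch that \<open>T\<close> lacks, and the argument continues in each
  branch.\<close>

lemma tree_ext:
  "is_ptree P T \<Longrightarrow> is_ptree P U \<Longrightarrow> (\<And>q x. node T q x \<Longrightarrow> node U q x) \<Longrightarrow> T = U"
proof (induction T arbitrary: U)
  case (Unit i)
  then show ?case by (cases U) (use Unit(3)[of "[]"] in \<open>auto\<close>)
next
  case (Dot b S)
  note D = Dot.prems(1)
  obtain S' where U: "U = Dot b S'" using Dot.prems(3)[of "[]" "Inr b"] by (cases U) auto
  note D' = Dot.prems(2)[unfolded U]
  have "branch S e = branch S' e" if e: "e \<in> fib P b" for e
  proof (rule Dot.IH[OF branch_mem[OF D e]])
    show "branch S e \<in> Basic_BNFs.snds (e, branch S e)" by (simp add: snds.simps)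
    show "is_ptree P (branch S e)" "is_ptree P (branch S' e)"
      using branch_ptree(1)[OF D e] branch_ptree(1)[OF D' e] by auto
    show "node (branch S' e) q x" if "node (branch S e) q x" for q x
      using Dot.prems(3)[of "e # q" x] that e node_branch[OF D] node_branch[OF D'] U by simp
  qed
  then have "fset S = fset S'" unfolding fset_branches[OF D] fset_branches[OF D'] by simp
  then show ?case by (simp add: U fset_inject)
qed

lemma node_graft:
  "node (graft F g) p x \<longleftrightarrow> (\<exists>b. x = Inr b \<and> node F p x) \<or> (\<exists>l s. l \<in> leaves F \<and> p = l @ s \<and> node (g l) s x)"
proof (induction F arbitrary: g p)
  case (Unit i)
  then show ?case by auto
next
  case (Dot b S)
  show ?case
  proof (cases p)
    case Nil
    then show ?thesis by (auto simp: graft_Dot)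
  next
    case (Cons e p')
    have l: "e' # l \<in> leaves (Dot b S) \<longleftrightarrow> (\<exists>T. (e', T) |\<in>| S \<and> l \<in> leaves T)" for e' l
      by (auto simp: leaves_node node_Dot_Cons)
    have IH: "node (graft T (\<lambda>q. g (e # q))) p' x \<longleftrightarrow>
        (\<exists>b. x = Inr b \<and> node T p' x) \<or> (\<exists>l s. l \<in> leaves T \<and> p' = l @ s \<and> node (g (e # l)) s x)"
      if "(e, T) |\<in>| S" for T
      using Dot.IH[OF that, of T "\<lambda>q. g (e # q)" p'] by (simp add: snds.simps)
    have "node (graft (Dot b S) g) p x \<longleftrightarrow> (\<exists>T. (e, T) |\<in>| S \<and> node (graft T (\<lambda>q. g (e # q))) p' x)"
      unfolding graft_Dot Cons node_Dot_Cons by auto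
    also have "\<dots> \<longleftrightarrow> (\<exists>T. (e, T) |\<in>| S \<and> ((\<exists>b. x = Inr b \<and> node T p' x) \<or>
        (\<exists>l s. l \<in> leaves T \<and> p' = l @ s \<and> node (g (e # l)) s x)))"
      using IH by blast
    also have "\<dots> \<longleftrightarrow> (\<exists>b'. x = Inr b' \<and> node (Dot b S) p x) \<or>
        (\<exists>l s. e # l \<in> leaves (Dot b S) \<and> p = (e # l) @ s \<and> node (g (e # l)) s x)"
      unfolding Cons node_Dot_Cons l by auto
    also have "\<dots> \<longleftrightarrow> (\<exists>b'. x = Inr b' \<and> node (Dot b S) p x) \<or>
        (\<exists>l s. l \<in> leaves (Dot b S) \<and> p = l @ s \<and> node (g l) s x)"
    proof -
      have "(\<exists>l s. l \<in> leaves (Dot b S) \<and> p = l @ s \<and> node (g l) s x) \<Longrightarrow>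
        (\<exists>l s. e # l \<in> leaves (Dot b S) \<and> p = (e # l) @ s \<and> node (g (e # l)) s x)"
      proof (elim exE conjE)
        fix l s assume l: "l \<in> leaves (Dot b S)" "p = l @ s" "node (g l) s x"
        then obtain l' where "l = e # l'" using Cons by (cases l) auto
        with l show "\<exists>l s. e # l \<in> leaves (Dot b S) \<and> p = (e # l) @ s \<and> node (g (e # l)) s x" by blast
      qed
      then show ?thesis by blast
    qed
    finally show ?thesis .
  qed
qed

section \<open>Replacing a dot and the addresses in the result\<close>

lemma outer_dot_Nil [simp]: "outer_dot P F q [] = []" "outer_dot P F [] (e # s) = leaf_of P F e @ s"
  by (auto simp: outer_dot_def)

lemma outer_dot_Cons [simp]:
  "outer_dot P F (f # q) (e # r) = (if e = f then f # outer_dot P F q r else e # r)"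
  by (auto simp: outer_dot_def)

lemma outer_dot_append [simp]: "outer_dot P F (p @ q) (p @ r) = p @ outer_dot P F q r"
  by (induction p) simp_all

lemma outer_dot_above [simp]: "outer_dot P F q (q @ e # s) = q @ leaf_of P F e @ s"
  using outer_dot_append[of P F q "[]" "e # s"] by simp

lemma outer_dot_other: "\<not> prefix q r \<Longrightarrow> outer_dot P F q r = r"
  by (auto simp: outer_dot_def)

text \<open>This is \<open>composable\<close> for \<open>BD P\<close> (see
  \<open>composable_BD\<close>), with the decoration of the dot expressed by \<open>node\<close>
  instead of the definite description \<open>dot_dec\<close>.\<close>

definition replaceable :: "('i, 'b, 'e) pm \<Rightarrow> ('i, 'b, 'e) ptree \<Rightarrow> 'e list \<Rightarrow> ('i, 'b, 'e) ptree \<Rightarrow> bool" where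
  "replaceable P F q G \<longleftrightarrow> is_ptree P F \<and> is_ptree P G \<and> node G q (Inr (tree_op P F))"

context polynomial_monad
begin

text \<open>At the root, \<open>G\<close> contracts by substituting its branches into the corolla,
  and the new tree by substituting the same branches into \<open>F\<close> at its leaves. The
  corolla and \<open>F\<close> have the same operation and differ by the renaming of
  \<open>[e]\<close> to the leaf for \<open>e\<close>, which \<open>atts_rel\<close> carries through
  the substitutions. For a higher dot only one branch changes, and by induction it keeps its
  operation.\<close>

lemma replace_dot_main:
  "replaceable P F q G \<Longrightarrow> is_ptree P (replace_dot P F q G) \<and> root_type P (replace_dot P F q G) = root_type P G \<and>
    (\<forall>p x. node (replace_dot P F q G) p x \<longleftrightarrow>
       (\<exists>s b. p = q @ s \<and> x = Inr b \<and> node F s x) \<or> (\<exists>r. r \<noteq> q \<and> node G r x \<and> p = outer_dot P F q r)) \<and>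
    lop_rel id id (outer_dot P F q) (lop_of P G) (lop_of P (replace_dot P F q G))"
proof (induction q arbitrary: G)
  case Nil
  then obtain b S where G: "G = Dot b S" "b = tree_op P F" "is_ptree P F" "is_ptree P (Dot b S)"
    by (cases G) (auto simp: replaceable_def)
  note D = G(4)
  let ?g = "\<lambda>l. branch S (leaf_input P F l)"
  have li: "leaf_input P F l \<in> fib P b" if "l \<in> leaves F" for l
    using leaf_input_bij[OF G(3)] that G(2) by (auto simp: bij_betw_def)
  have g: "is_ptree P (?g l) \<and> root_type P (?g l) = i" if "subtree_at F l (Unit i)" for l i
  proof -
    have "l \<in> leaves F" using that by (auto simp: leaves_def)
    then show ?thesis using branch_ptree[OF D li] src_leaf_input[OF G(3) that] by simp
  qed
  have R: "replace_dot P F [] G = graft F ?g" by (simp add: G(1))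
  obtain es where es: "distinct es" "set es = fib P b"
    using finite_distinct_list[OF finite_fib[OF dot_tree_op[OF D]]] by blast
  have lo: "leaf_of P F e \<in> leaves F" "leaf_input P F (leaf_of P F e) = e" if "e \<in> fib P b" for e
    using leaf_of[OF G(3)] that G(2) by auto
  \<comment> \<open>The leaves of \<open>F\<close> are enumerated along the inputs of
    \<open>b\<close>, so that the substitutions into \<open>F\<close> correspond one by one to those
    into the corolla.\<close>
  have lf: "leaf_of P F ` fib P b = leaves F"
    using lo li leaf_of_input[OF G(3)] by force
  have "inj_on (leaf_of P F) (fib P b)" using lo(2) by (metis inj_onI)
  then have ks: "distinct (map (leaf_of P F) es)" "set (map (leaf_of P F) es) = leaves F"
    using es lf by (auto simp: distinct_map)
  \<comment> \<open>With the identity arrow, \<open>atts_rel\<close> compares two operations of the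
    same monad that differ by their names only.\<close>
  interpret id: pm_arrow P P id_arr by (rule id_arrow)
  have "lop_rel id id (outer_dot P F [])
     (atts P (\<lambda>k. lop_of P (branch S (hd k))) (map (\<lambda>e. [e]) es) (corolla_lop P b))
     (atts P (\<lambda>k. lop_of P (?g k)) (map (outer_dot P F []) (map (\<lambda>e. [e]) es)) (lop_of P F)) \<and>
     valid_lop P (atts P (\<lambda>k. lop_of P (?g k)) (map (outer_dot P F []) (map (\<lambda>e. [e]) es)) (lop_of P F))"
  proof (rule id.atts_rel[unfolded id_arr_simps, where w="outer_dot P F []" and v="\<lambda>_. id"])
    show "lop_rel id id (outer_dot P F []) (corolla_lop P b) (lop_of P F)"
      unfolding lop_rel_def using lf lo by (auto simp: image_image snd_corolla_lop snd_lop_of G(2))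
    show "valid_lop P (corolla_lop P b)" by (rule corolla_lop_valid[OF dot_tree_op[OF D]])
    show "valid_lop P (lop_of P F)" by (rule lop_of_valid[OF G(3)])
    show "distinct (map (\<lambda>e. [e]) es)" using es by (auto simp: distinct_map inj_on_def)
    show "fits P (\<lambda>k. lop_of P (branch S (hd k))) (corolla_lop P b) (set (map (\<lambda>e. [e]) es))"
      by (rule fits_branches[OF D lop_of_branches[OF D]]) (use es in auto)
    show "lop_rel id id id (lop_of P (branch S (hd k))) (lop_of P (?g (outer_dot P F [] k))) \<and>
        valid_lop P (lop_of P (?g (outer_dot P F [] k)))" if "k \<in> set (map (\<lambda>e. [e]) es)" for k
      using that es lo lop_of_valid[OF branch_ptree(1)[OF D]] by (auto simp: lop_rel_def option.map_id)
    show "outer_dot P F [] (k @ j) = outer_dot P F [] k @ id j"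
      if "k \<in> set (map (\<lambda>e. [e]) es)" for k j using that by auto
  qed
  then have rel: "lop_rel id id (outer_dot P F []) (lop_of P G) (lop_of P (replace_dot P F [] G))"
    unfolding R[unfolded G(1)] G(1) lop_of_Dot[OF D es] using lop_of_graft[OF G(3) g ks] by (simp add: o_def)
  have "node (graft F ?g) p x \<longleftrightarrow> (\<exists>s b. p = [] @ s \<and> x = Inr b \<and> node F s x) \<or>
      (\<exists>r. r \<noteq> [] \<and> node G r x \<and> p = outer_dot P F [] r)" for p x
  proof -
    have "(\<exists>l s. l \<in> leaves F \<and> p = l @ s \<and> node (?g l) s x) \<longleftrightarrow>
        (\<exists>e s. e \<in> fib P b \<and> p = leaf_of P F e @ s \<and> node (branch S e) s x)"
      using lo li leaf_of_input[OF G(3)] by metis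
    also have "\<dots> \<longleftrightarrow> (\<exists>r. r \<noteq> [] \<and> node G r x \<and> p = outer_dot P F [] r)"
    proof
      assume "\<exists>e s. e \<in> fib P b \<and> p = leaf_of P F e @ s \<and> node (branch S e) s x"
      then obtain e s where "e \<in> fib P b" "p = leaf_of P F e @ s" "node (branch S e) s x" by blast
      then show "\<exists>r. r \<noteq> [] \<and> node G r x \<and> p = outer_dot P F [] r"
        by (intro exI[of _ "e # s"]) (simp add: G(1) node_branch[OF D])
    qed (auto simp: G(1) neq_Nil_conv node_branch[OF D])
    finally show ?thesis unfolding node_graft by auto
  qed
  moreover have "is_ptree P (graft F ?g)" "root_type P (graft F ?g) = root_type P G"
    using ptree_graft[OF G(3), of ?g] g tgt_tree_op[OF G(3)] by (simp_all add: G(1) G(2)[symmetric])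
  ultimately show ?case using rel unfolding R by blast
next
  case (Cons e q)
  then obtain b S where G: "G = Dot b S" "is_ptree P F" "is_ptree P (Dot b S)"
    by (cases G) (auto simp: replaceable_def)
  note D = G(3)
  have e: "e \<in> fib P b" "replaceable P F q (branch S e)"
    using Cons.prems node_branch[OF D] branch_ptree[OF D, of e] by (auto simp: replaceable_def G(1))
  note IH = Cons.IH[OF e(2)]
  let ?\<phi> = "\<lambda>e' T. if e' = e then replace_dot P F q T else T"
  let ?S = "(\<lambda>(e', T). (e', ?\<phi> e' T)) |`| S"
  have R: "replace_dot P F (e # q) G = Dot b ?S" by (simp add: G(1))
  have br: "is_ptree P (?\<phi> e' (branch S e')) \<and> root_type P (?\<phi> e' (branch S e')) = src P e'"
    if "e' \<in> fib P b" for e'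
    using branch_ptree[OF D that] IH by auto
  have D': "is_ptree P (Dot b ?S)" and S': "\<And>e'. e' \<in> fib P b \<Longrightarrow> branch ?S e' = ?\<phi> e' (branch S e')"
    using Dot_map_branches[where \<phi>="?\<phi>", OF D _ refl] br by blast+
  obtain es where es: "distinct es" "set es = fib P b"
    using finite_distinct_list[OF finite_fib[OF dot_tree_op[OF D]]] by blast
  let ?w = "outer_dot P F (e # q)" and ?ks = "map (\<lambda>e. [e]) es"
  interpret id: pm_arrow P P id_arr by (rule id_arrow)
  have w: "map ?w ?ks = ?ks" by simp
  have "lop_rel id id ?w
     (atts P (\<lambda>k. lop_of P (branch S (hd k))) ?ks (corolla_lop P b))
     (atts P (\<lambda>k. lop_of P (branch ?S (hd k))) (map ?w ?ks) (corolla_lop P b)) \<and>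
     valid_lop P (atts P (\<lambda>k. lop_of P (branch ?S (hd k))) (map ?w ?ks) (corolla_lop P b))"
  proof (rule id.atts_rel[unfolded id_arr_simps, where v="\<lambda>k. if hd k = e then outer_dot P F q else id"])
    show "lop_rel id id ?w (corolla_lop P b) (corolla_lop P b)"
      unfolding lop_rel_def by (auto simp: image_image snd_corolla_lop)
    show "valid_lop P (corolla_lop P b)" "valid_lop P (corolla_lop P b)"
      by (rule corolla_lop_valid[OF dot_tree_op[OF D]])+
    show "distinct ?ks" using es by (auto simp: distinct_map inj_on_def)
    show "fits P (\<lambda>k. lop_of P (branch S (hd k))) (corolla_lop P b) (set ?ks)"
      by (rule fits_branches[OF D lop_of_branches[OF D]]) (use es in auto)
    show "lop_rel id id (if hd k = e then outer_dot P F q else id) (lop_of P (branch S (hd k)))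
          (lop_of P (branch ?S (hd (?w k)))) \<and> valid_lop P (lop_of P (branch ?S (hd (?w k))))"
      if k: "k \<in> set ?ks" for k
    proof -
      obtain e' where e': "k = [e']" "e' \<in> fib P b" using k es by auto
      have "valid_lop P (lop_of P (branch ?S e'))" using lop_of_valid[OF branch_ptree(1)[OF D' e'(2)]] .
      moreover have "lop_rel id id id X X" for X :: "('b, 'e, 'e) lop" by (simp add: lop_rel_def option.map_id)
      moreover have "lop_rel id id (outer_dot P F q) (lop_of P (branch S e)) (lop_of P (replace_dot P F q (branch S e)))"
        using IH by blast
      moreover have h: "hd k = e'" "hd (?w k) = e'" by (simp_all add: e'(1))
      ultimately show ?thesis unfolding h S'[OF e'(2)] by simp
    qed
    show "?w (k @ j) = ?w k @ (if hd k = e then outer_dot P F q else id) j" if "k \<in> set ?ks" for k j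
      using that by auto
  qed
  then have rel: "lop_rel id id ?w (lop_of P G) (lop_of P (replace_dot P F (e # q) G))"
    unfolding R[unfolded G(1)] w G(1) lop_of_Dot[OF D es] lop_of_Dot[OF D' es] by blast
  have "node (Dot b ?S) p x \<longleftrightarrow> (\<exists>s b. p = (e # q) @ s \<and> x = Inr b \<and> node F s x) \<or>
      (\<exists>r. r \<noteq> e # q \<and> node G r x \<and> p = ?w r)" for p x
  proof (cases p)
    case Nil
    \<comment> \<open>The replaced dot lies strictly above the root, so the root keeps its address
      and no other node takes it.\<close>
    have "?w r = [] \<longleftrightarrow> r = []" for r by (cases r) auto
    then have "(\<exists>r. r \<noteq> e # q \<and> node G r x \<and> [] = ?w r) \<longleftrightarrow> node G [] x" by (metis list.distinct(1))
    then show ?thesis by (simp add: Nil G(1))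
  next
    case p: (Cons e' p')
    have r: "(\<exists>r. r \<noteq> e # q \<and> node G r x \<and> p = ?w r) \<longleftrightarrow>
        (\<exists>r. e' # r \<noteq> e # q \<and> e' \<in> fib P b \<and> node (branch S e') r x \<and> p' = (if e' = e then outer_dot P F q r else r))"
      (is "?A \<longleftrightarrow> ?B")
    proof
      assume ?A
      then obtain r where r: "r \<noteq> e # q" "node G r x" "p = ?w r" by blast
      with p obtain f s where "r = f # s" by (cases r) auto
      with r p have "f = e'" by (auto split: if_splits)
      with r p \<open>r = f # s\<close> show ?B by (auto simp: G(1) node_branch[OF D] split: if_splits)
    next
      assume ?B
      then obtain r where "e' # r \<noteq> e # q" "e' \<in> fib P b" "node (branch S e') r x"
        "p' = (if e' = e then outer_dot P F q r else r)" by blast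
      then show ?A using p by (intro exI[of _ "e' # r"]) (auto simp: G(1) node_branch[OF D])
    qed
    show ?thesis
    proof (cases "e' = e")
      case True
      then show ?thesis using IH e(1) unfolding r unfolding p node_branch[OF D'] by (auto simp: S')
    next
      case False
      then show ?thesis unfolding r unfolding p node_branch[OF D'] by (auto simp: S')
    qed
  qed
  moreover have "root_type P (Dot b ?S) = root_type P G" by (simp add: G(1))
  ultimately show ?case using D' rel unfolding R by blast
qed

lemma replace_ptree: "replaceable P F q G \<Longrightarrow> is_ptree P (replace_dot P F q G)"
  and replace_node: "replaceable P F q G \<Longrightarrow> node (replace_dot P F q G) p x \<longleftrightarrow>
     (\<exists>s b. p = q @ s \<and> x = Inr b \<and> node F s x) \<or> (\<exists>r. r \<noteq> q \<and> node G r x \<and> p = outer_dot P F q r)"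
  and replace_rel: "replaceable P F q G \<Longrightarrow>
     lop_rel id id (outer_dot P F q) (lop_of P G) (lop_of P (replace_dot P F q G))"
  using replace_dot_main by blast+

lemma replace_node_inner: "replaceable P F q G \<Longrightarrow> node F s (Inr b) \<Longrightarrow> node (replace_dot P F q G) (q @ s) (Inr b)"
  and replace_node_outer: "replaceable P F q G \<Longrightarrow> node G r x \<Longrightarrow> r \<noteq> q \<Longrightarrow>
     node (replace_dot P F q G) (outer_dot P F q r) x"
  by (auto simp: replace_node)

lemma replace_nodeE:
  assumes "replaceable P F q G" "node (replace_dot P F q G) p x"
  obtains s b where "p = q @ s" "x = Inr b" "node F s (Inr b)"
  | r where "p = outer_dot P F q r" "r \<noteq> q" "node G r x"
  using assms by (auto simp: replace_node)

lemma replace_tree_op: "replaceable P F q G \<Longrightarrow> tree_op P (replace_dot P F q G) = tree_op P G"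
  using replace_rel[of F q G] by (simp add: lop_rel_def)

text \<open>The correspondence between leaves and inputs of the contraction is the part of
  \<open>lop_rel\<close> that concerns names. It is needed as soon as the new tree is itself
  inserted into another one.\<close>

lemma replace_leaf_of:
  assumes R: "replaceable P F q G" and e: "e \<in> fib P (tree_op P G)"
  shows "leaf_of P (replace_dot P F q G) e = outer_dot P F q (leaf_of P G e)"
proof -
  have G: "is_ptree P G" using R by (simp add: replaceable_def)
  note l = leaf_of[OF G e]
  note L = replace_rel[OF R, unfolded lop_rel_def dom_lop_of]
  then have m: "outer_dot P F q (leaf_of P G e) \<in> leaves (replace_dot P F q G)" using l by simp
  have "snd (lop_of P (replace_dot P F q G)) (outer_dot P F q (leaf_of P G e)) = Some e"
    using bspec[OF conjunct2[OF conjunct2[OF L]] l(1)] l(2) by (simp add: snd_lop_of[OF l(1)])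
  then have "leaf_input P (replace_dot P F q G) (outer_dot P F q (leaf_of P G e)) = e"
    by (simp add: snd_lop_of[OF m])
  then show ?thesis using leaf_of_input[OF replace_ptree[OF R] m] by simp
qed

text \<open>Leaves are pairwise parallel, so two of them with a common extension coincide, and a
  leaf determines its input.\<close>

lemma leaf_of_parallel:
  assumes "is_ptree P F" "e \<in> fib P (tree_op P F)" "f \<in> fib P (tree_op P F)" "leaf_of P F e @ s = leaf_of P F f @ t"
  shows "e = f" "s = t"
proof -
  have "\<not> leaf_of P F e \<parallel> leaf_of P F f" using assms(4) by (metis prefixI prefix_same_cases parallelE)
  then have eq: "leaf_of P F e = leaf_of P F f"
    using leaves_parallel[OF assms(1)] leaf_of(1)[OF assms(1)] assms(2,3) by blast
  with assms(4) show "s = t" by simp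
  have "e = leaf_input P F (leaf_of P F e)" by (rule leaf_of(2)[OF assms(1,2), symmetric])
  also have "\<dots> = f" unfolding eq by (rule leaf_of(2)[OF assms(1,3)])
  finally show "e = f" .
qed

lemma outer_dot_inj:
  assumes R: "replaceable P F q G" and r: "node G r x" "r \<noteq> q" and r': "node G r' x'" "r' \<noteq> q"
    and eq: "outer_dot P F q r = outer_dot P F q r'"
  shows "r = r'"
proof -
  have F: "is_ptree P F" "is_ptree P G" "node G q (Inr (tree_op P F))" using R by (auto simp: replaceable_def)
  from node_above[OF F(2,3) r] show ?thesis
  proof cases
    case (1 e s)
    from node_above[OF F(2,3) r'] show ?thesis
    proof cases
      case (1 e' s')
      then show ?thesis using leaf_of_parallel[OF F(1), of e e' s s'] eq \<open>r = q @ e # s\<close> \<open>e \<in> fib P _\<close> by simp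
    next
      case 2
      then show ?thesis using eq outer_dot_other[OF 2, of P F] 1 by auto
    qed
  next
    case 2
    from node_above[OF F(2,3) r'] show ?thesis
    proof cases
      case (1 e s)
      then show ?thesis using eq outer_dot_other[OF 2, of P F] 2 by auto
    next
      case 2
      then show ?thesis using eq outer_dot_other[OF 2, of P F] outer_dot_other[OF \<open>\<not> prefix q r\<close>, of P F] by simp
    qed
  qed
qed

text \<open>A node of \<open>G\<close> that is moved ends up above a leaf of \<open>F\<close>, and
  no dot of \<open>F\<close> lies above a leaf of \<open>F\<close>; a node that is not moved does
  not lie above \<open>q\<close> at all.\<close>

lemma outer_dot_neq_inner:
  assumes R: "replaceable P F q G" and r: "node G r x" "r \<noteq> q" and s: "node F s (Inr b)"
  shows "outer_dot P F q r \<noteq> q @ s"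
proof -
  have F: "is_ptree P F" "is_ptree P G" "node G q (Inr (tree_op P F))" using R by (auto simp: replaceable_def)
  from node_above[OF F(2,3) r] show ?thesis
  proof cases
    case (1 e t)
    then have "\<not> prefix (leaf_of P F e) s"
      using leaf_not_dot[OF F(1) leaf_of(1)[OF F(1)]] s dots_node by metis
    then show ?thesis using 1 by auto
  next
    case 2
    then show ?thesis by (auto simp: outer_dot_other)
  qed
qed

text \<open>No dot of \<open>F\<close> lies at or above a leaf of \<open>F\<close>. Hence the
  position of an extended leaf relative to the dot \<open>r\<close> is already decided within
  \<open>F\<close>, and the extension is carried along unchanged.\<close>

lemma outer_dot_leaf_append:
  assumes F: "is_ptree P F" and l: "l \<in> leaves F" and r: "r \<in> dots F"
  shows "outer_dot P D r (l @ s) = outer_dot P D r l @ s"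
proof (cases "prefix r l")
  case True
  then obtain z where z: "l = r @ z" by (auto simp: prefix_def)
  have "z \<noteq> []" using leaf_not_dot[OF F l r] z by auto
  then obtain f z' where "z = f # z'" by (auto simp: neq_Nil_conv)
  then show ?thesis by (simp add: z)
next
  case False
  moreover have "\<not> prefix r (l @ s)"
    using False leaf_not_dot[OF F l r] prefix_same_cases[of r "l @ s" l] by auto
  ultimately show ?thesis by (simp add: outer_dot_other)
qed

lemma outer_dot_nested:
  assumes R: "replaceable P F q G" and R': "replaceable P D r F" and v: "node G v x" "v \<noteq> q"
  shows "outer_dot P D (q @ r) (outer_dot P F q v) = outer_dot P (replace_dot P D r F) q v"
proof -
  have F: "is_ptree P F" "is_ptree P G" "node G q (Inr (tree_op P F))" using R by (auto simp: replaceable_def)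
  have r: "r \<in> dots F" using R' by (auto simp: replaceable_def dots_node)
  from node_above[OF F(2,3) v] show ?thesis
  proof cases
    case (1 e s)
    then show ?thesis
      using outer_dot_leaf_append[OF F(1) leaf_of(1)[OF F(1)] r] replace_leaf_of[OF R'] by simp
  next
    case 2
    then have "\<not> prefix (q @ r) v" using append_prefixD by blast
    with 2 show ?thesis by (simp add: outer_dot_other)
  qed
qed

text \<open>The nodes of both sides come from \<open>D\<close>, from the rest of \<open>F\<close> or
  from the rest of \<open>G\<close>. Only the last kind needs an argument,
  \<open>outer_dot_nested\<close>, since both orders of replacement move these nodes to leaves of
  the final insert.\<close>

lemma replaceable_nested:
  assumes R: "replaceable P F q G" and R': "replaceable P D r F"
  shows "replaceable P D (q @ r) (replace_dot P F q G)" "replaceable P (replace_dot P D r F) q G"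
    "replace_dot P D (q @ r) (replace_dot P F q G) = replace_dot P (replace_dot P D r F) q G"
proof -
  show S: "replaceable P D (q @ r) (replace_dot P F q G)"
    using R R' replace_ptree[OF R] by (auto simp: replaceable_def replace_node[OF R])
  show S': "replaceable P (replace_dot P D r F) q G"
    using R R' replace_ptree[OF R'] replace_tree_op[OF R'] by (auto simp: replaceable_def)
  show "replace_dot P D (q @ r) (replace_dot P F q G) = replace_dot P (replace_dot P D r F) q G"
  proof (rule tree_ext[OF replace_ptree[OF S] replace_ptree[OF S']])
    fix p x assume "node (replace_dot P D (q @ r) (replace_dot P F q G)) p x"
    then show "node (replace_dot P (replace_dot P D r F) q G) p x"
    proof (cases rule: replace_nodeE[OF S, consumes 1])
      case (1 s b)
      then show ?thesis using replace_node_inner[OF S' replace_node_inner[OF R' 1(3)]] by simp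
    next
      case (2 u)
      note u = 2
      from u(3) show ?thesis
      proof (cases rule: replace_nodeE[OF R, consumes 1])
        case (1 t b)
        then have "t \<noteq> r" using u by auto
        with 1 have "node (replace_dot P D r F) (outer_dot P D r t) (Inr b)"
          by (intro replace_node_outer[OF R'])
        then show ?thesis using replace_node_inner[OF S'] u 1 by simp
      next
        case (2 v)
        then show ?thesis using replace_node_outer[OF S' 2(3,2)] outer_dot_nested[OF R R' 2(3,2)] u by simp
      qed
    qed
  qed
qed

text \<open>The condition \<open>\<not> prefix q' q\<close> ensures that the dot \<open>q\<close> keeps its address when \<open>q'\<close> is replaced.\<close>

lemma outer_dot_parallel0:
  assumes R: "replaceable P C q G" and R': "replaceable P D q' G" and nq: "\<not> prefix q' q"
  shows "\<lbrakk>node G v x; v \<noteq> q; v \<noteq> q'\<rbrakk> \<Longrightarrow>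
      outer_dot P D (outer_dot P C q q') (outer_dot P C q v) = outer_dot P C q (outer_dot P D q' v)"
    and "s \<in> dots C \<Longrightarrow> outer_dot P D (outer_dot P C q q') (q @ s) = q @ s"
    and "outer_dot P C q q' @ t = outer_dot P C q (q' @ t)"
proof -
  have C: "is_ptree P C" "is_ptree P G" "node G q (Inr (tree_op P C))" using R by (auto simp: replaceable_def)
  have D: "is_ptree P D" "node G q' (Inr (tree_op P D))" using R' by (auto simp: replaceable_def)
  have ne: "q' \<noteq> q" using nq by auto
  have np: "\<not> prefix q' (q @ u)" if "\<not> prefix q q'" for u
    using that nq prefix_same_cases[of q' "q @ u" q] by auto
  have np': "\<not> prefix q (q' @ u)" if "\<not> prefix q q'" for u
    using that nq prefix_same_cases[of q "q' @ u" q'] by auto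
  show "outer_dot P C q q' @ t = outer_dot P C q (q' @ t)"
    using node_above[OF C(2,3) D(2) ne] by cases (use np' in \<open>simp_all add: outer_dot_other\<close>)
  show "outer_dot P D (outer_dot P C q q') (q @ s) = q @ s" if s: "s \<in> dots C"
    using node_above[OF C(2,3) D(2) ne]
  proof cases
    case (1 e u)
    have "\<not> prefix (leaf_of P C e @ u) s"
      using leaf_not_dot[OF C(1) leaf_of(1)[OF C(1) 1(1)] s] append_prefixD by blast
    then show ?thesis by (simp add: 1(2) outer_dot_other)
  next
    case 2
    then show ?thesis by (simp add: np outer_dot_other)
  qed
  assume v: "node G v x" "v \<noteq> q" "v \<noteq> q'"
  from node_above[OF C(2,3) D(2) ne]
  show "outer_dot P D (outer_dot P C q q') (outer_dot P C q v) = outer_dot P C q (outer_dot P D q' v)"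
  proof cases
    case q': (1 e u)
    from node_above[OF C(2,3) v(1,2)] show ?thesis
    proof cases
      case (1 f w)
      show ?thesis
      proof (cases "prefix q' v")
        case True
        then obtain z where z: "v = q' @ z" by (auto simp: prefix_def)
        then obtain g z' where "z = g # z'" using v(3) by (cases z) auto
        then show ?thesis using z by (simp add: q'(2))
      next
        case False
        have "\<not> prefix (leaf_of P C e @ u) (leaf_of P C f @ w)"
        proof
          assume "prefix (leaf_of P C e @ u) (leaf_of P C f @ w)"
          then obtain z where "leaf_of P C f @ w = leaf_of P C e @ (u @ z)" by (auto simp: prefix_def)
          from leaf_of_parallel[OF C(1) 1(1) q'(1) this] have "v = q' @ z" by (simp add: 1(2) q'(2))
          with False show False by simp
        qed
        then show ?thesis using False by (simp add: outer_dot_other 1(2) q'(2))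
      qed
    next
      case 2
      have "\<not> prefix q' v" "\<not> prefix (q @ leaf_of P C e @ u) v"
        using 2 append_prefixD unfolding q'(2) by blast+
      with 2 show ?thesis by (simp add: outer_dot_other q'(2))
    qed
  next
    case nqq: 2
    from node_above[OF C(2,3) v(1,2)] show ?thesis
    proof cases
      case (1 f w)
      then show ?thesis using nqq np[OF nqq] by (simp add: outer_dot_other)
    next
      case 2
      have "\<not> prefix q (outer_dot P D q' v)"
        using node_above[OF C(2) D(2) v(1,3)] by cases (use 2 np'[OF nqq] in \<open>simp_all add: outer_dot_other\<close>)
      with 2 nqq show ?thesis by (simp add: outer_dot_other)
    qed
  qed
qed

text \<open>Of two distinct dots at least one is not below the other, and the claim is symmetric in
  the two replacements. So the asymmetric \<open>outer_dot_parallel0\<close> covers all cases,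
  including that of one dot above the other.\<close>

lemma outer_dot_parallel:
  assumes R: "replaceable P C q G" and R': "replaceable P D q' G" and ne: "q \<noteq> q'"
  shows "\<lbrakk>node G v x; v \<noteq> q; v \<noteq> q'\<rbrakk> \<Longrightarrow>
      outer_dot P D (outer_dot P C q q') (outer_dot P C q v) =
      outer_dot P C (outer_dot P D q' q) (outer_dot P D q' v)"
    and "s \<in> dots C \<Longrightarrow> outer_dot P D (outer_dot P C q q') (q @ s) = outer_dot P D q' q @ s"
    and "t \<in> dots D \<Longrightarrow> outer_dot P C q q' @ t = outer_dot P C (outer_dot P D q' q) (q' @ t)"
proof -
  have "\<not> prefix q q' \<or> \<not> prefix q' q" using ne by (meson prefix_order.antisym)
  then have "(node G v x \<and> v \<noteq> q \<and> v \<noteq> q' \<longrightarrow>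
      outer_dot P D (outer_dot P C q q') (outer_dot P C q v) =
      outer_dot P C (outer_dot P D q' q) (outer_dot P D q' v)) \<and>
    (s \<in> dots C \<longrightarrow> outer_dot P D (outer_dot P C q q') (q @ s) = outer_dot P D q' q @ s) \<and>
    (t \<in> dots D \<longrightarrow> outer_dot P C q q' @ t = outer_dot P C (outer_dot P D q' q) (q' @ t))"
  proof
    assume n: "\<not> prefix q' q"
    show ?thesis
      using outer_dot_parallel0(1)[OF R R' n, of v x] outer_dot_parallel0(2)[OF R R' n, of s]
        outer_dot_parallel0(3)[OF R R' n, of t] unfolding outer_dot_other[OF n] by auto
  next
    assume n: "\<not> prefix q q'"
    show ?thesis
      using outer_dot_parallel0(1)[OF R' R n, of v x] outer_dot_parallel0(2)[OF R' R n, of t]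
        outer_dot_parallel0(3)[OF R' R n, of s] unfolding outer_dot_other[OF n] by auto
  qed
  then show "\<lbrakk>node G v x; v \<noteq> q; v \<noteq> q'\<rbrakk> \<Longrightarrow>
      outer_dot P D (outer_dot P C q q') (outer_dot P C q v) =
      outer_dot P C (outer_dot P D q' q) (outer_dot P D q' v)"
    and "s \<in> dots C \<Longrightarrow> outer_dot P D (outer_dot P C q q') (q @ s) = outer_dot P D q' q @ s"
    and "t \<in> dots D \<Longrightarrow> outer_dot P C q q' @ t = outer_dot P C (outer_dot P D q' q) (q' @ t)"
    by blast+
qed

lemma replaceable_outer:
  assumes R: "replaceable P C q G" and R': "replaceable P D q' G" and ne: "q \<noteq> q'"
  shows "replaceable P D (outer_dot P C q q') (replace_dot P C q G)"
  using R' replace_node_outer[OF R _ ne[symmetric]] replace_ptree[OF R] by (auto simp: replaceable_def)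

lemma replace_parallel:
  assumes R: "replaceable P C q G" and R': "replaceable P D q' G" and ne: "q \<noteq> q'"
  shows "replace_dot P D (outer_dot P C q q') (replace_dot P C q G) =
    replace_dot P C (outer_dot P D q' q) (replace_dot P D q' G)"
proof (rule tree_ext)
  note S = replaceable_outer[OF R R' ne] and S' = replaceable_outer[OF R' R ne[symmetric]]
  show "is_ptree P (replace_dot P D (outer_dot P C q q') (replace_dot P C q G))"
    "is_ptree P (replace_dot P C (outer_dot P D q' q) (replace_dot P D q' G))"
    using replace_ptree[OF S] replace_ptree[OF S'] .
  have q: "node G q (Inr (tree_op P C))" using R by (simp add: replaceable_def)
  fix p x assume "node (replace_dot P D (outer_dot P C q q') (replace_dot P C q G)) p x"
  then show "node (replace_dot P C (outer_dot P D q' q) (replace_dot P D q' G)) p x"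
  proof (cases rule: replace_nodeE[OF S, consumes 1])
    case (1 t b)
    have "q' @ t \<noteq> outer_dot P D q' q" using outer_dot_neq_inner[OF R' q ne 1(3)] by simp
    moreover have "p = outer_dot P C (outer_dot P D q' q) (q' @ t)"
      using outer_dot_parallel(3)[OF R R' ne, of t] 1 dots_node by metis
    ultimately show ?thesis using replace_node_outer[OF S' replace_node_inner[OF R' 1(3)]] 1(2) by simp
  next
    case (2 u)
    note u = 2
    from u(3) show ?thesis
    proof (cases rule: replace_nodeE[OF R, consumes 1])
      case (1 s b)
      have "p = outer_dot P D q' q @ s"
        using outer_dot_parallel(2)[OF R R' ne, of s] 1 u dots_node by metis
      then show ?thesis using replace_node_inner[OF S' 1(3)] 1(2) by simp
    next
      case (2 v)
      have v: "v \<noteq> q'" using u 2 by auto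
      have "outer_dot P D q' v \<noteq> outer_dot P D q' q" using outer_dot_inj[OF R' 2(3) v q ne] 2(2) by blast
      moreover have "p = outer_dot P C (outer_dot P D q' q) (outer_dot P D q' v)"
        using outer_dot_parallel(1)[OF R R' ne 2(3,2) v] u 2 by simp
      ultimately show ?thesis using replace_node_outer[OF S' replace_node_outer[OF R' 2(3) v]] by simp
    qed
  qed
qed

end

section \<open>The Baez--Dolan construction\<close>

lemma BD_simps [simp]:
  "types (BD P) = ops P" "ops (BD P) = {T. is_ptree P T}"
  "inputs (BD P) = {(T, q). is_ptree P T \<and> q \<in> dots T}"
  "src (BD P) (T, q) = dot_dec T q" "opr (BD P) x = fst x" "tgt (BD P) = tree_op P"
  "unt (BD P) = one_dot_tree P" "sub (BD P) F (G, q) = replace_dot P F q G"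
  "outer (BD P) F (G, q) (T, r) = (replace_dot P F q G, outer_dot P F q r)"
  "inner (BD P) F (G, q) (T, r) = (replace_dot P F q G, q @ r)"
  by (simp_all add: BD_def)

lemma fib_BD: "x \<in> fib (BD P) T \<longleftrightarrow> is_ptree P T \<and> (\<exists>q \<in> dots T. x = (T, q))"
  by (cases x) (auto simp: fib_def)

lemma composable_BD: "composable (BD P) F (G, q) \<longleftrightarrow> replaceable P F q G"
  by (auto simp: composable_def replaceable_def dots_node dot_dec_node)

context polynomial_monad
begin

section \<open>One-dot trees and the monad laws for \<open>BD\<close>\<close>

lemma atts_units:
  assumes s: "valid_lop P s" and ks: "\<And>k. k \<in> set ks \<Longrightarrow> \<exists>e. snd s k = Some e \<and> X k = unit_lop (src P e)"
  shows "atts P X ks s = s"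
  using ks
proof (induction ks)
  case (Cons k ks)
  then obtain e where "snd s k = Some e" "X k = unit_lop (src P e)" by force
  then show ?case using Cons att_unit_right[OF s] by simp
qed simp

text \<open>Contracting the one-dot tree substitutes units into the corolla, which does nothing by
  the right unit law. Hence its contraction is the corolla, and its leaf for \<open>e\<close> is
  \<open>[e]\<close>.\<close>

lemma one_dot_tree:
  assumes b: "b \<in> ops P"
  shows one_dot_ptree: "is_ptree P (one_dot_tree P b)"
    and node_one_dot: "node (one_dot_tree P b) q x \<longleftrightarrow>
      (q = [] \<and> x = Inr b) \<or> (\<exists>e \<in> fib P b. q = [e] \<and> x = Inl (src P e))"
    and one_dot_tree_op: "tree_op P (one_dot_tree P b) = b"
    and one_dot_leaf_of: "e \<in> fib P b \<Longrightarrow> leaf_of P (one_dot_tree P b) e = [e]"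
proof -
  define S where "S = Abs_fset ((\<lambda>e. (e, Unit (src P e) :: ('i, 'b, 'e) ptree)) ` fib P b)"
  have T: "one_dot_tree P b = Dot b S" by (simp add: one_dot_tree_def S_def)
  have S: "fset S = (\<lambda>e. (e, Unit (src P e))) ` fib P b"
    unfolding S_def using finite_fib[OF b] by (simp add: Abs_fset_inverse)
  show D: "is_ptree P (one_dot_tree P b)"
    unfolding T using b S src_type fib_iff
    by (auto intro!: is_ptree.intros simp: bij_betw_def inj_on_def image_image)
  note D' = D[unfolded T]
  show N: "node (one_dot_tree P b) q x \<longleftrightarrow>
      (q = [] \<and> x = Inr b) \<or> (\<exists>e \<in> fib P b. q = [e] \<and> x = Inl (src P e))" for q x
    unfolding T by (cases q) (auto simp: node_Dot_Cons S)
  have br: "branch S e = Unit (src P e)" if "e \<in> fib P b" for e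
    using branch_eq[OF D'] S that by auto
  obtain es where es: "distinct es" "set es = fib P b"
    using finite_distinct_list[OF finite_fib[OF b]] by blast
  have L: "lop_of P (one_dot_tree P b) = corolla_lop P b"
    unfolding T lop_of_Dot[OF D' es]
    by (rule atts_units[OF corolla_lop_valid[OF b]]) (use es in \<open>auto simp: br lop_of_Unit snd_corolla_lop\<close>)
  from arg_cong[OF L, of fst] show "tree_op P (one_dot_tree P b) = b" by simp
  assume e: "e \<in> fib P b"
  then have l: "[e] \<in> leaves (one_dot_tree P b)" using N by (auto simp: leaves_node)
  have "leaf_input P (one_dot_tree P b) [e] = e"
    using arg_cong[OF L, of "\<lambda>s. snd s [e]"] by (simp add: snd_lop_of[OF l] snd_corolla_lop[OF e])
  with leaf_of_input[OF D l] show "leaf_of P (one_dot_tree P b) e = [e]" by simp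
qed

lemma dots_one_dot: "b \<in> ops P \<Longrightarrow> dots (one_dot_tree P b) = {[]}"
  by (auto simp: dots_node node_one_dot)

lemma replaceD:
  assumes "replaceable P F q G"
  shows "is_ptree P F" "is_ptree P G" "node G q (Inr (tree_op P F))" "q \<in> dots G"
  using assms by (auto simp: replaceable_def dots_node)

theorem BD_monad: "polynomial_monad (BD P)"
proof
  show "src (BD P) e \<in> types (BD P)" if e': "e \<in> inputs (BD P)" for e
  proof -
    obtain T q where e: "e = (T, q)" "is_ptree P T" "q \<in> dots T" using e' by auto
    then obtain b S where S: "subtree_at T q (Dot b S)" by (auto simp: dots_def)
    have "dot_dec T q = b" using S by (intro dot_dec_node[OF e(2)]) (auto simp: node_def)
    then show ?thesis using dot_tree_op[OF subtree_ptree[OF S e(2)]] by (simp add: e(1))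
  qed
  show "opr (BD P) e \<in> ops (BD P)" if "e \<in> inputs (BD P)" for e
    using that by auto
  show "tgt (BD P) b \<in> types (BD P)" if "b \<in> ops (BD P)" for b
    using that tree_op_ops by simp
  show "finite (fib (BD P) b)" for b
  proof (rule finite_subset)
    show "fib (BD P) b \<subseteq> Pair b ` addresses b"
      by (auto simp: fib_BD dots_def addresses_def intro!: imageI)
  qed (simp add: finite_addresses)
  show "unt (BD P) i \<in> ops (BD P)" if "i \<in> types (BD P)" for i
    using that one_dot_ptree by simp
  show "tgt (BD P) (unt (BD P) i) = i" if "i \<in> types (BD P)" for i
    using that one_dot_tree_op by simp
  show "\<exists>e. fib (BD P) (unt (BD P) i) = {e} \<and> src (BD P) e = i" if "i \<in> types (BD P)" for i
  proof (intro exI[of _ "(one_dot_tree P i, [])"] conjI)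
    have i: "i \<in> ops P" using that by simp
    show "fib (BD P) (unt (BD P) i) = {(one_dot_tree P i, [])}"
      by (intro set_eqI) (simp add: fib_BD dots_one_dot[OF i] one_dot_ptree[OF i])
    show "src (BD P) (one_dot_tree P i, []) = i"
      using dot_dec_node[OF one_dot_ptree[OF i], of "[]" i] node_one_dot[OF i] by simp
  qed
next
  fix F e assume C: "composable (BD P) F e"
  obtain G q where e: "e = (G, q)" by (cases e)
  have R: "replaceable P F q G" using C by (simp add: e composable_BD)
  note D = replaceD[OF R]
  show "sub (BD P) F e \<in> ops (BD P)" using replace_ptree[OF R] by (simp add: e)
  show "tgt (BD P) (sub (BD P) F e) = tgt (BD P) (opr (BD P) e)"
    using replace_tree_op[OF R] by (simp add: e)
  show "bij_betw (case_sum (outer (BD P) F e) (inner (BD P) F e))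
      ((fib (BD P) (opr (BD P) e) - {e}) <+> fib (BD P) F) (fib (BD P) (sub (BD P) F e))"
    unfolding bij_betw_def
  proof
    show "inj_on (case_sum (outer (BD P) F e) (inner (BD P) F e)) ((fib (BD P) (opr (BD P) e) - {e}) <+> fib (BD P) F)"
    proof (rule inj_onI)
      have i1: "r = s" if "r \<in> dots G" "r \<noteq> q" "s \<in> dots G" "s \<noteq> q" "outer_dot P F q r = outer_dot P F q s" for r s
        using that outer_dot_inj[OF R] unfolding dots_node by blast
      have i2: "outer_dot P F q r \<noteq> q @ s" if "r \<in> dots G" "r \<noteq> q" "s \<in> dots F" for r s
        using that outer_dot_neq_inner[OF R] unfolding dots_node by blast
      fix x y
      assume xy: "x \<in> (fib (BD P) (opr (BD P) e) - {e}) <+> fib (BD P) F"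
          "y \<in> (fib (BD P) (opr (BD P) e) - {e}) <+> fib (BD P) F"
        and eq: "case_sum (outer (BD P) F e) (inner (BD P) F e) x = case_sum (outer (BD P) F e) (inner (BD P) F e) y"
      have cases: "(\<exists>r. z = Inl (G, r) \<and> r \<in> dots G \<and> r \<noteq> q) \<or> (\<exists>r. z = Inr (F, r) \<and> r \<in> dots F)"
        if "z \<in> (fib (BD P) (opr (BD P) e) - {e}) <+> fib (BD P) F" for z
        using that by (auto simp: e fib_BD)
      from cases[OF xy(1)] cases[OF xy(2)] show "x = y"
      proof (elim disjE exE conjE)
        fix r s assume "x = Inl (G, r)" "r \<in> dots G" "r \<noteq> q" "y = Inl (G, s)" "s \<in> dots G" "s \<noteq> q"
        with eq i1[of r s] show ?thesis by (simp add: e)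
      next
        fix r s assume "x = Inl (G, r)" "r \<in> dots G" "r \<noteq> q" "y = Inr (F, s)" "s \<in> dots F"
        with eq i2[of r s] show ?thesis by (simp add: e)
      next
        fix r s assume "x = Inr (F, s)" "s \<in> dots F" "y = Inl (G, r)" "r \<in> dots G" "r \<noteq> q"
        with eq i2[of r s] show ?thesis by (simp add: e)
      next
        fix r s assume "x = Inr (F, r)" "y = Inr (F, s)"
        with eq show ?thesis by (simp add: e)
      qed
    qed
    have dots: "r \<in> dots (replace_dot P F q G) \<longleftrightarrow>
        (\<exists>s \<in> dots F. r = q @ s) \<or> (\<exists>s \<in> dots G - {q}. r = outer_dot P F q s)" for r
      unfolding Bex_def Diff_iff dots_node replace_node[OF R] by blast
    show "case_sum (outer (BD P) F e) (inner (BD P) F e) ` ((fib (BD P) (opr (BD P) e) - {e}) <+> fib (BD P) F) =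
        fib (BD P) (sub (BD P) F e)" (is "?L = ?R")
    proof (intro set_eqI iffI)
      fix y assume "y \<in> ?L"
      then show "y \<in> ?R" using replace_ptree[OF R] by (auto simp: e fib_BD dots)
    next
      fix y assume "y \<in> ?R"
      then obtain r where r: "y = (replace_dot P F q G, r)" "r \<in> dots (replace_dot P F q G)"
        by (auto simp: e fib_BD)
      from r(2)[unfolded dots] show "y \<in> ?L"
      proof (elim disjE bexE)
        fix s assume "s \<in> dots F" "r = q @ s"
        then show ?thesis using D by (intro image_eqI[of _ _ "Inr (F, s)"]) (auto simp: r e fib_BD)
      next
        fix s assume "s \<in> dots G - {q}" "r = outer_dot P F q s"
        then show ?thesis using D by (intro image_eqI[of _ _ "Inl (G, s)"]) (auto simp: r e fib_BD)
      qed
    qed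
  qed
  show "src (BD P) (outer (BD P) F e x) = src (BD P) x" if x: "x \<in> fib (BD P) (opr (BD P) e) - {e}" for x
  proof -
    obtain r where r: "x = (G, r)" "r \<in> dots G" "r \<noteq> q" using x by (auto simp: e fib_BD)
    show ?thesis
      using dot_dec_node[OF replace_ptree[OF R] replace_node_outer[OF R node_dot_dec[OF D(2) r(2)] r(3)]]
      by (simp add: e r(1))
  qed
  show "src (BD P) (inner (BD P) F e x) = src (BD P) x" if x: "x \<in> fib (BD P) F" for x
  proof -
    obtain r where r: "x = (F, r)" "r \<in> dots F" using x by (auto simp: fib_BD)
    show ?thesis
      using dot_dec_node[OF replace_ptree[OF R] replace_node_inner[OF R node_dot_dec[OF D(1) r(2)]]]
      by (simp add: e r(1))
  qed
next
  fix c e assume c: "c \<in> ops (BD P)" and e: "fib (BD P) (unt (BD P) (tgt (BD P) c)) = {e}"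
  have T: "is_ptree P c" and b: "tree_op P c \<in> ops P" using c tree_op_ops by auto
  have e': "e = (one_dot_tree P (tree_op P c), [])"
  proof -
    have "(one_dot_tree P (tree_op P c), []) \<in> fib (BD P) (unt (BD P) (tgt (BD P) c))"
      using one_dot_ptree[OF b] dots_one_dot[OF b] by (simp add: fib_BD)
    then show ?thesis unfolding e by simp
  qed
  have R: "replaceable P c [] (one_dot_tree P (tree_op P c))"
    using T one_dot_ptree[OF b] node_one_dot[OF b] by (simp add: replaceable_def)
  have "replace_dot P c [] (one_dot_tree P (tree_op P c)) = c"
  proof (rule tree_ext[OF replace_ptree[OF R] T])
    fix p x assume "node (replace_dot P c [] (one_dot_tree P (tree_op P c))) p x"
    then show "node c p x"
    proof (cases rule: replace_nodeE[OF R, consumes 1])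
      \<comment> \<open>These are the types on the leaves of the one-dot tree, moved to the leaves
        of \<open>c\<close>; by \<open>src_leaf_input\<close> the tree \<open>c\<close> carries the
        same types there.\<close>
      case (2 r)
      then obtain f where f: "f \<in> fib P (tree_op P c)" "r = [f]" "x = Inl (src P f)"
        unfolding node_one_dot[OF b] by blast
      note l = leaf_of[OF T f(1)]
      obtain i where i: "subtree_at c (leaf_of P c f) (Unit i)" using l(1) by (auto simp: leaves_def)
      have "src P f = i" using src_leaf_input[OF T i] l(2) by simp
      then show ?thesis using i 2(1) f by (simp add: node_def)
    qed simp
  qed
  then show "sub (BD P) c e = c \<and> (\<forall>x \<in> fib (BD P) c. inner (BD P) c e x = x)"
    by (auto simp: e' fib_BD)
next
  fix e x assume e: "e \<in> inputs (BD P)" and x: "fib (BD P) (unt (BD P) (src (BD P) e)) = {x}"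
  obtain G q where G: "e = (G, q)" "is_ptree P G" "q \<in> dots G" using e by auto
  define b where "b = dot_dec G q"
  have n: "node G q (Inr b)" using node_dot_dec[OF G(2,3)] by (simp add: b_def)
  then obtain S where S: "subtree_at G q (Dot b S)" by (auto simp: node_def)
  have b: "b \<in> ops P" by (rule dot_tree_op[OF subtree_ptree[OF S G(2)]])
  have sb: "src (BD P) e = b" by (simp add: G(1) b_def)
  have x': "x = (one_dot_tree P b, [])"
  proof -
    have "(one_dot_tree P b, []) \<in> fib (BD P) (unt (BD P) (src (BD P) e))"
      using one_dot_ptree[OF b] dots_one_dot[OF b] by (simp add: fib_BD sb)
    then show ?thesis unfolding x by simp
  qed
  let ?u = "one_dot_tree P b"
  have R: "replaceable P ?u q G"
    using G(2) n one_dot_ptree[OF b] by (simp add: replaceable_def one_dot_tree_op[OF b])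
  \<comment> \<open>The leaf of a one-dot tree for \<open>e\<close> has address \<open>[e]\<close>,
    so inserting it leaves all addresses unchanged.\<close>
  have o: "outer_dot P ?u q r = r" if "node G r y" "r \<noteq> q" for r y
    using node_above[OF G(2) n that] by cases (simp_all add: one_dot_leaf_of[OF b] outer_dot_other)
  have R_eq: "replace_dot P ?u q G = G"
  proof (rule tree_ext[OF replace_ptree[OF R] G(2)])
    fix p y assume "node (replace_dot P ?u q G) p y"
    then show "node G p y"
      by (cases rule: replace_nodeE[OF R, consumes 1]) (auto simp: node_one_dot[OF b] n o)
  qed
  have "outer (BD P) ?u e y = y" if y: "y \<in> fib (BD P) (opr (BD P) e) - {e}" for y
  proof -
    obtain r where "y = (G, r)" "r \<in> dots G" "r \<noteq> q" using y by (auto simp: G(1) fib_BD)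
    then show ?thesis using o by (auto simp: G(1) R_eq dots_node)
  qed
  then show "sub (BD P) (unt (BD P) (src (BD P) e)) e = opr (BD P) e \<and>
      inner (BD P) (unt (BD P) (src (BD P) e)) e x = e \<and>
      (\<forall>y \<in> fib (BD P) (opr (BD P) e) - {e}. outer (BD P) (unt (BD P) (src (BD P) e)) e y = y)"
    unfolding sb x' by (simp add: G(1) R_eq)
next
  fix F e f D assume C: "composable (BD P) F e" and f: "f \<in> fib (BD P) F" and C': "composable (BD P) D f"
  obtain G q where e: "e = (G, q)" by (cases e)
  obtain r where r: "f = (F, r)" using f by (auto simp: fib_BD)
  have R: "replaceable P F q G" "replaceable P D r F" using C C' by (simp_all add: e r composable_BD)
  note N = replaceable_nested[OF R]
  have nest: "outer_dot P D (q @ r) (outer_dot P F q v) = outer_dot P (replace_dot P D r F) q v"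
    if "v \<in> dots G" "v \<noteq> q" for v
    using that outer_dot_nested[OF R] by (auto simp: dots_node)
  show "sub (BD P) D (inner (BD P) F e f) = sub (BD P) (sub (BD P) D f) e \<and>
      (\<forall>x \<in> fib (BD P) (opr (BD P) e) - {e}.
         outer (BD P) D (inner (BD P) F e f) (outer (BD P) F e x) = outer (BD P) (sub (BD P) D f) e x) \<and>
      (\<forall>x \<in> fib (BD P) F - {f}.
         outer (BD P) D (inner (BD P) F e f) (inner (BD P) F e x) = inner (BD P) (sub (BD P) D f) e (outer (BD P) D f x)) \<and>
      (\<forall>x \<in> fib (BD P) D. inner (BD P) D (inner (BD P) F e f) x = inner (BD P) (sub (BD P) D f) e (inner (BD P) D f x))"
    using nest by (force simp: e r fib_BD N(3))
next
  fix C e D f assume c: "composable (BD P) C e" and d: "composable (BD P) D f"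
    and o: "opr (BD P) f = opr (BD P) e" and ne: "f \<noteq> e"
  obtain G q where e: "e = (G, q)" by (cases e)
  then obtain q' where f: "f = (G, q')" using o by (cases f) auto
  have R: "replaceable P C q G" "replaceable P D q' G" "q \<noteq> q'" using c d ne by (auto simp: e f composable_BD)
  note O = outer_dot_parallel[OF R]
  have "outer_dot P D (outer_dot P C q q') (outer_dot P C q v) =
      outer_dot P C (outer_dot P D q' q) (outer_dot P D q' v)" if "v \<in> dots G" "v \<noteq> q" "v \<noteq> q'" for v
    using that O(1) by (auto simp: dots_node)
  then show "sub (BD P) D (outer (BD P) C e f) = sub (BD P) C (outer (BD P) D f e) \<and>
      (\<forall>x \<in> fib (BD P) (opr (BD P) e) - {e, f}.
         outer (BD P) D (outer (BD P) C e f) (outer (BD P) C e x) = outer (BD P) C (outer (BD P) D f e) (outer (BD P) D f x)) \<and>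
      (\<forall>x \<in> fib (BD P) C. outer (BD P) D (outer (BD P) C e f) (inner (BD P) C e x) = inner (BD P) C (outer (BD P) D f e) x) \<and>
      (\<forall>x \<in> fib (BD P) D. inner (BD P) D (outer (BD P) C e f) x = outer (BD P) C (outer (BD P) D f e) (inner (BD P) D f x))"
    using replace_parallel[OF R] O(2,3) by (force simp: e f fib_BD)
qed

end

section \<open>Functoriality of \<open>BD\<close>\<close>

lemma subtree_map: "subtree_at (map_ptree f g h T) p U' \<longleftrightarrow>
    (\<exists>q U. p = map h q \<and> U' = map_ptree f g h U \<and> subtree_at T q U)"
proof (induction p arbitrary: T)
  case (Cons e p)
  show ?case
  proof (cases T)
    case (Unit i)
    then show ?thesis by (auto simp: subtree_Cons Cons_eq_map_conv)
  next
    case (Dot b S)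
    have "subtree_at (map_ptree f g h T) (e # p) U' \<longleftrightarrow>
        (\<exists>e' V. (e', V) |\<in>| S \<and> e = h e' \<and> subtree_at (map_ptree f g h V) p U')"
      by (auto simp: Dot subtree_Cons)
    also have "\<dots> \<longleftrightarrow> (\<exists>e' V q U. (e', V) |\<in>| S \<and> e = h e' \<and> p = map h q \<and> U' = map_ptree f g h U \<and> subtree_at V q U)"
      unfolding Cons.IH by blast
    also have "\<dots> \<longleftrightarrow> (\<exists>q U. e # p = map h q \<and> U' = map_ptree f g h U \<and> subtree_at T q U)"
    proof -
      have "e # p = map h q \<longleftrightarrow> (\<exists>e' q'. q = e' # q' \<and> e = h e' \<and> p = map h q')" for q by (cases q) auto
      then have *: "(\<exists>q U. e # p = map h q \<and> B q U) \<longleftrightarrow> (\<exists>e' q' U. e = h e' \<and> p = map h q' \<and> B (e' # q') U)" for B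
        by blast
      have "subtree_at T (e' # q') U \<longleftrightarrow> (\<exists>V. (e', V) |\<in>| S \<and> subtree_at V q' U)" for e' q' U
        by (simp add: Dot subtree_Cons)
      then show ?thesis unfolding * by blast
    qed
    finally show ?thesis .
  qed
qed auto

lemma node_map: "node (map_ptree f g h T) p y \<longleftrightarrow> (\<exists>q x. p = map h q \<and> y = map_sum f g x \<and> node T q x)"
proof (cases y)
  case (Inl j)
  have "Unit j = map_ptree f g h U \<longleftrightarrow> (\<exists>i. U = Unit i \<and> j = f i)" for U by (cases U) auto
  then have "node (map_ptree f g h T) p y \<longleftrightarrow> (\<exists>q i. p = map h q \<and> j = f i \<and> subtree_at T q (Unit i))"
    unfolding Inl node_def subtree_map by auto
  also have "\<dots> \<longleftrightarrow> (\<exists>q x. p = map h q \<and> y = map_sum f g x \<and> node T q x)"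
  proof -
    have *: "Inl j = map_sum f g x \<longleftrightarrow> (\<exists>i. x = Inl i \<and> j = f i)" for x by (cases x) auto
    have "node T q (Inl i) \<longleftrightarrow> subtree_at T q (Unit i)" for q i by (simp add: node_def)
    then show ?thesis unfolding Inl * by blast
  qed
  finally show ?thesis .
next
  case (Inr c)
  have *: "(\<exists>S. Dot c S = map_ptree f g h U) \<longleftrightarrow> (\<exists>b S. U = Dot b S \<and> c = g b)" for U by (cases U) auto
  have "node (map_ptree f g h T) p y \<longleftrightarrow> (\<exists>S. subtree_at (map_ptree f g h T) p (Dot c S))"
    by (simp add: Inr node_def)
  also have "\<dots> \<longleftrightarrow> (\<exists>q U. p = map h q \<and> (\<exists>S. Dot c S = map_ptree f g h U) \<and> subtree_at T q U)"
    unfolding subtree_map by blast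
  finally have "node (map_ptree f g h T) p y \<longleftrightarrow> (\<exists>q b S. p = map h q \<and> c = g b \<and> subtree_at T q (Dot b S))"
    unfolding * by blast
  also have "\<dots> \<longleftrightarrow> (\<exists>q x. p = map h q \<and> y = map_sum f g x \<and> node T q x)"
  proof -
    have *: "Inr c = map_sum f g x \<longleftrightarrow> (\<exists>b. x = Inr b \<and> c = g b)" for x by (cases x) auto
    have "node T q (Inr b) \<longleftrightarrow> (\<exists>S. subtree_at T q (Dot b S))" for q b by (simp add: node_def)
    then show ?thesis unfolding Inr * by blast
  qed
  finally show ?thesis .
qed

lemma dots_map: "dots (map_ptree f g h T) = map h ` dots T"
proof -
  have *: "(\<exists>c. Inr c = map_sum f g x) \<longleftrightarrow> (\<exists>b. x = Inr b)" for x by (cases x) auto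
  have "p \<in> dots (map_ptree f g h T) \<longleftrightarrow> p \<in> map h ` dots T" for p
  proof -
    have "p \<in> dots (map_ptree f g h T) \<longleftrightarrow> (\<exists>q x. p = map h q \<and> (\<exists>c. Inr c = map_sum f g x) \<and> node T q x)"
      unfolding dots_node node_map by blast
    also have "\<dots> \<longleftrightarrow> p \<in> map h ` dots T"
      unfolding * image_iff Bex_def dots_node by blast
    finally show ?thesis .
  qed
  then show ?thesis by blast
qed

lemma node_prefix: "node T (q @ r) x \<Longrightarrow> \<exists>y. node T q y"
  unfolding node_append by (metis node_Dot_Nil node_Unit ptree.exhaust append_Nil2 node_append)

lemma BD_arr_simps [simp]:
  "onI (BD_arr h) = onB h" "onB (BD_arr h) = map_ptree (onI h) (onB h) (onE h)"
  "onE (BD_arr h) (T, q) = (map_ptree (onI h) (onB h) (onE h) T, map (onE h) q)"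
  by (simp_all add: BD_arr_def)

context pm_arrow
begin

abbreviation map_tree where "map_tree \<equiv> map_ptree (onI h) (onB h) (onE h)"

text \<open>The pullback condition on \<open>h\<close> enters here: it makes the images of the
  inputs of \<open>b\<close> run through the fibre of \<open>onB h b\<close> exactly once, so that
  the image of a dot is again a well-formed dot.\<close>

lemma map_Dot:
  assumes D: "is_ptree P (Dot b S)"
    and B: "\<And>e. e \<in> fib P b \<Longrightarrow> is_ptree Q (map_tree (branch S e)) \<and>
       root_type Q (map_tree (branch S e)) = onI h (root_type P (branch S e))"
  shows "is_ptree Q (Dot (onB h b) (map_prod (onE h) map_tree |`| S))"
    and "e \<in> fib P b \<Longrightarrow> branch (map_prod (onE h) map_tree |`| S) (onE h e) = map_tree (branch S e)"
proof -
  let ?S = "map_prod (onE h) map_tree |`| S"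
  have b: "b \<in> ops P" by (rule dot_tree_op[OF D])
  have S: "fset ?S = (\<lambda>e. (onE h e, map_tree (branch S e))) ` fib P b"
    by (simp add: fset_branches[OF D] image_image)
  have "inj_on fst (fset ?S)"
    unfolding S
  proof (rule inj_onI, elim imageE)
    fix x y e e' assume "fst x = fst y" "x = (onE h e, map_tree (branch S e))" "e \<in> fib P b"
      "y = (onE h e', map_tree (branch S e'))" "e' \<in> fib P b"
    with onE_inj[of e b e'] show "x = y" by simp
  qed
  moreover have "fst ` fset ?S = fib Q (onB h b)"
    unfolding S image_image using onE_bij[OF b] by (simp add: bij_betw_def)
  moreover have "is_ptree Q T \<and> root_type Q T = src Q e" if eT: "(e, T) |\<in>| ?S" for e T
  proof -
    obtain e' where e': "e' \<in> fib P b" "e = onE h e'" "T = map_tree (branch S e')" using eT S by auto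
    then show ?thesis using B[OF e'(1)] branch_ptree(2)[OF D e'(1)] arr_src dom.fib_iff by simp
  qed
  ultimately show D': "is_ptree Q (Dot (onB h b) ?S)"
    using onB_op[OF b] by (intro is_ptree.intros) (auto simp: bij_betw_def)
  show "branch ?S (onE h e) = map_tree (branch S e)" if "e \<in> fib P b"
    using branch_eq[OF D'] S that by blast
qed

lemma map_ptree_root: "is_ptree P T \<Longrightarrow> is_ptree Q (map_tree T) \<and> root_type Q (map_tree T) = onI h (root_type P T)"
proof (induction T)
  case (Unit i)
  then show ?case by (auto elim!: unit_treeE intro: is_ptree.intros onI_type)
next
  case (Dot b S)
  have "is_ptree Q (map_tree (branch S e)) \<and> root_type Q (map_tree (branch S e)) = onI h (root_type P (branch S e))"
    if e: "e \<in> fib P b" for e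
    using Dot.IH[OF branch_mem[OF Dot.prems e], of "branch S e"] branch_ptree[OF Dot.prems e] by (simp add: snds.simps)
  with map_Dot(1)[OF Dot.prems] arr_tgt[OF dot_tree_op[OF Dot.prems]] show ?case by simp
qed

text \<open>Arrows commute with contraction. The step over a dot is \<open>atts_rel\<close> for the
  arrow itself, with the labels of the addresses mapped by \<open>onE h\<close>.\<close>

lemma map_tree_lop:
  "is_ptree P T \<Longrightarrow> lop_rel (onB h) (onE h) (map (onE h)) (lop_of P T) (lop_of Q (map_tree T))"
proof (induction T)
  case (Unit i)
  then have i: "i \<in> types P" by (auto elim: unit_treeE)
  have "onE h (THE e. e \<in> fib P (unt P i)) \<in> fib Q (unt Q (onI h i))"
    using dom.unit_input(1)[OF i] onE_fib[of _ "unt P i"] arr_unt[OF i] by auto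
  \<comment> \<open>Both fibres are singletons, so the inputs selected by the definite descriptions
    correspond.\<close>
  then have "onE h (THE e. e \<in> fib P (unt P i)) = (THE e. e \<in> fib Q (unt Q (onI h i)))"
    using cod.unit_input(1)[OF onI_type[OF i]] by auto
  then show ?case
    by (simp add: lop_rel_def dom.lop_of_Unit cod.lop_of_Unit dom.unit_lop_def cod.unit_lop_def arr_unt[OF i])
next
  case (Dot b S)
  note D = Dot.prems
  let ?S = "map_prod (onE h) map_tree |`| S"
  have B: "is_ptree Q (map_tree (branch S e)) \<and> root_type Q (map_tree (branch S e)) = onI h (root_type P (branch S e))"
    if e: "e \<in> fib P b" for e using map_ptree_root[OF branch_ptree(1)[OF D e]] .
  have D': "is_ptree Q (Dot (onB h b) ?S)" by (rule map_Dot(1)[OF D B])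
  have S': "branch ?S (onE h e) = map_tree (branch S e)" if "e \<in> fib P b" for e
    using map_Dot(2)[OF D B that] .
  have IH: "lop_rel (onB h) (onE h) (map (onE h)) (lop_of P (branch S e)) (lop_of Q (map_tree (branch S e)))"
    if e: "e \<in> fib P b" for e
    using Dot.IH[OF branch_mem[OF Dot.prems e], of "branch S e"] branch_ptree[OF Dot.prems e] by (simp add: snds.simps)
  note b = dot_tree_op[OF D] and b' = dot_tree_op[OF D']
  obtain es where es: "distinct es" "set es = fib P b"
    using finite_distinct_list[OF dom.finite_fib[OF b]] by blast
  have es': "distinct (map (onE h) es)" "set (map (onE h) es) = fib Q (onB h b)"
    using es onE_bij[OF b] by (simp_all add: distinct_map bij_betw_def)
  have m: "map (\<lambda>e. [e]) (map (onE h) es) = map (map (onE h)) (map (\<lambda>e. [e]) es)" by simp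
  have "lop_rel (onB h) (onE h) (map (onE h))
     (atts P (\<lambda>k. lop_of P (branch S (hd k))) (map (\<lambda>e. [e]) es) (corolla_lop P b))
     (atts Q (\<lambda>k. lop_of Q (branch ?S (hd k))) (map (map (onE h)) (map (\<lambda>e. [e]) es)) (corolla_lop Q (onB h b))) \<and>
     valid_lop Q (atts Q (\<lambda>k. lop_of Q (branch ?S (hd k))) (map (map (onE h)) (map (\<lambda>e. [e]) es)) (corolla_lop Q (onB h b)))"
  proof (rule atts_rel[where v="\<lambda>k. map (onE h)"])
    have "(\<lambda>e. [e]) ` fib Q (onB h b) = map (onE h) ` (\<lambda>e. [e]) ` fib P b"
      using onE_bij[OF b] by (auto simp: bij_betw_def image_image)
    then show "lop_rel (onB h) (onE h) (map (onE h)) (corolla_lop P b) (corolla_lop Q (onB h b))"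
      unfolding lop_rel_def dom_corolla_lop using onE_fib by (auto simp: snd_corolla_lop)
    show "valid_lop P (corolla_lop P b)" "valid_lop Q (corolla_lop Q (onB h b))"
      by (rule corolla_lop_valid[OF b], rule corolla_lop_valid[OF b'])
    show "distinct (map (\<lambda>e. [e]) es)" using es by (auto simp: distinct_map inj_on_def)
    show "fits P (\<lambda>k. lop_of P (branch S (hd k))) (corolla_lop P b) (set (map (\<lambda>e. [e]) es))"
      by (rule dom.fits_branches[OF D dom.lop_of_branches[OF D]]) (use es in auto)
    show "lop_rel (onB h) (onE h) (map (onE h)) (lop_of P (branch S (hd k))) (lop_of Q (branch ?S (hd (map (onE h) k)))) \<and>
        valid_lop Q (lop_of Q (branch ?S (hd (map (onE h) k))))" if k: "k \<in> set (map (\<lambda>e. [e]) es)" for k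
    proof -
      obtain e where e: "k = [e]" "e \<in> fib P b" using k es by auto
      have "hd k = e" "hd (map (onE h) k) = onE h e" by (simp_all add: e(1))
      with IH[OF e(2)] S'[OF e(2)] cod.lop_of_valid B[OF e(2)] show ?thesis by simp
    qed
  qed simp
  then show ?case using dom.lop_of_Dot[OF D es] cod.lop_of_Dot[OF D' es'] unfolding m by simp
qed

lemma map_tree_op: "is_ptree P T \<Longrightarrow> tree_op Q (map_tree T) = onB h (tree_op P T)"
  using map_tree_lop[of T] by (simp add: lop_rel_def)

lemma map_leaf_of:
  assumes T: "is_ptree P T" and e: "e \<in> fib P (tree_op P T)"
  shows "leaf_of Q (map_tree T) (onE h e) = map (onE h) (leaf_of P T e)"
proof -
  note l = dom.leaf_of[OF T e]
  note L = map_tree_lop[OF T, unfolded lop_rel_def dom_lop_of]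
  then have m: "map (onE h) (leaf_of P T e) \<in> leaves (map_tree T)" using l by simp
  have "snd (lop_of Q (map_tree T)) (map (onE h) (leaf_of P T e)) = Some (onE h e)"
    using bspec[OF conjunct2[OF conjunct2[OF L]] l(1)] l(2) by (simp add: snd_lop_of[OF l(1)])
  then have "leaf_input Q (map_tree T) (map (onE h) (leaf_of P T e)) = onE h e"
    by (simp add: snd_lop_of[OF m])
  then show ?thesis using cod.leaf_of_input[OF _ m] map_ptree_root[OF T] by metis
qed

text \<open>\<open>onE h\<close> is injective on fibres only, so \<open>map (onE h)\<close> need not
  be injective on lists. Along an address of a well-formed tree, however, each label belongs to the
  fibre of the dot just reached, and addresses can be compared label by label.\<close>

lemma map_address_inj:
  "is_ptree P T \<Longrightarrow> node T q x \<Longrightarrow> node T r y \<Longrightarrow> map (onE h) q = map (onE h) r \<Longrightarrow> q = r"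
proof (induction q arbitrary: T r)
  case (Cons e q)
  then obtain f r' where r: "r = f # r'" by auto
  obtain b S where T: "T = Dot b S" using Cons.prems(2) by (cases T) auto
  note D = Cons.prems(1)[unfolded T]
  have e: "e \<in> fib P b" "node (branch S e) q x" and f: "f \<in> fib P b" "node (branch S f) r' y"
    using Cons.prems(2,3) node_branch[OF D] by (auto simp: T r)
  have "e = f" using onE_inj[OF e(1) f(1)] Cons.prems(4) r by simp
  moreover have "q = r'"
    using Cons.IH[OF branch_ptree(1)[OF D e(1)] e(2)] f(2) Cons.prems(4) \<open>e = f\<close> r by simp
  ultimately show ?case by (simp add: r)
qed simp

lemma map_prefix:
  assumes T: "is_ptree P T" and q: "node T q x" and r: "node T r y" and p: "prefix (map (onE h) q) (map (onE h) r)"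
  shows "prefix q r"
proof -
  obtain z where "map (onE h) r = map (onE h) q @ z" using p by (auto simp: prefix_def)
  then obtain r1 r2 where r12: "r = r1 @ r2" "map (onE h) q = map (onE h) r1"
    by (auto simp: map_eq_append_conv)
  then obtain y' where "node T r1 y'" using node_prefix r by blast
  from map_address_inj[OF T q this r12(2)] show ?thesis using r12(1) by simp
qed

lemma map_replaceable:
  "replaceable P F q G \<Longrightarrow> replaceable Q (map_tree F) (map (onE h) q) (map_tree G)"
  using map_ptree_root by (force simp: replaceable_def node_map map_tree_op)

lemma map_outer_dot:
  assumes R: "replaceable P F q G" and r: "node G r x" "r \<noteq> q"
  shows "outer_dot Q (map_tree F) (map (onE h) q) (map (onE h) r) = map (onE h) (outer_dot P F q r)"
proof -
  note D = dom.replaceD[OF R]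
  from node_above[OF D(2,3) r] show ?thesis
  proof cases
    case (1 e s)
    then show ?thesis using map_leaf_of[OF D(1)] by simp
  next
    case 2
    then have "\<not> prefix (map (onE h) q) (map (onE h) r)" using map_prefix[OF D(2,3) r(1)] by blast
    with 2 show ?thesis by (simp add: outer_dot_other)
  qed
qed

lemma map_replace_dot:
  assumes R: "replaceable P F q G"
  shows "map_tree (replace_dot P F q G) = replace_dot Q (map_tree F) (map (onE h) q) (map_tree G)"
proof (rule tree_ext)
  note R' = map_replaceable[OF R] and D = dom.replaceD[OF R]
  show "is_ptree Q (map_tree (replace_dot P F q G))" using map_ptree_root[OF dom.replace_ptree[OF R]] by simp
  show "is_ptree Q (replace_dot Q (map_tree F) (map (onE h) q) (map_tree G))" by (rule cod.replace_ptree[OF R'])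
  fix p y assume "node (map_tree (replace_dot P F q G)) p y"
  then obtain p' x where p: "p = map (onE h) p'" "y = map_sum (onI h) (onB h) x" "node (replace_dot P F q G) p' x"
    unfolding node_map by blast
  from p(3) show "node (replace_dot Q (map_tree F) (map (onE h) q) (map_tree G)) p y"
  proof (cases rule: dom.replace_nodeE[OF R, consumes 1])
    case (1 s b)
    then have "node (map_tree F) (map (onE h) s) (Inr (onB h b))" unfolding node_map by force
    from cod.replace_node_inner[OF R' this] show ?thesis using p 1 by simp
  next
    case (2 r)
    then have "node (map_tree G) (map (onE h) r) y" unfolding node_map using p by blast
    moreover have "map (onE h) r \<noteq> map (onE h) q" using map_address_inj[OF D(2) 2(3) D(3)] 2(2) by blast
    ultimately show ?thesis using cod.replace_node_outer[OF R'] map_outer_dot[OF R 2(3,2)] p 2 by metis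
  qed
qed

theorem BD_arrow: "pm_arrow (BD P) (BD Q) (BD_arr h)"
proof (intro pm_arrow.intro pm_arrow_axioms.intro dom.BD_monad cod.BD_monad)
  show "onI (BD_arr h) i \<in> types (BD Q)" if "i \<in> types (BD P)" for i using that onB_op by simp
  show "onB (BD_arr h) T \<in> ops (BD Q)" if "T \<in> ops (BD P)" for T using that map_ptree_root by simp
  show "onE (BD_arr h) e \<in> inputs (BD Q)" if "e \<in> inputs (BD P)" for e
    using that map_ptree_root by (auto simp: dots_map)
  show "src (BD Q) (onE (BD_arr h) e) = onI (BD_arr h) (src (BD P) e)" if e': "e \<in> inputs (BD P)" for e
  proof -
    obtain T q where e: "e = (T, q)" "is_ptree P T" "q \<in> dots T" using e' by auto
    have n: "node (map_tree T) (map (onE h) q) (Inr (onB h (dot_dec T q)))"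
      unfolding node_map using node_dot_dec[OF e(2,3)] by force
    show ?thesis using dot_dec_node[OF conjunct1[OF map_ptree_root[OF e(2)]] n] by (simp add: e(1))
  qed
  show "opr (BD Q) (onE (BD_arr h) e) = onB (BD_arr h) (opr (BD P) e)" for e by (cases e) simp
  show "tgt (BD Q) (onB (BD_arr h) T) = onI (BD_arr h) (tgt (BD P) T)" if "T \<in> ops (BD P)" for T
    using that map_tree_op by simp
  show "\<exists>!e. e \<in> inputs (BD P) \<and> opr (BD P) e = T \<and> onE (BD_arr h) e = f"
    if f: "T \<in> ops (BD P)" "f \<in> inputs (BD Q)" "opr (BD Q) f = onB (BD_arr h) T" for T f
  proof -
    have T: "is_ptree P T" using f by simp
    obtain p where p: "f = (map_tree T, p)" "p \<in> dots (map_tree T)" using f by (cases f) auto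
    then obtain q where q: "q \<in> dots T" "p = map (onE h) q" unfolding dots_map by blast
    show ?thesis
    proof (rule ex1I[of _ "(T, q)"])
      show "(T, q) \<in> inputs (BD P) \<and> opr (BD P) (T, q) = T \<and> onE (BD_arr h) (T, q) = f" using T p q by simp
      fix e assume "e \<in> inputs (BD P) \<and> opr (BD P) e = T \<and> onE (BD_arr h) e = f"
      then obtain r where r: "e = (T, r)" "r \<in> dots T" "map (onE h) r = p" using p by (cases e) auto
      obtain b b' where "node T r (Inr b)" "node T q (Inr b')" using r(2) q(1) unfolding dots_node by blast
      from map_address_inj[OF T this] show "e = (T, q)" using r q by simp
    qed
  qed
  show "onB (BD_arr h) (unt (BD P) i) = unt (BD Q) (onI (BD_arr h) i)" if "i \<in> types (BD P)" for i
  proof -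
    have b: "i \<in> ops P" using that by simp
    note b' = onB_op[OF b]
    have "map_tree (one_dot_tree P i) = one_dot_tree Q (onB h i)"
    proof (rule tree_ext)
      show "is_ptree Q (map_tree (one_dot_tree P i))" using map_ptree_root[OF dom.one_dot_ptree[OF b]] by simp
      show "is_ptree Q (one_dot_tree Q (onB h i))" by (rule cod.one_dot_ptree[OF b'])
      fix q x assume "node (map_tree (one_dot_tree P i)) q x"
      then show "node (one_dot_tree Q (onB h i)) q x"
        unfolding node_map dom.node_one_dot[OF b] cod.node_one_dot[OF b']
        using onE_fib arr_src dom.fib_iff by force
    qed
    then show ?thesis by simp
  qed
next
  fix F e assume C: "composable (BD P) F e"
  obtain G q where e: "e = (G, q)" by (cases e)
  have R: "replaceable P F q G" using C by (simp add: e composable_BD)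
  show "onB (BD_arr h) (sub (BD P) F e) = sub (BD Q) (onB (BD_arr h) F) (onE (BD_arr h) e)"
    using map_replace_dot[OF R] by (simp add: e)
  show "onE (BD_arr h) (outer (BD P) F e x) = outer (BD Q) (onB (BD_arr h) F) (onE (BD_arr h) e) (onE (BD_arr h) x)"
    if x: "x \<in> fib (BD P) (opr (BD P) e) - {e}" for x
  proof -
    obtain r where r: "x = (G, r)" "r \<in> dots G" "r \<noteq> q" using x by (auto simp: e fib_BD)
    then obtain b where "node G r (Inr b)" by (auto simp: dots_node)
    then show ?thesis using map_replace_dot[OF R] map_outer_dot[OF R _ r(3)] by (simp add: e r)
  qed
  show "onE (BD_arr h) (inner (BD P) F e x) = inner (BD Q) (onB (BD_arr h) F) (onE (BD_arr h) e) (onE (BD_arr h) x)"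
    if "x \<in> fib (BD P) F" for x
    using that map_replace_dot[OF R] by (cases x) (simp add: e)
qed

end

section \<open>Sequential colimits of polynomial monads\<close>

lemma arr_eq_refl [simp]: "arr_eq P h h"
  by (simp add: arr_eq_def)

lemma arr_eq_sym: "arr_eq P h k \<Longrightarrow> arr_eq P k h"
  by (simp add: arr_eq_def)

lemma arr_eq_trans: "arr_eq P h k \<Longrightarrow> arr_eq P k l \<Longrightarrow> arr_eq P h l"
  by (simp add: arr_eq_def)

lemma arr_eq_post: "arr_eq P h k \<Longrightarrow> arr_eq P (l \<circ>\<^sub>a h) (l \<circ>\<^sub>a k)"
  by (simp add: arr_eq_def)

lemma arr_eq_pre: "pm_arrow P Q h \<Longrightarrow> arr_eq Q k l \<Longrightarrow> arr_eq P (k \<circ>\<^sub>a h) (l \<circ>\<^sub>a h)"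
  by (simp add: arr_eq_def pm_arrow.onI_type pm_arrow.onB_op pm_arrow.onE_input)

lemma arr_comp_assoc: "(l \<circ>\<^sub>a k) \<circ>\<^sub>a h = l \<circ>\<^sub>a k \<circ>\<^sub>a h"
  by (simp add: arr_comp_def o_assoc)

lemma BD_arr_comp: "BD_arr (k \<circ>\<^sub>a h) = BD_arr k \<circ>\<^sub>a BD_arr h"
  by (simp add: BD_arr_def arr_comp_def fun_eq_iff ptree.map_comp)

lemma node_inputs: "is_ptree P T \<Longrightarrow> node T q x \<Longrightarrow> set q \<subseteq> inputs P"
proof (induction q arbitrary: T)
  case (Cons e q)
  obtain b S where T: "T = Dot b S" using Cons.prems(2) by (cases T) auto
  note D = Cons.prems(1)[unfolded T]
  have e: "e \<in> fib P b" "node (branch S e) q x" using Cons.prems(2) by (auto simp: T node_branch[OF D])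
  then show ?case using Cons.IH[OF branch_ptree(1)[OF D e(1)] e(2)] by (simp add: fib_def)
qed simp

lemma map_ptree_arr_eq:
  assumes "arr_eq P h k"
  shows "is_ptree P T \<Longrightarrow> map_ptree (onI h) (onB h) (onE h) T = map_ptree (onI k) (onB k) (onE k) T"
proof (induction T)
  case (Unit i)
  then show ?case using assms by (auto simp: arr_eq_def elim: unit_treeE)
next
  case (Dot b S)
  note D = Dot.prems
  have "map_prod (onE h) (map_ptree (onI h) (onB h) (onE h)) |`| S =
      map_prod (onE k) (map_ptree (onI k) (onB k) (onE k)) |`| S"
  proof (rule fimage_cong[OF refl])
    fix x assume x: "x |\<in>| S"
    obtain e T where eT: "x = (e, T)" by (cases x)
    have e: "e \<in> fib P b" "T = branch S e" using x mem_branches[OF D] unfolding eT by blast+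
    have "map_ptree (onI h) (onB h) (onE h) T = map_ptree (onI k) (onB k) (onE k) T"
      using Dot.IH[OF x, of T] branch_ptree(1)[OF D e(1)] e(2) by (simp add: eT snds.simps)
    then show "map_prod (onE h) (map_ptree (onI h) (onB h) (onE h)) x =
        map_prod (onE k) (map_ptree (onI k) (onB k) (onE k)) x"
      using assms e(1) by (simp add: eT arr_eq_def fib_def)
  qed
  then show ?case using assms dot_tree_op[OF D] by (simp add: arr_eq_def)
qed

text \<open>In a well-formed tree the labels of edges (\<open>node_inputs\<close>), dots and leaves
  all belong to the carriers, so values outside the carriers cannot enter.\<close>

lemma BD_arr_eq:
  assumes "arr_eq P h k"
  shows "arr_eq (BD P) (BD_arr h) (BD_arr k)"
proof -
  have "map (onE h) q = map (onE k) q" if "is_ptree P T" "q \<in> dots T" for T q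
    using node_inputs[OF that(1)] that(2) assms by (fastforce simp: dots_node arr_eq_def)
  then show ?thesis using assms map_ptree_arr_eq[OF assms] by (auto simp: arr_eq_def)
qed

lemma BD_arr_comp_eq:
  "arr_eq P (k \<circ>\<^sub>a h) l \<Longrightarrow> arr_eq (BD P) (BD_arr k \<circ>\<^sub>a BD_arr h) (BD_arr l)"
  using BD_arr_eq by (simp flip: BD_arr_comp)

lemma Dot_branch_subset:
  assumes "is_ptree P (Dot b S)" "is_ptree P (Dot b S')" "fset S \<subseteq> fset S'"
  shows "S = S'"
proof -
  have "branch S e = branch S' e" if "e \<in> fib P b" for e
    by (rule branch_eq[OF assms(2), symmetric]) (rule subsetD[OF assms(3) branch_mem[OF assms(1) that]])
  then have "fset S = fset S'" unfolding fset_branches[OF assms(1)] fset_branches[OF assms(2)] by simp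
  then show ?thesis by (simp add: fset_inject)
qed

lemma bij_betw_map_sum:
  assumes "bij_betw f A A'" "bij_betw g B B'"
  shows "bij_betw (map_sum f g) (A <+> B) (A' <+> B')"
proof -
  have "map_sum f g ` (A <+> B) = A' <+> B'"
    using assms by (simp add: Plus_def image_Un image_image bij_betw_def flip: image_image[of Inl f] image_image[of Inr g])
  moreover have "inj_on (map_sum f g) (A <+> B)"
  proof (rule inj_onI)
    fix x y assume "x \<in> A <+> B" "y \<in> A <+> B" "map_sum f g x = map_sum f g y"
    then show "x = y" using assms by (cases x; cases y) (auto simp: bij_betw_def inj_on_def)
  qed
  ultimately show ?thesis by (simp add: bij_betw_def)
qed

text \<open>
  \<open>Q\<close> is the colimit of the sequence \<open>D\<close>.  It is not assumed to be a monad: this is \<open>Q_monad\<close>.  No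
  injectivity is assumed for inputs, since it follows from that of operations by the pullback property.
\<close>

locale pm_cocone =
  fixes D :: "nat \<Rightarrow> ('i, 'b, 'e) pm"
    and t :: "nat \<Rightarrow> nat \<Rightarrow> ('i, 'b, 'e, 'i, 'b, 'e) arr"
    and Q :: "('j, 'c, 'f) pm"
    and j :: "nat \<Rightarrow> ('i, 'b, 'e, 'j, 'c, 'f) arr"
  assumes t_arrow: "n \<le> m \<Longrightarrow> pm_arrow (D n) (D m) (t n m)"
    and t_comp: "n \<le> m \<Longrightarrow> m \<le> p \<Longrightarrow> arr_eq (D n) (t m p \<circ>\<^sub>a t n m) (t n p)"
    and j_axioms: "pm_arrow_axioms (D n) Q (j n)"
    and j_t: "n \<le> m \<Longrightarrow> arr_eq (D n) (j m \<circ>\<^sub>a t n m) (j n)"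
    and surj_types: "i' \<in> types Q \<Longrightarrow> \<exists>n. \<exists>i \<in> types (D n). onI (j n) i = i'"
    and surj_ops: "b' \<in> ops Q \<Longrightarrow> \<exists>n. \<exists>b \<in> ops (D n). onB (j n) b = b'"
    and surj_inputs: "e' \<in> inputs Q \<Longrightarrow> \<exists>n. \<exists>e \<in> inputs (D n). onE (j n) e = e'"
    and inj_types: "x \<in> types (D n) \<Longrightarrow> y \<in> types (D n) \<Longrightarrow> onI (j n) x = onI (j n) y \<Longrightarrow>
      \<exists>m \<ge> n. onI (t n m) x = onI (t n m) y"
    and inj_ops: "b \<in> ops (D n) \<Longrightarrow> c \<in> ops (D n) \<Longrightarrow> onB (j n) b = onB (j n) c \<Longrightarrow>
      \<exists>m \<ge> n. onB (t n m) b = onB (t n m) c"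
begin

lemma D_monad: "polynomial_monad (D n)"
  using pm_arrow.axioms(1)[OF t_arrow[OF order.refl]] .

sublocale D: polynomial_monad "D n" for n by (rule D_monad)

lemmas j_simps = j_axioms[unfolded pm_arrow_axioms_def]

lemma
  shows j_types: "i \<in> types (D n) \<Longrightarrow> onI (j n) i \<in> types Q"
    and j_ops: "b \<in> ops (D n) \<Longrightarrow> onB (j n) b \<in> ops Q"
    and j_inputs: "e \<in> inputs (D n) \<Longrightarrow> onE (j n) e \<in> inputs Q"
    and j_src: "e \<in> inputs (D n) \<Longrightarrow> src Q (onE (j n) e) = onI (j n) (src (D n) e)"
    and j_opr: "e \<in> inputs (D n) \<Longrightarrow> opr Q (onE (j n) e) = onB (j n) (opr (D n) e)"
    and j_tgt: "b \<in> ops (D n) \<Longrightarrow> tgt Q (onB (j n) b) = onI (j n) (tgt (D n) b)"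
    and j_pullback: "b \<in> ops (D n) \<Longrightarrow> f \<in> inputs Q \<Longrightarrow> opr Q f = onB (j n) b \<Longrightarrow>
      \<exists>!e. e \<in> inputs (D n) \<and> opr (D n) e = b \<and> onE (j n) e = f"
    and j_unt: "i \<in> types (D n) \<Longrightarrow> unt Q (onI (j n) i) = onB (j n) (unt (D n) i)"
    and j_sub: "composable (D n) c e \<Longrightarrow> sub Q (onB (j n) c) (onE (j n) e) = onB (j n) (sub (D n) c e)"
    and j_outer: "composable (D n) c e \<Longrightarrow> x \<in> fib (D n) (opr (D n) e) - {e} \<Longrightarrow>
      outer Q (onB (j n) c) (onE (j n) e) (onE (j n) x) = onE (j n) (outer (D n) c e x)"
    and j_inner: "composable (D n) c e \<Longrightarrow> x \<in> fib (D n) c \<Longrightarrow>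
      inner Q (onB (j n) c) (onE (j n) e) (onE (j n) x) = onE (j n) (inner (D n) c e x)"
  using j_simps[of n] by (simp_all del: Diff_iff)

lemma
  assumes "n \<le> m"
  shows j_tI: "i \<in> types (D n) \<Longrightarrow> onI (j m) (onI (t n m) i) = onI (j n) i"
    and j_tB: "b \<in> ops (D n) \<Longrightarrow> onB (j m) (onB (t n m) b) = onB (j n) b"
    and j_tE: "e \<in> inputs (D n) \<Longrightarrow> onE (j m) (onE (t n m) e) = onE (j n) e"
  using j_t[OF assms] by (simp_all add: arr_eq_def)

lemma
  assumes "n \<le> m" "m \<le> p"
  shows t_tI: "i \<in> types (D n) \<Longrightarrow> onI (t m p) (onI (t n m) i) = onI (t n p) i"
    and t_tB: "b \<in> ops (D n) \<Longrightarrow> onB (t m p) (onB (t n m) b) = onB (t n p) b"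
    and t_tE: "e \<in> inputs (D n) \<Longrightarrow> onE (t m p) (onE (t n m) e) = onE (t n p) e"
  using t_comp[OF assms] by (simp_all add: arr_eq_def)

lemma j_fib: "e \<in> fib (D n) b \<Longrightarrow> onE (j n) e \<in> fib Q (onB (j n) b)"
  using j_inputs j_opr by (auto simp: fib_def)

lemma lift_fib:
  assumes "b \<in> ops (D n)" "x \<in> fib Q (onB (j n) b)"
  obtains x' where "x' \<in> fib (D n) b" "onE (j n) x' = x"
  using j_pullback[OF assms(1), of x] assms(2) by (auto simp: fib_def)

lemma inj_fib: "x \<in> fib (D n) b \<Longrightarrow> y \<in> fib (D n) b \<Longrightarrow> onE (j n) x = onE (j n) y \<Longrightarrow> x = y"
  using j_pullback[of b n "onE (j n) x"] j_inputs j_opr D.opr_op by (auto simp: fib_def)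

lemma fib_bij: "b \<in> ops (D n) \<Longrightarrow> bij_betw (onE (j n)) (fib (D n) b) (fib Q (onB (j n) b))"
  unfolding bij_betw_def using j_fib by (auto intro!: inj_onI inj_fib elim: lift_fib)

lemma lift_op:
  assumes "b \<in> ops Q"
  obtains m b' where "n \<le> m" "b' \<in> ops (D m)" "onB (j m) b' = b"
proof -
  obtain k b1 where b1: "b1 \<in> ops (D k)" "onB (j k) b1 = b" using surj_ops[OF assms] by blast
  have le: "n \<le> max n k" "k \<le> max n k" by simp_all
  show thesis
    using that[OF le(1), of "onB (t k (max n k)) b1"] b1 j_tB[OF le(2)] pm_arrow.onB_op[OF t_arrow[OF le(2)]] by simp
qed

lemma eq_type:
  assumes "x \<in> types (D n)" "y \<in> types (D m)" "onI (j n) x = onI (j m) y"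
  obtains p where "n \<le> p" "m \<le> p" "onI (t n p) x = onI (t m p) y"
proof -
  let ?k = "max n m"
  have le: "n \<le> ?k" "m \<le> ?k" by simp_all
  have "onI (t n ?k) x \<in> types (D ?k)" "onI (t m ?k) y \<in> types (D ?k)"
    using assms pm_arrow.onI_type t_arrow le by metis+
  moreover have "onI (j ?k) (onI (t n ?k) x) = onI (j ?k) (onI (t m ?k) y)"
    using assms j_tI le by metis
  ultimately obtain p where p: "?k \<le> p" "onI (t ?k p) (onI (t n ?k) x) = onI (t ?k p) (onI (t m ?k) y)"
    using inj_types by blast
  then show thesis using that[of p] t_tI[OF le(1) p(1)] t_tI[OF le(2) p(1)] assms by simp
qed

lemma eq_op:
  assumes "x \<in> ops (D n)" "y \<in> ops (D m)" "onB (j n) x = onB (j m) y"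
  obtains p where "n \<le> p" "m \<le> p" "onB (t n p) x = onB (t m p) y"
proof -
  let ?k = "max n m"
  have le: "n \<le> ?k" "m \<le> ?k" by simp_all
  have "onB (t n ?k) x \<in> ops (D ?k)" "onB (t m ?k) y \<in> ops (D ?k)"
    using assms pm_arrow.onB_op t_arrow le by metis+
  moreover have "onB (j ?k) (onB (t n ?k) x) = onB (j ?k) (onB (t m ?k) y)"
    using assms j_tB le by metis
  ultimately obtain p where p: "?k \<le> p" "onB (t ?k p) (onB (t n ?k) x) = onB (t ?k p) (onB (t m ?k) y)"
    using inj_ops by blast
  then show thesis using that[of p] t_tB[OF le(1) p(1)] t_tB[OF le(2) p(1)] assms by simp
qed

text \<open>Once the underlying operations agree at a stage \<open>p\<close>, both inputs lie in one
  fibre of \<open>D p\<close>, and fibres map injectively to \<open>Q\<close>.\<close>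

lemma eq_input:
  assumes x: "x \<in> inputs (D n)" and y: "y \<in> inputs (D m)" and eq: "onE (j n) x = onE (j m) y"
  obtains p where "n \<le> p" "m \<le> p" "onE (t n p) x = onE (t m p) y"
proof -
  have "onB (j n) (opr (D n) x) = onB (j m) (opr (D m) y)"
    using j_opr[OF x] j_opr[OF y] eq by simp
  then obtain p where p: "n \<le> p" "m \<le> p" "onB (t n p) (opr (D n) x) = onB (t m p) (opr (D m) y)"
    using eq_op D.opr_op x y by metis
  interpret n: pm_arrow "D n" "D p" "t n p" using t_arrow[OF p(1)] .
  interpret m: pm_arrow "D m" "D p" "t m p" using t_arrow[OF p(2)] .
  have "onE (t n p) x = onE (t m p) y"
  proof (rule inj_fib)
    show "onE (t n p) x \<in> fib (D p) (onB (t n p) (opr (D n) x))" using x by (intro n.onE_fib) (simp add: fib_def)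
    show "onE (t m p) y \<in> fib (D p) (onB (t n p) (opr (D n) x))"
      unfolding p(3) using y by (intro m.onE_fib) (simp add: fib_def)
    show "onE (j p) (onE (t n p) x) = onE (j p) (onE (t m p) y)"
      using eq j_tE[OF p(1) x] j_tE[OF p(2) y] by simp
  qed
  with p that show thesis by blast
qed

text \<open>A lift of \<open>c\<close> has a target that agrees with the source of \<open>e\<close>
  only at some later stage. Starting from a given lift of \<open>e\<close> lets a second
  substitution be lifted on top of a first one, as associativity requires.\<close>

lemma lift_composable:
  assumes C: "composable Q c (onE (j n) e)" and e: "e \<in> inputs (D n)"
  obtains m c' where "n \<le> m" "composable (D m) c' (onE (t n m) e)" "onB (j m) c' = c"
proof -
  have c: "c \<in> ops Q" "tgt Q c = onI (j n) (src (D n) e)" using C j_src[OF e] by (auto simp: composable_def)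
  obtain k c1 where k: "n \<le> k" "c1 \<in> ops (D k)" "onB (j k) c1 = c" using lift_op[OF c(1)] by metis
  have "onI (j k) (tgt (D k) c1) = onI (j n) (src (D n) e)" using j_tgt[OF k(2)] k(3) c(2) by simp
  then obtain m where m: "k \<le> m" "n \<le> m" "onI (t k m) (tgt (D k) c1) = onI (t n m) (src (D n) e)"
    using eq_type D.tgt_type[OF k(2)] D.src_type[OF e] by metis
  interpret n: pm_arrow "D n" "D m" "t n m" using t_arrow[OF m(2)] .
  interpret k: pm_arrow "D k" "D m" "t k m" using t_arrow[OF m(1)] .
  show thesis
  proof (rule that[OF m(2)])
    show "composable (D m) (onB (t k m) c1) (onE (t n m) e)"
      using m(3) k e by (simp add: composable_def k.onB_op n.onE_input k.arr_tgt n.arr_src)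
    show "onB (j m) (onB (t k m) c1) = c" using j_tB[OF m(1) k(2)] k(3) by simp
  qed
qed

lemma lift_composable0:
  assumes "composable Q c e"
  obtains n c' e' where "composable (D n) c' e'" "onB (j n) c' = c" "onE (j n) e' = e"
proof -
  obtain k e1 where e1: "e1 \<in> inputs (D k)" "onE (j k) e1 = e"
    using assms surj_inputs unfolding composable_def by metis
  obtain m c' where "k \<le> m" "composable (D m) c' (onE (t k m) e1)" "onB (j m) c' = c"
    using lift_composable[of c k e1] assms e1 by metis
  then show thesis using that j_tE e1 by metis
qed

lemma unit_input_lift:
  assumes i: "i \<in> types (D n)" and e: "fib Q (unt Q (onI (j n) i)) = {e}"
  obtains e' where "fib (D n) (unt (D n) i) = {e'}" "onE (j n) e' = e"
proof -
  obtain e' where e': "fib (D n) (unt (D n) i) = {e'}" using D.fib_unt[OF i] by blast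
  have "onE (j n) e' \<in> fib Q (unt Q (onI (j n) i))" unfolding j_unt[OF i] by (rule j_fib) (simp add: e')
  then show thesis using that e' e by blast
qed

text \<open>The operations in each law are lifted to one common stage. The inputs over which the
  laws quantify then lift at that same stage, because the fibre over a lifted operation is in
  bijection with the fibre in \<open>Q\<close>.\<close>

theorem Q_monad: "polynomial_monad Q"
proof
  show "src Q e \<in> types Q" if "e \<in> inputs Q" for e
    using surj_inputs[OF that] j_src j_types D.src_type by metis
  show "opr Q e \<in> ops Q" if "e \<in> inputs Q" for e
    using surj_inputs[OF that] j_opr j_ops D.opr_op by metis
  show "tgt Q b \<in> types Q" if "b \<in> ops Q" for b
    using surj_ops[OF that] j_tgt j_types D.tgt_type by metis
  show "finite (fib Q b)" if "b \<in> ops Q" for b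
    using surj_ops[OF that] fib_bij D.finite_fib bij_betw_finite by metis
  show "unt Q i \<in> ops Q" if "i \<in> types Q" for i
    using surj_types[OF that] j_unt j_ops D.unt_op by metis
  show "tgt Q (unt Q i) = i" if "i \<in> types Q" for i
    using surj_types[OF that] j_unt j_tgt D.unt_op D.tgt_unt by metis
  show "\<exists>e. fib Q (unt Q i) = {e} \<and> src Q e = i" if i0: "i \<in> types Q" for i
  proof -
    obtain n i' where i: "i' \<in> types (D n)" "onI (j n) i' = i" using surj_types[OF i0] by blast
    obtain e where e: "fib (D n) (unt (D n) i') = {e}" "src (D n) e = i'" using D.fib_unt[OF i(1)] by blast
    have "e \<in> inputs (D n)" using e(1) by (auto simp: fib_def)
    then have "src Q (onE (j n) e) = i" using j_src e(2) i(2) by simp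
    moreover have "fib Q (unt Q i) = {onE (j n) e}"
      using bij_betw_imp_surj_on[OF fib_bij[OF D.unt_op[OF i(1)]]] e(1) j_unt[OF i(1)] i(2) by simp
    ultimately show ?thesis by blast
  qed
next
  fix c e assume C: "composable Q c e"
  obtain n c' e' where l: "composable (D n) c' e'" "onB (j n) c' = c" "onE (j n) e' = e"
    using lift_composable0[OF C] by blast
  have e': "e' \<in> inputs (D n)" "opr (D n) e' \<in> ops (D n)" "c' \<in> ops (D n)" "e' \<in> fib (D n) (opr (D n) e')"
    using l(1) D.opr_op by (auto simp: composable_def fib_def)
  have o: "opr Q e = onB (j n) (opr (D n) e')" using j_opr[OF e'(1)] l by simp
  have s: "sub Q c e = onB (j n) (sub (D n) c' e')" using j_sub[OF l(1)] l by simp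
  show "sub Q c e \<in> ops Q" unfolding s using j_ops D.sub_op[OF l(1)] by blast
  show "tgt Q (sub Q c e) = tgt Q (opr Q e)"
    unfolding s o using j_tgt D.sub_op[OF l(1)] D.tgt_sub[OF l(1)] e'(2) by simp
  note b1 = fib_bij[OF e'(2), folded o] and b2 = fib_bij[OF e'(3), unfolded l(2)]
    and b3 = fib_bij[OF D.sub_op[OF l(1)], folded s]
  let ?J = "onE (j n)" and ?A = "(fib (D n) (opr (D n) e') - {e'}) <+> fib (D n) c'"
  have b1': "bij_betw ?J (fib (D n) (opr (D n) e') - {e'}) (fib Q (opr Q e) - {e})"
    using b1 e'(4) l(3) by (metis bij_betw_DiffI bij_betw_singletonI empty_subsetI insert_subset bij_betw_apply)
  \<comment> \<open>The required bijection is the one at stage \<open>n\<close>, conjugated by the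
    identifications of fibres.\<close>
  have "bij_betw (map_sum ?J ?J) ?A ((fib Q (opr Q e) - {e}) <+> fib Q c)"
    by (rule bij_betw_map_sum[OF b1' b2])
  moreover have "bij_betw (case_sum (outer Q c e) (inner Q c e) \<circ> map_sum ?J ?J) ?A (fib Q (sub Q c e))"
  proof -
    have B: "bij_betw (?J \<circ> case_sum (outer (D n) c' e') (inner (D n) c' e')) ?A (fib Q (sub Q c e))"
      using bij_betw_trans[OF D.fib_sub[OF l(1)] b3] .
    have eq: "(case_sum (outer Q c e) (inner Q c e) \<circ> map_sum ?J ?J) x =
        (?J \<circ> case_sum (outer (D n) c' e') (inner (D n) c' e')) x" if "x \<in> ?A" for x
      using that
    proof (cases x)
      case (Inl y)
      with that have "y \<in> fib (D n) (opr (D n) e') - {e'}" by auto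
      with Inl j_outer[OF l(1)] l(2,3) show ?thesis by simp
    next
      case (Inr y)
      with that have "y \<in> fib (D n) c'" by auto
      with Inr j_inner[OF l(1)] l(2,3) show ?thesis by simp
    qed
    show ?thesis by (rule iffD2[OF bij_betw_cong[OF eq] B])
  qed
  ultimately show "bij_betw (case_sum (outer Q c e) (inner Q c e)) ((fib Q (opr Q e) - {e}) <+> fib Q c) (fib Q (sub Q c e))"
    by (simp only: bij_betw_comp_iff)
  show "src Q (outer Q c e x) = src Q x" if x: "x \<in> fib Q (opr Q e) - {e}" for x
  proof -
    obtain x' where x': "x' \<in> fib (D n) (opr (D n) e') - {e'}" "?J x' = x"
      using x unfolding bij_betw_imp_surj_on[OF b1', symmetric] by (metis imageE)
    then have "x' \<in> inputs (D n)" "outer (D n) c' e' x' \<in> inputs (D n)"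
      using D.outer_fib[OF l(1), of x'] by (auto simp: fib_def)
    from this[THEN j_src] show ?thesis
      using j_outer[OF l(1) x'(1)] D.src_outer[OF l(1) x'(1)] by (simp add: l(2,3) x'(2))
  qed
  show "src Q (inner Q c e x) = src Q x" if x: "x \<in> fib Q c" for x
  proof -
    obtain x' where x': "x' \<in> fib (D n) c'" "?J x' = x"
      using x unfolding bij_betw_imp_surj_on[OF b2, symmetric] by (metis imageE)
    then have "x' \<in> inputs (D n)" "inner (D n) c' e' x' \<in> inputs (D n)"
      using D.inner_fib[OF l(1), of x'] by (auto simp: fib_def)
    from this[THEN j_src] show ?thesis
      using j_inner[OF l(1) x'(1)] D.src_inner[OF l(1) x'(1)] by (simp add: l(2,3) x'(2))
  qed
next
  fix c e assume c: "c \<in> ops Q" and e: "fib Q (unt Q (tgt Q c)) = {e}"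
  obtain n c' where c': "c' \<in> ops (D n)" "onB (j n) c' = c" using surj_ops[OF c] by blast
  have t: "tgt Q c = onI (j n) (tgt (D n) c')" using j_tgt[OF c'(1)] c'(2) by simp
  obtain e' where e': "fib (D n) (unt (D n) (tgt (D n) c')) = {e'}" "onE (j n) e' = e"
    using unit_input_lift[OF D.tgt_type[OF c'(1)]] e t by metis
  have C: "composable (D n) c' e'"
    using c'(1) e'(1) D.fib_unt[OF D.tgt_type[OF c'(1)]] by (auto simp: composable_def fib_def)
  note u = D.sub_unt_left[OF c'(1) e'(1)]
  have "inner Q c e x = x" if x: "x \<in> fib Q c" for x
  proof -
    obtain x' where x': "x' \<in> fib (D n) c'" "onE (j n) x' = x" using lift_fib[OF c'(1)] x c'(2) by metis
    then show ?thesis using j_inner[OF C x'(1)] u c'(2) e'(2) by simp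
  qed
  then show "sub Q c e = c \<and> (\<forall>x \<in> fib Q c. inner Q c e x = x)" using j_sub[OF C] u c'(2) e'(2) by simp
next
  fix e x assume e: "e \<in> inputs Q" and x: "fib Q (unt Q (src Q e)) = {x}"
  obtain n e' where e': "e' \<in> inputs (D n)" "onE (j n) e' = e" using surj_inputs[OF e] by blast
  have s: "src Q e = onI (j n) (src (D n) e')" and o: "opr Q e = onB (j n) (opr (D n) e')"
    using j_src[OF e'(1)] j_opr[OF e'(1)] e'(2) by simp_all
  note st = D.src_type[OF e'(1)]
  obtain x' where x': "fib (D n) (unt (D n) (src (D n) e')) = {x'}" "onE (j n) x' = x"
    using unit_input_lift[OF st] x s by metis
  have C: "composable (D n) (unt (D n) (src (D n) e')) e'"
    using D.unt_op[OF st] D.tgt_unt[OF st] e'(1) by (simp add: composable_def)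
  note u = D.sub_unt_right[OF e'(1) x'(1)]
  have q: "unt Q (src Q e) = onB (j n) (unt (D n) (src (D n) e'))" using j_unt[OF st] s by simp
  have "outer Q (unt Q (src Q e)) e y = y" if y: "y \<in> fib Q (opr Q e) - {e}" for y
  proof -
    obtain y' where y': "y' \<in> fib (D n) (opr (D n) e')" "onE (j n) y' = y"
      using lift_fib[OF D.opr_op[OF e'(1)]] y unfolding o by blast
    then have "y' \<in> fib (D n) (opr (D n) e') - {e'}" using y e'(2) by auto
    then show ?thesis using j_outer[OF C, of y'] u e'(2) y'(2) q by simp
  qed
  moreover have "inner Q (unt Q (src Q e)) e x = e"
    using j_inner[OF C, of x'] x' u e'(2) q by simp
  ultimately show "sub Q (unt Q (src Q e)) e = opr Q e \<and> inner Q (unt Q (src Q e)) e x = e \<and>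
      (\<forall>y \<in> fib Q (opr Q e) - {e}. outer Q (unt Q (src Q e)) e y = y)"
    using j_sub[OF C] u e'(2) q o by simp
next
  fix c e f d assume C: "composable Q c e" and f: "f \<in> fib Q c" and F: "composable Q d f"
  obtain k c1 e1 where l1: "composable (D k) c1 e1" "onB (j k) c1 = c" "onE (j k) e1 = e"
    using lift_composable0[OF C] by blast
  have c1: "c1 \<in> ops (D k)" "e1 \<in> inputs (D k)" using l1(1) by (auto simp: composable_def)
  obtain f1 where f1: "f1 \<in> fib (D k) c1" "onE (j k) f1 = f" using lift_fib[OF c1(1)] f l1(2) by metis
  have "f1 \<in> inputs (D k)" using f1(1) by (simp add: fib_def)
  then obtain n d' where n: "k \<le> n" "composable (D n) d' (onE (t k n) f1)" "onB (j n) d' = d"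
    using lift_composable[of d k f1] F f1(2) by metis
  interpret T: pm_arrow "D k" "D n" "t k n" using t_arrow[OF n(1)] .
  \<comment> \<open>A lift of \<open>d\<close> that is composable with the lifted input exists only
    at a later stage \<open>n\<close>, so the data already lifted at stage \<open>k\<close> are
    pushed forward to it.\<close>
  define c' e' f' where "c' = onB (t k n) c1" "e' = onE (t k n) e1" "f' = onE (t k n) f1"
  note defs = c'_e'_f'_def
  have C': "composable (D n) c' e'" using T.composable_onE[OF l1(1)] by (simp add: defs)
  have f': "f' \<in> fib (D n) c'" using T.onE_fib[OF f1(1)] by (simp add: defs)
  have F': "composable (D n) d' f'" using n(2) by (simp add: defs)
  have J: "onB (j n) c' = c" "onE (j n) e' = e" "onE (j n) f' = f" "onB (j n) d' = d"
    using l1 f1 n(3) j_tB[OF n(1)] j_tE[OF n(1)] c1 \<open>f1 \<in> inputs (D k)\<close> by (simp_all add: defs)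
  have o: "opr (D n) f' = c'" "opr (D n) e' \<in> ops (D n)" "opr Q e = onB (j n) (opr (D n) e')" "c' \<in> ops (D n)" "d' \<in> ops (D n)"
    using f' C' F' D.opr_op j_opr J(2) by (auto simp: fib_def composable_def)
  note A = D.assoc_nested[OF C' f' F']
  have i: "inner Q c e f = onE (j n) (inner (D n) c' e' f')" using j_inner[OF C' f'] J by simp
  have s: "sub Q d f = onB (j n) (sub (D n) d' f')" using j_sub[OF F'] J by simp
  have inn: "inner (D n) c' e' f' \<in> fib (D n) (sub (D n) c' e')" using D.inner_fib[OF C' f'] .
  have CI: "composable (D n) d' (inner (D n) c' e' f')"
    using F' inn D.src_inner[OF C' f'] by (auto simp: composable_def fib_def)
  have CS: "composable (D n) (sub (D n) d' f') e'"
    using D.sub_op[OF F'] D.tgt_sub[OF F'] C' o by (auto simp: composable_def)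
  have si: "opr (D n) (inner (D n) c' e' f') = sub (D n) c' e'" using inn by (simp add: fib_def)
  show "sub Q d (inner Q c e f) = sub Q (sub Q d f) e \<and>
      (\<forall>x \<in> fib Q (opr Q e) - {e}. outer Q d (inner Q c e f) (outer Q c e x) = outer Q (sub Q d f) e x) \<and>
      (\<forall>x \<in> fib Q c - {f}. outer Q d (inner Q c e f) (inner Q c e x) = inner Q (sub Q d f) e (outer Q d f x)) \<and>
      (\<forall>x \<in> fib Q d. inner Q d (inner Q c e f) x = inner Q (sub Q d f) e (inner Q d f x))"
  proof (intro conjI ballI)
    show "sub Q d (inner Q c e f) = sub Q (sub Q d f) e"
      using j_sub[OF CI] j_sub[OF CS] A J i s by simp
  next
    fix x assume x: "x \<in> fib Q (opr Q e) - {e}"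
    then obtain x' where x': "x' \<in> fib (D n) (opr (D n) e')" "onE (j n) x' = x"
      using lift_fib[OF o(2)] unfolding o(3) by blast
    then have x'': "x' \<in> fib (D n) (opr (D n) e') - {e'}" using x J by auto
    have "outer (D n) c' e' x' \<in> fib (D n) (opr (D n) (inner (D n) c' e' f')) - {inner (D n) c' e' f'}"
      using D.outer_fib[OF C', of x'] x'' D.outer_neq_inner[OF C' x'' f'] si by simp
    from j_outer[OF CI this] show "outer Q d (inner Q c e f) (outer Q c e x) = outer Q (sub Q d f) e x"
      using j_outer[OF C' x''] j_outer[OF CS x''] A x'' J i s x'(2) by simp
  next
    fix x assume x: "x \<in> fib Q c - {f}"
    then obtain x' where x': "x' \<in> fib (D n) c'" "onE (j n) x' = x" using lift_fib[OF o(4)] J by blast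
    then have x'': "x' \<in> fib (D n) c' - {f'}" using x J by auto
    have 1: "inner (D n) c' e' x' \<in> fib (D n) (opr (D n) (inner (D n) c' e' f')) - {inner (D n) c' e' f'}"
      using D.inner_fib[OF C' x'(1)] D.inner_inj[OF C' x'(1) f'] x'' si by auto
    have 2: "outer (D n) d' f' x' \<in> fib (D n) (sub (D n) d' f')"
      using D.outer_fib[OF F', of x'] x'' o(1) by simp
    show "outer Q d (inner Q c e f) (inner Q c e x) = inner Q (sub Q d f) e (outer Q d f x)"
      using j_outer[OF CI 1] j_inner[OF C' x'(1)] j_inner[OF CS 2] j_outer[OF F', of x'] o(1) A x'' J i s x'(2) by simp
  next
    fix x assume x: "x \<in> fib Q d"
    then obtain x' where x': "x' \<in> fib (D n) d'" "onE (j n) x' = x" using lift_fib[OF o(5)] J by metis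
    show "inner Q d (inner Q c e f) x = inner Q (sub Q d f) e (inner Q d f x)"
      using j_inner[OF CI x'(1)] j_inner[OF CS D.inner_fib[OF F' x'(1)]] j_inner[OF F' x'(1)] A x'(1) J i s x'(2) by simp
  qed
next
  fix c e d f assume C: "composable Q c e" and F: "composable Q d f" and of: "opr Q f = opr Q e" and ne: "f \<noteq> e"
  obtain k c1 e1 where l1: "composable (D k) c1 e1" "onB (j k) c1 = c" "onE (j k) e1 = e"
    using lift_composable0[OF C] by blast
  have c1: "c1 \<in> ops (D k)" "e1 \<in> inputs (D k)" using l1(1) by (auto simp: composable_def)
  have "f \<in> fib Q (onB (j k) (opr (D k) e1))"
    using F of j_opr[OF c1(2)] l1(3) by (simp add: fib_def composable_def)
  then obtain f1 where f1: "f1 \<in> fib (D k) (opr (D k) e1)" "onE (j k) f1 = f"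
    using lift_fib[OF D.opr_op[OF c1(2)]] by metis
  have "f1 \<in> inputs (D k)" using f1(1) by (simp add: fib_def)
  then obtain n d' where n: "k \<le> n" "composable (D n) d' (onE (t k n) f1)" "onB (j n) d' = d"
    using lift_composable[of d k f1] F f1(2) by metis
  interpret T: pm_arrow "D k" "D n" "t k n" using t_arrow[OF n(1)] .
  define c' e' f' where "c' = onB (t k n) c1" "e' = onE (t k n) e1" "f' = onE (t k n) f1"
  note defs = c'_e'_f'_def
  have C': "composable (D n) c' e'" using T.composable_onE[OF l1(1)] by (simp add: defs)
  have F': "composable (D n) d' f'" using n(2) by (simp add: defs)
  have oo: "opr (D n) f' = opr (D n) e'"
    using T.arr_opr[OF c1(2)] T.arr_opr[OF \<open>f1 \<in> inputs (D k)\<close>] f1(1) by (simp add: defs fib_def)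
  have J: "onB (j n) c' = c" "onE (j n) e' = e" "onE (j n) f' = f" "onB (j n) d' = d"
    using l1 f1 n(3) j_tB[OF n(1)] j_tE[OF n(1)] c1 \<open>f1 \<in> inputs (D k)\<close> by (simp_all add: defs)
  have ne': "f' \<noteq> e'" using ne J by auto
  have e': "e' \<in> fib (D n) (opr (D n) e') - {f'}" and f': "f' \<in> fib (D n) (opr (D n) e') - {e'}"
    using C' F' oo ne' by (auto simp: composable_def fib_def)
  have o: "opr (D n) e' \<in> ops (D n)" "opr Q e = onB (j n) (opr (D n) e')" "c' \<in> ops (D n)" "d' \<in> ops (D n)"
    using C' F' D.opr_op j_opr J(2) by (auto simp: composable_def)
  note A = D.assoc_parallel[OF C' F' oo ne']
  have u: "outer Q c e f = onE (j n) (outer (D n) c' e' f')" using j_outer[OF C' f'] J by simp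
  have v: "outer Q d f e = onE (j n) (outer (D n) d' f' e')" using j_outer[OF F', of e'] e' oo J by simp
  have CU: "composable (D n) d' (outer (D n) c' e' f')"
    using F' D.outer_fib[OF C', of f'] f' D.src_outer[OF C' f'] by (auto simp: composable_def fib_def)
  have CV: "composable (D n) c' (outer (D n) d' f' e')"
    using C' D.outer_fib[OF F', of e'] e' D.src_outer[OF F', of e'] oo by (auto simp: composable_def fib_def)
  have ou: "opr (D n) (outer (D n) c' e' f') = sub (D n) c' e'"
    using D.outer_fib[OF C', of f'] f' by (simp add: fib_def)
  have ov: "opr (D n) (outer (D n) d' f' e') = sub (D n) d' f'"
    using D.outer_fib[OF F', of e'] e' oo by (simp add: fib_def)
  show "sub Q d (outer Q c e f) = sub Q c (outer Q d f e) \<and>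
      (\<forall>x \<in> fib Q (opr Q e) - {e, f}.
         outer Q d (outer Q c e f) (outer Q c e x) = outer Q c (outer Q d f e) (outer Q d f x)) \<and>
      (\<forall>x \<in> fib Q c. outer Q d (outer Q c e f) (inner Q c e x) = inner Q c (outer Q d f e) x) \<and>
      (\<forall>x \<in> fib Q d. inner Q d (outer Q c e f) x = outer Q c (outer Q d f e) (inner Q d f x))"
  proof (intro conjI ballI)
    show "sub Q d (outer Q c e f) = sub Q c (outer Q d f e)"
      using j_sub[OF CU] j_sub[OF CV] A J u v by simp
  next
    fix x assume x: "x \<in> fib Q (opr Q e) - {e, f}"
    then obtain x' where x': "x' \<in> fib (D n) (opr (D n) e')" "onE (j n) x' = x"
      using lift_fib[OF o(1)] unfolding o(2) by blast
    then have x1: "x' \<in> fib (D n) (opr (D n) e') - {e'}" and x2: "x' \<in> fib (D n) (opr (D n) f') - {f'}"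
      and x3: "x' \<in> fib (D n) (opr (D n) e') - {e', f'}" using x J oo by auto
    have 1: "outer (D n) c' e' x' \<in> fib (D n) (opr (D n) (outer (D n) c' e' f')) - {outer (D n) c' e' f'}"
      using D.outer_fib[OF C', of x'] D.outer_inj[OF C' x1 f'] x3 ou by auto
    have 2: "outer (D n) d' f' x' \<in> fib (D n) (opr (D n) (outer (D n) d' f' e')) - {outer (D n) d' f' e'}"
      using D.outer_fib[OF F', of x'] D.outer_inj[OF F' x2, of e'] e' x3 oo ov by auto
    show "outer Q d (outer Q c e f) (outer Q c e x) = outer Q c (outer Q d f e) (outer Q d f x)"
      using j_outer[OF CU 1] j_outer[OF CV 2] j_outer[OF C' x1] j_outer[OF F' x2] A x3 J u v x'(2) by simp
  next
    fix x assume x: "x \<in> fib Q c"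
    then obtain x' where x': "x' \<in> fib (D n) c'" "onE (j n) x' = x" using lift_fib[OF o(3)] J by metis
    have 1: "inner (D n) c' e' x' \<in> fib (D n) (opr (D n) (outer (D n) c' e' f')) - {outer (D n) c' e' f'}"
      using D.inner_fib[OF C' x'(1)] D.outer_neq_inner[OF C' f' x'(1)] ou by auto
    show "outer Q d (outer Q c e f) (inner Q c e x) = inner Q c (outer Q d f e) x"
      using j_outer[OF CU 1] j_inner[OF CV x'(1)] j_inner[OF C' x'(1)] A x'(1) J u v x'(2) by simp
  next
    fix x assume x: "x \<in> fib Q d"
    then obtain x' where x': "x' \<in> fib (D n) d'" "onE (j n) x' = x" using lift_fib[OF o(4)] J by metis
    have 1: "inner (D n) d' f' x' \<in> fib (D n) (opr (D n) (outer (D n) d' f' e')) - {outer (D n) d' f' e'}"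
      using D.inner_fib[OF F' x'(1)] D.outer_neq_inner[OF F', of e' x'] e' x'(1) oo ov by auto
    show "inner Q d (outer Q c e f) x = outer Q c (outer Q d f e) (inner Q d f x)"
      using j_outer[OF CV 1] j_inner[OF CU x'(1)] j_inner[OF F' x'(1)] A x'(1) J u v x'(2) by simp
  qed
qed

lemma j_arrow: "pm_arrow (D n) Q (j n)"
  by (intro pm_arrow.intro D_monad Q_monad j_axioms)

text \<open>The pullback condition is checked at a stage where the operation is represented: its
  fibre there is the fibre in \<open>Q\<close>, and \<open>k n\<close> maps it bijectively to the
  fibre in \<open>X\<close>. All other conditions are equations between lifted elements.\<close>

lemma arrow_out:
  assumes k: "\<And>n. pm_arrow (D n) X (k n)" and h: "\<And>n. arr_eq (D n) (h \<circ>\<^sub>a j n) (k n)"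
  shows "pm_arrow Q X h"
proof -
  interpret k: pm_arrow "D n" X "k n" for n by (rule k)
  interpret j: pm_arrow "D n" Q "j n" for n by (rule j_arrow)
  have hI: "onI h (onI (j n) i) = onI (k n) i" if "i \<in> types (D n)" for n i
    using h[of n] that by (simp add: arr_eq_def)
  have hB: "onB h (onB (j n) i) = onB (k n) i" if "i \<in> ops (D n)" for n i
    using h[of n] that by (simp add: arr_eq_def)
  have hE: "onE h (onE (j n) i) = onE (k n) i" if "i \<in> inputs (D n)" for n i
    using h[of n] that by (simp add: arr_eq_def)
  show ?thesis
  proof (intro pm_arrow.intro pm_arrow_axioms.intro Q_monad k.cod.polynomial_monad_axioms)
    show "onI h i \<in> types X" if "i \<in> types Q" for i
      using surj_types[OF that] hI k.onI_type by metis
    show "onB h i \<in> ops X" if "i \<in> ops Q" for i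
      using surj_ops[OF that] hB k.onB_op by metis
    show "onE h i \<in> inputs X" if "i \<in> inputs Q" for i
      using surj_inputs[OF that] hE k.onE_input by metis
    show "src X (onE h e) = onI h (src Q e)" if "e \<in> inputs Q" for e
      using surj_inputs[OF that] hE hI k.arr_src j_src D.src_type by metis
    show "opr X (onE h e) = onB h (opr Q e)" if "e \<in> inputs Q" for e
      using surj_inputs[OF that] hE hB k.arr_opr j_opr D.opr_op by metis
    show "tgt X (onB h b) = onI h (tgt Q b)" if "b \<in> ops Q" for b
      using surj_ops[OF that] hB hI k.arr_tgt j_tgt D.tgt_type by metis
    show "onB h (unt Q i) = unt X (onI h i)" if "i \<in> types Q" for i
      using surj_types[OF that] hB hI k.arr_unt j_unt D.unt_op by metis
    show "\<exists>!e. e \<in> inputs Q \<and> opr Q e = b \<and> onE h e = f"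
      if b: "b \<in> ops Q" and f: "f \<in> inputs X" "opr X f = onB h b" for b f
    proof -
      obtain n b' where b': "b' \<in> ops (D n)" "onB (j n) b' = b" using surj_ops[OF b] by blast
      have "opr X f = onB (k n) b'" using f(2) hB[OF b'(1)] b'(2) by simp
      from k.pullback[OF b'(1) f(1) this]
      obtain e where e: "e \<in> inputs (D n)" "opr (D n) e = b'" "onE (k n) e = f"
        and u: "\<And>e'. e' \<in> inputs (D n) \<Longrightarrow> opr (D n) e' = b' \<Longrightarrow> onE (k n) e' = f \<Longrightarrow> e' = e" by blast
      show ?thesis
      proof (rule ex1I[of _ "onE (j n) e"])
        show "onE (j n) e \<in> inputs Q \<and> opr Q (onE (j n) e) = b \<and> onE h (onE (j n) e) = f"
          using e b'(2) j_inputs j_opr hE by simp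
        fix y assume y: "y \<in> inputs Q \<and> opr Q y = b \<and> onE h y = f"
        then have "y \<in> fib Q (onB (j n) b')" using b' by (simp add: fib_def)
        then obtain y' where "y' \<in> fib (D n) b'" "onE (j n) y' = y" by (rule lift_fib[OF b'(1)])
        then show "y = onE (j n) e" using u[of y'] y hE[of y' n] by (auto simp: fib_def)
      qed
    qed
  next
    fix c e assume C: "composable Q c e"
    obtain n c' e' where l: "composable (D n) c' e'" "onB (j n) c' = c" "onE (j n) e' = e"
      using lift_composable0[OF C] by blast
    have e': "e' \<in> inputs (D n)" "c' \<in> ops (D n)" using l(1) by (auto simp: composable_def)
    have H: "onB h c = onB (k n) c'" "onE h e = onE (k n) e'" using hB[OF e'(2)] hE[OF e'(1)] l by simp_all
    show "onB h (sub Q c e) = sub X (onB h c) (onE h e)"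
      using j_sub[OF l(1)] k.arr_sub[OF l(1)] hB[OF D.sub_op[OF l(1)]] H l by simp
    show "onE h (outer Q c e x) = outer X (onB h c) (onE h e) (onE h x)" if x: "x \<in> fib Q (opr Q e) - {e}" for x
    proof -
      have o: "opr Q e = onB (j n) (opr (D n) e')" using j_opr[OF e'(1)] l(3) by simp
      obtain x' where x': "x' \<in> fib (D n) (opr (D n) e')" "onE (j n) x' = x"
        using lift_fib[OF D.opr_op[OF e'(1)]] x unfolding o by blast
      have x'': "x' \<in> fib (D n) (opr (D n) e') - {e'}" using x' x l(3) by auto
      have "outer (D n) c' e' x' \<in> inputs (D n)" "x' \<in> inputs (D n)"
        using D.outer_fib[OF l(1), of x'] x'' by (auto simp: fib_def)
      from this[THEN hE] show ?thesis
        using j_outer[OF l(1) x''] k.arr_outer[OF l(1) x''] by (simp add: H l(2,3) x'(2))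
    qed
    show "onE h (inner Q c e x) = inner X (onB h c) (onE h e) (onE h x)" if x: "x \<in> fib Q c" for x
    proof -
      obtain x' where x': "x' \<in> fib (D n) c'" "onE (j n) x' = x" using lift_fib[OF e'(2)] x l(2) by metis
      have "inner (D n) c' e' x' \<in> inputs (D n)" "x' \<in> inputs (D n)"
        using D.inner_fib[OF l(1), of x'] x' by (auto simp: fib_def)
      from this[THEN hE] show ?thesis
        using j_inner[OF l(1) x'(1)] k.arr_inner[OF l(1) x'(1)] by (simp add: H l(2,3) x'(2))
    qed
  qed
qed

text \<open>Only maps are produced, from any compatible family of maps; \<open>arrow_out\<close>
  makes them an arrow when the \<open>k n\<close> are arrows. Keeping the two apart allows
  \<open>universal\<close> to serve as a proof of well-definedness as well.\<close>

lemma universal: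
  assumes k: "\<And>n m. n \<le> m \<Longrightarrow> arr_eq (D n) (k m \<circ>\<^sub>a t n m) (k n)"
  shows "\<exists>h. \<forall>n. arr_eq (D n) (h \<circ>\<^sub>a j n) (k n)"
proof -
  \<comment> \<open>Any representative may be chosen: by \<open>I\<close>, \<open>B\<close> and
    \<open>E\<close> below the value of \<open>k\<close> does not depend on it, since two
    representatives agree at a later stage.\<close>
  define h where "h = \<lparr>
    onI = \<lambda>z. SOME w. \<exists>n x. x \<in> types (D n) \<and> z = onI (j n) x \<and> w = onI (k n) x,
    onB = \<lambda>z. SOME w. \<exists>n x. x \<in> ops (D n) \<and> z = onB (j n) x \<and> w = onB (k n) x,
    onE = \<lambda>z. SOME w. \<exists>n x. x \<in> inputs (D n) \<and> z = onE (j n) x \<and> w = onE (k n) x\<rparr>"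
  have I: "onI (k n) x = onI (k m) y" if xy: "x \<in> types (D n)" "y \<in> types (D m)" "onI (j n) x = onI (j m) y" for n m x y
  proof -
    obtain p where p: "n \<le> p" "m \<le> p" "onI (t n p) x = onI (t m p) y" using eq_type[OF xy] .
    then show ?thesis using k[OF p(1)] k[OF p(2)] xy by (simp add: arr_eq_def) metis
  qed
  have B: "onB (k n) x = onB (k m) y" if xy: "x \<in> ops (D n)" "y \<in> ops (D m)" "onB (j n) x = onB (j m) y" for n m x y
  proof -
    obtain p where p: "n \<le> p" "m \<le> p" "onB (t n p) x = onB (t m p) y" using eq_op[OF xy] .
    then show ?thesis using k[OF p(1)] k[OF p(2)] xy by (simp add: arr_eq_def) metis
  qed
  have E: "onE (k n) x = onE (k m) y" if xy: "x \<in> inputs (D n)" "y \<in> inputs (D m)" "onE (j n) x = onE (j m) y" for n m x y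
  proof -
    obtain p where p: "n \<le> p" "m \<le> p" "onE (t n p) x = onE (t m p) y" using eq_input[OF xy] .
    then show ?thesis using k[OF p(1)] k[OF p(2)] xy by (simp add: arr_eq_def) metis
  qed
  have "arr_eq (D n) (h \<circ>\<^sub>a j n) (k n)" for n
    unfolding arr_eq_def h_def
    by (auto intro!: some_equality dest: I B E)
  then show ?thesis by blast
qed

end

section \<open>Preservation of sequential colimits by \<open>BD\<close>\<close>

lemma finite_stage:
  fixes n :: nat
  assumes "finite A" and "\<And>a. a \<in> A \<Longrightarrow> \<exists>m \<ge> n. R a m" and mono: "\<And>a m p. R a m \<Longrightarrow> m \<le> p \<Longrightarrow> R a p"
  shows "\<exists>m \<ge> n. \<forall>a \<in> A. R a m"
  using assms(1,2)
proof (induction A)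
  case (insert a A)
  obtain m where m: "m \<ge> n" "\<forall>a \<in> A. R a m" using insert.IH insert.prems by blast
  obtain p where p: "p \<ge> n" "R a p" using insert.prems[of a] by blast
  have "R b (max m p)" if "b \<in> insert a A" for b
  proof (cases "b = a")
    case True
    show ?thesis unfolding True by (rule mono[OF p(2)]) simp
  next
    case False
    then have "R b m" using m that by blast
    then show ?thesis by (rule mono) simp
  qed
  moreover have "max m p \<ge> n" using m by simp
  ultimately show ?case by blast
qed auto

abbreviation tmap :: "('i, 'b, 'e, 'j, 'c, 'f) arr \<Rightarrow> ('i, 'b, 'e) ptree \<Rightarrow> ('j, 'c, 'f) ptree" where
  "tmap h \<equiv> map_ptree (onI h) (onB h) (onE h)"

lemma tmap_comp: "is_ptree P T \<Longrightarrow> arr_eq P (k \<circ>\<^sub>a h) l \<Longrightarrow> tmap k (tmap h T) = tmap l T"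
  using map_ptree_arr_eq[of P "k \<circ>\<^sub>a h" l T] by (simp add: ptree.map_comp o_def)

context pm_cocone
begin

lemma arr_eq_out: "(\<And>n. arr_eq (D n) (h \<circ>\<^sub>a j n) (h' \<circ>\<^sub>a j n)) \<Longrightarrow> arr_eq Q h h'"
  using surj_types surj_ops surj_inputs unfolding arr_eq_def arr_comp_simps comp_def by metis

text \<open>The lift of the root type is prescribed because the branches are lifted separately: each
  must end up with exactly the source of its input as root type, and an arbitrary lift would match
  it only in the colimit. Over a dot, first the operation is lifted and moved to a stage where its
  target is the prescribed type, then the finitely many branches are brought to a common
  stage.\<close>

lemma lift_tree:
  "is_ptree Q T \<Longrightarrow> i \<in> types (D n) \<Longrightarrow> onI (j n) i = root_type Q T \<Longrightarrow>
     \<exists>m \<ge> n. \<exists>T'. is_ptree (D m) T' \<and> tmap (j m) T' = T \<and> root_type (D m) T' = onI (t n m) i"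
proof (induction T arbitrary: n i)
  case (Unit x)
  have "onI (t n n) i \<in> types (D n)" using pm_arrow.onI_type[OF t_arrow[OF order.refl]] Unit.prems(2) .
  then have "is_ptree (D n) (Unit (onI (t n n) i))" by (rule is_ptree.intros)
  moreover have "tmap (j n) (Unit (onI (t n n) i)) = Unit x"
    using j_tI[OF order.refl Unit.prems(2)] Unit.prems(3) by simp
  moreover have "root_type (D n) (Unit (onI (t n n) i)) = onI (t n n) i" by simp
  ultimately show ?case by blast
next
  case (Dot b S)
  note T = Dot.prems(1)
  obtain m1 b1 where m1: "n \<le> m1" "b1 \<in> ops (D m1)" "onB (j m1) b1 = b"
    using lift_op[OF dot_tree_op[OF T]] by metis
  have "onI (j m1) (tgt (D m1) b1) = onI (j n) i" using j_tgt[OF m1(2)] m1(3) Dot.prems(3) by simp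
  then obtain m2 where m2: "m1 \<le> m2" "n \<le> m2" "onI (t m1 m2) (tgt (D m1) b1) = onI (t n m2) i"
    using eq_type[OF D.tgt_type[OF m1(2)] Dot.prems(2)] by metis
  interpret t12: pm_arrow "D m1" "D m2" "t m1 m2" using t_arrow[OF m2(1)] .
  define b2 where "b2 = onB (t m1 m2) b1"
  have b2: "b2 \<in> ops (D m2)" "onB (j m2) b2 = b" "tgt (D m2) b2 = onI (t n m2) i"
    using t12.onB_op[OF m1(2)] j_tB[OF m2(1) m1(2)] m1(3) t12.arr_tgt[OF m1(2)] m2(3) by (simp_all add: b2_def)
  \<comment> \<open>\<open>R e m\<close> says that the branch above \<open>e\<close> has a lift at
    stage \<open>m\<close> with the root type required by \<open>e\<close>; it stays true at later
    stages, which is what \<open>finite_stage\<close> exploits.\<close>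
  define R where "R e m \<longleftrightarrow> m2 \<le> m \<and> (\<exists>T'. is_ptree (D m) T' \<and> tmap (j m) T' = branch S (onE (j m2) e) \<and>
      root_type (D m) T' = onI (t m2 m) (src (D m2) e))" for e m
  have "\<exists>m \<ge> m2. R e m" if e: "e \<in> fib (D m2) b2" for e
  proof -
    have e': "onE (j m2) e \<in> fib Q b" using j_fib[OF e] b2(2) by simp
    have ei: "e \<in> inputs (D m2)" using e by (simp add: fib_def)
    have "is_ptree Q (branch S (onE (j m2) e))" "onI (j m2) (src (D m2) e) = root_type Q (branch S (onE (j m2) e))"
      using branch_ptree[OF T e'] j_src[OF ei] by simp_all
    from Dot.IH[OF branch_mem[OF T e'] _ this(1) D.src_type[OF ei] this(2)]
    show ?thesis unfolding R_def by (auto simp: snds.simps)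
  qed
  moreover have "R e p" if R: "R e m" "m \<le> p" and e: "e \<in> fib (D m2) b2" for e m p
  proof -
    obtain T' where T': "m2 \<le> m" "is_ptree (D m) T'" "tmap (j m) T' = branch S (onE (j m2) e)"
      "root_type (D m) T' = onI (t m2 m) (src (D m2) e)" using R(1) unfolding R_def by blast
    interpret tm: pm_arrow "D m" "D p" "t m p" using t_arrow[OF R(2)] .
    have "is_ptree (D p) (tmap (t m p) T')" "root_type (D p) (tmap (t m p) T') = onI (t m p) (root_type (D m) T')"
      using tm.map_ptree_root[OF T'(2)] by simp_all
    moreover have "onI (t m p) (root_type (D m) T') = onI (t m2 p) (src (D m2) e)"
      unfolding T'(4) using t_tI[OF T'(1) R(2)] D.src_type e by (simp add: fib_def)
    moreover have "tmap (j p) (tmap (t m p) T') = branch S (onE (j m2) e)"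
      using tmap_comp[OF T'(2) j_t[OF R(2)]] T'(3) by simp
    ultimately show ?thesis using T'(1) R(2) unfolding R_def by auto
  qed
  \<comment> \<open>Membership in the fibre is repeated as a premise because
    \<open>finite_stage\<close> asks for monotonicity at every \<open>e\<close>, whereas it was
    shown for inputs of \<open>b2\<close>.\<close>
  ultimately have "\<exists>m \<ge> m2. \<forall>e \<in> fib (D m2) b2. e \<in> fib (D m2) b2 \<longrightarrow> R e m"
    by (intro finite_stage[OF D.finite_fib[OF b2(1)]]) blast+
  then obtain m3 where m3: "m2 \<le> m3" "\<forall>e \<in> fib (D m2) b2. R e m3" by blast
  then have "\<forall>e \<in> fib (D m2) b2. \<exists>T'. is_ptree (D m3) T' \<and> tmap (j m3) T' = branch S (onE (j m2) e) \<and>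
      root_type (D m3) T' = onI (t m2 m3) (src (D m2) e)" unfolding R_def by blast
  from bchoice[OF this] obtain U where U: "\<And>e. e \<in> fib (D m2) b2 \<Longrightarrow> is_ptree (D m3) (U e)"
    "\<And>e. e \<in> fib (D m2) b2 \<Longrightarrow> tmap (j m3) (U e) = branch S (onE (j m2) e)"
    "\<And>e. e \<in> fib (D m2) b2 \<Longrightarrow> root_type (D m3) (U e) = onI (t m2 m3) (src (D m2) e)" by blast
  interpret t23: pm_arrow "D m2" "D m3" "t m2 m3" using t_arrow[OF m3(1)] .
  define b3 S3 where "b3 = onB (t m2 m3) b2" and "S3 = Abs_fset ((\<lambda>e. (onE (t m2 m3) e, U e)) ` fib (D m2) b2)"
  have S3: "fset S3 = (\<lambda>e. (onE (t m2 m3) e, U e)) ` fib (D m2) b2"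
    unfolding S3_def using D.finite_fib[OF b2(1)] by (simp add: Abs_fset_inverse)
  have "is_ptree (D m3) (Dot b3 S3)"
  proof (rule is_ptree.intros)
    show "b3 \<in> ops (D m3)" using t23.onB_op[OF b2(1)] by (simp add: b3_def)
    have "inj_on fst (fset S3)"
      unfolding S3
    proof (rule inj_onI, elim imageE)
      fix x y e e' assume "fst x = fst y" "x = (onE (t m2 m3) e, U e)" "e \<in> fib (D m2) b2"
        "y = (onE (t m2 m3) e', U e')" "e' \<in> fib (D m2) b2"
      with t23.onE_inj[of e b2 e'] show "x = y" by simp
    qed
    moreover have "fst ` fset S3 = fib (D m3) b3"
      unfolding S3 b3_def image_image using bij_betw_imp_surj_on[OF t23.onE_bij[OF b2(1)]] by simp
    ultimately show "bij_betw fst (fset S3) (fib (D m3) b3)" by (simp add: bij_betw_def)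
    fix f V assume "(f, V) |\<in>| S3"
    then obtain e where e: "e \<in> fib (D m2) b2" "f = onE (t m2 m3) e" "V = U e" unfolding S3 by blast
    then show "is_ptree (D m3) V \<and> root_type (D m3) V = src (D m3) f"
      using U(1,3)[OF e(1)] t23.arr_src D.fib_iff by simp
  qed
  moreover have "tmap (j m3) (Dot b3 S3) = Dot b S"
  proof -
    have "fset (map_prod (onE (j m3)) (tmap (j m3)) |`| S3) = (\<lambda>e. (onE (j m2) e, branch S (onE (j m2) e))) ` fib (D m2) b2"
      unfolding fimage.rep_eq S3 image_image
    proof (intro image_cong refl)
      fix e assume e: "e \<in> fib (D m2) b2"
      then show "map_prod (onE (j m3)) (tmap (j m3)) (onE (t m2 m3) e, U e) = (onE (j m2) e, branch S (onE (j m2) e))"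
        using U(2)[OF e] j_tE[OF m3(1), of e] by (simp add: fib_def)
    qed
    also have "\<dots> = (\<lambda>e. (e, branch S e)) ` onE (j m2) ` fib (D m2) b2" by (simp only: image_image)
    also have "\<dots> = fset S"
      using bij_betw_imp_surj_on[OF fib_bij[OF b2(1)]] by (simp add: fset_branches[OF T] b2(2))
    finally have "map_prod (onE (j m3)) (tmap (j m3)) |`| S3 = S" by (simp only: fset_inject)
    moreover have "onB (j m3) b3 = b" using j_tB[OF m3(1) b2(1)] b2(2) by (simp add: b3_def)
    ultimately show ?thesis by simp
  qed
  moreover have "root_type (D m3) (Dot b3 S3) = onI (t n m3) i"
    using t23.arr_tgt[OF b2(1)] b2(3) t_tI[OF m2(2) m3(1) Dot.prems(2)] by (simp add: b3_def)
  moreover have "n \<le> m3" using m2 m3 by simp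
  ultimately show ?case by blast
qed

text \<open>At a stage where the two root operations agree their inputs can be paired, and the
  paired branches have equal images in \<open>Q\<close>. By induction they agree at later stages,
  and one stage serves for the finitely many branches. One inclusion between the sets of branches
  then suffices, as the root operation is shared (\<open>Dot_branch_subset\<close>).\<close>

lemma inj_tree:
  "is_ptree (D n) T \<Longrightarrow> is_ptree (D n) T' \<Longrightarrow> tmap (j n) T = tmap (j n) T' \<Longrightarrow>
     \<exists>m \<ge> n. tmap (t n m) T = tmap (t n m) T'"
proof (induction T arbitrary: T')
  case (Unit x)
  then obtain y where y: "T' = Unit y" by (cases T') auto
  have xy: "x \<in> types (D n)" "y \<in> types (D n)" using Unit.prems(1,2) y by (auto elim: unit_treeE)
  then show ?case using inj_types[OF xy] Unit.prems(3) by (simp add: y)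
next
  case (Dot b S)
  then obtain b' S' where T': "T' = Dot b' S'" by (cases T') auto
  note B = Dot.prems(1) and B' = Dot.prems(2)[unfolded T']
  note b = dot_tree_op[OF B] and b' = dot_tree_op[OF B']
  interpret j: pm_arrow "D n" Q "j n" by (rule j_arrow)
  have jb: "onB (j n) b = onB (j n) b'"
    and jS: "map_prod (onE (j n)) (tmap (j n)) |`| S = map_prod (onE (j n)) (tmap (j n)) |`| S'"
    using Dot.prems(3) by (simp_all add: T')
  obtain m1 where m1: "n \<le> m1" "onB (t n m1) b = onB (t n m1) b'" using inj_ops[OF b b' jb] by blast
  interpret t1: pm_arrow "D n" "D m1" "t n m1" using t_arrow[OF m1(1)] .
  have br: "tmap (j n) (branch S e) = branch (map_prod (onE (j n)) (tmap (j n)) |`| S) (onE (j n) e)"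
    if "is_ptree (D n) (Dot b S)" "e \<in> fib (D n) b" for e b S
    using j.map_Dot(2)[OF that(1) j.map_ptree_root[OF branch_ptree(1)[OF that(1)]] that(2)] by simp
  define R where "R e m \<longleftrightarrow> n \<le> m \<and> m1 \<le> m \<and> (\<exists>e' \<in> fib (D n) b'. onE (t n m) e = onE (t n m) e' \<and>
      tmap (t n m) (branch S e) = tmap (t n m) (branch S' e'))" for e m
  have mono: "R e p" if R: "R e m" "m \<le> p" and e: "e \<in> fib (D n) b" for e m p
  proof -
    obtain e' where e': "n \<le> m" "m1 \<le> m" "e' \<in> fib (D n) b'" "onE (t n m) e = onE (t n m) e'"
      "tmap (t n m) (branch S e) = tmap (t n m) (branch S' e')" using R(1) unfolding R_def by blast
    have "onE (t n p) e = onE (t n p) e'"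
      using t_tE[OF e'(1) R(2), of e] t_tE[OF e'(1) R(2), of e'] e e'(3,4) by (simp add: fib_def)
    moreover have "tmap (t n p) (branch S e) = tmap (t n p) (branch S' e')"
      using tmap_comp[OF branch_ptree(1)[OF B e] t_comp[OF e'(1) R(2)]]
        tmap_comp[OF branch_ptree(1)[OF B' e'(3)] t_comp[OF e'(1) R(2)]] e'(5) by simp
    ultimately show ?thesis using e'(1-3) R(2) unfolding R_def by auto
  qed
  have "\<exists>m \<ge> n. R e m" if e: "e \<in> fib (D n) b" for e
  proof -
    \<comment> \<open>The partner \<open>e'\<close> of \<open>e\<close> is found by moving to stage
      \<open>m1\<close>, where the operations agree, and pulling back along the bijection of fibres
      for \<open>b'\<close>.\<close>
    have "onE (t n m1) e \<in> fib (D m1) (onB (t n m1) b')" using t1.onE_fib[OF e] m1(2) by simp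
    then obtain e' where e': "e' \<in> fib (D n) b'" "onE (t n m1) e' = onE (t n m1) e"
      using bij_betw_imp_surj_on[OF t1.onE_bij[OF b']] by (metis imageE)
    have "onE (j n) e = onE (j n) e'"
      using j_tE[OF m1(1), of e] j_tE[OF m1(1), of e'] e e' by (simp add: fib_def)
    then have "tmap (j n) (branch S e) = tmap (j n) (branch S' e')"
      using br[OF B e] br[OF B' e'(1)] jS by simp
    then obtain m where m: "n \<le> m" "tmap (t n m) (branch S e) = tmap (t n m) (branch S' e')"
      using Dot.IH[OF branch_mem[OF B e], of "branch S e" "branch S' e'"] branch_ptree(1)[OF B e]
        branch_ptree(1)[OF B' e'(1)] by (auto simp: snds.simps)
    let ?p = "max m m1"
    have le: "m \<le> ?p" "m1 \<le> ?p" by simp_all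
    have "onE (t n ?p) e = onE (t n ?p) e'"
      using t_tE[OF m1(1) le(2), of e] t_tE[OF m1(1) le(2), of e'] e e' by (simp add: fib_def)
    moreover have "tmap (t n ?p) (branch S e) = tmap (t n ?p) (branch S' e')"
      using tmap_comp[OF branch_ptree(1)[OF B e] t_comp[OF m(1) le(1)]]
        tmap_comp[OF branch_ptree(1)[OF B' e'(1)] t_comp[OF m(1) le(1)]] m(2) by simp
    ultimately have "R e ?p" using e'(1) m(1) le unfolding R_def by auto
    then show ?thesis using m(1) le(1) by (meson order_trans)
  qed
  then have "\<exists>m \<ge> n. \<forall>e \<in> fib (D n) b. e \<in> fib (D n) b \<longrightarrow> R e m"
    using mono by (intro finite_stage[OF D.finite_fib[OF b]]) blast+
  then obtain m2 where m2: "n \<le> m2" "\<And>e. e \<in> fib (D n) b \<Longrightarrow> R e m2" by blast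
  define m where "m = max m1 m2"
  have m: "n \<le> m" "m1 \<le> m" "\<And>e. e \<in> fib (D n) b \<Longrightarrow> R e m"
    using m2 m1 mono[OF m2(2)] by (auto simp: m_def)
  interpret t: pm_arrow "D n" "D m" "t n m" using t_arrow[OF m(1)] .
  have bb: "onB (t n m) b = onB (t n m) b'"
    using t_tB[OF m1(1) m(2) b] t_tB[OF m1(1) m(2) b'] m1(2) by simp
  have P1: "is_ptree (D m) (Dot (onB (t n m) b) (map_prod (onE (t n m)) (tmap (t n m)) |`| S))"
    using conjunct1[OF t.map_ptree_root[OF B]] by simp
  have P2: "is_ptree (D m) (Dot (onB (t n m) b) (map_prod (onE (t n m)) (tmap (t n m)) |`| S'))"
    using conjunct1[OF t.map_ptree_root[OF B']] by (simp add: bb)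
  have "fset (map_prod (onE (t n m)) (tmap (t n m)) |`| S) \<subseteq> fset (map_prod (onE (t n m)) (tmap (t n m)) |`| S')"
  proof
    fix z assume "z |\<in>| map_prod (onE (t n m)) (tmap (t n m)) |`| S"
    then obtain e where e: "e \<in> fib (D n) b" "z = (onE (t n m) e, tmap (t n m) (branch S e))"
      unfolding fimage.rep_eq fset_branches[OF B] by auto
    then obtain e' where e': "e' \<in> fib (D n) b'" "z = (onE (t n m) e', tmap (t n m) (branch S' e'))"
      using m(3)[OF e(1)] unfolding R_def by auto
    then show "z |\<in>| map_prod (onE (t n m)) (tmap (t n m)) |`| S'"
      unfolding fimage.rep_eq fset_branches[OF B'] by (auto simp: image_image)
  qed
  from Dot_branch_subset[OF P1 P2 this] have "tmap (t n m) (Dot b S) = tmap (t n m) T'" by (simp add: T' bb)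
  with m(1) show ?case by blast
qed

text \<open>The types of \<open>BD Q\<close> are the operations of \<open>Q\<close>, so for types
  nothing new is needed. Operations are handled by \<open>lift_tree\<close> and
  \<open>inj_tree\<close>, and a marked dot lifts with its tree because the dots of an image tree
  are images of dots.\<close>

theorem BD_cocone: "pm_cocone (\<lambda>n. BD (D n)) (\<lambda>n m. BD_arr (t n m)) (BD Q) (\<lambda>n. BD_arr (j n))"
proof (rule pm_cocone.intro)
  show "pm_arrow (BD (D n)) (BD (D m)) (BD_arr (t n m))" if "n \<le> m" for n m
    using pm_arrow.BD_arrow[OF t_arrow[OF that]] .
  show "arr_eq (BD (D n)) (BD_arr (t m p) \<circ>\<^sub>a BD_arr (t n m)) (BD_arr (t n p))" if "n \<le> m" "m \<le> p" for n m p
    by (rule BD_arr_comp_eq[OF t_comp[OF that]])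
  show "pm_arrow_axioms (BD (D n)) (BD Q) (BD_arr (j n))" for n
    using pm_arrow.axioms(3)[OF pm_arrow.BD_arrow[OF j_arrow]] .
  show "arr_eq (BD (D n)) (BD_arr (j m) \<circ>\<^sub>a BD_arr (t n m)) (BD_arr (j n))" if "n \<le> m" for n m
    by (rule BD_arr_comp_eq[OF j_t[OF that]])
  show "\<exists>n. \<exists>i \<in> types (BD (D n)). onI (BD_arr (j n)) i = i'" if "i' \<in> types (BD Q)" for i'
    using surj_ops that by simp
  have tree: "\<exists>n T'. is_ptree (D n) T' \<and> tmap (j n) T' = T" if T: "is_ptree Q T" for T
  proof -
    obtain n i where "i \<in> types (D n)" "onI (j n) i = root_type Q T"
      using surj_types polynomial_monad.root_type_types[OF Q_monad T] by blast
    from lift_tree[OF T this] show ?thesis by blast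
  qed
  show "\<exists>n. \<exists>T' \<in> ops (BD (D n)). onB (BD_arr (j n)) T' = T" if "T \<in> ops (BD Q)" for T
    using tree that by simp
  show "\<exists>n. \<exists>e \<in> inputs (BD (D n)). onE (BD_arr (j n)) e = e'" if e': "e' \<in> inputs (BD Q)" for e'
  proof -
    obtain T q where T: "e' = (T, q)" "is_ptree Q T" "q \<in> dots T" using e' by auto
    obtain n T' where T': "is_ptree (D n) T'" "tmap (j n) T' = T" using tree[OF T(2)] by blast
    obtain q' where "q' \<in> dots T'" "map (onE (j n)) q' = q" using T(3) unfolding T'(2)[symmetric] dots_map by blast
    then have "(T', q') \<in> inputs (BD (D n))" "onE (BD_arr (j n)) (T', q') = e'" using T T' by simp_all
    then show ?thesis by blast
  qed
  show "\<exists>m \<ge> n. onI (BD_arr (t n m)) x = onI (BD_arr (t n m)) y"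
    if "x \<in> types (BD (D n))" "y \<in> types (BD (D n))" "onI (BD_arr (j n)) x = onI (BD_arr (j n)) y" for n x y
    using inj_ops[of x n y] that by simp
  show "\<exists>m \<ge> n. onB (BD_arr (t n m)) x = onB (BD_arr (t n m)) y"
    if "x \<in> ops (BD (D n))" "y \<in> ops (BD (D n))" "onB (BD_arr (j n)) x = onB (BD_arr (j n)) y" for n x y
    using inj_tree[of n x y] that by simp
qed

end

text \<open>A monad renamed along injections is a colimit of a constant sequence.\<close>

lemma rename_pm_arrows:
  assumes P: "polynomial_monad P"
    and k: "\<And>x. onI k (onI h x) = x" "\<And>x. onB k (onB h x) = x" "\<And>x. onE k (onE h x) = x"
  shows "pm_arrow P (rename_pm h k P) h" "pm_arrow (rename_pm h k P) P k"
proof -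
  interpret P: polynomial_monad P by fact
  have e: "onE h x = onE h y \<longleftrightarrow> x = y" for x y using k(3) by metis
  have b: "onB h x = onB h y \<longleftrightarrow> x = y" for x y using k(2) by metis
  have i: "onI h x = onI h y \<longleftrightarrow> x = y" for x y using k(1) by metis
  have "pm_arrow_axioms P (rename_pm h k P) h"
    by unfold_locales (auto simp: rename_pm_def k b e)
  then interpret C: pm_cocone "\<lambda>_. P" "\<lambda>_ _. id_arr" "rename_pm h k P" "\<lambda>_. h"
    by (intro pm_cocone.intro P.id_arrow) (auto simp: arr_eq_def rename_pm_def i b)
  show "pm_arrow P (rename_pm h k P) h" by (rule C.j_arrow)
  show "pm_arrow (rename_pm h k P) P k"
    by (rule C.arrow_out[OF P.id_arrow]) (simp add: arr_eq_def k)
qed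

section \<open>The trivial monad and arrows out of it\<close>

lemma trivial_monad: "polynomial_monad (trivial_pm a)"
proof -
  have "fib (trivial_pm a) a = {a}" by (auto simp: fib_def trivial_pm_def)
  then show ?thesis
    by unfold_locales (auto simp: composable_def bij_betw_def inj_on_def trivial_pm_def Plus_def)
qed

text \<open>An arrow out of the trivial monad is a choice of a type: preservation of units forces
  the operation, whose fibre has one element. The base points and the suspension
  \<open>susp0\<close> are all of this form.\<close>

lemma (in polynomial_monad) trivial_arrow:
  assumes i: "i \<in> types P" and e: "fib P (unt P i) = {e}"
  shows "pm_arrow (trivial_pm a) P \<lparr>onI = \<lambda>_. i, onB = \<lambda>_. unt P i, onE = \<lambda>_. e\<rparr>"
proof -
  have e': "e \<in> inputs P" "opr P e = unt P i" using e by (auto simp: fib_def)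
  have s: "src P e = i" using fib_unt[OF i] e by auto
  have f: "fib (trivial_pm a) a = {a}" by (auto simp: fib_def trivial_pm_def)
  have u: "sub P (unt P i) e = unt P i" "inner P (unt P i) e e = e"
    using sub_unt_left[OF unt_op[OF i], of e] tgt_unt[OF i] e by auto
  show ?thesis
  proof (intro pm_arrow.intro pm_arrow_axioms.intro trivial_monad polynomial_monad_axioms)
    show "\<exists>!x. x \<in> inputs (trivial_pm a) \<and> opr (trivial_pm a) x = b \<and>
        onE \<lparr>onI = \<lambda>_. i, onB = \<lambda>_. unt P i, onE = \<lambda>_. e\<rparr> x = y"
      if "b \<in> ops (trivial_pm a)" "y \<in> inputs P" "opr P y = onB \<lparr>onI = \<lambda>_. i, onB = \<lambda>_. unt P i, onE = \<lambda>_. e\<rparr> b" for b y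
    proof -
      have "y \<in> fib P (unt P i)" using that by (simp add: fib_def)
      then show ?thesis using that(1) e by (auto simp: trivial_pm_def)
    qed
  qed (use i e' s u f in \<open>auto simp: trivial_pm_def composable_def unt_op tgt_unt fib_def\<close>)
qed

text \<open>The unit of \<open>BD\<close> at the only operation is the one-dot tree, and for the
  trivial monad this is the linear tree with one dot. So \<open>susp0\<close> is the arrow that
  \<open>trivial_arrow\<close> assigns to the type \<open>a\<close>.\<close>

lemma susp0_arrow: "pm_arrow (trivial_pm a) (BD (trivial_pm a)) (susp0 a)"
proof -
  interpret T: polynomial_monad "trivial_pm a" by (rule trivial_monad)
  interpret B: polynomial_monad "BD (trivial_pm a)" by (rule T.BD_monad)
  have a: "a \<in> types (BD (trivial_pm a))" "a \<in> ops (trivial_pm a)" by (simp_all add: trivial_pm_def)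
  have f: "fib (trivial_pm a) a = {a}" by (auto simp: fib_def trivial_pm_def)
  have o: "one_dot_tree (trivial_pm a) a = Dot a {|(a, Unit a)|}"
  proof -
    have "{(a, Unit a)} = fset {|(a, Unit a)|}" by simp
    then have "Abs_fset {(a, Unit a)} = {|(a, Unit a)|}" by (metis fset_inverse)
    then show ?thesis by (simp add: one_dot_tree_def f) (simp add: trivial_pm_def)
  qed
  have "fib (BD (trivial_pm a)) (unt (BD (trivial_pm a)) a) = {(Dot a {|(a, Unit a)|}, [])}"
    using T.one_dot_ptree[OF a(2), unfolded o] T.dots_one_dot[OF a(2), unfolded o]
    by (intro set_eqI) (simp add: fib_BD o)
  from B.trivial_arrow[OF a(1) this] show ?thesis by (simp add: susp0_def o)
qed

section \<open>Colimits of sequences of sets\<close>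

lemma shift_add: "shift f n (k + l) x = shift f (n + k) l (shift f n k x)"
  by (induction l) (simp_all add: add.assoc)

lemma colim_equiv: "equiv (SIGMA n:UNIV. A n) (colim_rel A f)"
proof (rule equivI)
  show "colim_rel A f \<subseteq> (SIGMA n:UNIV. A n) \<times> (SIGMA n:UNIV. A n)" by (auto simp: colim_rel_def)
  show "refl_on (SIGMA n:UNIV. A n) (colim_rel A f)" by (auto simp: refl_on_def colim_rel_def)
  show "sym (colim_rel A f)" by (auto simp: sym_def colim_rel_def) metis
  show "trans (colim_rel A f)"
  proof (rule transI)
    fix a b c assume "(a, b) \<in> colim_rel A f" "(b, c) \<in> colim_rel A f"
    then obtain n x m y p z k l k' l' where *: "a = (n, x)" "b = (m, y)" "c = (p, z)" "x \<in> A n" "z \<in> A p"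
      "n + k = m + l" "shift f n k x = shift f m l y" "m + k' = p + l'" "shift f m k' y = shift f p l' z"
      by (fastforce simp: colim_rel_def)
    have "shift f n (k + k') x = shift f (m + l) k' (shift f m l y)" by (simp add: shift_add * flip: *(6))
    also have "\<dots> = shift f m (k' + l) y" by (simp add: add.commute[of k'] flip: shift_add)
    also have "\<dots> = shift f p (l' + l) z" unfolding shift_add by (simp add: *)
    finally have "shift f n (k + k') x = shift f p (l' + l) z" .
    moreover have "n + (k + k') = p + (l' + l)" using *(6,8) by simp
    ultimately show "(a, c) \<in> colim_rel A f"
      using *(4,5) unfolding colim_rel_def *(1,3) by blast
  qed
qed

lemma colim_in_eq_iff:
  assumes "x \<in> A n" "y \<in> A m"
  shows "colim_in A f n x = colim_in A f m y \<longleftrightarrow> (\<exists>k l. n + k = m + l \<and> shift f n k x = shift f m l y)"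
proof -
  have "colim_in A f n x = colim_in A f m y \<longleftrightarrow> ((n, x), (m, y)) \<in> colim_rel A f"
    unfolding colim_in_def using assms by (intro eq_equiv_class_iff[OF colim_equiv]) auto
  then show ?thesis using assms by (simp add: colim_rel_def)
qed

lemma colim_iff: "z \<in> colim A f \<longleftrightarrow> (\<exists>n. \<exists>x \<in> A n. z = colim_in A f n x)"
  by (auto simp: colim_def colim_in_def quotient_def)


section \<open>Opetopes\<close>

lemma dec_enc: "dec \<circ>\<^sub>a enc = id_arr"
  by (auto simp: arr_comp_def dec_def enc_def id_arr_def fun_eq_iff)

lemma id_arr_comp [simp]: "id_arr \<circ>\<^sub>a h = h" "h \<circ>\<^sub>a id_arr = h"
  by (cases h, simp add: arr_comp_def id_arr_def)+

lemma dec_enc_comp: "dec \<circ>\<^sub>a enc \<circ>\<^sub>a h = h"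
  by (simp add: dec_enc flip: arr_comp_assoc)

lemma opetopic_monad: "polynomial_monad (opetopic n)"
proof (induction n)
  case (Suc n)
  \<comment> \<open>Being an arrow includes that the codomain is a monad, which is the fact wanted
    here.\<close>
  have "pm_arrow (BD (opetopic n)) (opetopic (Suc n)) enc"
    unfolding opetopic.simps
    by (rule rename_pm_arrows(1)[OF polynomial_monad.BD_monad[OF Suc]]) (auto simp: enc_def dec_def split: prod.splits)
  then show ?case by (rule pm_arrow.axioms(2))
qed (simp add: trivial_monad)

interpretation opetopic: polynomial_monad "opetopic n" for n by (rule opetopic_monad)

lemma
  shows enc_arrow: "pm_arrow (BD (opetopic n)) (opetopic (Suc n)) enc"
    and dec_arrow: "pm_arrow (opetopic (Suc n)) (BD (opetopic n)) dec"
  unfolding opetopic.simps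
  by (rule rename_pm_arrows[OF opetopic.BD_monad]; auto simp: enc_def dec_def split: prod.splits)+

text \<open>This composite is controlled on carriers only, as \<open>dec\<close> forgets the shape
  of a cell; \<open>dec_enc\<close>, by contrast, is an equality of arrows.\<close>

lemma enc_dec: "arr_eq (opetopic (Suc n)) (enc \<circ>\<^sub>a dec) id_arr"
  by (auto simp: arr_eq_def rename_pm_def enc_def dec_def)

lemma suspension_arrow: "pm_arrow (opetopic n) (opetopic (Suc n)) (suspension n)"
proof (induction n)
  case 0
  show ?case using pm_arrow_comp[OF susp0_arrow enc_arrow[of 0, simplified]] by simp
next
  case (Suc n)
  show ?case
    unfolding suspension.simps
    using pm_arrow_comp[OF pm_arrow_comp[OF dec_arrow pm_arrow.BD_arrow[OF Suc]] enc_arrow] .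
qed

text \<open>The value \<open>id_arr\<close> in the second equation serves the case
  \<open>n = Suc m\<close>, where it is the identity of stage \<open>n\<close>; for larger
  \<open>n\<close> it is a mere default.\<close>

primrec susp_to :: "nat \<Rightarrow> nat \<Rightarrow> cell_arr" where
  "susp_to n 0 = id_arr"
| "susp_to n (Suc m) = (if n \<le> m then suspension m \<circ>\<^sub>a susp_to n m else id_arr)"

lemma susp_to_refl [simp]: "susp_to n n = id_arr"
  by (cases n) simp_all

lemma susp_to_shift:
  "onI (susp_to n (n + k)) = shift (\<lambda>n. onI (suspension n)) n k"
  "onE (susp_to n (n + k)) = shift (\<lambda>n. onE (suspension n)) n k"
  by (induction k) (simp_all add: fun_eq_iff)

lemma susp_to_arrow: "n \<le> m \<Longrightarrow> pm_arrow (opetopic n) (opetopic m) (susp_to n m)"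
proof (induction m rule: dec_induct)
  case base
  show ?case using opetopic.id_arrow by simp
next
  case (step m)
  then show ?case using pm_arrow_comp[OF step.IH suspension_arrow] by simp
qed

lemma susp_to_comp:
  assumes "n \<le> m" "m \<le> p"
  shows "susp_to m p \<circ>\<^sub>a susp_to n m = susp_to n p"
  using assms(2)
proof (induction p rule: dec_induct)
  case (step p)
  then show ?case using assms(1) by (simp add: arr_comp_assoc)
qed simp

text \<open>From its second term on, the sequence of opetopic monads is the image of the whole
  sequence under \<open>BD\<close>, up to the renaming of cells. This shift is the source of the
  structure map on \<open>P_inf\<close>.\<close>

lemma susp_to_Suc:
  "n \<le> m \<Longrightarrow> arr_eq (opetopic (Suc n)) (susp_to (Suc n) (Suc m)) (enc \<circ>\<^sub>a BD_arr (susp_to n m) \<circ>\<^sub>a dec)"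
proof (induction m rule: dec_induct)
  case base
  have "BD_arr (id_arr :: cell_arr) = id_arr"
    by (auto simp: BD_arr_def id_arr_def ptree.map_id0 fun_eq_iff)
  then show ?case using arr_eq_sym[OF enc_dec] by simp
next
  case (step m)
  have "arr_eq (opetopic (Suc n)) (suspension (Suc m) \<circ>\<^sub>a susp_to (Suc n) (Suc m))
      (suspension (Suc m) \<circ>\<^sub>a enc \<circ>\<^sub>a BD_arr (susp_to n m) \<circ>\<^sub>a dec)"
    by (rule arr_eq_post[OF step.IH])
  moreover have "suspension (Suc m) \<circ>\<^sub>a enc \<circ>\<^sub>a BD_arr (susp_to n m) \<circ>\<^sub>a dec =
      enc \<circ>\<^sub>a BD_arr (suspension m \<circ>\<^sub>a susp_to n m) \<circ>\<^sub>a dec"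
    by (simp add: BD_arr_comp arr_comp_assoc dec_enc_comp)
  ultimately show ?case using step.hyps by simp
qed

lemma types_opetopic_Suc: "types (opetopic (Suc n)) = ops (opetopic n)"
  by (simp add: rename_pm_def enc_def)

lemma onI_suspension_Suc: "onI (suspension (Suc n)) = onB (suspension n)"
  by (simp add: enc_def dec_def)

lemma onI_susp_to_Suc: "n \<le> m \<Longrightarrow> onI (susp_to (Suc n) (Suc m)) = onB (susp_to n m)"
proof (induction m rule: dec_induct)
  case (step m)
  then show ?case by (simp add: onI_suspension_Suc del: suspension.simps)
qed simp

lemma shift_common:
  "(\<exists>k l. (n::nat) + k = m + l \<and> R (n + k) (m + l)) \<longleftrightarrow> (\<exists>p. n \<le> p \<and> m \<le> p \<and> R p p)"
  by (metis le_Suc_ex le_add1)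

section \<open>Equality of representatives in the colimits\<close>

lemma in_type_eq_iff:
  assumes "x \<in> types (opetopic n)" "y \<in> types (opetopic m)"
  shows "in_type n x = in_type m y \<longleftrightarrow> (\<exists>p. n \<le> p \<and> m \<le> p \<and> onI (susp_to n p) x = onI (susp_to m p) y)"
  unfolding in_type_def colim_in_eq_iff[of x "\<lambda>n. types (opetopic n)", OF assms] susp_to_shift[symmetric]
  by (rule shift_common)

lemma in_input_eq_iff:
  assumes "x \<in> inputs (opetopic n)" "y \<in> inputs (opetopic m)"
  shows "in_input n x = in_input m y \<longleftrightarrow> (\<exists>p. n \<le> p \<and> m \<le> p \<and> onE (susp_to n p) x = onE (susp_to m p) y)"
  unfolding in_input_def colim_in_eq_iff[of x "\<lambda>n. inputs (opetopic n)", OF assms] susp_to_shift[symmetric]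
  by (rule shift_common)

text \<open>An operation of stage \<open>n\<close> is a type of stage \<open>Suc n\<close>, so the
  stages in \<open>in_type_eq_iff\<close> are shifted by one; being positive, they can be shifted
  back.\<close>

lemma in_op_eq_iff:
  assumes "x \<in> ops (opetopic n)" "y \<in> ops (opetopic m)"
  shows "in_op n x = in_op m y \<longleftrightarrow> (\<exists>p. n \<le> p \<and> m \<le> p \<and> onB (susp_to n p) x = onB (susp_to m p) y)"
proof -
  have "in_op n x = in_op m y \<longleftrightarrow>
      (\<exists>p. Suc n \<le> p \<and> Suc m \<le> p \<and> onI (susp_to (Suc n) p) x = onI (susp_to (Suc m) p) y)"
    unfolding in_op_def using assms by (intro in_type_eq_iff) (simp_all add: types_opetopic_Suc del: opetopic.simps)
  also have "\<dots> \<longleftrightarrow> (\<exists>p. n \<le> p \<and> m \<le> p \<and> onB (susp_to n p) x = onB (susp_to m p) y)"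
  proof -
    have "(\<exists>p. Suc n \<le> p \<and> Suc m \<le> p \<and> R p) \<longleftrightarrow> (\<exists>p. n \<le> p \<and> m \<le> p \<and> R (Suc p))" for R :: "nat \<Rightarrow> bool"
      by (metis Suc_le_D Suc_le_mono)
    then show ?thesis by (simp add: onI_susp_to_Suc cong: conj_cong del: susp_to.simps)
  qed
  finally show ?thesis .
qed

lemma in_stable_simps [simp]:
  "onI (in_stable n) = in_type n" "onB (in_stable n) = in_op n" "onE (in_stable n) = in_input n"
  by (simp_all add: in_stable_def)

lemma
  assumes "n \<le> m"
  shows in_type_susp: "x \<in> types (opetopic n) \<Longrightarrow> in_type m (onI (susp_to n m) x) = in_type n x"
    and in_op_susp: "b \<in> ops (opetopic n) \<Longrightarrow> in_op m (onB (susp_to n m) b) = in_op n b"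
    and in_input_susp: "e \<in> inputs (opetopic n) \<Longrightarrow> in_input m (onE (susp_to n m) e) = in_input n e"
proof -
  interpret t: pm_arrow "opetopic n" "opetopic m" "susp_to n m" using susp_to_arrow[OF assms] .
  show "in_type m (onI (susp_to n m) x) = in_type n x" if "x \<in> types (opetopic n)"
    unfolding in_type_eq_iff[OF t.onI_type[OF that] that] using assms by (intro exI[of _ m]) simp
  show "in_op m (onB (susp_to n m) b) = in_op n b" if "b \<in> ops (opetopic n)"
    unfolding in_op_eq_iff[OF t.onB_op[OF that] that] using assms by (intro exI[of _ m]) simp
  show "in_input m (onE (susp_to n m) e) = in_input n e" if "e \<in> inputs (opetopic n)"
    unfolding in_input_eq_iff[OF t.onE_input[OF that] that] using assms by (intro exI[of _ m]) simp
qed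


section \<open>Stable opetopes\<close>

lemma Z_inf_type: "x \<in> types (opetopic n) \<Longrightarrow> in_type n x \<in> Z_inf"
  unfolding Z_inf_def in_type_def colim_iff by blast

lemma Z_inf_op: "b \<in> ops (opetopic n) \<Longrightarrow> in_op n b \<in> Z_inf"
  unfolding in_op_def by (rule Z_inf_type) (simp add: types_opetopic_Suc del: opetopic.simps)

lemma Z_bar_inf_input: "e \<in> inputs (opetopic n) \<Longrightarrow> in_input n e \<in> Z_bar_inf"
  unfolding Z_bar_inf_def in_input_def colim_iff by blast

lemma Z_inf_typeE:
  assumes "z \<in> Z_inf" obtains n x where "x \<in> types (opetopic n)" "in_type n x = z"
  using assms unfolding Z_inf_def in_type_def colim_iff by blast

text \<open>After one suspension a type of stage \<open>n\<close> is a type of stage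
  \<open>Suc n\<close>, that is, an operation of stage \<open>n\<close>. This is why the same set
  can serve as types and as operations of \<open>P_inf\<close>, although \<open>Star\<close> at
  stage 0 has nothing below it.\<close>

lemma Z_inf_opE:
  assumes "z \<in> Z_inf" obtains n b where "b \<in> ops (opetopic n)" "in_op n b = z"
proof -
  obtain n x where x: "x \<in> types (opetopic n)" "in_type n x = z" using assms by (rule Z_inf_typeE)
  interpret s: pm_arrow "opetopic n" "opetopic (Suc n)" "susp_to n (Suc n)" by (rule susp_to_arrow) simp
  have "onI (susp_to n (Suc n)) x \<in> ops (opetopic n)" using s.onI_type[OF x(1)] unfolding types_opetopic_Suc .
  moreover have "in_op n (onI (susp_to n (Suc n)) x) = z"
    unfolding in_op_def using in_type_susp[OF _ x(1), of "Suc n"] x(2) by simp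
  ultimately show thesis by (rule that)
qed

lemma Z_bar_inf_inputE:
  assumes "z \<in> Z_bar_inf" obtains n e where "e \<in> inputs (opetopic n)" "in_input n e = z"
  using assms unfolding Z_bar_inf_def in_input_def colim_iff by blast

lemma in_type_common:
  assumes "x \<in> types (opetopic n)" "y \<in> types (opetopic m)" "in_type n x = in_type m y"
  obtains p where "n \<le> p" "m \<le> p" "\<And>q. p \<le> q \<Longrightarrow> onI (susp_to n q) x = onI (susp_to m q) y"
proof -
  obtain p where p: "n \<le> p" "m \<le> p" "onI (susp_to n p) x = onI (susp_to m p) y"
    using assms(3) unfolding in_type_eq_iff[OF assms(1,2)] by blast
  have "onI (susp_to n q) x = onI (susp_to m q) y" if "p \<le> q" for q
    using p(3) arg_cong[OF susp_to_comp[OF p(1) that], of "\<lambda>h. onI h x"]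
      arg_cong[OF susp_to_comp[OF p(2) that], of "\<lambda>h. onI h y"] by simp
  with p that show thesis by blast
qed

lemma in_op_common:
  assumes "x \<in> ops (opetopic n)" "y \<in> ops (opetopic m)" "in_op n x = in_op m y"
  obtains p where "n \<le> p" "m \<le> p" "\<And>q. p \<le> q \<Longrightarrow> onB (susp_to n q) x = onB (susp_to m q) y"
proof -
  obtain p where p: "n \<le> p" "m \<le> p" "onB (susp_to n p) x = onB (susp_to m p) y"
    using assms(3) unfolding in_op_eq_iff[OF assms(1,2)] by blast
  have "onB (susp_to n q) x = onB (susp_to m q) y" if "p \<le> q" for q
    using p(3) arg_cong[OF susp_to_comp[OF p(1) that], of "\<lambda>h. onB h x"]
      arg_cong[OF susp_to_comp[OF p(2) that], of "\<lambda>h. onB h y"] by simp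
  with p that show thesis by blast
qed

lemma in_input_common:
  assumes "x \<in> inputs (opetopic n)" "y \<in> inputs (opetopic m)" "in_input n x = in_input m y"
  obtains p where "n \<le> p" "m \<le> p" "\<And>q. p \<le> q \<Longrightarrow> onE (susp_to n q) x = onE (susp_to m q) y"
proof -
  obtain p where p: "n \<le> p" "m \<le> p" "onE (susp_to n p) x = onE (susp_to m p) y"
    using assms(3) unfolding in_input_eq_iff[OF assms(1,2)] by blast
  have "onE (susp_to n q) x = onE (susp_to m q) y" if "p \<le> q" for q
    using p(3) arg_cong[OF susp_to_comp[OF p(1) that], of "\<lambda>h. onE h x"]
      arg_cong[OF susp_to_comp[OF p(2) that], of "\<lambda>h. onE h y"] by simp
  with p that show thesis by blast
qed

text \<open>Well-definedness of the definite description: two representatives agree at a common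
  later stage, and suspensions preserve sources. The other structure maps are treated in the same
  way, with several representatives brought to one stage.\<close>

lemma P_inf_src:
  assumes e: "e \<in> inputs (opetopic n)"
  shows "src P_inf (in_input n e) = in_type n (src (opetopic n) e)"
proof -
  have "in_type m (src (opetopic m) f) = in_type n (src (opetopic n) e)"
    if f: "f \<in> inputs (opetopic m)" "in_input n e = in_input m f" for m f
  proof -
    obtain p where p: "n \<le> p" "m \<le> p" "onE (susp_to n p) e = onE (susp_to m p) f"
      using in_input_common[OF e f] by (metis order.refl)
    interpret n: pm_arrow "opetopic n" "opetopic p" "susp_to n p" using susp_to_arrow[OF p(1)] .
    interpret m: pm_arrow "opetopic m" "opetopic p" "susp_to m p" using susp_to_arrow[OF p(2)] .
    show ?thesis
      using in_type_susp[OF p(1) opetopic.src_type[OF e]] in_type_susp[OF p(2) opetopic.src_type[OF f(1)]]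
        n.arr_src[OF e] m.arr_src[OF f(1)] p(3) by simp
  qed
  then show ?thesis unfolding P_inf_def pm.simps using e by (intro the_equality) blast+
qed

lemma P_inf_opr:
  assumes e: "e \<in> inputs (opetopic n)"
  shows "opr P_inf (in_input n e) = in_op n (opr (opetopic n) e)"
proof -
  have "in_op m (opr (opetopic m) f) = in_op n (opr (opetopic n) e)"
    if f: "f \<in> inputs (opetopic m)" "in_input n e = in_input m f" for m f
  proof -
    obtain p where p: "n \<le> p" "m \<le> p" "onE (susp_to n p) e = onE (susp_to m p) f"
      using in_input_common[OF e f] by (metis order.refl)
    interpret n: pm_arrow "opetopic n" "opetopic p" "susp_to n p" using susp_to_arrow[OF p(1)] .
    interpret m: pm_arrow "opetopic m" "opetopic p" "susp_to m p" using susp_to_arrow[OF p(2)] .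
    show ?thesis
      using in_op_susp[OF p(1) opetopic.opr_op[OF e]] in_op_susp[OF p(2) opetopic.opr_op[OF f(1)]]
        n.arr_opr[OF e] m.arr_opr[OF f(1)] p(3) by simp
  qed
  then show ?thesis unfolding P_inf_def pm.simps using e by (intro the_equality) blast+
qed

lemma P_inf_tgt:
  assumes e: "e \<in> ops (opetopic n)"
  shows "tgt P_inf (in_op n e) = in_type n (tgt (opetopic n) e)"
proof -
  have "in_type m (tgt (opetopic m) f) = in_type n (tgt (opetopic n) e)"
    if f: "f \<in> ops (opetopic m)" "in_op n e = in_op m f" for m f
  proof -
    obtain p where p: "n \<le> p" "m \<le> p" "onB (susp_to n p) e = onB (susp_to m p) f"
      using in_op_common[OF e f] by (metis order.refl)
    interpret n: pm_arrow "opetopic n" "opetopic p" "susp_to n p" using susp_to_arrow[OF p(1)] .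
    interpret m: pm_arrow "opetopic m" "opetopic p" "susp_to m p" using susp_to_arrow[OF p(2)] .
    show ?thesis
      using in_type_susp[OF p(1) opetopic.tgt_type[OF e]] in_type_susp[OF p(2) opetopic.tgt_type[OF f(1)]]
        n.arr_tgt[OF e] m.arr_tgt[OF f(1)] p(3) by simp
  qed
  then show ?thesis unfolding P_inf_def pm.simps using e by (intro the_equality) blast+
qed

lemma P_inf_unt:
  assumes e: "e \<in> types (opetopic n)"
  shows "unt P_inf (in_type n e) = in_op n (unt (opetopic n) e)"
proof -
  have "in_op m (unt (opetopic m) f) = in_op n (unt (opetopic n) e)"
    if f: "f \<in> types (opetopic m)" "in_type n e = in_type m f" for m f
  proof -
    obtain p where p: "n \<le> p" "m \<le> p" "onI (susp_to n p) e = onI (susp_to m p) f"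
      using in_type_common[OF e f] by (metis order.refl)
    interpret n: pm_arrow "opetopic n" "opetopic p" "susp_to n p" using susp_to_arrow[OF p(1)] .
    interpret m: pm_arrow "opetopic m" "opetopic p" "susp_to m p" using susp_to_arrow[OF p(2)] .
    show ?thesis
      using in_op_susp[OF p(1) opetopic.unt_op[OF e]] in_op_susp[OF p(2) opetopic.unt_op[OF f(1)]]
        n.arr_unt[OF e] m.arr_unt[OF f(1)] p(3) by simp
  qed
  then show ?thesis unfolding P_inf_def pm.simps using e by (intro the_equality) blast+
qed

lemma composable_common:
  assumes C: "composable (opetopic n) c e" and C': "composable (opetopic m) c' e'"
    and eq: "in_op n c = in_op m c'" "in_input n e = in_input m e'"
  obtains p where "n \<le> p" "m \<le> p" "\<And>q. p \<le> q \<Longrightarrow> onB (susp_to n q) c = onB (susp_to m q) c'"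
    "\<And>q. p \<le> q \<Longrightarrow> onE (susp_to n q) e = onE (susp_to m q) e'"
proof -
  have ce: "c \<in> ops (opetopic n)" "e \<in> inputs (opetopic n)" "c' \<in> ops (opetopic m)" "e' \<in> inputs (opetopic m)"
    using C C' by (auto simp: composable_def)
  obtain p1 where p1: "n \<le> p1" "m \<le> p1" "\<And>q. p1 \<le> q \<Longrightarrow> onB (susp_to n q) c = onB (susp_to m q) c'"
    using in_op_common[OF ce(1,3) eq(1)] by blast
  obtain p2 where p2: "n \<le> p2" "m \<le> p2" "\<And>q. p2 \<le> q \<Longrightarrow> onE (susp_to n q) e = onE (susp_to m q) e'"
    using in_input_common[OF ce(2,4) eq(2)] by blast
  show thesis by (rule that[of "max p1 p2"]) (use p1 p2 in auto)
qed

lemma P_inf_sub: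
  assumes C: "composable (opetopic n) c e"
  shows "sub P_inf (in_op n c) (in_input n e) = in_op n (sub (opetopic n) c e)"
proof -
  have "in_op m (sub (opetopic m) c' e') = in_op n (sub (opetopic n) c e)"
    if C': "composable (opetopic m) c' e'" "in_op n c = in_op m c'" "in_input n e = in_input m e'" for m c' e'
  proof -
    obtain p where p: "n \<le> p" "m \<le> p" "onB (susp_to n p) c = onB (susp_to m p) c'"
      "onE (susp_to n p) e = onE (susp_to m p) e'"
      using composable_common[OF C C'] by (metis order.refl)
    interpret n: pm_arrow "opetopic n" "opetopic p" "susp_to n p" using susp_to_arrow[OF p(1)] .
    interpret m: pm_arrow "opetopic m" "opetopic p" "susp_to m p" using susp_to_arrow[OF p(2)] .
    show ?thesis
      using in_op_susp[OF p(1) opetopic.sub_op[OF C]] in_op_susp[OF p(2) opetopic.sub_op[OF C'(1)]]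
        n.arr_sub[OF C] m.arr_sub[OF C'(1)] p(3,4) by simp
  qed
  then show ?thesis unfolding P_inf_def pm.simps using C by (intro the_equality) blast+
qed

lemma P_inf_outer:
  assumes C: "composable (opetopic n) c e" and x: "x \<in> fib (opetopic n) (opr (opetopic n) e) - {e}"
  shows "outer P_inf (in_op n c) (in_input n e) (in_input n x) = in_input n (outer (opetopic n) c e x)"
proof -
  have "in_input m (outer (opetopic m) c' e' x') = in_input n (outer (opetopic n) c e x)"
    if C': "composable (opetopic m) c' e'" "in_op n c = in_op m c'" "in_input n e = in_input m e'"
      and x': "x' \<in> fib (opetopic m) (opr (opetopic m) e') - {e'}" "in_input n x = in_input m x'" for m c' e' x'
  proof -
    obtain p1 where p1: "n \<le> p1" "m \<le> p1" "\<And>q. p1 \<le> q \<Longrightarrow> onB (susp_to n q) c = onB (susp_to m q) c'"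
      "\<And>q. p1 \<le> q \<Longrightarrow> onE (susp_to n q) e = onE (susp_to m q) e'" using composable_common[OF C C'] by blast
    have xi: "x \<in> inputs (opetopic n)" "x' \<in> inputs (opetopic m)" using x x' by (auto simp: fib_def)
    obtain p2 where p2: "\<And>q. p2 \<le> q \<Longrightarrow> onE (susp_to n q) x = onE (susp_to m q) x'"
      using in_input_common[OF xi x'(2)] by blast
    define p where "p = max p1 p2"
    have p: "n \<le> p" "m \<le> p" "onB (susp_to n p) c = onB (susp_to m p) c'"
      "onE (susp_to n p) e = onE (susp_to m p) e'" "onE (susp_to n p) x = onE (susp_to m p) x'"
      using p1 p2 by (auto simp: p_def)
    interpret n: pm_arrow "opetopic n" "opetopic p" "susp_to n p" using susp_to_arrow[OF p(1)] .
    interpret m: pm_arrow "opetopic m" "opetopic p" "susp_to m p" using susp_to_arrow[OF p(2)] .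
    have "outer (opetopic n) c e x \<in> inputs (opetopic n)" "outer (opetopic m) c' e' x' \<in> inputs (opetopic m)"
      using opetopic.outer_fib[OF C, of x] opetopic.outer_fib[OF C'(1), of x'] x x' by (auto simp: fib_def)
    from in_input_susp[OF p(1) this(1)] in_input_susp[OF p(2) this(2)] show ?thesis
      using n.arr_outer[OF C x] m.arr_outer[OF C'(1) x'(1)] p(3-5) by simp
  qed
  then show ?thesis unfolding P_inf_def pm.simps using C x by (intro the_equality) blast+
qed

lemma P_inf_inner:
  assumes C: "composable (opetopic n) c e" and x: "x \<in> fib (opetopic n) c"
  shows "inner P_inf (in_op n c) (in_input n e) (in_input n x) = in_input n (inner (opetopic n) c e x)"
proof -
  have "in_input m (inner (opetopic m) c' e' x') = in_input n (inner (opetopic n) c e x)"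
    if C': "composable (opetopic m) c' e'" "in_op n c = in_op m c'" "in_input n e = in_input m e'"
      and x': "x' \<in> fib (opetopic m) c'" "in_input n x = in_input m x'" for m c' e' x'
  proof -
    obtain p1 where p1: "n \<le> p1" "m \<le> p1" "\<And>q. p1 \<le> q \<Longrightarrow> onB (susp_to n q) c = onB (susp_to m q) c'"
      "\<And>q. p1 \<le> q \<Longrightarrow> onE (susp_to n q) e = onE (susp_to m q) e'" using composable_common[OF C C'] by blast
    have xi: "x \<in> inputs (opetopic n)" "x' \<in> inputs (opetopic m)" using x x' by (auto simp: fib_def)
    obtain p2 where p2: "\<And>q. p2 \<le> q \<Longrightarrow> onE (susp_to n q) x = onE (susp_to m q) x'"
      using in_input_common[OF xi x'(2)] by blast
    define p where "p = max p1 p2"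
    have p: "n \<le> p" "m \<le> p" "onB (susp_to n p) c = onB (susp_to m p) c'"
      "onE (susp_to n p) e = onE (susp_to m p) e'" "onE (susp_to n p) x = onE (susp_to m p) x'"
      using p1 p2 by (auto simp: p_def)
    interpret n: pm_arrow "opetopic n" "opetopic p" "susp_to n p" using susp_to_arrow[OF p(1)] .
    interpret m: pm_arrow "opetopic m" "opetopic p" "susp_to m p" using susp_to_arrow[OF p(2)] .
    have "inner (opetopic n) c e x \<in> inputs (opetopic n)" "inner (opetopic m) c' e' x' \<in> inputs (opetopic m)"
      using opetopic.inner_fib[OF C, of x] opetopic.inner_fib[OF C'(1), of x'] x x' by (auto simp: fib_def)
    from in_input_susp[OF p(1) this(1)] in_input_susp[OF p(2) this(2)] show ?thesis
      using n.arr_inner[OF C x] m.arr_inner[OF C'(1) x'(1)] p(3-5) by simp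
  qed
  then show ?thesis unfolding P_inf_def pm.simps using C x by (intro the_equality) blast+
qed

lemma P_inf_carriers: "types P_inf = Z_inf" "ops P_inf = Z_inf" "inputs P_inf = Z_bar_inf"
  by (simp_all add: P_inf_def)

text \<open>The pullback condition is the one that needs an argument, since an input over
  \<open>b\<close> may be represented at a stage unrelated to \<open>n\<close>. It is pushed to a
  stage where its operation is the suspension of \<open>b\<close> and brought back to stage
  \<open>n\<close> by the pullback property of the suspension.\<close>

lemma in_stable_axioms: "pm_arrow_axioms (opetopic n) P_inf (in_stable n)"
proof
  fix b f assume b: "b \<in> ops (opetopic n)" and f: "f \<in> inputs P_inf" "opr P_inf f = onB (in_stable n) b"
  obtain m e where e: "e \<in> inputs (opetopic m)" "in_input m e = f"
    using f(1) unfolding P_inf_carriers by (rule Z_bar_inf_inputE)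
  have "in_op m (opr (opetopic m) e) = in_op n b" using P_inf_opr[OF e(1)] e(2) f(2) by simp
  then obtain p where p: "m \<le> p" "n \<le> p" "onB (susp_to m p) (opr (opetopic m) e) = onB (susp_to n p) b"
    using in_op_common[OF opetopic.opr_op[OF e(1)] b] by (metis order.refl)
  interpret n: pm_arrow "opetopic n" "opetopic p" "susp_to n p" using susp_to_arrow[OF p(2)] .
  interpret m: pm_arrow "opetopic m" "opetopic p" "susp_to m p" using susp_to_arrow[OF p(1)] .
  have "opr (opetopic p) (onE (susp_to m p) e) = onB (susp_to n p) b" using m.arr_opr[OF e(1)] p(3) by simp
  from n.pullback[OF b m.onE_input[OF e(1)] this] obtain e0 where e0: "e0 \<in> inputs (opetopic n)"
    "opr (opetopic n) e0 = b" "onE (susp_to n p) e0 = onE (susp_to m p) e" by blast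
  show "\<exists>!e. e \<in> inputs (opetopic n) \<and> opr (opetopic n) e = b \<and> onE (in_stable n) e = f"
  proof (rule ex1I[of _ e0])
    show "e0 \<in> inputs (opetopic n) \<and> opr (opetopic n) e0 = b \<and> onE (in_stable n) e0 = f"
      using e0 in_input_susp[OF p(2) e0(1)] in_input_susp[OF p(1) e(1)] e(2) by simp
    fix e1 assume e1: "e1 \<in> inputs (opetopic n) \<and> opr (opetopic n) e1 = b \<and> onE (in_stable n) e1 = f"
    have "in_input n e1 = in_input n e0"
      using e1 e0 in_input_susp[OF p(2) e0(1)] in_input_susp[OF p(1) e(1)] e(2) by simp
    then obtain q where q: "n \<le> q" "onE (susp_to n q) e1 = onE (susp_to n q) e0"
      using in_input_common e1 e0(1) by (metis order.refl)
    interpret q: pm_arrow "opetopic n" "opetopic q" "susp_to n q" using susp_to_arrow[OF q(1)] .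
    show "e1 = e0" using q.onE_inj[of e1 b e0] e1 e0 q(2) by (simp add: fib_def)
  qed
qed (simp_all add: P_inf_carriers Z_inf_type Z_inf_op Z_bar_inf_input P_inf_src P_inf_opr P_inf_tgt P_inf_unt
    P_inf_sub P_inf_outer P_inf_inner del: Diff_iff)

interpretation P_inf: pm_cocone opetopic susp_to P_inf in_stable
proof (rule pm_cocone.intro)
  show "pm_arrow (opetopic n) (opetopic m) (susp_to n m)" if "n \<le> m" for n m
    using susp_to_arrow[OF that] .
  show "arr_eq (opetopic n) (susp_to m p \<circ>\<^sub>a susp_to n m) (susp_to n p)" if "n \<le> m" "m \<le> p" for n m p
    by (simp add: susp_to_comp[OF that])
  show "pm_arrow_axioms (opetopic n) P_inf (in_stable n)" for n
    by (rule in_stable_axioms)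
  show "arr_eq (opetopic n) (in_stable m \<circ>\<^sub>a susp_to n m) (in_stable n)" if "n \<le> m" for n m
    using in_type_susp[OF that] in_op_susp[OF that] in_input_susp[OF that] by (simp add: arr_eq_def)
  show "\<exists>n. \<exists>i \<in> types (opetopic n). onI (in_stable n) i = z" if "z \<in> types P_inf" for z
    using that unfolding P_inf_carriers in_stable_simps by (metis Z_inf_typeE)
  show "\<exists>n. \<exists>i \<in> ops (opetopic n). onB (in_stable n) i = z" if "z \<in> ops P_inf" for z
    using that unfolding P_inf_carriers in_stable_simps by (metis Z_inf_opE)
  show "\<exists>n. \<exists>i \<in> inputs (opetopic n). onE (in_stable n) i = z" if "z \<in> inputs P_inf" for z
    using that unfolding P_inf_carriers in_stable_simps by (metis Z_bar_inf_inputE)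
  show "\<exists>m \<ge> n. onI (susp_to n m) x = onI (susp_to n m) y"
    if "x \<in> types (opetopic n)" "y \<in> types (opetopic n)" "onI (in_stable n) x = onI (in_stable n) y" for n x y
    using that(3) in_type_eq_iff[OF that(1,2)] by auto
  show "\<exists>m \<ge> n. onB (susp_to n m) x = onB (susp_to n m) y"
    if "x \<in> ops (opetopic n)" "y \<in> ops (opetopic n)" "onB (in_stable n) x = onB (in_stable n) y" for n x y
    using that(3) in_op_eq_iff[OF that(1,2)] by auto
qed

interpretation BD_P_inf: pm_cocone "\<lambda>n. BD (opetopic n)" "\<lambda>n m. BD_arr (susp_to n m)" "BD P_inf" "\<lambda>n. BD_arr (in_stable n)"
  by (rule P_inf.BD_cocone)

text \<open>\<open>universal\<close> provides some map \<open>h\<close> with the required values on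
  representatives. Its existence shows that these values do not depend on the representatives, so
  the definite descriptions in \<open>P_inf_struct\<close> return the values of
  \<open>h\<close>.\<close>

lemma P_inf_struct_stage:
  "arr_eq (BD (opetopic n)) (P_inf_struct \<circ>\<^sub>a BD_arr (in_stable n)) (in_stable (Suc n) \<circ>\<^sub>a enc)"
proof -
  have "arr_eq (BD (opetopic n)) ((in_stable (Suc m) \<circ>\<^sub>a enc) \<circ>\<^sub>a BD_arr (susp_to n m)) (in_stable (Suc n) \<circ>\<^sub>a enc)"
    if nm: "n \<le> m" for n m
  proof -
    have "arr_eq (opetopic (Suc n)) (in_stable (Suc m) \<circ>\<^sub>a enc \<circ>\<^sub>a BD_arr (susp_to n m) \<circ>\<^sub>a dec) (in_stable (Suc n))"
      using arr_eq_trans[OF arr_eq_sym[OF arr_eq_post[OF susp_to_Suc[OF nm]]] P_inf.j_t[of "Suc n" "Suc m"]] nm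
      by simp
    from arr_eq_pre[OF enc_arrow this] show ?thesis by (simp add: arr_comp_assoc dec_enc)
  qed
  from BD_P_inf.universal[OF this] obtain h where
    h: "\<And>n. arr_eq (BD (opetopic n)) (h \<circ>\<^sub>a BD_arr (in_stable n)) (in_stable (Suc n) \<circ>\<^sub>a enc)" by blast
  have B: "in_op (Suc n) (onB enc T) = onB h (onB (BD_arr (in_stable n)) T)" if "T \<in> ops (BD (opetopic n))" for n T
    using h[of n] that unfolding arr_eq_def by simp
  have E: "in_input (Suc n) (onE enc M) = onE h (onE (BD_arr (in_stable n)) M)" if "M \<in> inputs (BD (opetopic n))" for n M
    using h[of n] that unfolding arr_eq_def arr_comp_simps comp_def in_stable_simps by metis
  show ?thesis
    unfolding arr_eq_def
  proof (intro conjI ballI)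
    show "onI (P_inf_struct \<circ>\<^sub>a BD_arr (in_stable n)) i = onI (in_stable (Suc n) \<circ>\<^sub>a enc) i" for i
      by (simp add: P_inf_struct_def enc_def in_op_def)
    show "onB (P_inf_struct \<circ>\<^sub>a BD_arr (in_stable n)) T = onB (in_stable (Suc n) \<circ>\<^sub>a enc) T"
      if T: "T \<in> ops (BD (opetopic n))" for T
    proof -
      have "onB P_inf_struct (onB (BD_arr (in_stable n)) T) = onB h (onB (BD_arr (in_stable n)) T)"
        unfolding P_inf_struct_def arr.simps using T B by (intro the_equality) metis+
      then show ?thesis using B[OF T] by simp
    qed
    show "onE (P_inf_struct \<circ>\<^sub>a BD_arr (in_stable n)) M = onE (in_stable (Suc n) \<circ>\<^sub>a enc) M"
      if M: "M \<in> inputs (BD (opetopic n))" for M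
    proof -
      have "onE P_inf_struct (onE (BD_arr (in_stable n)) M) = onE h (onE (BD_arr (in_stable n)) M)"
        unfolding P_inf_struct_def arr.simps using M E by (intro the_equality) metis+
      then show ?thesis using E[OF M] by simp
    qed
  qed
qed

lemma P_inf_struct_arrow: "pm_arrow (BD P_inf) P_inf P_inf_struct"
  by (rule BD_P_inf.arrow_out[OF pm_arrow_comp[OF enc_arrow P_inf.j_arrow] P_inf_struct_stage])

section \<open>Base points, the algebra on \<open>P_inf\<close>, and initiality\<close>

definition const_arr :: "'a \<Rightarrow> 'b \<Rightarrow> ('a, 'a, 'a, 'b, 'b, 'b) arr" where
  "const_arr a b = \<lparr>onI = \<lambda>_. b, onB = \<lambda>_. b, onE = \<lambda>_. b\<rparr>"

text \<open>Base points start at the trivial monad on \<open>unit\<close>, whereas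
  \<open>opetopic 0\<close> is its copy on the cell \<open>Star\<close>. These arrows pass between
  the two copies.\<close>

lemma const_arrow: "pm_arrow (trivial_pm a) (trivial_pm b) (const_arr a b)"
proof -
  interpret T: polynomial_monad "trivial_pm b" by (rule trivial_monad)
  have "fib (trivial_pm b) (unt (trivial_pm b) b) = {b}" by (auto simp: fib_def trivial_pm_def)
  from T.trivial_arrow[OF _ this] show ?thesis by (simp add: const_arr_def trivial_pm_def)
qed

lemma trivial_arr_eq: "arr_eq (trivial_pm a) h k \<longleftrightarrow> onI h a = onI k a \<and> onB h a = onB k a \<and> onE h a = onE k a"
  by (simp add: arr_eq_def trivial_pm_def)

lemma P_inf_pointed_eq: "P_inf_pointed = (P_inf, in_stable 0 \<circ>\<^sub>a const_arr () Star)"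
  by (simp add: P_inf_pointed_def const_arr_def arr_comp_def comp_def)

lemma P_inf_is_pointed: "is_pointed_pm P_inf_pointed"
  unfolding is_pointed_pm_def P_inf_pointed_eq fst_conv snd_conv
  using pm_arrow_comp[OF const_arrow P_inf.j_arrow[of 0, unfolded opetopic.simps]] .

lemma BD_is_pointed: "is_pointed_pm X \<Longrightarrow> is_pointed_pm (BD_pointed X)"
  unfolding is_pointed_pm_def BD_pointed_def fst_conv snd_conv
  by (rule pm_arrow_comp[OF susp0_arrow pm_arrow.BD_arrow])

text \<open>Only the base point remains to be checked. That of \<open>BD P_inf\<close> factors
  through \<open>susp0 Star\<close> at stage 0, which the structure map turns into the suspension of
  stage 0 followed by the inclusion of stage 1, hence into the inclusion of stage 0.\<close>

lemma P_inf_algebra: "is_BD_algebra P_inf_pointed P_inf_struct"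
proof -
  have s: "BD_arr (const_arr () Star) \<circ>\<^sub>a susp0 () = susp0 Star \<circ>\<^sub>a const_arr () Star"
    by (simp add: arr_comp_def BD_arr_def const_arr_def susp0_def comp_def)
  have c: "pm_arrow Id_pm (BD (opetopic 0)) (susp0 Star \<circ>\<^sub>a const_arr () Star)"
    using pm_arrow_comp[OF const_arrow susp0_arrow] by simp
  have "arr_eq Id_pm ((P_inf_struct \<circ>\<^sub>a BD_arr (in_stable 0)) \<circ>\<^sub>a susp0 Star \<circ>\<^sub>a const_arr () Star)
      ((in_stable (Suc 0) \<circ>\<^sub>a enc) \<circ>\<^sub>a susp0 Star \<circ>\<^sub>a const_arr () Star)"
    by (rule arr_eq_pre[OF c P_inf_struct_stage])
  moreover have "arr_eq Id_pm ((in_stable (Suc 0) \<circ>\<^sub>a susp_to 0 (Suc 0)) \<circ>\<^sub>a const_arr () Star)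
      (in_stable 0 \<circ>\<^sub>a const_arr () Star)"
    by (rule arr_eq_pre[OF _ P_inf.j_t]) (use const_arrow[of "()" Star] in simp_all)
  ultimately have "arr_eq Id_pm (P_inf_struct \<circ>\<^sub>a BD_arr (in_stable 0) \<circ>\<^sub>a susp0 Star \<circ>\<^sub>a const_arr () Star)
      (in_stable 0 \<circ>\<^sub>a const_arr () Star)"
    by (simp add: arr_comp_assoc) (rule arr_eq_trans)
  then show ?thesis
    unfolding is_BD_algebra_def is_pointed_arrow_def
    using P_inf_is_pointed BD_is_pointed[OF P_inf_is_pointed] P_inf_struct_arrow
    by (simp add: P_inf_pointed_eq BD_pointed_def BD_arr_comp arr_comp_assoc s)
qed

primrec to_algebra :: "('i, 'b, 'e) pointed_pm \<Rightarrow>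
    ('b, ('i, 'b, 'e) ptree, ('i, 'b, 'e) ptree \<times> 'e list, 'i, 'b, 'e) arr \<Rightarrow> nat \<Rightarrow>
    (cell, cell, cell, 'i, 'b, 'e) arr" where
  "to_algebra X x 0 = snd X \<circ>\<^sub>a const_arr Star ()"
| "to_algebra X x (Suc n) = x \<circ>\<^sub>a BD_arr (to_algebra X x n) \<circ>\<^sub>a dec"

lemma to_algebra_enc: "to_algebra X x (Suc n) \<circ>\<^sub>a enc \<circ>\<^sub>a h = x \<circ>\<^sub>a BD_arr (to_algebra X x n) \<circ>\<^sub>a h"
  by (simp add: arr_comp_assoc dec_enc_comp)

context
  fixes X :: "('i, 'b, 'e) pointed_pm" and x
  assumes X: "is_BD_algebra X x"
begin

lemma
  shows X_pointed: "pm_arrow Id_pm (fst X) (snd X)"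
    and x_arrow: "pm_arrow (BD (fst X)) (fst X) x"
    and x_pointed: "arr_eq Id_pm (x \<circ>\<^sub>a BD_arr (snd X) \<circ>\<^sub>a susp0 ()) (snd X)"
  using X by (simp_all add: is_BD_algebra_def is_pointed_arrow_def is_pointed_pm_def BD_pointed_def)

lemma to_algebra_arrow: "pm_arrow (opetopic n) (fst X) (to_algebra X x n)"
proof (induction n)
  case 0
  show ?case using pm_arrow_comp[OF const_arrow X_pointed] by simp
next
  case (Suc n)
  show ?case
    unfolding to_algebra.simps
    using pm_arrow_comp[OF pm_arrow_comp[OF dec_arrow pm_arrow.BD_arrow[OF Suc]] x_arrow] .
qed

text \<open>At stage 0 this is the condition that \<open>x\<close> preserves base points, since
  \<open>susp0\<close> enters the base point of \<open>BD_pointed X\<close>. \<open>BD\<close>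
  carries the equation from one stage to the next.\<close>

lemma to_algebra_suspension: "arr_eq (opetopic n) (to_algebra X x (Suc n) \<circ>\<^sub>a suspension n) (to_algebra X x n)"
proof (induction n)
  case 0
  have "arr_eq (opetopic 0) (x \<circ>\<^sub>a BD_arr (snd X \<circ>\<^sub>a const_arr Star ()) \<circ>\<^sub>a susp0 Star) (snd X \<circ>\<^sub>a const_arr Star ())"
    using x_pointed unfolding opetopic.simps trivial_arr_eq
    by (simp add: susp0_def const_arr_def)
  then show ?case unfolding suspension.simps to_algebra_enc by simp
next
  case (Suc n)
  have "arr_eq (BD (opetopic n)) (BD_arr (to_algebra X x (Suc n)) \<circ>\<^sub>a BD_arr (suspension n)) (BD_arr (to_algebra X x n))"
    by (rule BD_arr_comp_eq[OF Suc])
  from arr_eq_pre[OF dec_arrow arr_eq_post[OF this]] show ?case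
    unfolding suspension.simps to_algebra_enc by (simp add: arr_comp_assoc)
qed

lemma to_algebra_susp_to:
  "n \<le> m \<Longrightarrow> arr_eq (opetopic n) (to_algebra X x m \<circ>\<^sub>a susp_to n m) (to_algebra X x n)"
proof (induction m rule: dec_induct)
  case (step m)
  have "arr_eq (opetopic n) ((to_algebra X x (Suc m) \<circ>\<^sub>a suspension m) \<circ>\<^sub>a susp_to n m) (to_algebra X x m \<circ>\<^sub>a susp_to n m)"
    by (rule arr_eq_pre[OF susp_to_arrow[OF step.hyps(1)] to_algebra_suspension])
  from arr_eq_trans[OF this step.IH] show ?case
    using step.hyps by (simp add: arr_comp_assoc)
qed simp

lemma algebra_arrow_exists: "\<exists>h. is_BD_algebra_arrow P_inf_pointed P_inf_struct X x h"
proof -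
  obtain h where h: "\<And>n. arr_eq (opetopic n) (h \<circ>\<^sub>a in_stable n) (to_algebra X x n)"
    using P_inf.universal[OF to_algebra_susp_to] by blast
  have H: "pm_arrow P_inf (fst X) h" by (rule P_inf.arrow_out[OF to_algebra_arrow h])
  have "arr_eq Id_pm ((h \<circ>\<^sub>a in_stable 0) \<circ>\<^sub>a const_arr () Star) ((snd X \<circ>\<^sub>a const_arr Star ()) \<circ>\<^sub>a const_arr () Star)"
    using arr_eq_pre[OF _ h[of 0], of Id_pm "const_arr () Star"] const_arrow[of "()" Star] by simp
  moreover have "arr_eq Id_pm ((snd X \<circ>\<^sub>a const_arr Star ()) \<circ>\<^sub>a const_arr () Star) (snd X)"
    unfolding trivial_arr_eq by (simp add: const_arr_def)
  ultimately have pt: "arr_eq Id_pm (h \<circ>\<^sub>a in_stable 0 \<circ>\<^sub>a const_arr () Star) (snd X)"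
    unfolding arr_comp_assoc by (rule arr_eq_trans)
  \<comment> \<open>Since \<open>BD P_inf\<close> is the colimit of the
    \<open>BD (opetopic n)\<close>, the equation may be tested on each of them. There both sides are
    \<open>x\<close> after \<open>BD_arr\<close> of the arrow of stage \<open>n\<close>.\<close>
  have "arr_eq (BD P_inf) (h \<circ>\<^sub>a P_inf_struct) (x \<circ>\<^sub>a BD_arr h)"
  proof (rule BD_P_inf.arr_eq_out)
    fix n
    have A: "arr_eq (BD (opetopic n)) (h \<circ>\<^sub>a P_inf_struct \<circ>\<^sub>a BD_arr (in_stable n)) (h \<circ>\<^sub>a in_stable (Suc n) \<circ>\<^sub>a enc)"
      by (rule arr_eq_post[OF P_inf_struct_stage])
    have B: "arr_eq (BD (opetopic n)) ((h \<circ>\<^sub>a in_stable (Suc n)) \<circ>\<^sub>a enc) (to_algebra X x (Suc n) \<circ>\<^sub>a enc)"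
      by (rule arr_eq_pre[OF enc_arrow h])
    have C: "to_algebra X x (Suc n) \<circ>\<^sub>a enc = x \<circ>\<^sub>a BD_arr (to_algebra X x n)"
      by (simp add: arr_comp_assoc dec_enc)
    have D: "arr_eq (BD (opetopic n)) (x \<circ>\<^sub>a BD_arr (to_algebra X x n)) (x \<circ>\<^sub>a BD_arr h \<circ>\<^sub>a BD_arr (in_stable n))"
      by (rule arr_eq_post[OF arr_eq_sym[OF BD_arr_comp_eq[OF h]]])
    show "arr_eq (BD (opetopic n)) ((h \<circ>\<^sub>a P_inf_struct) \<circ>\<^sub>a BD_arr (in_stable n))
        ((x \<circ>\<^sub>a BD_arr h) \<circ>\<^sub>a BD_arr (in_stable n))"
      unfolding arr_comp_assoc
      by (rule arr_eq_trans[OF A arr_eq_trans[OF B[unfolded C arr_comp_assoc] D]])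
  qed
  then have "is_BD_algebra_arrow P_inf_pointed P_inf_struct X x h"
    using H pt P_inf_is_pointed X_pointed
    by (simp add: is_BD_algebra_arrow_def is_pointed_arrow_def P_inf_pointed_eq is_pointed_pm_def)
  then show ?thesis ..
qed

text \<open>The base point fixes the restriction to stage 0. The structure map identifies the image
  of \<open>BD\<close> of stage \<open>n\<close> with stage \<open>Suc n\<close>, so compatibility
  with it determines each restriction from the preceding one; this gives uniqueness.\<close>

lemma algebra_arrow_stage:
  assumes "is_BD_algebra_arrow P_inf_pointed P_inf_struct X x h"
  shows "arr_eq (opetopic n) (h \<circ>\<^sub>a in_stable n) (to_algebra X x n)"
proof -
  have pt: "arr_eq Id_pm (h \<circ>\<^sub>a in_stable 0 \<circ>\<^sub>a const_arr () Star) (snd X)"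
    and alg: "arr_eq (BD P_inf) (h \<circ>\<^sub>a P_inf_struct) (x \<circ>\<^sub>a BD_arr h)"
    using assms by (simp_all add: is_BD_algebra_arrow_def is_pointed_arrow_def P_inf_pointed_eq)
  show ?thesis
  proof (induction n)
    case 0
    show ?case using pt unfolding opetopic.simps trivial_arr_eq by (simp add: const_arr_def)
  next
    case (Suc n)
    note j = BD_P_inf.j_arrow[of n]
    have A: "arr_eq (BD (opetopic n)) (h \<circ>\<^sub>a in_stable (Suc n) \<circ>\<^sub>a enc) (h \<circ>\<^sub>a P_inf_struct \<circ>\<^sub>a BD_arr (in_stable n))"
      by (rule arr_eq_post[OF arr_eq_sym[OF P_inf_struct_stage]])
    have B: "arr_eq (BD (opetopic n)) ((h \<circ>\<^sub>a P_inf_struct) \<circ>\<^sub>a BD_arr (in_stable n)) ((x \<circ>\<^sub>a BD_arr h) \<circ>\<^sub>a BD_arr (in_stable n))"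
      by (rule arr_eq_pre[OF j alg])
    have C: "arr_eq (BD (opetopic n)) (x \<circ>\<^sub>a BD_arr h \<circ>\<^sub>a BD_arr (in_stable n)) (x \<circ>\<^sub>a BD_arr (to_algebra X x n))"
      by (rule arr_eq_post[OF BD_arr_comp_eq[OF Suc]])
    have "arr_eq (BD (opetopic n)) (h \<circ>\<^sub>a in_stable (Suc n) \<circ>\<^sub>a enc) (x \<circ>\<^sub>a BD_arr (to_algebra X x n))"
      by (rule arr_eq_trans[OF A arr_eq_trans[OF B[unfolded arr_comp_assoc] C]])
    from arr_eq_pre[OF dec_arrow this]
    have "arr_eq (opetopic (Suc n)) ((h \<circ>\<^sub>a in_stable (Suc n)) \<circ>\<^sub>a enc \<circ>\<^sub>a dec) (to_algebra X x (Suc n))"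
      by (simp add: arr_comp_assoc del: opetopic.simps)
    moreover have "arr_eq (opetopic (Suc n)) ((h \<circ>\<^sub>a in_stable (Suc n)) \<circ>\<^sub>a enc \<circ>\<^sub>a dec) (h \<circ>\<^sub>a in_stable (Suc n))"
      using arr_eq_post[OF enc_dec[of n], of "h \<circ>\<^sub>a in_stable (Suc n)"] by (simp del: opetopic.simps)
    ultimately show ?case by (rule arr_eq_trans[OF arr_eq_sym, rotated])
  qed
qed

end

theorem proposition4p6:
  shows "is_BD_algebra P_inf_pointed P_inf_struct \<and>
    (\<forall>(X :: ('i, 'b, 'e) pointed_pm) x. is_BD_algebra X x \<longrightarrow>
       (\<exists>h. is_BD_algebra_arrow P_inf_pointed P_inf_struct X x h \<and>
            (\<forall>h'. is_BD_algebra_arrow P_inf_pointed P_inf_struct X x h' \<longrightarrow> arr_eq P_inf h h')))"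
proof (intro conjI allI impI)
  show "is_BD_algebra P_inf_pointed P_inf_struct" by (rule P_inf_algebra)
next
  fix X :: "('i, 'b, 'e) pointed_pm" and x
  assume X: "is_BD_algebra X x"
  obtain h where h: "is_BD_algebra_arrow P_inf_pointed P_inf_struct X x h"
    using algebra_arrow_exists[OF X] by blast
  have "arr_eq P_inf h h'" if h': "is_BD_algebra_arrow P_inf_pointed P_inf_struct X x h'" for h'
    by (rule P_inf.arr_eq_out)
      (rule arr_eq_trans[OF algebra_arrow_stage[OF X h] arr_eq_sym[OF algebra_arrow_stage[OF X h']]])
  with h show "\<exists>h. is_BD_algebra_arrow P_inf_pointed P_inf_struct X x h \<and>
      (\<forall>h'. is_BD_algebra_arrow P_inf_pointed P_inf_struct X x h' \<longrightarrow> arr_eq P_inf h h')" by blast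
qed

end
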